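(* Let $\alpha=(\alpha_1,\dots,\alpha_n)\in(\Lambda^\times)^n$, and let $\mathcal I_F^{u\text{-}\mathrm{sm}}(\alpha)$ be the uniformly smooth principal series category defined in the context. Then $\mathcal I_F^{u\text{-}\mathrm{sm}}(\alpha)$ is $\Lambda$-linear and abelian. Right translation defines an exact strict uniformly smooth 2-representation $$\rho_\alpha:H_{\mathrm{disc}}\longrightarrow \operatorname{Aut}^{\mathrm{ex}}_\Lambda\bigl(\mathcal I_F^{u\text{-}\mathrm{sm}}(\alpha)\bigr),\qquad h\longmapsto R_h .$$ Every object and every morphism of $\mathcal I_F^{u\text{-}\mathrm{sm}}(\alpha)$ has an open stabilizer in $\mathcal C_H$.
   Context: **Field.** $k=\mathbb F_q$, $E=k((u))$, $F=E((t))$, $\mathcal O_2=k[[u]]+tE[[t]]\subset F$. $v_t:F^\times\to\mathbb Z$, $v_u:E^\times\to\mathbb Z$ are the normalized valuations; a bar denotes reduction modulo $t$ of a $t$-adic unit. For $a,b\in F^\times$ put $\partial_t\{a,b\}=(-1)^{v_t(a)v_t(b)}\,\overline{a^{v_t(b)}b^{-v_t(a)}}\in E^\times$ and $\nu_F\{a,b\}=v_u(\partial_t\{a,b\})\in\mathbb Z$. **Multiplier.** $\Lambda=\mathbb C((X))$, $n\ge1$, $G=\mathrm{GL}_n(F)$, $H=G_L\times G_R$ (two copies of $G$), $B\subset G$ the upper triangular Borel subgroup, $B_H=B_L\times B_R$. For $b=(b_L,b_R)\in B_H$ put $x_r(b)=(b_L)_{rr}$, $y_r(b)=(b_R)_{rr}$.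 Define $\sigma_\alpha(b,b')=\prod_{r=1}^n\alpha_r^{-\nu_F\{x_r(b),y_r(b')\}}$, a normalized 2-cocycle on the abstract group $B_H$. Let $L_\alpha(b)=\Lambda e_b$ be the line with basis $e_b$, and $m_{b,b'}:L_\alpha(b)\otimes L_\alpha(b')\to L_\alpha(bb')$, $e_b\otimes e_{b'}\mapsto\sigma_\alpha(b,b')e_{bb'}$. **Levels and topology.** For $i,j\ge1$, $K_{ij}=I_n+u^it^jM_n(\mathcal O_2)$ and $C^{\mathrm{dbl}}_{ij}=K_{ij,L}\times K_{ij,R}\subset H$. $\mathcal C_H$ is the family of finite intersections of $H$-conjugates of the groups $C^{\mathrm{dbl}}_{ij}$, ordered by reverse inclusion and used as a basis of identity neighbourhoods of $H$; a subgroup is open if it contains a member of $\mathcal C_H$. Fix Grothendieck universes $\mathbb U\in\mathbb V$; $\operatorname{Vect}_\Lambda$ is the category of $\mathbb U$-small $\Lambda$-vector spaces. For $C\in\mathcal C_H$ put $S_C=H/C$ and $\mathcal V_C=\operatorname{Fun}(S_C,\operatorname{Vect}_\Lambda)$ (families $(V_s)_{s\in S_C}$). For $D\subseteq C$, $\pi^*_{D,C}:\mathcal V_C\to\mathcal V_D$ is pullback along $gD\mapsto gC$. **Fixed-level principal series.** For $b\in B_H$ let $(T_bV)_s=L_\alpha(b)\otimes V_{b^{-1}s}$, with $\mu_{b,b'}:T_bT_{b'}\Rightarrow T_{bb'}$ given by $m_{b,b'}\otimes\mathrm{id}$ and unit $u_V:T_1V\to V$, $e_1\otimes v\mapsto v$.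 $\mathcal I_C(\alpha)$ is the category of pairs $(V,\varepsilon)$ with $V\in\mathcal V_C$ and isomorphisms $\varepsilon_b:T_bV\to V$ ($b\in B_H$) satisfying $\varepsilon_{bb'}\circ\mu_{b,b'}(V)=\varepsilon_b\circ T_b(\varepsilon_{b'})$ and $\varepsilon_1=u_V$; morphisms are morphisms of $\mathcal V_C$ commuting with all $\varepsilon_b$. Pullback induces $\pi_{D,C}^*:\mathcal I_C(\alpha)\to\mathcal I_D(\alpha)$. **Pseudocolimit.** $\mathcal I_F^{u\text{-}\mathrm{sm}}(\alpha)$ has objects the pairs $(C,V)$ with $C\in\mathcal C_H$, $V\in\mathcal I_C(\alpha)$, and $$\operatorname{Hom}\bigl((C,V),(C',V')\bigr)=\varinjlim_{D\subseteq C\cap C',\,D\in\mathcal C_H}\operatorname{Hom}_{\mathcal I_D(\alpha)}\bigl(\pi^*_{D,C}V,\pi^*_{D,C'}V'\bigr),$$ with composition formed after passage to a common refinement. **Right translation.** For $h\in H$, $r_h:S_{hCh^{-1}}\to S_C$, $g(hCh^{-1})\mapsto ghC$, and $R_h^C=(r_h)^*:\mathcal V_C\to\mathcal V_{hCh^{-1}}$. Since $R_h^CT_b=T_bR_h^C$ strictly, $R_h^C$ descends to $\mathcal I_C(\alpha)\to\mathcal I_{hCh^{-1}}(\alpha)$; these commute with refinement and induce the endofunctor $R_h$, $(C,V)\mapsto(hCh^{-1},R_h^CV)$. **2-representations.** $\operatorname{Aut}^{\mathrm{ex}}_\Lambda(\mathcal A)$ is the monoidal groupoid of exact $\Lambda$-linear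 autoequivalences of an abelian category $\mathcal A$ and natural isomorphisms, with composition as monoidal product. $H_{\mathrm{disc}}$ is $H$ viewed as a discrete strict 2-group (only identity morphisms). A 2-representation of $H_{\mathrm{disc}}$ on $\mathcal A$ is a strong monoidal functor to the monoidal groupoid of $\Lambda$-linear autoequivalences; it is exact if it lands in $\operatorname{Aut}^{\mathrm{ex}}_\Lambda(\mathcal A)$, and strict if $R_{h_1}R_{h_2}=R_{h_1h_2}$ and $R_1=\mathrm{id}$ literally, with identity coherence constraints. A strict action is uniformly smooth if every object $Y$ is literally fixed by all elements of some $C_Y\in\mathcal C_H$ and every morphism $w$ is literally fixed by all elements of some $C_w\in\mathcal C_H$. *)

theory Defs
  imports
    "HOL-Analysis.Finite_Cartesian_Product"
    "HOL-Computational_Algebra.Formal_Laurent_Series"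
    "HOL-Algebra.Module"
    "HOL-Algebra.Coset"
begin

hide_const (open) Modules.module

section \<open>Categories, linear and abelian categories\<close>

text \<open>Hom-sets are indexed by their source and target, and need not be disjoint; hence
  \<open>Cmp \<A> X Y Z g f\<close> (the composite of \<open>f : X \<rightarrow> Y\<close> and \<open>g : Y \<rightarrow> Z\<close>) carries the objects.\<close>

record ('o, 'm) cat =
  Ob :: "'o set"
  Hom :: "'o \<Rightarrow> 'o \<Rightarrow> 'm set"
  Idm :: "'o \<Rightarrow> 'm"
  Cmp :: "'o \<Rightarrow> 'o \<Rightarrow> 'o \<Rightarrow> 'm \<Rightarrow> 'm \<Rightarrow> 'm"

record ('r, 'o, 'm) lincat = "('o, 'm) cat" +
  Zero :: "'o \<Rightarrow> 'o \<Rightarrow> 'm"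
  Add :: "'o \<Rightarrow> 'o \<Rightarrow> 'm \<Rightarrow> 'm \<Rightarrow> 'm"
  Scale :: "'o \<Rightarrow> 'o \<Rightarrow> 'r \<Rightarrow> 'm \<Rightarrow> 'm"

definition is_category :: "('o, 'm, 'z) cat_scheme \<Rightarrow> bool" where
  "is_category \<A> \<longleftrightarrow>
     (\<forall>X\<in>Ob \<A>. Idm \<A> X \<in> Hom \<A> X X) \<and>
     (\<forall>X\<in>Ob \<A>. \<forall>Y\<in>Ob \<A>. \<forall>Z\<in>Ob \<A>. \<forall>f\<in>Hom \<A> X Y. \<forall>g\<in>Hom \<A> Y Z. Cmp \<A> X Y Z g f \<in> Hom \<A> X Z) \<and>
     (\<forall>X\<in>Ob \<A>. \<forall>Y\<in>Ob \<A>. \<forall>f\<in>Hom \<A> X Y.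
        Cmp \<A> X X Y f (Idm \<A> X) = f \<and> Cmp \<A> X Y Y (Idm \<A> Y) f = f) \<and>
     (\<forall>W\<in>Ob \<A>. \<forall>X\<in>Ob \<A>. \<forall>Y\<in>Ob \<A>. \<forall>Z\<in>Ob \<A>.
        \<forall>f\<in>Hom \<A> W X. \<forall>g\<in>Hom \<A> X Y. \<forall>h\<in>Hom \<A> Y Z.
        Cmp \<A> W Y Z h (Cmp \<A> W X Y g f) = Cmp \<A> W X Z (Cmp \<A> X Y Z h g) f)"

definition is_iso :: "('o, 'm, 'z) cat_scheme \<Rightarrow> 'o \<Rightarrow> 'o \<Rightarrow> 'm \<Rightarrow> bool" where
  "is_iso \<A> X Y f \<longleftrightarrow> f \<in> Hom \<A> X Y \<and>
     (\<exists>g\<in>Hom \<A> Y X. Cmp \<A> X Y X g f = Idm \<A> X \<and> Cmp \<A> Y X Y f g = Idm \<A> Y)"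

text \<open>The fields \<open>mult\<close> and \<open>one\<close> of a \<^typ>\<open>('a, 'b) module\<close> play no role in \<^const>\<open>module\<close>.\<close>

definition hom_module :: "('r, 'o, 'm, 'z) lincat_scheme \<Rightarrow> 'o \<Rightarrow> 'o \<Rightarrow> ('r, 'm) module" where
  "hom_module \<A> X Y = \<lparr>carrier = Hom \<A> X Y, mult = undefined, one = undefined,
     zero = Zero \<A> X Y, add = Add \<A> X Y, smult = Scale \<A> X Y\<rparr>"

definition linear_category :: "'r ring \<Rightarrow> ('r, 'o, 'm, 'z) lincat_scheme \<Rightarrow> bool" where
  "linear_category R \<A> \<longleftrightarrow> is_category \<A> \<and>
     (\<forall>X\<in>Ob \<A>. \<forall>Y\<in>Ob \<A>. module R (hom_module \<A> X Y)) \<and>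
     (\<forall>X\<in>Ob \<A>. \<forall>Y\<in>Ob \<A>. \<forall>Z\<in>Ob \<A>. \<forall>f\<in>Hom \<A> X Y. \<forall>f'\<in>Hom \<A> X Y. \<forall>g\<in>Hom \<A> Y Z. \<forall>g'\<in>Hom \<A> Y Z.
        Cmp \<A> X Y Z g (Add \<A> X Y f f') = Add \<A> X Z (Cmp \<A> X Y Z g f) (Cmp \<A> X Y Z g f') \<and>
        Cmp \<A> X Y Z (Add \<A> Y Z g g') f = Add \<A> X Z (Cmp \<A> X Y Z g f) (Cmp \<A> X Y Z g' f)) \<and>
     (\<forall>X\<in>Ob \<A>. \<forall>Y\<in>Ob \<A>. \<forall>Z\<in>Ob \<A>. \<forall>f\<in>Hom \<A> X Y. \<forall>g\<in>Hom \<A> Y Z. \<forall>c\<in>carrier R.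
        Cmp \<A> X Y Z g (Scale \<A> X Y c f) = Scale \<A> X Z c (Cmp \<A> X Y Z g f) \<and>
        Cmp \<A> X Y Z (Scale \<A> Y Z c g) f = Scale \<A> X Z c (Cmp \<A> X Y Z g f))"

definition is_zero_object :: "('o, 'm, 'z) cat_scheme \<Rightarrow> 'o \<Rightarrow> bool" where
  "is_zero_object \<A> Z \<longleftrightarrow> Z \<in> Ob \<A> \<and>
     (\<forall>X\<in>Ob \<A>. (\<exists>!f. f \<in> Hom \<A> Z X) \<and> (\<exists>!f. f \<in> Hom \<A> X Z))"

definition is_biproduct ::
  "('r, 'o, 'm, 'z) lincat_scheme \<Rightarrow> 'o \<Rightarrow> 'o \<Rightarrow> 'o \<Rightarrow> 'm \<Rightarrow> 'm \<Rightarrow> 'm \<Rightarrow> 'm \<Rightarrow> bool" where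
  "is_biproduct \<A> X Y P i j p q \<longleftrightarrow> P \<in> Ob \<A> \<and>
     i \<in> Hom \<A> X P \<and> j \<in> Hom \<A> Y P \<and> p \<in> Hom \<A> P X \<and> q \<in> Hom \<A> P Y \<and>
     Cmp \<A> X P X p i = Idm \<A> X \<and> Cmp \<A> Y P Y q j = Idm \<A> Y \<and>
     Cmp \<A> X P Y q i = Zero \<A> X Y \<and> Cmp \<A> Y P X p j = Zero \<A> Y X \<and>
     Add \<A> P P (Cmp \<A> P X P i p) (Cmp \<A> P Y P j q) = Idm \<A> P"

definition is_kernel :: "('r, 'o, 'm, 'z) lincat_scheme \<Rightarrow> 'o \<Rightarrow> 'o \<Rightarrow> 'm \<Rightarrow> 'o \<Rightarrow> 'm \<Rightarrow> bool" where
  "is_kernel \<A> X Y f K i \<longleftrightarrow> K \<in> Ob \<A> \<and> i \<in> Hom \<A> K X \<and> Cmp \<A> K X Y f i = Zero \<A> K Y \<and>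
     (\<forall>W\<in>Ob \<A>. \<forall>g\<in>Hom \<A> W X. Cmp \<A> W X Y f g = Zero \<A> W Y \<longrightarrow>
        (\<exists>!l. l \<in> Hom \<A> W K \<and> Cmp \<A> W K X i l = g))"

definition is_cokernel :: "('r, 'o, 'm, 'z) lincat_scheme \<Rightarrow> 'o \<Rightarrow> 'o \<Rightarrow> 'm \<Rightarrow> 'o \<Rightarrow> 'm \<Rightarrow> bool" where
  "is_cokernel \<A> X Y f Q p \<longleftrightarrow> Q \<in> Ob \<A> \<and> p \<in> Hom \<A> Y Q \<and> Cmp \<A> X Y Q p f = Zero \<A> X Q \<and>
     (\<forall>W\<in>Ob \<A>. \<forall>g\<in>Hom \<A> Y W. Cmp \<A> X Y W g f = Zero \<A> X W \<longrightarrow>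
        (\<exists>!l. l \<in> Hom \<A> Q W \<and> Cmp \<A> Y Q W l p = g))"

definition is_mono :: "('o, 'm, 'z) cat_scheme \<Rightarrow> 'o \<Rightarrow> 'o \<Rightarrow> 'm \<Rightarrow> bool" where
  "is_mono \<A> X Y f \<longleftrightarrow> (\<forall>W\<in>Ob \<A>. \<forall>g\<in>Hom \<A> W X. \<forall>h\<in>Hom \<A> W X.
     Cmp \<A> W X Y f g = Cmp \<A> W X Y f h \<longrightarrow> g = h)"

definition is_epi :: "('o, 'm, 'z) cat_scheme \<Rightarrow> 'o \<Rightarrow> 'o \<Rightarrow> 'm \<Rightarrow> bool" where
  "is_epi \<A> X Y f \<longleftrightarrow> (\<forall>W\<in>Ob \<A>. \<forall>g\<in>Hom \<A> Y W. \<forall>h\<in>Hom \<A> Y W.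
     Cmp \<A> X Y W g f = Cmp \<A> X Y W h f \<longrightarrow> g = h)"

definition abelian_linear_category :: "'r ring \<Rightarrow> ('r, 'o, 'm, 'z) lincat_scheme \<Rightarrow> bool" where
  "abelian_linear_category R \<A> \<longleftrightarrow> linear_category R \<A> \<and>
     (\<exists>Z. is_zero_object \<A> Z) \<and>
     (\<forall>X\<in>Ob \<A>. \<forall>Y\<in>Ob \<A>. \<exists>P i j p q. is_biproduct \<A> X Y P i j p q) \<and>
     (\<forall>X\<in>Ob \<A>. \<forall>Y\<in>Ob \<A>. \<forall>f\<in>Hom \<A> X Y.
        (\<exists>K i. is_kernel \<A> X Y f K i) \<and> (\<exists>Q p. is_cokernel \<A> X Y f Q p)) \<and>
     (\<forall>X\<in>Ob \<A>. \<forall>Y\<in>Ob \<A>. \<forall>f\<in>Hom \<A> X Y. is_mono \<A> X Y f \<longrightarrow>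
        (\<exists>Z\<in>Ob \<A>. \<exists>g\<in>Hom \<A> Y Z. is_kernel \<A> Y Z g X f)) \<and>
     (\<forall>X\<in>Ob \<A>. \<forall>Y\<in>Ob \<A>. \<forall>f\<in>Hom \<A> X Y. is_epi \<A> X Y f \<longrightarrow>
        (\<exists>Z\<in>Ob \<A>. \<exists>g\<in>Hom \<A> Z X. is_cokernel \<A> Z X g Y f))"

definition short_exact ::
  "('r, 'o, 'm, 'z) lincat_scheme \<Rightarrow> 'o \<Rightarrow> 'o \<Rightarrow> 'o \<Rightarrow> 'm \<Rightarrow> 'm \<Rightarrow> bool" where
  "short_exact \<A> X Y Z f g \<longleftrightarrow> is_kernel \<A> Y Z g X f \<and> is_cokernel \<A> X Y f Z g"


section \<open>Functors and natural transformations\<close>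

text \<open>Functors and natural transformations are \<^const>\<open>undefined\<close> outside their domain, so that
  HOL equality of functors is literal equality on objects and morphisms.\<close>

record ('o, 'm, 'p, 'q) ftor =
  FOb :: "'o \<Rightarrow> 'p"
  FMor :: "'o \<Rightarrow> 'o \<Rightarrow> 'm \<Rightarrow> 'q"

definition mk_ftor :: "('o, 'm, 'z) cat_scheme \<Rightarrow> ('o \<Rightarrow> 'p) \<Rightarrow> ('o \<Rightarrow> 'o \<Rightarrow> 'm \<Rightarrow> 'q) \<Rightarrow>
    ('o, 'm, 'p, 'q) ftor" where
  "mk_ftor \<A> fo fm = \<lparr>FOb = restrict fo (Ob \<A>),
     FMor = (\<lambda>X Y f. if X \<in> Ob \<A> \<and> Y \<in> Ob \<A> \<and> f \<in> Hom \<A> X Y then fm X Y f else undefined)\<rparr>"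

definition is_ftor :: "('o, 'm, 'y) cat_scheme \<Rightarrow> ('p, 'q, 'z) cat_scheme \<Rightarrow>
    ('o, 'm, 'p, 'q, 'w) ftor_scheme \<Rightarrow> bool" where
  "is_ftor \<A> \<B> F \<longleftrightarrow>
     FOb F \<in> Ob \<A> \<rightarrow>\<^sub>E Ob \<B> \<and>
     (\<forall>X\<in>Ob \<A>. \<forall>Y\<in>Ob \<A>. FMor F X Y \<in> Hom \<A> X Y \<rightarrow>\<^sub>E Hom \<B> (FOb F X) (FOb F Y)) \<and>
     (\<forall>X Y f. X \<notin> Ob \<A> \<or> Y \<notin> Ob \<A> \<longrightarrow> FMor F X Y f = undefined) \<and>
     (\<forall>X\<in>Ob \<A>. FMor F X X (Idm \<A> X) = Idm \<B> (FOb F X)) \<and>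
     (\<forall>X\<in>Ob \<A>. \<forall>Y\<in>Ob \<A>. \<forall>Z\<in>Ob \<A>. \<forall>f\<in>Hom \<A> X Y. \<forall>g\<in>Hom \<A> Y Z.
        FMor F X Z (Cmp \<A> X Y Z g f) =
        Cmp \<B> (FOb F X) (FOb F Y) (FOb F Z) (FMor F Y Z g) (FMor F X Y f))"

definition id_ftor :: "('o, 'm, 'z) cat_scheme \<Rightarrow> ('o, 'm, 'o, 'm) ftor" where
  "id_ftor \<A> = mk_ftor \<A> (\<lambda>X. X) (\<lambda>X Y f. f)"

text \<open>The composite \<open>G \<circ> F\<close> of \<open>F\<close>, defined on \<open>\<A>\<close>, and \<open>G\<close>.\<close>

definition comp_ftor :: "('o, 'm, 'z) cat_scheme \<Rightarrow> ('p, 'q, 's, 'u) ftor \<Rightarrow>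
    ('o, 'm, 'p, 'q) ftor \<Rightarrow> ('o, 'm, 's, 'u) ftor" where
  "comp_ftor \<A> G F = mk_ftor \<A> (\<lambda>X. FOb G (FOb F X))
     (\<lambda>X Y f. FMor G (FOb F X) (FOb F Y) (FMor F X Y f))"

definition is_nat_trans :: "('o, 'm, 'y) cat_scheme \<Rightarrow> ('p, 'q, 'z) cat_scheme \<Rightarrow>
    ('o, 'm, 'p, 'q) ftor \<Rightarrow> ('o, 'm, 'p, 'q) ftor \<Rightarrow> ('o \<Rightarrow> 'q) \<Rightarrow> bool" where
  "is_nat_trans \<A> \<B> F G \<eta> \<longleftrightarrow>
     \<eta> \<in> (\<Pi>\<^sub>E X\<in>Ob \<A>. Hom \<B> (FOb F X) (FOb G X)) \<and>
     (\<forall>X\<in>Ob \<A>. \<forall>Y\<in>Ob \<A>. \<forall>f\<in>Hom \<A> X Y.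
        Cmp \<B> (FOb F X) (FOb F Y) (FOb G Y) (\<eta> Y) (FMor F X Y f) =
        Cmp \<B> (FOb F X) (FOb G X) (FOb G Y) (FMor G X Y f) (\<eta> X))"

definition is_nat_iso :: "('o, 'm, 'y) cat_scheme \<Rightarrow> ('p, 'q, 'z) cat_scheme \<Rightarrow>
    ('o, 'm, 'p, 'q) ftor \<Rightarrow> ('o, 'm, 'p, 'q) ftor \<Rightarrow> ('o \<Rightarrow> 'q) \<Rightarrow> bool" where
  "is_nat_iso \<A> \<B> F G \<eta> \<longleftrightarrow> is_nat_trans \<A> \<B> F G \<eta> \<and>
     (\<forall>X\<in>Ob \<A>. is_iso \<B> (FOb F X) (FOb G X) (\<eta> X))"

definition autoequivalence :: "('o, 'm, 'z) cat_scheme \<Rightarrow> ('o, 'm, 'o, 'm) ftor \<Rightarrow> bool" where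
  "autoequivalence \<A> F \<longleftrightarrow> is_ftor \<A> \<A> F \<and>
     (\<exists>G. is_ftor \<A> \<A> G \<and>
        (\<exists>\<eta>. is_nat_iso \<A> \<A> (comp_ftor \<A> G F) (id_ftor \<A>) \<eta>) \<and>
        (\<exists>\<eta>. is_nat_iso \<A> \<A> (comp_ftor \<A> F G) (id_ftor \<A>) \<eta>))"

definition linear_ftor :: "'r ring \<Rightarrow> ('r, 'o, 'm, 'y) lincat_scheme \<Rightarrow>
    ('r, 'p, 'q, 'z) lincat_scheme \<Rightarrow> ('o, 'm, 'p, 'q) ftor \<Rightarrow> bool" where
  "linear_ftor R \<A> \<B> F \<longleftrightarrow> is_ftor \<A> \<B> F \<and>
     (\<forall>X\<in>Ob \<A>. \<forall>Y\<in>Ob \<A>. \<forall>f\<in>Hom \<A> X Y. \<forall>g\<in>Hom \<A> X Y.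
        FMor F X Y (Add \<A> X Y f g) = Add \<B> (FOb F X) (FOb F Y) (FMor F X Y f) (FMor F X Y g)) \<and>
     (\<forall>X\<in>Ob \<A>. \<forall>Y\<in>Ob \<A>. \<forall>f\<in>Hom \<A> X Y. \<forall>c\<in>carrier R.
        FMor F X Y (Scale \<A> X Y c f) = Scale \<B> (FOb F X) (FOb F Y) c (FMor F X Y f))"

definition exact_ftor :: "('r, 'o, 'm, 'y) lincat_scheme \<Rightarrow>
    ('r, 'p, 'q, 'z) lincat_scheme \<Rightarrow> ('o, 'm, 'p, 'q) ftor \<Rightarrow> bool" where
  "exact_ftor \<A> \<B> F \<longleftrightarrow>
     (\<forall>X\<in>Ob \<A>. \<forall>Y\<in>Ob \<A>. \<forall>Z\<in>Ob \<A>. \<forall>f\<in>Hom \<A> X Y. \<forall>g\<in>Hom \<A> Y Z. short_exact \<A> X Y Z f g \<longrightarrow>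
        short_exact \<B> (FOb F X) (FOb F Y) (FOb F Z) (FMor F X Y f) (FMor F Y Z g))"


section \<open>Monoidal categories and 2-representations\<close>

text \<open>Both monoidal categories needed here, a discrete strict 2-group and a category of
  endofunctors under composition, are strictly associative and strictly unital, so the
  associativity and unit constraints are identities and are not recorded.
  \<open>TMor M X X' Y Y' f g\<close> is the tensor product of \<open>f : X \<rightarrow> X'\<close> and \<open>g : Y \<rightarrow> Y'\<close>.\<close>

record ('o, 'm) moncat = "('o, 'm) cat" +
  TOb :: "'o \<Rightarrow> 'o \<Rightarrow> 'o"
  TMor :: "'o \<Rightarrow> 'o \<Rightarrow> 'o \<Rightarrow> 'o \<Rightarrow> 'm \<Rightarrow> 'm \<Rightarrow> 'm"
  TUnit :: "'o"

record ('o, 'm, 'p, 'q) monftor = "('o, 'm, 'p, 'q) ftor" +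
  MMu :: "'o \<Rightarrow> 'o \<Rightarrow> 'q"
  MEps :: "'q"

definition strong_monoidal_ftor :: "('o, 'm) moncat \<Rightarrow> ('p, 'q) moncat \<Rightarrow>
    ('o, 'm, 'p, 'q) monftor \<Rightarrow> bool" where
  "strong_monoidal_ftor M N F \<longleftrightarrow> is_ftor M N F \<and>
     is_iso N (TUnit N) (FOb F (TUnit M)) (MEps F) \<and>
     (\<forall>X\<in>Ob M. \<forall>Y\<in>Ob M. is_iso N (TOb N (FOb F X) (FOb F Y)) (FOb F (TOb M X Y)) (MMu F X Y)) \<and>
     (\<forall>X\<in>Ob M. \<forall>X'\<in>Ob M. \<forall>Y\<in>Ob M. \<forall>Y'\<in>Ob M. \<forall>f\<in>Hom M X X'. \<forall>g\<in>Hom M Y Y'.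
        Cmp N (TOb N (FOb F X) (FOb F Y)) (TOb N (FOb F X') (FOb F Y')) (FOb F (TOb M X' Y'))
          (MMu F X' Y')
          (TMor N (FOb F X) (FOb F X') (FOb F Y) (FOb F Y') (FMor F X X' f) (FMor F Y Y' g)) =
        Cmp N (TOb N (FOb F X) (FOb F Y)) (FOb F (TOb M X Y)) (FOb F (TOb M X' Y'))
          (FMor F (TOb M X Y) (TOb M X' Y') (TMor M X X' Y Y' f g)) (MMu F X Y)) \<and>
     (\<forall>X\<in>Ob M. \<forall>Y\<in>Ob M. \<forall>Z\<in>Ob M.
        Cmp N (TOb N (TOb N (FOb F X) (FOb F Y)) (FOb F Z)) (TOb N (FOb F (TOb M X Y)) (FOb F Z))
            (FOb F (TOb M (TOb M X Y) Z))
          (MMu F (TOb M X Y) Z)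
          (TMor N (TOb N (FOb F X) (FOb F Y)) (FOb F (TOb M X Y)) (FOb F Z) (FOb F Z)
             (MMu F X Y) (Idm N (FOb F Z))) =
        Cmp N (TOb N (FOb F X) (TOb N (FOb F Y) (FOb F Z))) (TOb N (FOb F X) (FOb F (TOb M Y Z)))
            (FOb F (TOb M X (TOb M Y Z)))
          (MMu F X (TOb M Y Z))
          (TMor N (FOb F X) (FOb F X) (TOb N (FOb F Y) (FOb F Z)) (FOb F (TOb M Y Z))
             (Idm N (FOb F X)) (MMu F Y Z))) \<and>
     (\<forall>X\<in>Ob M.
        Cmp N (TOb N (TUnit N) (FOb F X)) (TOb N (FOb F (TUnit M)) (FOb F X)) (FOb F (TOb M (TUnit M) X))
          (MMu F (TUnit M) X)
          (TMor N (TUnit N) (FOb F (TUnit M)) (FOb F X) (FOb F X) (MEps F) (Idm N (FOb F X))) =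
        Idm N (FOb F X) \<and>
        Cmp N (TOb N (FOb F X) (TUnit N)) (TOb N (FOb F X) (FOb F (TUnit M))) (FOb F (TOb M X (TUnit M)))
          (MMu F X (TUnit M))
          (TMor N (FOb F X) (FOb F X) (TUnit N) (FOb F (TUnit M)) (Idm N (FOb F X)) (MEps F)) =
        Idm N (FOb F X))"

definition strict_monoidal_ftor :: "('o, 'm) moncat \<Rightarrow> ('p, 'q) moncat \<Rightarrow>
    ('o, 'm, 'p, 'q) monftor \<Rightarrow> bool" where
  "strict_monoidal_ftor M N F \<longleftrightarrow> strong_monoidal_ftor M N F \<and>
     FOb F (TUnit M) = TUnit N \<and> MEps F = Idm N (TUnit N) \<and>
     (\<forall>X\<in>Ob M. \<forall>Y\<in>Ob M. TOb N (FOb F X) (FOb F Y) = FOb F (TOb M X Y) \<and>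
        MMu F X Y = Idm N (FOb F (TOb M X Y)))"

definition disc_2group :: "('g, 'z) monoid_scheme \<Rightarrow> ('g, unit) moncat" where
  "disc_2group G = \<lparr>Ob = carrier G, Hom = (\<lambda>g h. if g = h then {()} else {}),
     Idm = (\<lambda>g. ()), Cmp = (\<lambda>g h k x y. ()),
     TOb = mult G, TMor = (\<lambda>g g' h h' x y. ()), TUnit = one G\<rparr>"

text \<open>The monoidal groupoid of \<open>R\<close>-linear autoequivalences and natural isomorphisms, with
  composition of functors and horizontal composition of transformations as tensor product.\<close>

definition Aut_lin :: "'r ring \<Rightarrow> ('r, 'o, 'm, 'z) lincat_scheme \<Rightarrow>
    (('o, 'm, 'o, 'm) ftor, 'o \<Rightarrow> 'm) moncat" where
  "Aut_lin R \<A> = \<lparr>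
     Ob = {F. linear_ftor R \<A> \<A> F \<and> autoequivalence \<A> F},
     Hom = (\<lambda>F G. {\<eta>. is_nat_iso \<A> \<A> F G \<eta>}),
     Idm = (\<lambda>F. \<lambda>X\<in>Ob \<A>. Idm \<A> (FOb F X)),
     Cmp = (\<lambda>F G K \<theta> \<eta>. \<lambda>X\<in>Ob \<A>. Cmp \<A> (FOb F X) (FOb G X) (FOb K X) (\<theta> X) (\<eta> X)),
     TOb = comp_ftor \<A>,
     TMor = (\<lambda>F F' G G' \<eta> \<theta>. \<lambda>X\<in>Ob \<A>.
       Cmp \<A> (FOb F (FOb G X)) (FOb F (FOb G' X)) (FOb F' (FOb G' X))
         (\<eta> (FOb G' X)) (FMor F (FOb G X) (FOb G' X) (\<theta> X))),
     TUnit = id_ftor \<A>\<rparr>"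

definition Aut_ex :: "'r ring \<Rightarrow> ('r, 'o, 'm, 'z) lincat_scheme \<Rightarrow>
    (('o, 'm, 'o, 'm) ftor, 'o \<Rightarrow> 'm) moncat" where
  "Aut_ex R \<A> = (Aut_lin R \<A>)\<lparr>Ob := {F \<in> Ob (Aut_lin R \<A>). exact_ftor \<A> \<A> F}\<rparr>"

type_synonym ('g, 'o, 'm) two_rep = "('g, unit, ('o, 'm, 'o, 'm) ftor, 'o \<Rightarrow> 'm) monftor"

definition two_representation :: "('g, 'y) monoid_scheme \<Rightarrow> 'r ring \<Rightarrow>
    ('r, 'o, 'm, 'z) lincat_scheme \<Rightarrow> ('g, 'o, 'm) two_rep \<Rightarrow> bool" where
  "two_representation G R \<A> \<rho> \<longleftrightarrow> strong_monoidal_ftor (disc_2group G) (Aut_lin R \<A>) \<rho>"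

definition exact_two_representation :: "('g, 'y) monoid_scheme \<Rightarrow> 'r ring \<Rightarrow>
    ('r, 'o, 'm, 'z) lincat_scheme \<Rightarrow> ('g, 'o, 'm) two_rep \<Rightarrow> bool" where
  "exact_two_representation G R \<A> \<rho> \<longleftrightarrow> two_representation G R \<A> \<rho> \<and>
     strong_monoidal_ftor (disc_2group G) (Aut_ex R \<A>) \<rho>"

definition strict_two_representation :: "('g, 'y) monoid_scheme \<Rightarrow> 'r ring \<Rightarrow>
    ('r, 'o, 'm, 'z) lincat_scheme \<Rightarrow> ('g, 'o, 'm) two_rep \<Rightarrow> bool" where
  "strict_two_representation G R \<A> \<rho> \<longleftrightarrow> strict_monoidal_ftor (disc_2group G) (Aut_lin R \<A>) \<rho>"

definition stabilizer_ob :: "('g, 'y) monoid_scheme \<Rightarrow> ('g, 'o, 'm) two_rep \<Rightarrow> 'o \<Rightarrow> 'g set" where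
  "stabilizer_ob G \<rho> Y = {h \<in> carrier G. FOb (FOb \<rho> h) Y = Y}"

definition stabilizer_mor ::
  "('g, 'y) monoid_scheme \<Rightarrow> ('g, 'o, 'm) two_rep \<Rightarrow> 'o \<Rightarrow> 'o \<Rightarrow> 'm \<Rightarrow> 'g set" where
  "stabilizer_mor G \<rho> Y Y' w = {h \<in> carrier G.
     FOb (FOb \<rho> h) Y = Y \<and> FOb (FOb \<rho> h) Y' = Y' \<and> FMor (FOb \<rho> h) Y Y' w = w}"

text \<open>\<open>\<C>\<close> is the chosen family of basic identity neighbourhoods of \<open>G\<close>.\<close>

definition uniformly_smooth :: "('g, 'y) monoid_scheme \<Rightarrow> 'g set set \<Rightarrow>
    ('o, 'm, 'z) cat_scheme \<Rightarrow> ('g, 'o, 'm) two_rep \<Rightarrow> bool" where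
  "uniformly_smooth G \<C> \<A> \<rho> \<longleftrightarrow>
     (\<forall>Y\<in>Ob \<A>. \<exists>C\<in>\<C>. C \<subseteq> stabilizer_ob G \<rho> Y) \<and>
     (\<forall>Y\<in>Ob \<A>. \<forall>Y'\<in>Ob \<A>. \<forall>w\<in>Hom \<A> Y Y'. \<exists>C\<in>\<C>. C \<subseteq> stabilizer_mor G \<rho> Y Y' w)"

definition open_subgroup :: "('g, 'y) monoid_scheme \<Rightarrow> 'g set set \<Rightarrow> 'g set \<Rightarrow> bool" where
  "open_subgroup G \<C> S \<longleftrightarrow> subgroup S G \<and> (\<exists>C\<in>\<C>. C \<subseteq> S)"


section \<open>Small vector spaces over \<open>\<Lambda>\<close>\<close>

type_synonym lam = "complex fls"

definition Lam :: "lam ring" where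
  "Lam = \<lparr>carrier = UNIV, mult = (*), one = 1, zero = 0, add = (+)\<rparr>"

text \<open>A Grothendieck universe \<open>U\<close> (uncountable, as usual) is presented by a type \<open>'v\<close> whose
  elements are the members of \<open>U\<close>, together with \<open>elts x = {y. y \<in> x}\<close>. Transitivity of \<open>U\<close> is
  built into the type of \<open>elts\<close>; a set of elements of \<open>U\<close> is \<open>U\<close>-small iff it is in the range
  of \<open>elts\<close>.\<close>

locale grothendieck_universe =
  fixes elts :: "'v \<Rightarrow> 'v set"
  assumes extensionality: "inj elts"
    and foundation: "wf {(x, y). x \<in> elts y}"
    and pairing: "{x, y} \<in> range elts"
    and subsets: "S \<subseteq> elts a \<Longrightarrow> S \<in> range elts"
    and powerset: "{x. elts x \<subseteq> elts a} \<in> range elts"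
    and family_union: "(\<Union>i\<in>elts a. elts (f i)) \<in> range elts"
    and infinity: "\<exists>a. infinite (elts a)"

definition lin_maps :: "(lam, 'a) module \<Rightarrow> (lam, 'b) module \<Rightarrow> ('a \<Rightarrow> 'b) set" where
  "lin_maps M N = {f \<in> carrier M \<rightarrow>\<^sub>E carrier N.
     (\<forall>x\<in>carrier M. \<forall>y\<in>carrier M. f (x \<oplus>\<^bsub>M\<^esub> y) = f x \<oplus>\<^bsub>N\<^esub> f y) \<and>
     (\<forall>c. \<forall>x\<in>carrier M. f (c \<odot>\<^bsub>M\<^esub> x) = c \<odot>\<^bsub>N\<^esub> f x)}"

definition Vect :: "('v \<Rightarrow> 'v set) \<Rightarrow> (lam, (lam, 'v) module, 'v \<Rightarrow> 'v) lincat" where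
  "Vect elts = \<lparr>
     Ob = {M. module Lam M \<and> carrier M \<in> range elts},
     Hom = lin_maps,
     Idm = (\<lambda>M. \<lambda>x\<in>carrier M. x),
     Cmp = (\<lambda>M N P g f. compose (carrier M) g f),
     Zero = (\<lambda>M N. \<lambda>x\<in>carrier M. \<zero>\<^bsub>N\<^esub>),
     Add = (\<lambda>M N f g. \<lambda>x\<in>carrier M. f x \<oplus>\<^bsub>N\<^esub> g x),
     Scale = (\<lambda>M N c f. \<lambda>x\<in>carrier M. c \<odot>\<^bsub>N\<^esub> f x)\<rparr>"

definition bilinear_maps ::
  "(lam, 'a) module \<Rightarrow> (lam, 'b) module \<Rightarrow> (lam, 'c) module \<Rightarrow> ('a \<Rightarrow> 'b \<Rightarrow> 'c) set" where
  "bilinear_maps M N P = {\<beta>.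
     (\<forall>x\<in>carrier M. \<forall>y\<in>carrier N. \<beta> x y \<in> carrier P) \<and>
     (\<forall>x\<in>carrier M. \<forall>x'\<in>carrier M. \<forall>y\<in>carrier N. \<beta> (x \<oplus>\<^bsub>M\<^esub> x') y = \<beta> x y \<oplus>\<^bsub>P\<^esub> \<beta> x' y) \<and>
     (\<forall>x\<in>carrier M. \<forall>y\<in>carrier N. \<forall>y'\<in>carrier N. \<beta> x (y \<oplus>\<^bsub>N\<^esub> y') = \<beta> x y \<oplus>\<^bsub>P\<^esub> \<beta> x y') \<and>
     (\<forall>c. \<forall>x\<in>carrier M. \<forall>y\<in>carrier N.
        \<beta> (c \<odot>\<^bsub>M\<^esub> x) y = c \<odot>\<^bsub>P\<^esub> \<beta> x y \<and> \<beta> x (c \<odot>\<^bsub>N\<^esub> y) = c \<odot>\<^bsub>P\<^esub> \<beta> x y)}"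

definition is_tensor_product :: "('v \<Rightarrow> 'v set) \<Rightarrow> (lam, 'a) module \<Rightarrow> (lam, 'b) module \<Rightarrow>
    (lam, 'v) module \<Rightarrow> ('a \<Rightarrow> 'b \<Rightarrow> 'v) \<Rightarrow> bool" where
  "is_tensor_product elts M N P \<tau> \<longleftrightarrow> P \<in> Ob (Vect elts) \<and> \<tau> \<in> bilinear_maps M N P \<and>
     (\<forall>Q\<in>Ob (Vect elts). \<forall>\<beta>\<in>bilinear_maps M N Q.
        \<exists>!g. g \<in> lin_maps P Q \<and> (\<forall>x\<in>carrier M. \<forall>y\<in>carrier N. g (\<tau> x y) = \<beta> x y))"

text \<open>A fixed choice, for all \<open>M\<close> and \<open>N\<close>, of a tensor product in \<open>Vect\<close>. As it depends on the
  spaces alone, translating a family of spaces commutes strictly with tensoring.\<close>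

definition tensor_choice :: "('v \<Rightarrow> 'v set) \<Rightarrow> (lam, 'a) module \<Rightarrow> (lam, 'b) module \<Rightarrow>
    (lam, 'v) module \<times> ('a \<Rightarrow> 'b \<Rightarrow> 'v)" where
  "tensor_choice elts M N = (SOME (P, \<tau>). is_tensor_product elts M N P \<tau>)"

definition tensor_space where "tensor_space elts M N = fst (tensor_choice elts M N)"
definition tensor_elem where "tensor_elem elts M N = snd (tensor_choice elts M N)"

text \<open>\<open>id \<otimes> f : L \<otimes> V \<rightarrow> L \<otimes> W\<close>\<close>

definition tensor_id_map :: "('v \<Rightarrow> 'v set) \<Rightarrow> (lam, 'a) module \<Rightarrow> (lam, 'v) module \<Rightarrow>
    (lam, 'v) module \<Rightarrow> ('v \<Rightarrow> 'v) \<Rightarrow> 'v \<Rightarrow> 'v" where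
  "tensor_id_map elts L V W f = (THE g. g \<in> lin_maps (tensor_space elts L V) (tensor_space elts L W) \<and>
     (\<forall>x\<in>carrier L. \<forall>v\<in>carrier V. g (tensor_elem elts L V x v) = tensor_elem elts L W x (f v)))"

definition family_cat :: "'s set \<Rightarrow> ('r, 'o, 'm) lincat \<Rightarrow> ('r, 's \<Rightarrow> 'o, 's \<Rightarrow> 'm) lincat" where
  "family_cat S \<A> = \<lparr>
     Ob = S \<rightarrow>\<^sub>E Ob \<A>,
     Hom = (\<lambda>V W. \<Pi>\<^sub>E s\<in>S. Hom \<A> (V s) (W s)),
     Idm = (\<lambda>V. \<lambda>s\<in>S. Idm \<A> (V s)),
     Cmp = (\<lambda>U V W g f. \<lambda>s\<in>S. Cmp \<A> (U s) (V s) (W s) (g s) (f s)),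
     Zero = (\<lambda>V W. \<lambda>s\<in>S. Zero \<A> (V s) (W s)),
     Add = (\<lambda>V W f g. \<lambda>s\<in>S. Add \<A> (V s) (W s) (f s) (g s)),
     Scale = (\<lambda>V W c f. \<lambda>s\<in>S. Scale \<A> (V s) (W s) c (f s))\<rparr>"

text \<open>Pullback of families indexed by \<open>S\<close> along \<open>\<phi> : S' \<rightarrow> S\<close>.\<close>

definition reindex :: "'s set \<Rightarrow> 't set \<Rightarrow> ('t \<Rightarrow> 's) \<Rightarrow> ('r, 'o, 'm) lincat \<Rightarrow>
    ('s \<Rightarrow> 'o, 's \<Rightarrow> 'm, 't \<Rightarrow> 'o, 't \<Rightarrow> 'm) ftor" where
  "reindex S S' \<phi> \<A> = mk_ftor (family_cat S \<A>) (\<lambda>V. \<lambda>s\<in>S'. V (\<phi> s)) (\<lambda>V W f. \<lambda>s\<in>S'. f (\<phi> s))"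


section \<open>The two-dimensional local field and the doubled group\<close>

text \<open>\<open>E = k((u))\<close> is \<^typ>\<open>'k fls\<close> and \<open>F = E((t))\<close> is \<^typ>\<open>'k fls fls\<close>; on nonzero elements
  the normalized valuations \<open>v\<^sub>u\<close> and \<open>v\<^sub>t\<close> are \<^const>\<open>fls_subdegree\<close>. Matrix indices range over a
  finite linearly ordered type \<open>'n\<close>, standing for \<open>{1, \<dots>, n}\<close> with \<open>n \<ge> 1\<close> arbitrary.\<close>

definition unif_u :: "'k::field fls fls" where "unif_u = fls_const fls_X"
definition unif_t :: "'k::field fls fls" where "unif_t = fls_X"

definition O2 :: "'k::field fls fls set" where
  "O2 = {fls_const (fps_to_fls a) + unif_t * fps_to_fls g | a g. True}"

definition tame_symbol :: "'k::field fls fls \<Rightarrow> 'k fls fls \<Rightarrow> 'k fls" where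
  "tame_symbol a b = (let va = fls_subdegree a; vb = fls_subdegree b in
     (- 1) powi (va * vb) * fls_nth (a powi vb * b powi (- va)) 0)"

definition nu_F :: "'k::field fls fls \<Rightarrow> 'k fls fls \<Rightarrow> int" where
  "nu_F a b = fls_subdegree (tame_symbol a b)"

definition GL :: "('a::field ^ 'n ^ 'n) monoid" where
  "GL = \<lparr>carrier = {A. invertible A}, mult = (**), one = mat 1\<rparr>"

type_synonym ('k, 'n) dbl = "('k fls fls ^ 'n ^ 'n) \<times> ('k fls fls ^ 'n ^ 'n)"

definition GH :: "('k::field, 'n::finite) dbl monoid" where "GH = GL \<times>\<times> GL"

definition borel :: "(('a::field, 'n::{finite, linorder}) vec, 'n) vec set" where
  "borel = {A. invertible A \<and> (\<forall>i j. j < i \<longrightarrow> A $ i $ j = 0)}"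

definition BH :: "('k::field, 'n::{finite, linorder}) dbl set" where "BH = borel \<times> borel"

definition congr_K :: "nat \<Rightarrow> nat \<Rightarrow> ('k::field fls fls ^ 'n ^ 'n) set" where
  "congr_K i j = {mat 1 + map_matrix (\<lambda>x. unif_u ^ i * unif_t ^ j * x) M | M. \<forall>r s. M $ r $ s \<in> O2}"

definition C_dbl :: "nat \<Rightarrow> nat \<Rightarrow> ('k::field, 'n::finite) dbl set" where
  "C_dbl i j = congr_K i j \<times> congr_K i j"

definition conj_set :: "('k::field, 'n::finite) dbl \<Rightarrow> ('k, 'n) dbl set \<Rightarrow> ('k, 'n) dbl set" where
  "conj_set h C = (h <#\<^bsub>GH\<^esub> C) #>\<^bsub>GH\<^esub> (inv\<^bsub>GH\<^esub> h)"

text \<open>The intersections are over nonempty finite families.\<close>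

definition CH :: "('k::field, 'n::finite) dbl set set" where
  "CH = {\<Inter>\<K> | \<K>. finite \<K> \<and> \<K> \<noteq> {} \<and>
     \<K> \<subseteq> {conj_set h (C_dbl i j) | h i j. h \<in> carrier GH \<and> 1 \<le> i \<and> 1 \<le> j}}"

definition SC :: "('k::field, 'n::finite) dbl set \<Rightarrow> ('k, 'n) dbl set set" where
  "SC C = {g <#\<^bsub>GH\<^esub> C | g. g \<in> carrier GH}"

definition sigma :: "('n::{finite, linorder} \<Rightarrow> lam) \<Rightarrow> ('k::field, 'n) dbl \<Rightarrow> ('k, 'n) dbl \<Rightarrow> lam" where
  "sigma \<alpha> b b' = (\<Prod>r\<in>UNIV. \<alpha> r powi (- nu_F (fst b $ r $ r) (snd b' $ r $ r)))"

text \<open>The line \<open>L\<^sub>b = \<Lambda> e\<^sub>b\<close>, realized as the functions supported at \<open>b\<close>, with \<open>e\<^sub>b\<close> the indicator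
  function of \<open>b\<close>, and the multiplication \<open>L\<^sub>b \<times> L\<^sub>b' \<rightarrow> L\<^sub>b\<^sub>b'\<close> with \<open>e\<^sub>b e\<^sub>b' = \<sigma>(b, b') e\<^sub>b\<^sub>b'\<close>.\<close>

definition line :: "('k::field, 'n::finite) dbl \<Rightarrow> (lam, ('k, 'n) dbl \<Rightarrow> lam) module" where
  "line b = \<lparr>carrier = {x. \<forall>c. c \<noteq> b \<longrightarrow> x c = 0}, mult = undefined, one = undefined,
     zero = (\<lambda>c. 0), add = (\<lambda>x y c. x c + y c), smult = (\<lambda>a x c. a * x c)\<rparr>"

definition line_basis :: "('k::field, 'n::finite) dbl \<Rightarrow> ('k, 'n) dbl \<Rightarrow> lam" where
  "line_basis b = (\<lambda>c. if c = b then 1 else 0)"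

definition line_mult :: "('n::{finite, linorder} \<Rightarrow> lam) \<Rightarrow> ('k::field, 'n) dbl \<Rightarrow> ('k, 'n) dbl \<Rightarrow>
    (('k, 'n) dbl \<Rightarrow> lam) \<Rightarrow> (('k, 'n) dbl \<Rightarrow> lam) \<Rightarrow> (('k, 'n) dbl \<Rightarrow> lam)" where
  "line_mult \<alpha> b b' x y = (\<lambda>c. x b * y b' * sigma \<alpha> b b' * line_basis (b \<otimes>\<^bsub>GH\<^esub> b') c)"


section \<open>Principal series at a fixed level\<close>

type_synonym ('k, 'n, 'v) fam = "('k, 'n) dbl set \<Rightarrow> (lam, 'v) module"
type_synonym ('k, 'n, 'v) fmor = "('k, 'n) dbl set \<Rightarrow> 'v \<Rightarrow> 'v"
type_synonym ('k, 'n, 'v) lvl_ob = "('k, 'n, 'v) fam \<times> (('k, 'n) dbl \<Rightarrow> ('k, 'n, 'v) fmor)"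

definition VC :: "('v \<Rightarrow> 'v set) \<Rightarrow> ('k::field, 'n::finite) dbl set \<Rightarrow>
    (lam, ('k, 'n, 'v) fam, ('k, 'n, 'v) fmor) lincat" where
  "VC elts C = family_cat (SC C) (Vect elts)"

text \<open>For \<open>D \<subseteq> C\<close> the projection \<open>gD \<mapsto> gC\<close> is \<open>s \<mapsto> sC\<close>; right translation
  \<open>g(hCh\<inverse>) \<mapsto> ghC\<close> is \<open>s \<mapsto> sh\<close>.\<close>

definition pull_V :: "('v \<Rightarrow> 'v set) \<Rightarrow> ('k::field, 'n::finite) dbl set \<Rightarrow> ('k, 'n) dbl set \<Rightarrow>
    (('k, 'n, 'v) fam, ('k, 'n, 'v) fmor, ('k, 'n, 'v) fam, ('k, 'n, 'v) fmor) ftor" where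
  "pull_V elts D C = reindex (SC C) (SC D) (\<lambda>s. s <#>\<^bsub>GH\<^esub> C) (Vect elts)"

definition right_V :: "('v \<Rightarrow> 'v set) \<Rightarrow> ('k::field, 'n::finite) dbl \<Rightarrow> ('k, 'n) dbl set \<Rightarrow>
    (('k, 'n, 'v) fam, ('k, 'n, 'v) fmor, ('k, 'n, 'v) fam, ('k, 'n, 'v) fmor) ftor" where
  "right_V elts h C = reindex (SC C) (SC (conj_set h C)) (\<lambda>s. s #>\<^bsub>GH\<^esub> h) (Vect elts)"

definition T_ftor :: "('v \<Rightarrow> 'v set) \<Rightarrow> ('k::field, 'n::finite) dbl set \<Rightarrow> ('k, 'n) dbl \<Rightarrow>
    (('k, 'n, 'v) fam, ('k, 'n, 'v) fmor, ('k, 'n, 'v) fam, ('k, 'n, 'v) fmor) ftor" where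
  "T_ftor elts C b = mk_ftor (VC elts C)
     (\<lambda>V. \<lambda>s\<in>SC C. tensor_space elts (line b) (V (inv\<^bsub>GH\<^esub> b <#\<^bsub>GH\<^esub> s)))
     (\<lambda>V W f. \<lambda>s\<in>SC C. tensor_id_map elts (line b)
        (V (inv\<^bsub>GH\<^esub> b <#\<^bsub>GH\<^esub> s)) (W (inv\<^bsub>GH\<^esub> b <#\<^bsub>GH\<^esub> s)) (f (inv\<^bsub>GH\<^esub> b <#\<^bsub>GH\<^esub> s)))"

text \<open>\<open>\<mu>\<^sub>b\<^sub>,\<^sub>b\<^sub>'(V) : T\<^sub>b T\<^sub>b\<^sub>' V \<rightarrow> T\<^sub>b\<^sub>b\<^sub>' V\<close>, \<open>x \<otimes> (y \<otimes> v) \<mapsto> m(x, y) \<otimes> v\<close>.\<close>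

definition mu_T :: "('v \<Rightarrow> 'v set) \<Rightarrow> ('n::{finite, linorder} \<Rightarrow> lam) \<Rightarrow> ('k::field, 'n) dbl set \<Rightarrow>
    ('k, 'n) dbl \<Rightarrow> ('k, 'n) dbl \<Rightarrow> ('k, 'n, 'v) fam \<Rightarrow> ('k, 'n, 'v) fmor" where
  "mu_T elts \<alpha> C b b' V = (\<lambda>s\<in>SC C.
     let bb = b \<otimes>\<^bsub>GH\<^esub> b'; T' = FOb (T_ftor elts C b') V;
         s1 = inv\<^bsub>GH\<^esub> b <#\<^bsub>GH\<^esub> s; s2 = inv\<^bsub>GH\<^esub> b' <#\<^bsub>GH\<^esub> s1
     in THE g. g \<in> lin_maps (FOb (T_ftor elts C b) T' s) (FOb (T_ftor elts C bb) V s) \<and>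
          (\<forall>x\<in>carrier (line b). \<forall>y\<in>carrier (line b'). \<forall>v\<in>carrier (V s2).
             g (tensor_elem elts (line b) (T' s1) x (tensor_elem elts (line b') (V s2) y v)) =
             tensor_elem elts (line bb) (V s2) (line_mult \<alpha> b b' x y) v))"

definition unit_T :: "('v \<Rightarrow> 'v set) \<Rightarrow> ('k::field, 'n::finite) dbl set \<Rightarrow>
    ('k, 'n, 'v) fam \<Rightarrow> ('k, 'n, 'v) fmor" where
  "unit_T elts C V = (let e = (\<one>\<^bsub>GH\<^esub> :: ('k, 'n) dbl) in (\<lambda>s\<in>SC C.
     THE g. g \<in> lin_maps (FOb (T_ftor elts C e) V s) (V s) \<and>
       (\<forall>v\<in>carrier (V s). g (tensor_elem elts (line e) (V s) (line_basis e) v) = v)))"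

definition IC :: "('v \<Rightarrow> 'v set) \<Rightarrow> ('n::{finite, linorder} \<Rightarrow> lam) \<Rightarrow> ('k::field, 'n) dbl set \<Rightarrow>
    (lam, ('k, 'n, 'v) lvl_ob, ('k, 'n, 'v) fmor) lincat" where
  "IC elts \<alpha> C = (let \<V> = VC elts C; T = T_ftor elts C in \<lparr>
     Ob = {(V, \<epsilon>). V \<in> Ob \<V> \<and> \<epsilon> \<in> extensional BH \<and>
       (\<forall>b\<in>BH. is_iso \<V> (FOb (T b) V) V (\<epsilon> b)) \<and>
       (\<forall>b\<in>BH. \<forall>b'\<in>BH.
          Cmp \<V> (FOb (T b) (FOb (T b') V)) (FOb (T (b \<otimes>\<^bsub>GH\<^esub> b')) V) V
            (\<epsilon> (b \<otimes>\<^bsub>GH\<^esub> b')) (mu_T elts \<alpha> C b b' V) =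
          Cmp \<V> (FOb (T b) (FOb (T b') V)) (FOb (T b) V) V
            (\<epsilon> b) (FMor (T b) (FOb (T b') V) V (\<epsilon> b'))) \<and>
       \<epsilon> \<one>\<^bsub>GH\<^esub> = unit_T elts C V},
     Hom = (\<lambda>(V, \<epsilon>) (W, \<delta>). {f \<in> Hom \<V> V W. \<forall>b\<in>BH.
       Cmp \<V> (FOb (T b) V) V W f (\<epsilon> b) =
       Cmp \<V> (FOb (T b) V) (FOb (T b) W) W (\<delta> b) (FMor (T b) V W f)}),
     Idm = (\<lambda>(V, \<epsilon>). Idm \<V> V),
     Cmp = (\<lambda>(U, \<gamma>) (V, \<epsilon>) (W, \<delta>). Cmp \<V> U V W),
     Zero = (\<lambda>(V, \<epsilon>) (W, \<delta>). Zero \<V> V W),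
     Add = (\<lambda>(V, \<epsilon>) (W, \<delta>). Add \<V> V W),
     Scale = (\<lambda>(V, \<epsilon>) (W, \<delta>). Scale \<V> V W)\<rparr>)"

text \<open>A functor \<open>\<Phi> : \<V>\<^sub>C \<rightarrow> \<V>\<^sub>D\<close> commuting strictly with all \<open>T\<^sub>b\<close> acts on equivariant families by
  \<open>(V, \<epsilon>) \<mapsto> (\<Phi> V, b \<mapsto> \<Phi>(\<epsilon>\<^sub>b))\<close>.\<close>

definition lift_ftor :: "('v \<Rightarrow> 'v set) \<Rightarrow> ('n::{finite, linorder} \<Rightarrow> lam) \<Rightarrow> ('k::field, 'n) dbl set \<Rightarrow>
    (('k, 'n, 'v) fam, ('k, 'n, 'v) fmor, ('k, 'n, 'v) fam, ('k, 'n, 'v) fmor) ftor \<Rightarrow>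
    (('k, 'n, 'v) lvl_ob, ('k, 'n, 'v) fmor, ('k, 'n, 'v) lvl_ob, ('k, 'n, 'v) fmor) ftor" where
  "lift_ftor elts \<alpha> C \<Phi> = mk_ftor (IC elts \<alpha> C)
     (\<lambda>(V, \<epsilon>). (FOb \<Phi> V, \<lambda>b\<in>BH. FMor \<Phi> (FOb (T_ftor elts C b) V) V (\<epsilon> b)))
     (\<lambda>X Y. FMor \<Phi> (fst X) (fst Y))"

definition pull :: "('v \<Rightarrow> 'v set) \<Rightarrow> ('n::{finite, linorder} \<Rightarrow> lam) \<Rightarrow> ('k::field, 'n) dbl set \<Rightarrow>
    ('k, 'n) dbl set \<Rightarrow>
    (('k, 'n, 'v) lvl_ob, ('k, 'n, 'v) fmor, ('k, 'n, 'v) lvl_ob, ('k, 'n, 'v) fmor) ftor" where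
  "pull elts \<alpha> D C = lift_ftor elts \<alpha> C (pull_V elts D C)"

definition right_tr :: "('v \<Rightarrow> 'v set) \<Rightarrow> ('n::{finite, linorder} \<Rightarrow> lam) \<Rightarrow> ('k::field, 'n) dbl \<Rightarrow>
    ('k, 'n) dbl set \<Rightarrow>
    (('k, 'n, 'v) lvl_ob, ('k, 'n, 'v) fmor, ('k, 'n, 'v) lvl_ob, ('k, 'n, 'v) fmor) ftor" where
  "right_tr elts \<alpha> h C = lift_ftor elts \<alpha> C (right_V elts h C)"


section \<open>The uniformly smooth principal series category\<close>

type_synonym ('k, 'n, 'v) ps_ob = "('k, 'n) dbl set \<times> ('k, 'n, 'v) lvl_ob"
type_synonym ('k, 'n, 'v) ps_mor = "(('k, 'n) dbl set \<times> ('k, 'n, 'v) fmor) set"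

text \<open>\<open>hom_reps\<close> are the pairs \<open>(D, f)\<close> with \<open>f\<close> a morphism at level \<open>D\<close>; \<open>hom_eq\<close> is the equivalence
  relation whose quotient is the filtered colimit of the Hom-sets.\<close>

definition hom_reps :: "('v \<Rightarrow> 'v set) \<Rightarrow> ('n::{finite, linorder} \<Rightarrow> lam) \<Rightarrow>
    ('k::field, 'n, 'v) ps_ob \<Rightarrow> ('k, 'n, 'v) ps_ob \<Rightarrow> ('k, 'n, 'v) ps_mor" where
  "hom_reps elts \<alpha> Y Y' = {(D, f). D \<in> CH \<and> D \<subseteq> fst Y \<inter> fst Y' \<and>
     f \<in> Hom (IC elts \<alpha> D) (FOb (pull elts \<alpha> D (fst Y)) (snd Y)) (FOb (pull elts \<alpha> D (fst Y')) (snd Y'))}"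

definition hom_eq :: "('v \<Rightarrow> 'v set) \<Rightarrow> ('n::{finite, linorder} \<Rightarrow> lam) \<Rightarrow>
    ('k::field, 'n, 'v) ps_ob \<Rightarrow> ('k, 'n, 'v) ps_ob \<Rightarrow>
    (('k, 'n) dbl set \<times> ('k, 'n, 'v) fmor) rel" where
  "hom_eq elts \<alpha> Y Y' = {((D, f), (D', f')).
     (D, f) \<in> hom_reps elts \<alpha> Y Y' \<and> (D', f') \<in> hom_reps elts \<alpha> Y Y' \<and>
     (\<exists>D''\<in>CH. D'' \<subseteq> D \<inter> D' \<and>
        FMor (pull elts \<alpha> D'' D)
          (FOb (pull elts \<alpha> D (fst Y)) (snd Y)) (FOb (pull elts \<alpha> D (fst Y')) (snd Y')) f =
        FMor (pull elts \<alpha> D'' D')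
          (FOb (pull elts \<alpha> D' (fst Y)) (snd Y)) (FOb (pull elts \<alpha> D' (fst Y')) (snd Y')) f')}"

definition hom_class :: "('v \<Rightarrow> 'v set) \<Rightarrow> ('n::{finite, linorder} \<Rightarrow> lam) \<Rightarrow>
    ('k::field, 'n, 'v) ps_ob \<Rightarrow> ('k, 'n, 'v) ps_ob \<Rightarrow>
    ('k, 'n) dbl set \<times> ('k, 'n, 'v) fmor \<Rightarrow> ('k, 'n, 'v) ps_mor" where
  "hom_class elts \<alpha> Y Y' p = hom_eq elts \<alpha> Y Y' `` {p}"

text \<open>Operations on classes are given by the union of the classes obtained from all
  representatives at a common level; all these classes coincide.\<close>

definition I_usm :: "('v \<Rightarrow> 'v set) \<Rightarrow> ('n::{finite, linorder} \<Rightarrow> lam) \<Rightarrow>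
    (lam, ('k::field, 'n, 'v) ps_ob, ('k, 'n, 'v) ps_mor) lincat" where
  "I_usm elts \<alpha> = (let P = (\<lambda>D Y. FOb (pull elts \<alpha> D (fst Y)) (snd Y)) in \<lparr>
     Ob = {(C, X). C \<in> CH \<and> X \<in> Ob (IC elts \<alpha> C)},
     Hom = (\<lambda>Y Y'. hom_reps elts \<alpha> Y Y' // hom_eq elts \<alpha> Y Y'),
     Idm = (\<lambda>Y. hom_class elts \<alpha> Y Y (fst Y, Idm (IC elts \<alpha> (fst Y)) (P (fst Y) Y))),
     Cmp = (\<lambda>X Y Z w' w. \<Union>{hom_class elts \<alpha> X Z
       (D, Cmp (IC elts \<alpha> D) (P D X) (P D Y) (P D Z) g f) | D f g. (D, f) \<in> w \<and> (D, g) \<in> w'}),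
     Zero = (\<lambda>Y Y'. hom_class elts \<alpha> Y Y' (fst Y \<inter> fst Y',
       Zero (IC elts \<alpha> (fst Y \<inter> fst Y')) (P (fst Y \<inter> fst Y') Y) (P (fst Y \<inter> fst Y') Y'))),
     Add = (\<lambda>Y Y' w w'. \<Union>{hom_class elts \<alpha> Y Y'
       (D, Add (IC elts \<alpha> D) (P D Y) (P D Y') f g) | D f g. (D, f) \<in> w \<and> (D, g) \<in> w'}),
     Scale = (\<lambda>Y Y' c w. \<Union>{hom_class elts \<alpha> Y Y'
       (D, Scale (IC elts \<alpha> D) (P D Y) (P D Y') c f) | D f. (D, f) \<in> w})\<rparr>)"

definition R_ob :: "('v \<Rightarrow> 'v set) \<Rightarrow> ('n::{finite, linorder} \<Rightarrow> lam) \<Rightarrow> ('k::field, 'n) dbl \<Rightarrow>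
    ('k, 'n, 'v) ps_ob \<Rightarrow> ('k, 'n, 'v) ps_ob" where
  "R_ob elts \<alpha> h = (\<lambda>(C, X). (conj_set h C, FOb (right_tr elts \<alpha> h C) X))"

definition R_ftor :: "('v \<Rightarrow> 'v set) \<Rightarrow> ('n::{finite, linorder} \<Rightarrow> lam) \<Rightarrow> ('k::field, 'n) dbl \<Rightarrow>
    (('k, 'n, 'v) ps_ob, ('k, 'n, 'v) ps_mor, ('k, 'n, 'v) ps_ob, ('k, 'n, 'v) ps_mor) ftor" where
  "R_ftor elts \<alpha> h = mk_ftor (I_usm elts \<alpha>) (R_ob elts \<alpha> h)
     (\<lambda>Y Y' w. \<Union>{hom_class elts \<alpha> (R_ob elts \<alpha> h Y) (R_ob elts \<alpha> h Y')
        (conj_set h D, FMor (right_tr elts \<alpha> h D)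
           (FOb (pull elts \<alpha> D (fst Y)) (snd Y)) (FOb (pull elts \<alpha> D (fst Y')) (snd Y')) f)
        | D f. (D, f) \<in> w})"

definition rho :: "('v \<Rightarrow> 'v set) \<Rightarrow> ('n::{finite, linorder} \<Rightarrow> lam) \<Rightarrow>
    (('k::field, 'n::{finite, linorder}) dbl, ('k, 'n, 'v) ps_ob, ('k, 'n, 'v) ps_mor) two_rep" where
  "rho elts \<alpha> = (let \<N> = Aut_ex Lam (I_usm elts \<alpha>) in \<lparr>
     FOb = (\<lambda>h\<in>carrier GH. R_ftor elts \<alpha> h),
     FMor = (\<lambda>h h' x. if h \<in> carrier GH \<and> h = h' then Idm \<N> (R_ftor elts \<alpha> h) else undefined),
     MMu = (\<lambda>h h'. Idm \<N> (R_ftor elts \<alpha> (h \<otimes>\<^bsub>GH\<^esub> h'))),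
     MEps = Idm \<N> (R_ftor elts \<alpha> \<one>\<^bsub>GH\<^esub>)\<rparr>)"

end

theory Submission
  imports Defs "HOL-Analysis.Cartesian_Space"
begin

text \<open>The category is a filtered colimit of the fixed-level categories along pullback functors, and its
  properties are inherited from a single level.

  \<^bold>\<open>Abelian colimits.\<close> Finitely many morphisms of the colimit are represented at a common level, and two
  representatives define the same morphism iff they agree at some smaller level. A kernel formed at one
  level stays a kernel at all smaller levels, hence is a kernel in the colimit (\<open>colim_kernel\<close>). A
  monomorphism of the colimit has a kernel that vanishes at some level, so at that level it is a
  monomorphism and thus a kernel (\<open>colim_mono_is_kernel\<close>). With the opposite categories for cokernels this
  shows that a strict colimit of abelian categories along exact functors is abelian (\<open>abelian_colim\<close>).

  \<^bold>\<open>A fixed level.\<close> Tensoring with the line \<open>L\<^sub>b\<close> does not change a space up to isomorphism, as \<open>V\<close> itself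
  is a tensor product \<open>L\<^sub>b \<otimes> V\<close>. An equivariant family is therefore a family \<open>V\<close> with bijective linear
  maps \<open>V\<^bsub>b\<inverse>s\<^esub> \<rightarrow> V\<^sub>s\<close> that compose up to the cocycle, and its morphisms are the families of linear maps
  commuting with these (\<open>IC_ob_iff\<close>, \<open>IC_hom_iff\<close>). Kernels, quotients and direct sums formed at each coset
  inherit such maps, so the category is abelian (\<open>IC_abelian\<close>), and being a kernel or a cokernel is a
  condition at each coset (\<open>is_kernel_ptw\<close>, \<open>is_cokernel_ptw\<close>).

  \<^bold>\<open>Translation.\<close> Pullback to a smaller level and right translation both precompose families with a map of
  coset spaces. Hence they preserve conditions at each coset, in particular kernels and cokernels, and
  all literal equalities between their composites reduce to equalities between maps of coset spaces
  (\<open>reindexing_comp\<close>). Right translation by \<open>h\<close> is an isomorphism of categories with inverse right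
  translation by \<open>h\<inverse>\<close>, so it is exact (\<open>act_exact\<close>). An element \<open>h\<close> of \<open>C\<close> satisfies \<open>g C h = g C\<close>, so it
  fixes literally everything at level \<open>C\<close>; this is uniform smoothness.

  All of this requires the members of \<open>\<C>\<^sub>H\<close> to be subgroups, that is, \<open>1 + u\<^sup>i t\<^sup>j M\<^sub>n(O2)\<close> to be closed
  under inverses (\<open>congr_K_subgroup\<close>).\<close>

(* Frees the name of the locale of modules over a record ring, and the notation for coordinates of vectors. *)
hide_const (open) Modules.module

no_notation fps_nth (infixl "$" 75)

section \<open>Linear categories and their opposites\<close>

locale lin_cat =
  fixes R :: "'r ring" and \<A> :: "('r, 'o, 'm) lincat"
  assumes linear: "linear_category R \<A>"
begin

lemma id_in: "X \<in> Ob \<A> \<Longrightarrow> Idm \<A> X \<in> Hom \<A> X X"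
  and cmp_in: "\<lbrakk>X \<in> Ob \<A>; Y \<in> Ob \<A>; Z \<in> Ob \<A>; f \<in> Hom \<A> X Y; g \<in> Hom \<A> Y Z\<rbrakk>
    \<Longrightarrow> Cmp \<A> X Y Z g f \<in> Hom \<A> X Z"
  and id_right: "\<lbrakk>X \<in> Ob \<A>; Y \<in> Ob \<A>; f \<in> Hom \<A> X Y\<rbrakk> \<Longrightarrow> Cmp \<A> X X Y f (Idm \<A> X) = f"
  and id_left: "\<lbrakk>X \<in> Ob \<A>; Y \<in> Ob \<A>; f \<in> Hom \<A> X Y\<rbrakk> \<Longrightarrow> Cmp \<A> X Y Y (Idm \<A> Y) f = f"
  and assoc: "\<lbrakk>W \<in> Ob \<A>; X \<in> Ob \<A>; Y \<in> Ob \<A>; Z \<in> Ob \<A>;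
      f \<in> Hom \<A> W X; g \<in> Hom \<A> X Y; h \<in> Hom \<A> Y Z\<rbrakk>
    \<Longrightarrow> Cmp \<A> W Y Z h (Cmp \<A> W X Y g f) = Cmp \<A> W X Z (Cmp \<A> X Y Z h g) f"
  using linear unfolding linear_category_def is_category_def by simp_all

lemma hom_mod: "\<lbrakk>X \<in> Ob \<A>; Y \<in> Ob \<A>\<rbrakk> \<Longrightarrow> module R (hom_module \<A> X Y)"
  and cmp_add_right: "\<lbrakk>X \<in> Ob \<A>; Y \<in> Ob \<A>; Z \<in> Ob \<A>;
      f \<in> Hom \<A> X Y; f' \<in> Hom \<A> X Y; g \<in> Hom \<A> Y Z\<rbrakk>
    \<Longrightarrow> Cmp \<A> X Y Z g (Add \<A> X Y f f') = Add \<A> X Z (Cmp \<A> X Y Z g f) (Cmp \<A> X Y Z g f')"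
  and cmp_add_left: "\<lbrakk>X \<in> Ob \<A>; Y \<in> Ob \<A>; Z \<in> Ob \<A>;
      f \<in> Hom \<A> X Y; g \<in> Hom \<A> Y Z; g' \<in> Hom \<A> Y Z\<rbrakk>
    \<Longrightarrow> Cmp \<A> X Y Z (Add \<A> Y Z g g') f = Add \<A> X Z (Cmp \<A> X Y Z g f) (Cmp \<A> X Y Z g' f)"
  and cmp_scale_right: "\<lbrakk>X \<in> Ob \<A>; Y \<in> Ob \<A>; Z \<in> Ob \<A>;
      f \<in> Hom \<A> X Y; g \<in> Hom \<A> Y Z; c \<in> carrier R\<rbrakk>
    \<Longrightarrow> Cmp \<A> X Y Z g (Scale \<A> X Y c f) = Scale \<A> X Z c (Cmp \<A> X Y Z g f)"
  and cmp_scale_left: "\<lbrakk>X \<in> Ob \<A>; Y \<in> Ob \<A>; Z \<in> Ob \<A>;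
      f \<in> Hom \<A> X Y; g \<in> Hom \<A> Y Z; c \<in> carrier R\<rbrakk>
    \<Longrightarrow> Cmp \<A> X Y Z (Scale \<A> Y Z c g) f = Scale \<A> X Z c (Cmp \<A> X Y Z g f)"
  using linear unfolding linear_category_def by simp_all

context
  fixes X Y assumes XY: "X \<in> Ob \<A>" "Y \<in> Ob \<A>"
begin

interpretation M: module R "hom_module \<A> X Y" by (rule hom_mod[OF XY])

lemma zero_in: "Zero \<A> X Y \<in> Hom \<A> X Y"
  using M.zero_closed by (simp add: hom_module_def)

lemma add_in: "\<lbrakk>f \<in> Hom \<A> X Y; g \<in> Hom \<A> X Y\<rbrakk> \<Longrightarrow> Add \<A> X Y f g \<in> Hom \<A> X Y"
  using M.add.m_closed by (simp add: hom_module_def)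

lemma scale_in: "\<lbrakk>f \<in> Hom \<A> X Y; c \<in> carrier R\<rbrakk> \<Longrightarrow> Scale \<A> X Y c f \<in> Hom \<A> X Y"
  using M.smult_closed by (simp add: hom_module_def)

lemma zero_scale: "f \<in> Hom \<A> X Y \<Longrightarrow> Scale \<A> X Y \<zero>\<^bsub>R\<^esub> f = Zero \<A> X Y"
  using M.smult_l_null by (simp add: hom_module_def)

lemma add_zero: "f \<in> Hom \<A> X Y \<Longrightarrow> Add \<A> X Y (Zero \<A> X Y) f = f"
  using M.add.l_one by (simp add: hom_module_def)

lemma sub_eq_zero:
  assumes "f \<in> Hom \<A> X Y" "g \<in> Hom \<A> X Y"
  shows "Add \<A> X Y f (Scale \<A> X Y (\<ominus>\<^bsub>R\<^esub> \<one>\<^bsub>R\<^esub>) g) = Zero \<A> X Y \<longleftrightarrow> f = g"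
proof -
  let ?M = "hom_module \<A> X Y"
  have fg: "f \<in> carrier ?M" "g \<in> carrier ?M" using assms by (simp_all add: hom_module_def)
  have "(\<ominus>\<^bsub>R\<^esub> \<one>\<^bsub>R\<^esub>) \<odot>\<^bsub>?M\<^esub> g = \<ominus>\<^bsub>?M\<^esub> g"
    using fg by (simp add: M.smult_l_minus)
  moreover have "f \<oplus>\<^bsub>?M\<^esub> (\<ominus>\<^bsub>?M\<^esub> g) = \<zero>\<^bsub>?M\<^esub> \<longleftrightarrow> f = g"
    using fg by (metis M.r_neg M.minus_equality M.add.inv_closed M.minus_minus M.a_comm)
  ultimately show ?thesis by (simp add: hom_module_def)
qed

end

lemma cmp_zero_right:
  assumes "X \<in> Ob \<A>" "Y \<in> Ob \<A>" "Z \<in> Ob \<A>" "g \<in> Hom \<A> Y Z"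
  shows "Cmp \<A> X Y Z g (Zero \<A> X Y) = Zero \<A> X Z"
proof -
  interpret M: module R "hom_module \<A> X Y" using assms by (intro hom_mod)
  show ?thesis
    using assms cmp_scale_right[of X Y Z "Zero \<A> X Y" g "\<zero>\<^bsub>R\<^esub>"]
    by (simp add: zero_in zero_scale cmp_in)
qed

lemma cmp_zero_left:
  assumes "X \<in> Ob \<A>" "Y \<in> Ob \<A>" "Z \<in> Ob \<A>" "f \<in> Hom \<A> X Y"
  shows "Cmp \<A> X Y Z (Zero \<A> Y Z) f = Zero \<A> X Z"
proof -
  interpret M: module R "hom_module \<A> X Y" using assms by (intro hom_mod)
  show ?thesis
    using assms cmp_scale_left[of X Y Z f "Zero \<A> Y Z" "\<zero>\<^bsub>R\<^esub>"]
    by (simp add: zero_in zero_scale cmp_in)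
qed

lemma mono_iff:
  assumes "X \<in> Ob \<A>" "Y \<in> Ob \<A>" "f \<in> Hom \<A> X Y"
  shows "is_mono \<A> X Y f \<longleftrightarrow>
    (\<forall>W\<in>Ob \<A>. \<forall>g\<in>Hom \<A> W X. Cmp \<A> W X Y f g = Zero \<A> W Y \<longrightarrow> g = Zero \<A> W X)"
    (is "?L \<longleftrightarrow> ?R")
proof
  assume ?L
  then show ?R unfolding is_mono_def using assms by (metis cmp_zero_right zero_in)
next
  assume R: ?R
  have "g = h" if W: "W \<in> Ob \<A>" and g: "g \<in> Hom \<A> W X" and h: "h \<in> Hom \<A> W X"
    and eq: "Cmp \<A> W X Y f g = Cmp \<A> W X Y f h" for W g h
  proof -
    interpret M: module R "hom_module \<A> W X" using assms W by (intro hom_mod)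
    let ?d = "Scale \<A> W X (\<ominus>\<^bsub>R\<^esub> \<one>\<^bsub>R\<^esub>) h"
    have c: "\<ominus>\<^bsub>R\<^esub> \<one>\<^bsub>R\<^esub> \<in> carrier R" by simp
    have "Cmp \<A> W X Y f (Add \<A> W X g ?d) = Zero \<A> W Y"
      using assms W g h c eq
      by (simp add: cmp_add_right scale_in cmp_scale_right sub_eq_zero cmp_in)
    then have "Add \<A> W X g ?d = Zero \<A> W X"
      using R W assms g h c by (simp add: add_in scale_in)
    then show ?thesis using sub_eq_zero[OF W assms(1) g h] by simp
  qed
  then show ?L unfolding is_mono_def by blast
qed

lemma mono_of_zero_kernel:
  assumes "X \<in> Ob \<A>" "Y \<in> Ob \<A>" "f \<in> Hom \<A> X Y"
    and "is_kernel \<A> X Y f K (Zero \<A> K X)"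
  shows "is_mono \<A> X Y f"
  unfolding mono_iff[OF assms(1-3)]
  using assms(4) cmp_zero_left[of _ K X] assms(1) unfolding is_kernel_def by metis

lemma zero_object_iff:
  assumes "Z \<in> Ob \<A>" shows "is_zero_object \<A> Z \<longleftrightarrow> Idm \<A> Z = Zero \<A> Z Z"
proof
  assume "is_zero_object \<A> Z"
  then show "Idm \<A> Z = Zero \<A> Z Z"
    using assms id_in zero_in unfolding is_zero_object_def by metis
next
  assume e: "Idm \<A> Z = Zero \<A> Z Z"
  have "f = Zero \<A> Z X" if "X \<in> Ob \<A>" "f \<in> Hom \<A> Z X" for X f
    using that e id_right cmp_zero_right assms by metis
  moreover have "f = Zero \<A> X Z" if "X \<in> Ob \<A>" "f \<in> Hom \<A> X Z" for X f
    using that e id_left cmp_zero_left assms by metis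
  ultimately show "is_zero_object \<A> Z"
    unfolding is_zero_object_def using assms zero_in by metis
qed

end

lemma kernel_is_mono:
  assumes "is_kernel \<A> X Y f K i" "lin_cat R \<A>" "X \<in> Ob \<A>" "Y \<in> Ob \<A>" "f \<in> Hom \<A> X Y"
  shows "is_mono \<A> K X i"
proof -
  interpret lin_cat R \<A> by fact
  show ?thesis unfolding is_mono_def
  proof (intro ballI impI)
    fix W g h assume W: "W \<in> Ob \<A>" "g \<in> Hom \<A> W K" "h \<in> Hom \<A> W K"
      and e: "Cmp \<A> W K X i g = Cmp \<A> W K X i h"
    have K: "K \<in> Ob \<A>" "i \<in> Hom \<A> K X" "Cmp \<A> K X Y f i = Zero \<A> K Y"
      using assms(1) by (auto simp: is_kernel_def)
    have "Cmp \<A> W K X i g \<in> Hom \<A> W X" "Cmp \<A> W X Y f (Cmp \<A> W K X i g) = Zero \<A> W Y"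
      using W K assms by (simp_all add: cmp_in assoc cmp_zero_left)
    then show "g = h" using assms(1) W e unfolding is_kernel_def by metis
  qed
qed

text \<open>Cokernels are kernels in the opposite category, so every general result on kernels below also
  yields the corresponding one on cokernels.\<close>

lemma (in lin_cat)
  assumes "X \<in> Ob \<A>" "Y \<in> Ob \<A>"
  shows scalars_cring: "cring R"
    and add_assoc: "\<lbrakk>f \<in> Hom \<A> X Y; g \<in> Hom \<A> X Y; h \<in> Hom \<A> X Y\<rbrakk> \<Longrightarrow>
        Add \<A> X Y (Add \<A> X Y f g) h = Add \<A> X Y f (Add \<A> X Y g h)"
    and add_comm: "\<lbrakk>f \<in> Hom \<A> X Y; g \<in> Hom \<A> X Y\<rbrakk> \<Longrightarrow> Add \<A> X Y f g = Add \<A> X Y g f"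
    and add_neg: "f \<in> Hom \<A> X Y \<Longrightarrow>
        Add \<A> X Y (Scale \<A> X Y (\<ominus>\<^bsub>R\<^esub> \<one>\<^bsub>R\<^esub>) f) f = Zero \<A> X Y"
    and scale_add_left: "\<lbrakk>f \<in> Hom \<A> X Y; a \<in> carrier R; b \<in> carrier R\<rbrakk> \<Longrightarrow>
        Scale \<A> X Y (a \<oplus>\<^bsub>R\<^esub> b) f = Add \<A> X Y (Scale \<A> X Y a f) (Scale \<A> X Y b f)"
    and scale_add_right: "\<lbrakk>f \<in> Hom \<A> X Y; g \<in> Hom \<A> X Y; a \<in> carrier R\<rbrakk> \<Longrightarrow>
        Scale \<A> X Y a (Add \<A> X Y f g) = Add \<A> X Y (Scale \<A> X Y a f) (Scale \<A> X Y a g)"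
    and scale_mult: "\<lbrakk>f \<in> Hom \<A> X Y; a \<in> carrier R; b \<in> carrier R\<rbrakk> \<Longrightarrow>
        Scale \<A> X Y (a \<otimes>\<^bsub>R\<^esub> b) f = Scale \<A> X Y a (Scale \<A> X Y b f)"
    and scale_one: "f \<in> Hom \<A> X Y \<Longrightarrow> Scale \<A> X Y \<one>\<^bsub>R\<^esub> f = f"
proof -
  interpret M: module R "hom_module \<A> X Y" by (rule hom_mod[OF assms])
  show "cring R" by (rule M.R.is_cring)
  show "\<lbrakk>f \<in> Hom \<A> X Y; g \<in> Hom \<A> X Y; h \<in> Hom \<A> X Y\<rbrakk> \<Longrightarrow>
      Add \<A> X Y (Add \<A> X Y f g) h = Add \<A> X Y f (Add \<A> X Y g h)"
    using M.a_assoc by (simp add: hom_module_def)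
  show "\<lbrakk>f \<in> Hom \<A> X Y; g \<in> Hom \<A> X Y\<rbrakk> \<Longrightarrow> Add \<A> X Y f g = Add \<A> X Y g f"
    using M.a_comm by (simp add: hom_module_def)
  show "Add \<A> X Y (Scale \<A> X Y (\<ominus>\<^bsub>R\<^esub> \<one>\<^bsub>R\<^esub>) f) f = Zero \<A> X Y" if "f \<in> Hom \<A> X Y"
  proof -
    have f: "f \<in> carrier (hom_module \<A> X Y)" using that by (simp add: hom_module_def)
    then show ?thesis
      using M.l_neg[OF f] M.smult_l_minus[OF M.R.one_closed f, unfolded M.smult_one[OF f]] by (simp add: hom_module_def)
  qed
  show "\<lbrakk>f \<in> Hom \<A> X Y; a \<in> carrier R; b \<in> carrier R\<rbrakk> \<Longrightarrow>
      Scale \<A> X Y (a \<oplus>\<^bsub>R\<^esub> b) f = Add \<A> X Y (Scale \<A> X Y a f) (Scale \<A> X Y b f)"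
    using M.smult_l_distr by (simp add: hom_module_def)
  show "\<lbrakk>f \<in> Hom \<A> X Y; g \<in> Hom \<A> X Y; a \<in> carrier R\<rbrakk> \<Longrightarrow>
      Scale \<A> X Y a (Add \<A> X Y f g) = Add \<A> X Y (Scale \<A> X Y a f) (Scale \<A> X Y a g)"
    using M.smult_r_distr by (simp add: hom_module_def)
  show "\<lbrakk>f \<in> Hom \<A> X Y; a \<in> carrier R; b \<in> carrier R\<rbrakk> \<Longrightarrow>
      Scale \<A> X Y (a \<otimes>\<^bsub>R\<^esub> b) f = Scale \<A> X Y a (Scale \<A> X Y b f)"
    using M.smult_assoc1 by (simp add: hom_module_def)
  show "f \<in> Hom \<A> X Y \<Longrightarrow> Scale \<A> X Y \<one>\<^bsub>R\<^esub> f = f"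
    using M.smult_one by (simp add: hom_module_def)
qed

text \<open>Additive inverses are the multiples by \<open>-1\<close>, so the laws of scalars provide them.\<close>

lemma hom_moduleI:
  assumes "cring R"
    and "Zero \<A> X Y \<in> Hom \<A> X Y"
    and "\<And>f g. \<lbrakk>f \<in> Hom \<A> X Y; g \<in> Hom \<A> X Y\<rbrakk> \<Longrightarrow> Add \<A> X Y f g \<in> Hom \<A> X Y"
    and "\<And>a f. \<lbrakk>f \<in> Hom \<A> X Y; a \<in> carrier R\<rbrakk> \<Longrightarrow> Scale \<A> X Y a f \<in> Hom \<A> X Y"
    and "\<And>f g h. \<lbrakk>f \<in> Hom \<A> X Y; g \<in> Hom \<A> X Y; h \<in> Hom \<A> X Y\<rbrakk> \<Longrightarrow>
        Add \<A> X Y (Add \<A> X Y f g) h = Add \<A> X Y f (Add \<A> X Y g h)"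
    and "\<And>f g. \<lbrakk>f \<in> Hom \<A> X Y; g \<in> Hom \<A> X Y\<rbrakk> \<Longrightarrow> Add \<A> X Y f g = Add \<A> X Y g f"
    and "\<And>f. f \<in> Hom \<A> X Y \<Longrightarrow> Add \<A> X Y (Zero \<A> X Y) f = f"
    and "\<And>f. f \<in> Hom \<A> X Y \<Longrightarrow> Add \<A> X Y (Scale \<A> X Y (\<ominus>\<^bsub>R\<^esub> \<one>\<^bsub>R\<^esub>) f) f = Zero \<A> X Y"
    and "\<And>a b f. \<lbrakk>f \<in> Hom \<A> X Y; a \<in> carrier R; b \<in> carrier R\<rbrakk> \<Longrightarrow>
        Scale \<A> X Y (a \<oplus>\<^bsub>R\<^esub> b) f = Add \<A> X Y (Scale \<A> X Y a f) (Scale \<A> X Y b f)"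
    and "\<And>a f g. \<lbrakk>f \<in> Hom \<A> X Y; g \<in> Hom \<A> X Y; a \<in> carrier R\<rbrakk> \<Longrightarrow>
        Scale \<A> X Y a (Add \<A> X Y f g) = Add \<A> X Y (Scale \<A> X Y a f) (Scale \<A> X Y a g)"
    and "\<And>a b f. \<lbrakk>f \<in> Hom \<A> X Y; a \<in> carrier R; b \<in> carrier R\<rbrakk> \<Longrightarrow>
        Scale \<A> X Y (a \<otimes>\<^bsub>R\<^esub> b) f = Scale \<A> X Y a (Scale \<A> X Y b f)"
    and "\<And>f. f \<in> Hom \<A> X Y \<Longrightarrow> Scale \<A> X Y \<one>\<^bsub>R\<^esub> f = f"
  shows "module R (hom_module \<A> X Y)"
proof -
  interpret R: cring R by fact
  show ?thesis
  proof (intro moduleI abelian_groupI)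
    show "\<exists>g\<in>carrier (hom_module \<A> X Y). g \<oplus>\<^bsub>hom_module \<A> X Y\<^esub> f = \<zero>\<^bsub>hom_module \<A> X Y\<^esub>"
      if "f \<in> carrier (hom_module \<A> X Y)" for f
      using that assms(4,8)[of f] by (intro bexI[of _ "Scale \<A> X Y (\<ominus>\<^bsub>R\<^esub> \<one>\<^bsub>R\<^esub>) f"]) (simp_all add: hom_module_def)
    show "f \<oplus>\<^bsub>hom_module \<A> X Y\<^esub> g = g \<oplus>\<^bsub>hom_module \<A> X Y\<^esub> f"
      if "f \<in> carrier (hom_module \<A> X Y)" "g \<in> carrier (hom_module \<A> X Y)" for f g
      using that assms(6) by (simp add: hom_module_def)
  qed (simp_all add: hom_module_def R.is_cring assms(2-5,7,9-))
qed

definition op_cat :: "('r, 'o, 'm) lincat \<Rightarrow> ('r, 'o, 'm) lincat" where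
  "op_cat \<A> = \<lparr>Ob = Ob \<A>, Hom = (\<lambda>X Y. Hom \<A> Y X), Idm = Idm \<A>,
     Cmp = (\<lambda>X Y Z g f. Cmp \<A> Z Y X f g), Zero = (\<lambda>X Y. Zero \<A> Y X),
     Add = (\<lambda>X Y. Add \<A> Y X), Scale = (\<lambda>X Y. Scale \<A> Y X)\<rparr>"

definition op_ftor :: "('o, 'm, 'p, 'q) ftor \<Rightarrow> ('o, 'm, 'p, 'q) ftor" where
  "op_ftor F = \<lparr>FOb = FOb F, FMor = (\<lambda>X Y. FMor F Y X)\<rparr>"

lemma op_cat_simps [simp]:
  "Ob (op_cat \<A>) = Ob \<A>" "Hom (op_cat \<A>) X Y = Hom \<A> Y X" "Idm (op_cat \<A>) = Idm \<A>"
  "Cmp (op_cat \<A>) X Y Z g f = Cmp \<A> Z Y X f g" "Zero (op_cat \<A>) X Y = Zero \<A> Y X"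
  "Add (op_cat \<A>) X Y = Add \<A> Y X" "Scale (op_cat \<A>) X Y = Scale \<A> Y X"
  "hom_module (op_cat \<A>) X Y = hom_module \<A> Y X"
  by (simp_all add: op_cat_def hom_module_def)

lemma op_ftor_simps [simp]: "FOb (op_ftor F) = FOb F" "FMor (op_ftor F) X Y = FMor F Y X"
  by (simp_all add: op_ftor_def)

lemma is_kernel_op: "is_kernel (op_cat \<A>) X Y f K i \<longleftrightarrow> is_cokernel \<A> Y X f K i"
  and is_cokernel_op: "is_cokernel (op_cat \<A>) X Y f K i \<longleftrightarrow> is_kernel \<A> Y X f K i"
  and is_mono_op: "is_mono (op_cat \<A>) X Y f \<longleftrightarrow> is_epi \<A> Y X f"
  and is_epi_op: "is_epi (op_cat \<A>) X Y f \<longleftrightarrow> is_mono \<A> Y X f"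
  and is_zero_object_op: "is_zero_object (op_cat \<A>) Z \<longleftrightarrow> is_zero_object \<A> Z"
  and is_biproduct_op: "is_biproduct (op_cat \<A>) X Y B i j p q \<longleftrightarrow> is_biproduct \<A> X Y B p q i j"
  by (auto simp: is_kernel_def is_cokernel_def is_mono_def is_epi_def is_zero_object_def
      is_biproduct_def)

lemma linear_category_op:
  assumes "linear_category R \<A>" shows "linear_category R (op_cat \<A>)"
proof -
  interpret lin_cat R \<A> using assms by unfold_locales
  show ?thesis
    unfolding linear_category_def is_category_def
    by (simp add: id_in cmp_in id_left id_right assoc hom_mod cmp_add_left cmp_add_right
        cmp_scale_left cmp_scale_right)
qed

lemma abelian_op:
  assumes "abelian_linear_category R \<A>" shows "abelian_linear_category R (op_cat \<A>)"
  unfolding abelian_linear_category_def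
proof (intro conjI ballI impI)
  note a = assms[unfolded abelian_linear_category_def]
  show "linear_category R (op_cat \<A>)" using a by (simp add: linear_category_op)
  show "\<exists>Z. is_zero_object (op_cat \<A>) Z" using a by (simp add: is_zero_object_op)
  fix X Y assume XY: "X \<in> Ob (op_cat \<A>)" "Y \<in> Ob (op_cat \<A>)"
  show "\<exists>P i j p q. is_biproduct (op_cat \<A>) X Y P i j p q"
    using a XY unfolding is_biproduct_op op_cat_simps by metis
  fix f assume f: "f \<in> Hom (op_cat \<A>) X Y"
  show "\<exists>K i. is_kernel (op_cat \<A>) X Y f K i" "\<exists>K i. is_cokernel (op_cat \<A>) X Y f K i"
    using a XY f unfolding is_kernel_op is_cokernel_op op_cat_simps by blast+
  show "\<exists>Z\<in>Ob (op_cat \<A>). \<exists>g\<in>Hom (op_cat \<A>) Y Z. is_kernel (op_cat \<A>) Y Z g X f"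
    if "is_mono (op_cat \<A>) X Y f"
    using a XY f that unfolding is_kernel_op is_mono_op op_cat_simps by blast
  show "\<exists>Z\<in>Ob (op_cat \<A>). \<exists>g\<in>Hom (op_cat \<A>) Z X. is_cokernel (op_cat \<A>) Z X g Y f"
    if "is_epi (op_cat \<A>) X Y f"
    using a XY f that unfolding is_cokernel_op is_epi_op op_cat_simps by blast
qed

lemma is_ftor_op: "is_ftor \<A> \<B> F \<Longrightarrow> is_ftor (op_cat \<A>) (op_cat \<B>) (op_ftor F)"
  unfolding is_ftor_def by auto

lemma linear_ftor_op:
  "linear_ftor R \<A> \<B> F \<Longrightarrow> linear_ftor R (op_cat \<A>) (op_cat \<B>) (op_ftor F)"
  unfolding linear_ftor_def by (simp add: is_ftor_op)

lemma
  assumes "is_ftor \<A> \<B> F"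
  shows ftor_ob: "X \<in> Ob \<A> \<Longrightarrow> FOb F X \<in> Ob \<B>"
    and ftor_mor: "\<lbrakk>X \<in> Ob \<A>; Y \<in> Ob \<A>; f \<in> Hom \<A> X Y\<rbrakk> \<Longrightarrow> FMor F X Y f \<in> Hom \<B> (FOb F X) (FOb F Y)"
    and ftor_id: "X \<in> Ob \<A> \<Longrightarrow> FMor F X X (Idm \<A> X) = Idm \<B> (FOb F X)"
    and ftor_cmp: "\<lbrakk>X \<in> Ob \<A>; Y \<in> Ob \<A>; Z \<in> Ob \<A>; f \<in> Hom \<A> X Y; g \<in> Hom \<A> Y Z\<rbrakk> \<Longrightarrow>
        FMor F X Z (Cmp \<A> X Y Z g f) =
        Cmp \<B> (FOb F X) (FOb F Y) (FOb F Z) (FMor F Y Z g) (FMor F X Y f)"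
  using assms unfolding is_ftor_def by (auto simp: PiE_iff)

lemma
  assumes "linear_ftor R \<A> \<B> F"
  shows linear_ftor_is_ftor: "is_ftor \<A> \<B> F"
    and ftor_add: "\<lbrakk>X \<in> Ob \<A>; Y \<in> Ob \<A>; f \<in> Hom \<A> X Y; g \<in> Hom \<A> X Y\<rbrakk> \<Longrightarrow>
        FMor F X Y (Add \<A> X Y f g) = Add \<B> (FOb F X) (FOb F Y) (FMor F X Y f) (FMor F X Y g)"
    and ftor_scale: "\<lbrakk>X \<in> Ob \<A>; Y \<in> Ob \<A>; f \<in> Hom \<A> X Y; c \<in> carrier R\<rbrakk> \<Longrightarrow>
        FMor F X Y (Scale \<A> X Y c f) = Scale \<B> (FOb F X) (FOb F Y) c (FMor F X Y f)"
  using assms unfolding linear_ftor_def by simp_all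

lemma ftor_zero:
  assumes F: "linear_ftor R \<A> \<B> F" and "lin_cat R \<A>" "lin_cat R \<B>" and XY: "X \<in> Ob \<A>" "Y \<in> Ob \<A>"
  shows "FMor F X Y (Zero \<A> X Y) = Zero \<B> (FOb F X) (FOb F Y)"
proof -
  interpret A: lin_cat R \<A> by fact
  interpret B: lin_cat R \<B> by fact
  interpret M: module R "hom_module \<A> X Y" using XY by (rule A.hom_mod)
  have "FMor F X Y (Scale \<A> X Y \<zero>\<^bsub>R\<^esub> (Zero \<A> X Y)) =
      Scale \<B> (FOb F X) (FOb F Y) \<zero>\<^bsub>R\<^esub> (FMor F X Y (Zero \<A> X Y))"
    by (intro ftor_scale[OF F] XY A.zero_in) simp
  then show ?thesis
    using ftor_mor[OF linear_ftor_is_ftor[OF F] XY A.zero_in[OF XY]]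
      ftor_ob[OF linear_ftor_is_ftor[OF F]] XY
    by (simp add: A.zero_scale A.zero_in B.zero_scale)
qed


section \<open>Strict filtered colimits of linear categories\<close>

text \<open>The strict colimit of categories \<open>A C\<close> indexed by a family \<open>I\<close> of sets under reverse inclusion,
  with transition functors \<open>P D C\<close> from level \<open>C\<close> to level \<open>D \<subseteq> C\<close>. The construction follows the
  uniformly smooth principal series word for word, so that the latter is an instance by unfolding.\<close>

definition colim_reps ::
  "'c set set \<Rightarrow> ('c set \<Rightarrow> ('r, 'o, 'm) lincat) \<Rightarrow> ('c set \<Rightarrow> 'c set \<Rightarrow> ('o, 'm, 'o, 'm) ftor) \<Rightarrow>
    'c set \<times> 'o \<Rightarrow> 'c set \<times> 'o \<Rightarrow> ('c set \<times> 'm) set" where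
  "colim_reps I A P Y Y' = {(D, f). D \<in> I \<and> D \<subseteq> fst Y \<inter> fst Y' \<and>
     f \<in> Hom (A D) (FOb (P D (fst Y)) (snd Y)) (FOb (P D (fst Y')) (snd Y'))}"

definition colim_eq ::
  "'c set set \<Rightarrow> ('c set \<Rightarrow> ('r, 'o, 'm) lincat) \<Rightarrow> ('c set \<Rightarrow> 'c set \<Rightarrow> ('o, 'm, 'o, 'm) ftor) \<Rightarrow>
    'c set \<times> 'o \<Rightarrow> 'c set \<times> 'o \<Rightarrow> ('c set \<times> 'm) rel" where
  "colim_eq I A P Y Y' = {((D, f), (D', f')).
     (D, f) \<in> colim_reps I A P Y Y' \<and> (D', f') \<in> colim_reps I A P Y Y' \<and>
     (\<exists>D''\<in>I. D'' \<subseteq> D \<inter> D' \<and>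
        FMor (P D'' D) (FOb (P D (fst Y)) (snd Y)) (FOb (P D (fst Y')) (snd Y')) f =
        FMor (P D'' D') (FOb (P D' (fst Y)) (snd Y)) (FOb (P D' (fst Y')) (snd Y')) f')}"

definition colim_class ::
  "'c set set \<Rightarrow> ('c set \<Rightarrow> ('r, 'o, 'm) lincat) \<Rightarrow> ('c set \<Rightarrow> 'c set \<Rightarrow> ('o, 'm, 'o, 'm) ftor) \<Rightarrow>
    'c set \<times> 'o \<Rightarrow> 'c set \<times> 'o \<Rightarrow> 'c set \<times> 'm \<Rightarrow> ('c set \<times> 'm) set" where
  "colim_class I A P Y Y' x = colim_eq I A P Y Y' `` {x}"

definition colim_cat ::
  "'c set set \<Rightarrow> ('c set \<Rightarrow> ('r, 'o, 'm) lincat) \<Rightarrow> ('c set \<Rightarrow> 'c set \<Rightarrow> ('o, 'm, 'o, 'm) ftor) \<Rightarrow>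
    ('r, 'c set \<times> 'o, ('c set \<times> 'm) set) lincat" where
  "colim_cat I A P = (let L = (\<lambda>D Y. FOb (P D (fst Y)) (snd Y)); cl = colim_class I A P in \<lparr>
     Ob = {(C, X). C \<in> I \<and> X \<in> Ob (A C)},
     Hom = (\<lambda>Y Y'. colim_reps I A P Y Y' // colim_eq I A P Y Y'),
     Idm = (\<lambda>Y. cl Y Y (fst Y, Idm (A (fst Y)) (L (fst Y) Y))),
     Cmp = (\<lambda>X Y Z w' w. \<Union>{cl X Z (D, Cmp (A D) (L D X) (L D Y) (L D Z) g f) | D f g.
       (D, f) \<in> w \<and> (D, g) \<in> w'}),
     Zero = (\<lambda>Y Y'. cl Y Y' (fst Y \<inter> fst Y',
       Zero (A (fst Y \<inter> fst Y')) (L (fst Y \<inter> fst Y') Y) (L (fst Y \<inter> fst Y') Y'))),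
     Add = (\<lambda>Y Y' w w'. \<Union>{cl Y Y' (D, Add (A D) (L D Y) (L D Y') f g) | D f g.
       (D, f) \<in> w \<and> (D, g) \<in> w'}),
     Scale = (\<lambda>Y Y' c w. \<Union>{cl Y Y' (D, Scale (A D) (L D Y) (L D Y') c f) | D f. (D, f) \<in> w})\<rparr>)"

locale direct_system =
  fixes R :: "'r ring" and I :: "'c set set" and A :: "'c set \<Rightarrow> ('r, 'o, 'm) lincat"
    and P :: "'c set \<Rightarrow> 'c set \<Rightarrow> ('o, 'm, 'o, 'm) ftor"
  assumes nonempty: "I \<noteq> {}"
    and inter: "\<lbrakk>C \<in> I; D \<in> I\<rbrakk> \<Longrightarrow> C \<inter> D \<in> I"
    and abelian: "C \<in> I \<Longrightarrow> abelian_linear_category R (A C)"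
    and lin: "\<lbrakk>C \<in> I; D \<in> I; D \<subseteq> C\<rbrakk> \<Longrightarrow> linear_ftor R (A C) (A D) (P D C)"
    and pres_kernel: "\<lbrakk>C \<in> I; D \<in> I; D \<subseteq> C; X \<in> Ob (A C); Y \<in> Ob (A C); f \<in> Hom (A C) X Y;
        is_kernel (A C) X Y f K i\<rbrakk> \<Longrightarrow>
        is_kernel (A D) (FOb (P D C) X) (FOb (P D C) Y) (FMor (P D C) X Y f)
          (FOb (P D C) K) (FMor (P D C) K X i)"
    and pres_cokernel: "\<lbrakk>C \<in> I; D \<in> I; D \<subseteq> C; X \<in> Ob (A C); Y \<in> Ob (A C); f \<in> Hom (A C) X Y;
        is_cokernel (A C) X Y f Q p\<rbrakk> \<Longrightarrow>
        is_cokernel (A D) (FOb (P D C) X) (FOb (P D C) Y) (FMor (P D C) X Y f)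
          (FOb (P D C) Q) (FMor (P D C) Y Q p)"
    and P_id_ob: "\<lbrakk>C \<in> I; X \<in> Ob (A C)\<rbrakk> \<Longrightarrow> FOb (P C C) X = X"
    and P_id_mor: "\<lbrakk>C \<in> I; X \<in> Ob (A C); Y \<in> Ob (A C); f \<in> Hom (A C) X Y\<rbrakk> \<Longrightarrow> FMor (P C C) X Y f = f"
    and P_comp_ob: "\<lbrakk>C \<in> I; D \<in> I; E \<in> I; E \<subseteq> D; D \<subseteq> C; X \<in> Ob (A C)\<rbrakk> \<Longrightarrow>
        FOb (P E D) (FOb (P D C) X) = FOb (P E C) X"
    and P_comp_mor: "\<lbrakk>C \<in> I; D \<in> I; E \<in> I; E \<subseteq> D; D \<subseteq> C; X \<in> Ob (A C); Y \<in> Ob (A C);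
        f \<in> Hom (A C) X Y\<rbrakk> \<Longrightarrow>
        FMor (P E D) (FOb (P D C) X) (FOb (P D C) Y) (FMor (P D C) X Y f) = FMor (P E C) X Y f"
begin

text \<open>Objects and morphisms restricted to a level \<open>D\<close>, and classes of morphisms in the colimit.\<close>

abbreviation "\<C> \<equiv> colim_cat I A P"
abbreviation "lev D Y \<equiv> FOb (P D (fst Y)) (snd Y)"
abbreviation "lhom D Y Y' \<equiv> Hom (A D) (lev D Y) (lev D Y')"
abbreviation "res D E Y Y' f \<equiv> FMor (P D E) (lev E Y) (lev E Y') f"
abbreviation "cls Y Y' D f \<equiv> colim_class I A P Y Y' (D, f)"
abbreviation "below D Y \<equiv> D \<in> I \<and> D \<subseteq> fst Y \<and> Y \<in> Ob \<C>"

lemma Ob_iff: "Y \<in> Ob \<C> \<longleftrightarrow> fst Y \<in> I \<and> snd Y \<in> Ob (A (fst Y))"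
  by (auto simp: colim_cat_def Let_def split: prod.splits)

lemma lcat: "D \<in> I \<Longrightarrow> lin_cat R (A D)"
  using abelian by (auto simp: abelian_linear_category_def intro!: lin_cat.intro)

lemma ftor: "\<lbrakk>C \<in> I; D \<in> I; D \<subseteq> C\<rbrakk> \<Longrightarrow> is_ftor (A C) (A D) (P D C)"
  using lin by (rule linear_ftor_is_ftor)

lemma lev_ob: "below D Y \<Longrightarrow> lev D Y \<in> Ob (A D)"
  using ftor_ob[OF ftor] by (simp add: Ob_iff)

lemma lev_lev: "\<lbrakk>below E Y; D \<in> I; D \<subseteq> E\<rbrakk> \<Longrightarrow> FOb (P D E) (lev E Y) = lev D Y"
  using P_comp_ob by (simp add: Ob_iff)

lemma res_hom: "\<lbrakk>below E Y; below E Y'; f \<in> lhom E Y Y'; D \<in> I; D \<subseteq> E\<rbrakk> \<Longrightarrow> res D E Y Y' f \<in> lhom D Y Y'"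
  using ftor_mor[OF ftor[of E D], of "lev E Y" "lev E Y'" f] lev_ob[of E] by (simp add: lev_lev)

lemma res_self: "\<lbrakk>below E Y; below E Y'; f \<in> lhom E Y Y'\<rbrakk> \<Longrightarrow> res E E Y Y' f = f"
  using P_id_mor[of E "lev E Y" "lev E Y'"] lev_ob by auto

lemma res_res: "\<lbrakk>below F Y; below F Y'; f \<in> lhom F Y Y'; E \<in> I; E \<subseteq> F; D \<in> I; D \<subseteq> E\<rbrakk> \<Longrightarrow>
    res D E Y Y' (res E F Y Y' f) = res D F Y Y' f"
  using P_comp_mor[of F E D "lev F Y" "lev F Y'" f] lev_ob[of F] by (simp add: lev_lev)

lemma res_cmp: "\<lbrakk>below E X; below E Y; below E Z; f \<in> lhom E X Y; g \<in> lhom E Y Z; D \<in> I; D \<subseteq> E\<rbrakk> \<Longrightarrow>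
    res D E X Z (Cmp (A E) (lev E X) (lev E Y) (lev E Z) g f) =
    Cmp (A D) (lev D X) (lev D Y) (lev D Z) (res D E Y Z g) (res D E X Y f)"
  using ftor_cmp[OF ftor[of E D], of "lev E X" "lev E Y" "lev E Z" f g] lev_ob[of E] by (simp add: lev_lev)

lemma res_add: "\<lbrakk>below E X; below E Y; f \<in> lhom E X Y; g \<in> lhom E X Y; D \<in> I; D \<subseteq> E\<rbrakk> \<Longrightarrow>
    res D E X Y (Add (A E) (lev E X) (lev E Y) f g) =
    Add (A D) (lev D X) (lev D Y) (res D E X Y f) (res D E X Y g)"
  using ftor_add[OF lin[of E D], of "lev E X" "lev E Y" f g] lev_ob[of E] by (simp add: lev_lev)

lemma res_scale: "\<lbrakk>below E X; below E Y; f \<in> lhom E X Y; c \<in> carrier R; D \<in> I; D \<subseteq> E\<rbrakk> \<Longrightarrow>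
    res D E X Y (Scale (A E) (lev E X) (lev E Y) c f) =
    Scale (A D) (lev D X) (lev D Y) c (res D E X Y f)"
  using ftor_scale[OF lin[of E D], of "lev E X" "lev E Y" f c] lev_ob[of E] by (simp add: lev_lev)

lemma res_zero: "\<lbrakk>below E X; below E Y; D \<in> I; D \<subseteq> E\<rbrakk> \<Longrightarrow>
    res D E X Y (Zero (A E) (lev E X) (lev E Y)) = Zero (A D) (lev D X) (lev D Y)"
  using ftor_zero[OF lin[of E D] lcat lcat, of "lev E X" "lev E Y"] lev_ob[of E] by (simp add: lev_lev)

lemma res_id: "\<lbrakk>below E X; D \<in> I; D \<subseteq> E\<rbrakk> \<Longrightarrow>
    res D E X X (Idm (A E) (lev E X)) = Idm (A D) (lev D X)"
  using ftor_id[OF ftor[of E D], of "lev E X"] lev_ob[of E] by (simp add: lev_lev)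

lemma reps_iff:
  "\<lbrakk>Y \<in> Ob \<C>; Y' \<in> Ob \<C>\<rbrakk> \<Longrightarrow>
    (D, f) \<in> colim_reps I A P Y Y' \<longleftrightarrow> below D Y \<and> below D Y' \<and> f \<in> lhom D Y Y'"
  by (auto simp: colim_reps_def)

text \<open>Two equalities that hold at levels \<open>E\<close> and \<open>E'\<close> both hold at \<open>E \<inter> E'\<close>; this is where closure of
  \<open>I\<close> under intersections enters.\<close>

lemma equiv_colim_eq:
  assumes Y: "Y \<in> Ob \<C>" "Y' \<in> Ob \<C>"
  shows "equiv (colim_reps I A P Y Y') (colim_eq I A P Y Y')"
proof (rule equivI)
  show "colim_eq I A P Y Y' \<subseteq> colim_reps I A P Y Y' \<times> colim_reps I A P Y Y'"
    by (auto simp: colim_eq_def)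
  show "refl_on (colim_reps I A P Y Y') (colim_eq I A P Y Y')"
    by (auto simp: refl_on_def colim_eq_def colim_reps_def)
  show "sym (colim_eq I A P Y Y')"
  proof (rule symI)
    fix x y assume xy: "(x, y) \<in> colim_eq I A P Y Y'"
    obtain D f D' f' where e: "x = (D, f)" "y = (D', f')" by (metis prod.exhaust)
    have r: "(D, f) \<in> colim_reps I A P Y Y'" "(D', f') \<in> colim_reps I A P Y Y'"
      using xy by (simp_all add: e colim_eq_def)
    obtain E where "E \<in> I" "E \<subseteq> D' \<inter> D" "res E D' Y Y' f' = res E D Y Y' f"
      using xy by (auto simp: e colim_eq_def)
    then have "\<exists>E\<in>I. E \<subseteq> D' \<inter> D \<and> res E D' Y Y' f' = res E D Y Y' f" by blast
    then show "(y, x) \<in> colim_eq I A P Y Y'" using r by (simp add: e colim_eq_def)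
  qed
  show "trans (colim_eq I A P Y Y')"
  proof (rule transI)
    fix x y z assume xy: "(x, y) \<in> colim_eq I A P Y Y'" and yz: "(y, z) \<in> colim_eq I A P Y Y'"
    obtain D f D' f' D'' f'' where e: "x = (D, f)" "y = (D', f')" "z = (D'', f'')"
      by (metis prod.exhaust)
    obtain E where E: "E \<in> I" "E \<subseteq> D \<inter> D'" "res E D Y Y' f = res E D' Y Y' f'"
      using xy by (auto simp: e colim_eq_def)
    obtain E' where E': "E' \<in> I" "E' \<subseteq> D' \<inter> D''" "res E' D' Y Y' f' = res E' D'' Y Y' f''"
      using yz by (auto simp: e colim_eq_def)
    have r: "below D Y \<and> below D Y' \<and> f \<in> lhom D Y Y'"
      "below D' Y \<and> below D' Y' \<and> f' \<in> lhom D' Y Y'"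
      "below D'' Y \<and> below D'' Y' \<and> f'' \<in> lhom D'' Y Y'"
      using xy yz reps_iff[OF Y] by (auto simp: e colim_eq_def)
    have F: "E \<inter> E' \<in> I" using E E' by (simp add: inter)
    have "res (E \<inter> E') D Y Y' f = res (E \<inter> E') E Y Y' (res E D Y Y' f)"
      using r E F by (intro res_res[symmetric]) auto
    also have "\<dots> = res (E \<inter> E') D' Y Y' f'"
      unfolding E(3) using r E F by (intro res_res) auto
    also have "\<dots> = res (E \<inter> E') E' Y Y' (res E' D' Y Y' f')"
      using r E' F by (intro res_res[symmetric]) auto
    also have "\<dots> = res (E \<inter> E') D'' Y Y' f''"
      unfolding E'(3) using r E' F by (intro res_res) auto
    finally have "res (E \<inter> E') D Y Y' f = res (E \<inter> E') D'' Y Y' f''" .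
    then have "\<exists>F\<in>I. F \<subseteq> D \<inter> D'' \<and> res F D Y Y' f = res F D'' Y Y' f''"
      using F E(2) E'(2) by (intro bexI[of _ "E \<inter> E'"]) auto
    then show "(x, z) \<in> colim_eq I A P Y Y'"
      using r by (simp add: e colim_eq_def reps_iff[OF Y])
  qed
qed

lemma mem_cls:
  assumes Y: "Y \<in> Ob \<C>" "Y' \<in> Ob \<C>"
  shows "(E, g) \<in> cls Y Y' D f \<longleftrightarrow>
    below D Y \<and> below D Y' \<and> f \<in> lhom D Y Y' \<and> below E Y \<and> below E Y' \<and> g \<in> lhom E Y Y' \<and>
    (\<exists>F\<in>I. F \<subseteq> D \<inter> E \<and> res F D Y Y' f = res F E Y Y' g)"
  by (auto simp add: colim_class_def colim_eq_def reps_iff[OF Y])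

lemma cls_eq_iff:
  assumes "below D Y" "below D Y'" "f \<in> lhom D Y Y'" "below E Y" "below E Y'" "g \<in> lhom E Y Y'"
  shows "cls Y Y' D f = cls Y Y' E g \<longleftrightarrow> (\<exists>F\<in>I. F \<subseteq> D \<inter> E \<and> res F D Y Y' f = res F E Y Y' g)"
proof -
  have Y: "Y \<in> Ob \<C>" "Y' \<in> Ob \<C>" using assms by auto
  have "cls Y Y' D f = cls Y Y' E g \<longleftrightarrow> ((D, f), (E, g)) \<in> colim_eq I A P Y Y'"
    unfolding colim_class_def
    by (rule eq_equiv_class_iff[OF equiv_colim_eq[OF Y]]) (simp_all add: reps_iff[OF Y] assms)
  also have "\<dots> \<longleftrightarrow> (\<exists>F\<in>I. F \<subseteq> D \<inter> E \<and> res F D Y Y' f = res F E Y Y' g)"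
    using assms by (simp add: colim_eq_def reps_iff[OF Y])
  finally show ?thesis .
qed

lemma cls_res:
  assumes "below E Y" "below E Y'" "f \<in> lhom E Y Y'" "D \<in> I" "D \<subseteq> E"
  shows "cls Y Y' D (res D E Y Y' f) = cls Y Y' E f"
proof -
  have r: "res D E Y Y' f \<in> lhom D Y Y'" using assms by (rule res_hom)
  have "res D D Y Y' (res D E Y Y' f) = res D E Y Y' f"
    using assms r by (intro res_self) auto
  then show ?thesis using assms r by (subst cls_eq_iff) auto
qed

lemma Hom_eq: "Hom \<C> Y Y' = colim_reps I A P Y Y' // colim_eq I A P Y Y'"
  by (simp add: colim_cat_def Let_def)

lemma Idm_eq: "Idm \<C> Y = cls Y Y (fst Y) (Idm (A (fst Y)) (lev (fst Y) Y))"
  and Zero_eq: "Zero \<C> Y Y' = cls Y Y' (fst Y \<inter> fst Y')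
    (Zero (A (fst Y \<inter> fst Y')) (lev (fst Y \<inter> fst Y') Y) (lev (fst Y \<inter> fst Y') Y'))"
  by (simp_all add: colim_cat_def Let_def)

lemma cls_in: "\<lbrakk>below D Y; below D Y'; f \<in> lhom D Y Y'\<rbrakk> \<Longrightarrow> cls Y Y' D f \<in> Hom \<C> Y Y'"
  unfolding Hom_eq colim_class_def by (rule quotientI) (simp add: reps_iff)

lemma rep_below:
  assumes "w \<in> Hom \<C> Y Y'" "Y \<in> Ob \<C>" "Y' \<in> Ob \<C>"
  obtains E where "E \<in> I" "E \<subseteq> fst Y" "E \<subseteq> fst Y'"
    "\<And>D. D \<in> I \<Longrightarrow> D \<subseteq> E \<Longrightarrow> \<exists>f\<in>lhom D Y Y'. w = cls Y Y' D f"
proof -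
  obtain x where x: "x \<in> colim_reps I A P Y Y'" "w = colim_class I A P Y Y' x"
    using assms(1) unfolding Hom_eq colim_class_def by (auto elim: quotientE)
  obtain E f where "x = (E, f)" by (cases x)
  then have E: "below E Y" "below E Y'" "f \<in> lhom E Y Y'" "w = cls Y Y' E f"
    using x reps_iff assms by auto
  show thesis
  proof (rule that)
    show "E \<in> I" "E \<subseteq> fst Y" "E \<subseteq> fst Y'" using E by auto
    show "\<exists>f\<in>lhom D Y Y'. w = cls Y Y' D f" if "D \<in> I" "D \<subseteq> E" for D
      using cls_res[OF E(1-3) that] res_hom[OF E(1-3) that] E(4) by metis
  qed
qed

lemma Idm_cls:
  assumes "below D Y" shows "Idm \<C> Y = cls Y Y D (Idm (A D) (lev D Y))"
proof -
  have b: "below (fst Y) Y" using assms by (auto simp: Ob_iff)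
  have i: "Idm (A (fst Y)) (lev (fst Y) Y) \<in> lhom (fst Y) Y Y"
    by (rule lin_cat.id_in[OF lcat lev_ob]) (use b in auto)
  have "cls Y Y D (res D (fst Y) Y Y (Idm (A (fst Y)) (lev (fst Y) Y))) =
      cls Y Y (fst Y) (Idm (A (fst Y)) (lev (fst Y) Y))"
    using assms i b by (intro cls_res) auto
  then show ?thesis using assms b by (simp add: res_id Idm_eq)
qed

lemma Zero_cls:
  assumes "below D Y" "below D Y'" shows "Zero \<C> Y Y' = cls Y Y' D (Zero (A D) (lev D Y) (lev D Y'))"
proof -
  let ?E = "fst Y \<inter> fst Y'"
  have b: "below ?E Y" "below ?E Y'" using assms by (auto simp: Ob_iff inter)
  have i: "Zero (A ?E) (lev ?E Y) (lev ?E Y') \<in> lhom ?E Y Y'"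
    by (rule lin_cat.zero_in[OF lcat lev_ob lev_ob]) (use b in auto)
  have "cls Y Y' D (res D ?E Y Y' (Zero (A ?E) (lev ?E Y) (lev ?E Y'))) =
      cls Y Y' ?E (Zero (A ?E) (lev ?E Y) (lev ?E Y'))"
    using assms i b by (intro cls_res) auto
  then show ?thesis using assms b by (simp add: res_zero Zero_eq)
qed

text \<open>An operation on morphisms that commutes with restriction to smaller levels sends all
  representatives of its arguments at a common level to one class, so that the union of the
  resulting classes is this class.\<close>

lemma Union_cls:
  assumes o: "X \<in> Ob \<C>" "Y \<in> Ob \<C>" "X' \<in> Ob \<C>" "Y' \<in> Ob \<C>" "U \<in> Ob \<C>" "V \<in> Ob \<C>"
    and UV: "fst X \<inter> fst Y \<inter> fst X' \<inter> fst Y' \<subseteq> fst U \<inter> fst V"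
    and D: "D \<in> I" "D \<subseteq> fst X" "D \<subseteq> fst Y" "D \<subseteq> fst X'" "D \<subseteq> fst Y'"
    and f: "f \<in> lhom D X Y" and g: "g \<in> lhom D X' Y'"
    and in_hom: "\<And>E f g. \<lbrakk>E \<in> I; E \<subseteq> fst X; E \<subseteq> fst Y; E \<subseteq> fst X'; E \<subseteq> fst Y';
        f \<in> lhom E X Y; g \<in> lhom E X' Y'\<rbrakk> \<Longrightarrow> \<Phi> E f g \<in> lhom E U V"
    and natural: "\<And>E F f g. \<lbrakk>E \<in> I; E \<subseteq> fst X; E \<subseteq> fst Y; E \<subseteq> fst X'; E \<subseteq> fst Y';
        f \<in> lhom E X Y; g \<in> lhom E X' Y'; F \<in> I; F \<subseteq> E\<rbrakk> \<Longrightarrow>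
        res F E U V (\<Phi> E f g) = \<Phi> F (res F E X Y f) (res F E X' Y' g)"
  shows "\<Union>{cls U V E (\<Phi> E f' g') | E f' g'. (E, f') \<in> cls X Y D f \<and> (E, g') \<in> cls X' Y' D g} =
    cls U V D (\<Phi> D f g)" (is "\<Union>?S = ?c")
proof -
  have "(D, f) \<in> cls X Y D f" "(D, g) \<in> cls X' Y' D g" using D f g o by (auto simp: mem_cls)
  then have "?c \<in> ?S" by blast
  moreover have "s = ?c" if "s \<in> ?S" for s
  proof -
    obtain E f' g' where s: "s = cls U V E (\<Phi> E f' g')"
      and m: "(E, f') \<in> cls X Y D f" "(E, g') \<in> cls X' Y' D g" using \<open>s \<in> ?S\<close> by blast
    obtain F1 where F1: "F1 \<in> I" "F1 \<subseteq> D \<inter> E" "res F1 D X Y f = res F1 E X Y f'"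
      using m(1) o by (auto simp: mem_cls)
    obtain F2 where F2: "F2 \<in> I" "F2 \<subseteq> D \<inter> E" "res F2 D X' Y' g = res F2 E X' Y' g'"
      using m(2) o by (auto simp: mem_cls)
    have E: "E \<in> I" "E \<subseteq> fst X" "E \<subseteq> fst Y" "E \<subseteq> fst X'" "E \<subseteq> fst Y'"
      and h: "f' \<in> lhom E X Y" "g' \<in> lhom E X' Y'"
      using m o by (auto simp: mem_cls)
    have UVD: "D \<subseteq> fst U" "D \<subseteq> fst V" and UVE: "E \<subseteq> fst U" "E \<subseteq> fst V" using UV D E by blast+
    define F where "F = F1 \<inter> F2"
    have F: "F \<in> I" "F \<subseteq> D" "F \<subseteq> E" "F \<subseteq> F1" "F \<subseteq> F2"
      using F1 F2 inter by (auto simp: F_def)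
    have "res F D X Y f = res F F1 X Y (res F1 D X Y f)"
      using D o f F1 F by (intro res_res[symmetric]) auto
    also have "\<dots> = res F E X Y f'"
      unfolding F1(3) using E o h F1 F by (intro res_res) auto
    finally have 1: "res F D X Y f = res F E X Y f'" .
    have "res F D X' Y' g = res F F2 X' Y' (res F2 D X' Y' g)"
      using D o g F2 F by (intro res_res[symmetric]) auto
    also have "\<dots> = res F E X' Y' g'"
      unfolding F2(3) using E o h F2 F by (intro res_res) auto
    finally have 2: "res F D X' Y' g = res F E X' Y' g'" .
    have "s = cls U V F (res F E U V (\<Phi> E f' g'))"
      unfolding s using E o UVE in_hom[OF E h] F by (intro cls_res[symmetric]) auto
    also have "\<dots> = cls U V F (res F D U V (\<Phi> D f g))"
      using natural[OF E h F(1,3)] natural[OF D f g F(1,2)] 1 2 by simp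
    also have "\<dots> = ?c" using D o UVD in_hom[OF D f g] F by (intro cls_res) auto
    finally show ?thesis .
  qed
  ultimately show ?thesis by blast
qed

lemma Cmp_cls:
  assumes b: "below D X" "below D Y" "below D Z" and f: "f \<in> lhom D X Y" and g: "g \<in> lhom D Y Z"
  shows "Cmp \<C> X Y Z (cls Y Z D g) (cls X Y D f) =
    cls X Z D (Cmp (A D) (lev D X) (lev D Y) (lev D Z) g f)"
proof -
  have "\<Union>{cls X Z E (Cmp (A E) (lev E X) (lev E Y) (lev E Z) g' f') | E f' g'.
      (E, f') \<in> cls X Y D f \<and> (E, g') \<in> cls Y Z D g} =
    cls X Z D (Cmp (A D) (lev D X) (lev D Y) (lev D Z) g f)"
    by (rule Union_cls) (use b f g in \<open>auto simp: res_cmp intro!: lin_cat.cmp_in[OF lcat] lev_ob\<close>)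
  then show ?thesis by (simp add: colim_cat_def Let_def)
qed

lemma Add_cls:
  assumes b: "below D X" "below D Y" and f: "f \<in> lhom D X Y" and g: "g \<in> lhom D X Y"
  shows "Add \<C> X Y (cls X Y D f) (cls X Y D g) = cls X Y D (Add (A D) (lev D X) (lev D Y) f g)"
proof -
  have "\<Union>{cls X Y E (Add (A E) (lev E X) (lev E Y) f' g') | E f' g'.
      (E, f') \<in> cls X Y D f \<and> (E, g') \<in> cls X Y D g} = cls X Y D (Add (A D) (lev D X) (lev D Y) f g)"
    by (rule Union_cls) (use b f g in \<open>auto simp: res_add intro!: lin_cat.add_in[OF lcat] lev_ob\<close>)
  then show ?thesis by (simp add: colim_cat_def Let_def)
qed

lemma Scale_cls:
  assumes b: "below D X" "below D Y" and f: "f \<in> lhom D X Y" and r: "r \<in> carrier R"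
  shows "Scale \<C> X Y r (cls X Y D f) = cls X Y D (Scale (A D) (lev D X) (lev D Y) r f)"
proof -
  have "\<Union>{cls X Y E (Scale (A E) (lev E X) (lev E Y) r f') | E f' f''.
      (E, f') \<in> cls X Y D f \<and> (E, f'') \<in> cls X Y D f} = cls X Y D (Scale (A D) (lev D X) (lev D Y) r f)"
    by (rule Union_cls[where X' = X and Y' = Y and g = f])
      (use b f r in \<open>auto simp: res_scale intro!: lin_cat.scale_in[OF lcat] lev_ob\<close>)
  moreover have "{cls X Y E (Scale (A E) (lev E X) (lev E Y) r f') | E f' f''.
      (E, f') \<in> cls X Y D f \<and> (E, f'') \<in> cls X Y D f} =
    {cls X Y E (Scale (A E) (lev E X) (lev E Y) r f') | E f'. (E, f') \<in> cls X Y D f}"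
    by blast
  ultimately show ?thesis by (simp add: colim_cat_def Let_def)
qed

end

context direct_system
begin

text \<open>Three morphisms suffice for associativity and for the module axioms, and the bound \<open>D\<close> allows a
  representative fixed beforehand to be restricted to the same level.\<close>

lemma common_level:
  assumes "w1 \<in> Hom \<C> X1 Y1" "w2 \<in> Hom \<C> X2 Y2" "w3 \<in> Hom \<C> X3 Y3"
    and "X1 \<in> Ob \<C>" "Y1 \<in> Ob \<C>" "X2 \<in> Ob \<C>" "Y2 \<in> Ob \<C>" "X3 \<in> Ob \<C>" "Y3 \<in> Ob \<C>"
    and "D \<in> I"
  obtains E f1 f2 f3 where "E \<subseteq> D" "below E X1" "below E Y1" "below E X2" "below E Y2"
    "below E X3" "below E Y3" "f1 \<in> lhom E X1 Y1" "f2 \<in> lhom E X2 Y2" "f3 \<in> lhom E X3 Y3"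
    "w1 = cls X1 Y1 E f1" "w2 = cls X2 Y2 E f2" "w3 = cls X3 Y3 E f3"
proof -
  from rep_below[OF assms(1,4,5)] obtain E1 where E1: "E1 \<in> I" "E1 \<subseteq> fst X1" "E1 \<subseteq> fst Y1"
    "\<And>D. D \<in> I \<Longrightarrow> D \<subseteq> E1 \<Longrightarrow> \<exists>f\<in>lhom D X1 Y1. w1 = cls X1 Y1 D f" by blast
  from rep_below[OF assms(2,6,7)] obtain E2 where E2: "E2 \<in> I" "E2 \<subseteq> fst X2" "E2 \<subseteq> fst Y2"
    "\<And>D. D \<in> I \<Longrightarrow> D \<subseteq> E2 \<Longrightarrow> \<exists>f\<in>lhom D X2 Y2. w2 = cls X2 Y2 D f" by blast
  from rep_below[OF assms(3,8,9)] obtain E3 where E3: "E3 \<in> I" "E3 \<subseteq> fst X3" "E3 \<subseteq> fst Y3"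
    "\<And>D. D \<in> I \<Longrightarrow> D \<subseteq> E3 \<Longrightarrow> \<exists>f\<in>lhom D X3 Y3. w3 = cls X3 Y3 D f" by blast
  define E where "E = D \<inter> E1 \<inter> E2 \<inter> E3"
  have E: "E \<in> I" "E \<subseteq> D" "E \<subseteq> E1" "E \<subseteq> E2" "E \<subseteq> E3"
    using E1 E2 E3 \<open>D \<in> I\<close> by (auto simp: E_def intro!: inter)
  obtain f1 f2 f3 where "f1 \<in> lhom E X1 Y1" "f2 \<in> lhom E X2 Y2" "f3 \<in> lhom E X3 Y3"
    "w1 = cls X1 Y1 E f1" "w2 = cls X2 Y2 E f2" "w3 = cls X3 Y3 E f3"
    using E1(4)[OF E(1,3)] E2(4)[OF E(1,4)] E3(4)[OF E(1,5)] by blast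
  moreover have "below E X1" "below E Y1" "below E X2" "below E Y2" "below E X3" "below E Y3"
    using E E1 E2 E3 assms by auto
  ultimately show thesis using that E(2) by blast
qed

lemma colim_hom_module:
  assumes Y: "Y \<in> Ob \<C>" "Y' \<in> Ob \<C>"
  shows "module R (hom_module \<C> Y Y')"
proof -
  let ?E = "fst Y \<inter> fst Y'"
  have E: "below ?E Y" "below ?E Y'" "?E \<in> I" using Y by (auto simp: Ob_iff inter)
  note L = lin_cat.cmp_in[OF lcat] lin_cat.add_in[OF lcat] lin_cat.scale_in[OF lcat]
    lin_cat.zero_in[OF lcat]
  have cr: "cring R" using E by (intro lin_cat.scalars_cring[OF lcat lev_ob lev_ob]) auto
  then interpret R: cring R .
  show ?thesis
  proof (rule hom_moduleI)
    show "cring R" by fact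
    show "Zero \<C> Y Y' \<in> Hom \<C> Y Y'"
      using E by (subst Zero_cls[OF E(1,2)]) (auto intro!: cls_in L lev_ob)
  next
    fix f g h assume w: "f \<in> Hom \<C> Y Y'" "g \<in> Hom \<C> Y Y'" "h \<in> Hom \<C> Y Y'"
    obtain D a b c where D: "below D Y" "below D Y'"
      and h: "a \<in> lhom D Y Y'" "b \<in> lhom D Y Y'" "c \<in> lhom D Y Y'"
      and e: "f = cls Y Y' D a" "g = cls Y Y' D b" "h = cls Y Y' D c"
      by (rule common_level[OF w Y Y Y \<open>?E \<in> I\<close>]) blast
    interpret A: lin_cat R "A D" by (rule lcat) (use D in auto)
    have o: "lev D Y \<in> Ob (A D)" "lev D Y' \<in> Ob (A D)" using D by (auto intro!: lev_ob)
    show "Add \<C> Y Y' f g \<in> Hom \<C> Y Y'"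
      using D h o by (simp add: e Add_cls cls_in A.add_in)
    show "Add \<C> Y Y' f g = Add \<C> Y Y' g f"
      using D h o by (simp add: e Add_cls A.add_comm)
    show "Add \<C> Y Y' (Add \<C> Y Y' f g) h = Add \<C> Y Y' f (Add \<C> Y Y' g h)"
      using D h o by (simp add: e Add_cls A.add_in A.add_assoc)
  next
    fix f g r s assume w: "f \<in> Hom \<C> Y Y'" "g \<in> Hom \<C> Y Y'" and r: "r \<in> carrier R" "s \<in> carrier R"
    obtain D a b c where D: "below D Y" "below D Y'"
      and h: "a \<in> lhom D Y Y'" "b \<in> lhom D Y Y'"
      and e: "f = cls Y Y' D a" "g = cls Y Y' D b"
      by (rule common_level[OF w w(2) Y Y Y \<open>?E \<in> I\<close>]) blast
    interpret A: lin_cat R "A D" by (rule lcat) (use D in auto)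
    have o: "lev D Y \<in> Ob (A D)" "lev D Y' \<in> Ob (A D)" using D by (auto intro!: lev_ob)
    show "Scale \<C> Y Y' r f \<in> Hom \<C> Y Y'"
      using D h o r by (simp add: e Scale_cls cls_in A.scale_in)
    show "Scale \<C> Y Y' (r \<oplus>\<^bsub>R\<^esub> s) f = Add \<C> Y Y' (Scale \<C> Y Y' r f) (Scale \<C> Y Y' s f)"
      using D h o r by (simp add: e Scale_cls Add_cls A.scale_in A.scale_add_left)
    show "Scale \<C> Y Y' r (Add \<C> Y Y' f g) = Add \<C> Y Y' (Scale \<C> Y Y' r f) (Scale \<C> Y Y' r g)"
      using D h o r by (simp add: e Scale_cls Add_cls A.scale_in A.add_in A.scale_add_right)
    show "Scale \<C> Y Y' (r \<otimes>\<^bsub>R\<^esub> s) f = Scale \<C> Y Y' r (Scale \<C> Y Y' s f)"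
      using D h o r by (simp add: e Scale_cls A.scale_in A.scale_mult)
  next
    fix f assume w: "f \<in> Hom \<C> Y Y'"
    obtain D a where D: "below D Y" "below D Y'"
      and h: "a \<in> lhom D Y Y'" and e: "f = cls Y Y' D a"
      by (rule common_level[OF w w w Y Y Y \<open>?E \<in> I\<close>]) blast
    interpret A: lin_cat R "A D" by (rule lcat) (use D in auto)
    have o: "lev D Y \<in> Ob (A D)" "lev D Y' \<in> Ob (A D)" using D by (auto intro!: lev_ob)
    show "Add \<C> Y Y' (Zero \<C> Y Y') f = f"
      using D h o by (simp add: e Zero_cls[of D] Add_cls A.zero_in A.add_zero)
    show "Add \<C> Y Y' (Scale \<C> Y Y' (\<ominus>\<^bsub>R\<^esub> \<one>\<^bsub>R\<^esub>) f) f = Zero \<C> Y Y'"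
      using D h o by (simp add: e Zero_cls[of D] Add_cls Scale_cls A.scale_in A.add_neg)
    show "Scale \<C> Y Y' \<one>\<^bsub>R\<^esub> f = f"
      using D h o by (simp add: e Scale_cls A.scale_one)
  qed
qed

text \<open>Each law holds at a level where all morphisms involved are represented.\<close>

lemma linear_colim: "linear_category R \<C>"
  unfolding linear_category_def is_category_def
proof (intro conjI ballI)
  fix X assume X: "X \<in> Ob \<C>"
  have b: "below (fst X) X" using X by (auto simp: Ob_iff)
  have "Idm (A (fst X)) (lev (fst X) X) \<in> lhom (fst X) X X"
    using b by (intro lin_cat.id_in[OF lcat lev_ob]) auto
  then show "Idm \<C> X \<in> Hom \<C> X X" using b by (simp add: Idm_cls[OF b] cls_in)
next
  fix X Y f assume o: "X \<in> Ob \<C>" "Y \<in> Ob \<C>" and w: "f \<in> Hom \<C> X Y"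
  obtain D a where D: "below D X" "below D Y" and h: "a \<in> lhom D X Y" and e: "f = cls X Y D a"
    by (rule common_level[OF w w w o o o, of "fst X"]) (use o in \<open>auto simp: Ob_iff\<close>)
  interpret A: lin_cat R "A D" by (rule lcat) (use D in auto)
  have L: "lev D X \<in> Ob (A D)" "lev D Y \<in> Ob (A D)" using D by (auto intro!: lev_ob)
  show "Cmp \<C> X X Y f (Idm \<C> X) = f" "Cmp \<C> X Y Y (Idm \<C> Y) f = f"
    using D h L by (simp_all add: e Idm_cls[of D] Cmp_cls A.id_in A.id_left A.id_right)
next
  fix X Y Z f g assume o: "X \<in> Ob \<C>" "Y \<in> Ob \<C>" "Z \<in> Ob \<C>"
    and w: "f \<in> Hom \<C> X Y" "g \<in> Hom \<C> Y Z"
  obtain D a b where D: "below D X" "below D Y" "below D Z" and h: "a \<in> lhom D X Y" "b \<in> lhom D Y Z"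
    and e: "f = cls X Y D a" "g = cls Y Z D b"
    by (rule common_level[OF w w(2) o(1,2) o(2,3) o(2,3), of "fst X"]) (use o in \<open>auto simp: Ob_iff\<close>)
  interpret A: lin_cat R "A D" by (rule lcat) (use D in auto)
  have L: "lev D X \<in> Ob (A D)" "lev D Y \<in> Ob (A D)" "lev D Z \<in> Ob (A D)"
    using D by (auto intro!: lev_ob)
  show "Cmp \<C> X Y Z g f \<in> Hom \<C> X Z"
    using D h L by (simp add: e Cmp_cls cls_in A.cmp_in)
  fix c assume c: "c \<in> carrier R"
  show "Cmp \<C> X Y Z g (Scale \<C> X Y c f) = Scale \<C> X Z c (Cmp \<C> X Y Z g f)"
    "Cmp \<C> X Y Z (Scale \<C> Y Z c g) f = Scale \<C> X Z c (Cmp \<C> X Y Z g f)"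
    using D h L c
    by (simp_all add: e Cmp_cls Scale_cls A.cmp_in A.scale_in A.cmp_scale_left A.cmp_scale_right)
next
  fix W X Y Z f g k assume o: "W \<in> Ob \<C>" "X \<in> Ob \<C>" "Y \<in> Ob \<C>" "Z \<in> Ob \<C>"
    and w: "f \<in> Hom \<C> W X" "g \<in> Hom \<C> X Y" "k \<in> Hom \<C> Y Z"
  obtain D a b c where D: "below D W" "below D X" "below D Y" "below D Z"
    and h: "a \<in> lhom D W X" "b \<in> lhom D X Y" "c \<in> lhom D Y Z"
    and e: "f = cls W X D a" "g = cls X Y D b" "k = cls Y Z D c"
    by (rule common_level[OF w o(1,2) o(2,3) o(3,4), of "fst X"]) (use o in \<open>auto simp: Ob_iff\<close>)
  interpret A: lin_cat R "A D" by (rule lcat) (use D in auto)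
  have L: "lev D W \<in> Ob (A D)" "lev D X \<in> Ob (A D)" "lev D Y \<in> Ob (A D)" "lev D Z \<in> Ob (A D)"
    using D by (auto intro!: lev_ob)
  show "Cmp \<C> W Y Z k (Cmp \<C> W X Y g f) = Cmp \<C> W X Z (Cmp \<C> X Y Z k g) f"
    using D h L by (simp add: e Cmp_cls A.cmp_in A.assoc)
next
  fix X Y assume "X \<in> Ob \<C>" "Y \<in> Ob \<C>"
  then show "module R (hom_module \<C> X Y)" by (rule colim_hom_module)
next
  fix X Y Z f f' g assume o: "X \<in> Ob \<C>" "Y \<in> Ob \<C>" "Z \<in> Ob \<C>"
    and w: "f \<in> Hom \<C> X Y" "f' \<in> Hom \<C> X Y" "g \<in> Hom \<C> Y Z"
  obtain D a b c where D: "below D X" "below D Y" "below D Z"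
    and h: "a \<in> lhom D X Y" "b \<in> lhom D X Y" "c \<in> lhom D Y Z"
    and e: "f = cls X Y D a" "f' = cls X Y D b" "g = cls Y Z D c"
    by (rule common_level[OF w o(1,2) o(1,2) o(2,3), of "fst X"]) (use o in \<open>auto simp: Ob_iff\<close>)
  interpret A: lin_cat R "A D" by (rule lcat) (use D in auto)
  have L: "lev D X \<in> Ob (A D)" "lev D Y \<in> Ob (A D)" "lev D Z \<in> Ob (A D)"
    using D by (auto intro!: lev_ob)
  show "Cmp \<C> X Y Z g (Add \<C> X Y f f') = Add \<C> X Z (Cmp \<C> X Y Z g f) (Cmp \<C> X Y Z g f')"
    using D h L by (simp add: e Cmp_cls Add_cls A.cmp_in A.add_in A.cmp_add_right)
next
  fix X Y Z f g g' assume o: "X \<in> Ob \<C>" "Y \<in> Ob \<C>" "Z \<in> Ob \<C>"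
    and w: "f \<in> Hom \<C> X Y" "g \<in> Hom \<C> Y Z" "g' \<in> Hom \<C> Y Z"
  obtain D a b c where D: "below D X" "below D Y" "below D Z"
    and h: "a \<in> lhom D X Y" "b \<in> lhom D Y Z" "c \<in> lhom D Y Z"
    and e: "f = cls X Y D a" "g = cls Y Z D b" "g' = cls Y Z D c"
    by (rule common_level[OF w o(1,2) o(2,3) o(2,3), of "fst X"]) (use o in \<open>auto simp: Ob_iff\<close>)
  interpret A: lin_cat R "A D" by (rule lcat) (use D in auto)
  have L: "lev D X \<in> Ob (A D)" "lev D Y \<in> Ob (A D)" "lev D Z \<in> Ob (A D)"
    using D by (auto intro!: lev_ob)
  show "Cmp \<C> X Y Z (Add \<C> Y Z g g') f = Add \<C> X Z (Cmp \<C> X Y Z g f) (Cmp \<C> X Y Z g' f)"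
    using D h L by (simp add: e Cmp_cls Add_cls A.cmp_in A.add_in A.cmp_add_left)
qed

sublocale colim: lin_cat R \<C> by unfold_locales (rule linear_colim)

text \<open>Equality of two morphisms in the colimit only becomes visible at some smaller level, so
  cancellation has to be available at every smaller level.\<close>

lemma colim_monoI:
  assumes b: "below D X" "below D Y" and f: "f \<in> lhom D X Y"
    and mono: "\<And>E. E \<in> I \<Longrightarrow> E \<subseteq> D \<Longrightarrow> is_mono (A E) (lev E X) (lev E Y) (res E D X Y f)"
  shows "is_mono \<C> X Y (cls X Y D f)"
  unfolding is_mono_def
proof (intro ballI impI)
  fix W g k assume W: "W \<in> Ob \<C>" and w: "g \<in> Hom \<C> W X" "k \<in> Hom \<C> W X"
    and eq: "Cmp \<C> W X Y (cls X Y D f) g = Cmp \<C> W X Y (cls X Y D f) k"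
  have o: "X \<in> Ob \<C>" "Y \<in> Ob \<C>" "D \<in> I" using b by auto
  obtain E g' k' where E: "E \<subseteq> D" "below E W" "below E X"
    and h: "g' \<in> lhom E W X" "k' \<in> lhom E W X" and e: "g = cls W X E g'" "k = cls W X E k'"
    by (rule common_level[OF w w(2) W o(1) W o(1) W o(1) o(3)]) blast
  have bE: "below E Y" using E b by auto
  have fE: "res E D X Y f \<in> lhom E X Y" "cls X Y D f = cls X Y E (res E D X Y f)"
    using b f E by (simp_all add: res_hom cls_res)
  interpret A: lin_cat R "A E" by (rule lcat) (use E in auto)
  let ?c = "Cmp (A E) (lev E W) (lev E X) (lev E Y) (res E D X Y f)"
  have c: "?c g' \<in> lhom E W Y" "?c k' \<in> lhom E W Y"
    using E bE h fE by (auto intro!: A.cmp_in lev_ob)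
  have "cls W Y E (?c g') = cls W Y E (?c k')"
    using eq E bE h fE by (simp add: e fE(2) Cmp_cls)
  then obtain F where F: "F \<in> I" "F \<subseteq> E" "res F E W Y (?c g') = res F E W Y (?c k')"
    using c E bE by (auto simp: cls_eq_iff)
  have "res F E X Y (res E D X Y f) = res F D X Y f"
    using b f E F by (intro res_res) auto
  moreover have "is_mono (A F) (lev F X) (lev F Y) (res F D X Y f)" using F E by (intro mono) auto
  moreover have "res F E W X g' \<in> lhom F W X" "res F E W X k' \<in> lhom F W X" "lev F W \<in> Ob (A F)"
    using h E F by (auto intro!: res_hom lev_ob)
  ultimately have "res F E W X g' = res F E W X k'"
    using F h E bE fE unfolding is_mono_def by (simp add: res_cmp)
  then show "g = k" unfolding e using F E h by (subst cls_eq_iff) auto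
qed

lemma res_kernel:
  assumes b: "below D Y" "below D Y'" "below D Z" and f: "f \<in> lhom D Y Y'"
    and k: "is_kernel (A D) (lev D Y) (lev D Y') f (lev D Z) i" and E: "E \<in> I" "E \<subseteq> D"
  shows "is_kernel (A E) (lev E Y) (lev E Y') (res E D Y Y' f) (lev E Z) (res E D Z Y i)"
  using pres_kernel[OF _ E lev_ob lev_ob f k] b E by (simp add: lev_lev)

text \<open>A morphism that \<open>f\<close> kills in the colimit is killed by a restriction of \<open>f\<close> to a smaller level, and
  there the restriction of \<open>i\<close> is still a kernel.\<close>

lemma colim_kernel:
  assumes b: "below D Y" "below D Y'" "below D Z" and f: "f \<in> lhom D Y Y'"
    and k: "is_kernel (A D) (lev D Y) (lev D Y') f (lev D Z) i"
  shows "is_kernel \<C> Y Y' (cls Y Y' D f) Z (cls Z Y D i)"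
proof -
  have o: "Y \<in> Ob \<C>" "Y' \<in> Ob \<C>" "Z \<in> Ob \<C>" "D \<in> I" using b by auto
  have i: "i \<in> lhom D Z Y"
    and fi: "Cmp (A D) (lev D Z) (lev D Y) (lev D Y') f i = Zero (A D) (lev D Z) (lev D Y')"
    using k by (auto simp: is_kernel_def)
  have mono: "is_mono \<C> Z Y (cls Z Y D i)"
  proof (rule colim_monoI[OF b(3,1) i])
    fix E assume E: "E \<in> I" "E \<subseteq> D"
    show "is_mono (A E) (lev E Z) (lev E Y) (res E D Z Y i)"
      by (rule kernel_is_mono[OF res_kernel[OF b f k E] lcat[OF E(1)]])
        (use b f E in \<open>auto intro!: lev_ob res_hom\<close>)
  qed
  have fact: "\<exists>l. l \<in> Hom \<C> W Z \<and> Cmp \<C> W Z Y (cls Z Y D i) l = g"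
    if W: "W \<in> Ob \<C>" and g: "g \<in> Hom \<C> W Y"
      and z: "Cmp \<C> W Y Y' (cls Y Y' D f) g = Zero \<C> W Y'" for W g
  proof -
    obtain E g' where E: "E \<subseteq> D" "below E W" "below E Y"
      and h: "g' \<in> lhom E W Y" and e: "g = cls W Y E g'"
      by (rule common_level[OF g g g W o(1) W o(1) W o(1) o(4)]) blast
    have bE: "below E Y'" "below E Z" using E b by auto
    have fE: "res E D Y Y' f \<in> lhom E Y Y'" "cls Y Y' D f = cls Y Y' E (res E D Y Y' f)"
      using b f E by (simp_all add: res_hom cls_res)
    have L: "lev E W \<in> Ob (A E)" "lev E Y \<in> Ob (A E)" "lev E Y' \<in> Ob (A E)"
      using E bE by (auto intro!: lev_ob)
    interpret A: lin_cat R "A E" by (rule lcat) (use E in auto)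
    let ?c = "Cmp (A E) (lev E W) (lev E Y) (lev E Y') (res E D Y Y' f) g'"
    have "cls W Y' E ?c = cls W Y' E (Zero (A E) (lev E W) (lev E Y'))"
      using z E bE h fE by (simp add: e fE(2) Cmp_cls Zero_cls[of E])
    then obtain F where F: "F \<in> I" "F \<subseteq> E"
      "res F E W Y' ?c = res F E W Y' (Zero (A E) (lev E W) (lev E Y'))"
      using L fE h E bE by (auto simp: cls_eq_iff A.cmp_in A.zero_in)
    have bF: "below F W" "below F Y" "below F Y'" "below F Z" using E bE F by auto
    have FD: "F \<subseteq> D" using F E by auto
    have fF: "res F E Y Y' (res E D Y Y' f) = res F D Y Y' f"
      using b f E F by (intro res_res) auto
    have gF: "res F E W Y g' \<in> lhom F W Y" using h E F by (auto intro!: res_hom)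
    have "Cmp (A F) (lev F W) (lev F Y) (lev F Y') (res F D Y Y' f) (res F E W Y g') =
        Zero (A F) (lev F W) (lev F Y')"
      using F E bE h fE fF by (simp add: res_cmp res_zero)
    then obtain l where l: "l \<in> lhom F W Z"
      "Cmp (A F) (lev F W) (lev F Z) (lev F Y) (res F D Z Y i) l = res F E W Y g'"
      using res_kernel[OF b f k F(1) FD] gF lev_ob[OF bF(1)] unfolding is_kernel_def by blast
    have iF: "res F D Z Y i \<in> lhom F Z Y" "cls Z Y D i = cls Z Y F (res F D Z Y i)"
      using b i F FD by (simp_all add: res_hom cls_res)
    have "Cmp \<C> W Z Y (cls Z Y D i) (cls W Z F l) = g"
      using bF l iF F E h by (simp add: iF(2) Cmp_cls e cls_res)
    then show ?thesis using cls_in[OF bF(1,4) l(1)] by blast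
  qed
  show ?thesis unfolding is_kernel_def
  proof (intro conjI ballI impI)
    show "cls Z Y D i \<in> Hom \<C> Z Y" by (rule cls_in[OF b(3,1) i])
    show "Cmp \<C> Z Y Y' (cls Y Y' D f) (cls Z Y D i) = Zero \<C> Z Y'"
      using b f i by (simp add: Cmp_cls fi Zero_cls[of D])
    fix W g assume W: "W \<in> Ob \<C>" "g \<in> Hom \<C> W Y" "Cmp \<C> W Y Y' (cls Y Y' D f) g = Zero \<C> W Y'"
    show "\<exists>!l. l \<in> Hom \<C> W Z \<and> Cmp \<C> W Z Y (cls Z Y D i) l = g"
      using fact[OF W] mono W(1) unfolding is_mono_def by metis
  qed (use o in simp)
qed

lemma colim_has_kernel:
  assumes o: "Y \<in> Ob \<C>" "Y' \<in> Ob \<C>" and w: "w \<in> Hom \<C> Y Y'"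
  shows "\<exists>K i. is_kernel \<C> Y Y' w K i"
proof -
  have "fst Y \<in> I" using o by (simp add: Ob_iff)
  then obtain D f where D: "below D Y" "below D Y'" and f: "f \<in> lhom D Y Y'" and e: "w = cls Y Y' D f"
    by (rule common_level[OF w w w o o o]) blast
  obtain K i where k: "is_kernel (A D) (lev D Y) (lev D Y') f K i"
    using abelian[of D] D f lev_ob[OF D(1)] lev_ob[OF D(2)]
    unfolding abelian_linear_category_def by blast
  then have K: "K \<in> Ob (A D)" by (simp add: is_kernel_def)
  then have "below D (D, K)" using D by (simp add: Ob_iff)
  then show ?thesis
    using colim_kernel[OF D, of "(D, K)" f i] f k K D by (auto simp: e P_id_ob)
qed

text \<open>Let \<open>f\<close> represent \<open>w\<close>. The kernel of \<open>f\<close> is zero in the colimit because \<open>w\<close> is a monomorphism, hence it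
  is zero at some smaller level \<open>E\<close>. There the restriction of \<open>f\<close> is a monomorphism, so it is a kernel,
  and kernels at a level are kernels in the colimit.\<close>

lemma colim_mono_is_kernel:
  assumes o: "Y \<in> Ob \<C>" "Y' \<in> Ob \<C>" and w: "w \<in> Hom \<C> Y Y'" and m: "is_mono \<C> Y Y' w"
  shows "\<exists>Z\<in>Ob \<C>. \<exists>g\<in>Hom \<C> Y' Z. is_kernel \<C> Y' Z g Y w"
proof -
  have "fst Y \<in> I" using o by (simp add: Ob_iff)
  then obtain D f where D: "below D Y" "below D Y'" and f: "f \<in> lhom D Y Y'" and e: "w = cls Y Y' D f"
    by (rule common_level[OF w w w o o o]) blast
  obtain K i where k: "is_kernel (A D) (lev D Y) (lev D Y') f K i"
    using abelian[of D] D f lev_ob[OF D(1)] lev_ob[OF D(2)]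
    unfolding abelian_linear_category_def by blast
  define N where "N = (D, K)"
  have K: "K \<in> Ob (A D)" using k by (simp add: is_kernel_def)
  then have N: "below D N" "lev D N = K" using D by (simp_all add: N_def Ob_iff P_id_ob)
  have i: "i \<in> lhom D N Y" using k by (simp add: is_kernel_def N)
  have kN: "is_kernel (A D) (lev D Y) (lev D Y') f (lev D N) i" using k N by simp
  have "Cmp \<C> N Y Y' w (cls N Y D i) = Zero \<C> N Y'"
    using colim_kernel[OF D N(1) f kN] by (simp add: is_kernel_def e)
  then have "cls N Y D i = Zero \<C> N Y"
    using m colim.mono_iff[OF o w] N cls_in[OF N(1) D(1) i] by blast
  then have "cls N Y D i = cls N Y D (Zero (A D) (lev D N) (lev D Y))"
    using Zero_cls[OF N(1) D(1)] by simp
  then obtain E where E: "E \<in> I" "E \<subseteq> D"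
    "res E D N Y i = res E D N Y (Zero (A D) (lev D N) (lev D Y))"
    using N D i by (auto simp: cls_eq_iff lin_cat.zero_in[OF lcat lev_ob lev_ob])
  interpret A: lin_cat R "A E" by (rule lcat) (use E in auto)
  have bE: "below E Y" "below E Y'" using E D by auto
  have L: "lev E Y \<in> Ob (A E)" "lev E Y' \<in> Ob (A E)" using bE by (auto intro!: lev_ob)
  have fE: "res E D Y Y' f \<in> lhom E Y Y'" using D f E by (auto intro!: res_hom)
  have "is_kernel (A E) (lev E Y) (lev E Y') (res E D Y Y' f) (lev E N) (Zero (A E) (lev E N) (lev E Y))"
    using res_kernel[OF D N(1) f kN E(1,2)]
    unfolding trans[OF E(3) res_zero[OF N(1) D(1) E(1,2)]] .
  then have "is_mono (A E) (lev E Y) (lev E Y') (res E D Y Y' f)"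
    by (rule A.mono_of_zero_kernel[OF L fE])
  then obtain Z g where Z: "Z \<in> Ob (A E)" "g \<in> Hom (A E) (lev E Y') Z"
    "is_kernel (A E) (lev E Y') Z g (lev E Y) (res E D Y Y' f)"
    using abelian[OF E(1)] L fE unfolding abelian_linear_category_def by blast
  define M where "M = (E, Z)"
  have M: "below E M" "lev E M = Z" using E Z by (simp_all add: M_def Ob_iff P_id_ob)
  have "is_kernel \<C> Y' M (cls Y' M E g) Y (cls Y Y' E (res E D Y Y' f))"
    using colim_kernel[OF bE(2) M(1) bE(1)] Z M by simp
  moreover have "cls Y Y' E (res E D Y Y' f) = w" using D f E by (simp add: e cls_res)
  moreover have "cls Y' M E g \<in> Hom \<C> Y' M" using Z M bE by (intro cls_in) auto
  ultimately show ?thesis using M(1) by blast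
qed

lemma op_system: "direct_system R I (\<lambda>C. op_cat (A C)) (\<lambda>D C. op_ftor (P D C))"
  by unfold_locales
    (simp_all add: nonempty inter abelian_op abelian linear_ftor_op lin is_kernel_op is_cokernel_op
      pres_kernel pres_cokernel P_id_ob P_id_mor P_comp_ob P_comp_mor)

text \<open>Taking opposites commutes with the colimit, so cokernels in the colimit are kernels in the colimit
  of the opposite system.\<close>

lemma op_colim: "colim_cat I (\<lambda>C. op_cat (A C)) (\<lambda>D C. op_ftor (P D C)) = op_cat \<C>"
proof -
  let ?A = "\<lambda>C. op_cat (A C)" and ?P = "\<lambda>D C. op_ftor (P D C)"
  have r: "colim_reps I ?A ?P Y Y' = colim_reps I A P Y' Y" for Y Y'
    by (auto simp: colim_reps_def)
  have q: "colim_eq I ?A ?P Y Y' = colim_eq I A P Y' Y" for Y Y'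
    by (simp add: colim_eq_def r)
  have c: "colim_class I ?A ?P Y Y' = colim_class I A P Y' Y" for Y Y'
    by (simp add: colim_class_def q fun_eq_iff)
  show ?thesis
    unfolding colim_cat_def Let_def op_cat_def[of "\<lparr>Ob = _, Hom = _, Idm = _, Cmp = _, Zero = _, Add = _, Scale = _\<rparr>"]
    by (simp add: r q c fun_eq_iff Int_commute) (intro allI arg_cong[where f = Union]; blast)
qed

lemma abelian_colim: "abelian_linear_category R \<C>"
  unfolding abelian_linear_category_def
proof (intro conjI ballI impI)
  interpret op: direct_system R I "\<lambda>C. op_cat (A C)" "\<lambda>D C. op_ftor (P D C)" by (rule op_system)
  show "linear_category R \<C>" by (rule linear_colim)
  show "\<exists>Z. is_zero_object \<C> Z"
  proof -
    obtain C where C: "C \<in> I" using nonempty by blast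
    interpret A: lin_cat R "A C" by (rule lcat[OF C])
    obtain Z where Z: "is_zero_object (A C) Z"
      using abelian[OF C] by (auto simp: abelian_linear_category_def)
    then have o: "Z \<in> Ob (A C)" by (simp add: is_zero_object_def)
    have b: "below C (C, Z)" using C o by (simp add: Ob_iff)
    have "Idm \<C> (C, Z) = Zero \<C> (C, Z) (C, Z)"
      using Z A.zero_object_iff[OF o] by (simp add: Idm_cls[OF b] Zero_cls[OF b b] P_id_ob C o)
    then have "is_zero_object \<C> (C, Z)" using b by (simp add: colim.zero_object_iff)
    then show ?thesis by blast
  qed
  fix X Y assume o: "X \<in> Ob \<C>" "Y \<in> Ob \<C>"
  show "\<exists>B i j p q. is_biproduct \<C> X Y B i j p q"
  proof -
    have "fst X \<inter> fst Y \<in> I" using o by (auto simp: Ob_iff inter)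
    then obtain D where D: "D \<in> I" "below D X" "below D Y" using o by blast
    obtain B i j p q where B: "is_biproduct (A D) (lev D X) (lev D Y) B i j p q"
      using abelian[OF D(1)] lev_ob[OF D(2)] lev_ob[OF D(3)]
      unfolding abelian_linear_category_def by blast
    define N where "N = (D, B)"
    have "B \<in> Ob (A D)" using B by (simp add: is_biproduct_def)
    then have N: "below D N" "lev D N = B" using D by (auto simp: N_def Ob_iff P_id_ob)
    note Bd = B[folded N(2), unfolded is_biproduct_def]
    interpret A: lin_cat R "A D" by (rule lcat[OF D(1)])
    have L: "lev D X \<in> Ob (A D)" "lev D Y \<in> Ob (A D)" "lev D N \<in> Ob (A D)"
      using D N(1) by (auto intro!: lev_ob)
    have "is_biproduct \<C> X Y N (cls X N D i) (cls Y N D j) (cls N X D p) (cls N Y D q)"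
      unfolding is_biproduct_def using Bd D N(1) L
      by (simp add: cls_in Cmp_cls Add_cls Idm_cls[of D] Zero_cls[of D] A.cmp_in)
    then show ?thesis by blast
  qed
  fix w assume w: "w \<in> Hom \<C> X Y"
  show "\<exists>K i. is_kernel \<C> X Y w K i" by (rule colim_has_kernel[OF o w])
  show "\<exists>Q p. is_cokernel \<C> X Y w Q p"
    using op.colim_has_kernel[of Y X w] o w by (simp add: op_colim is_kernel_op)
  show "\<exists>Z\<in>Ob \<C>. \<exists>g\<in>Hom \<C> Y Z. is_kernel \<C> Y Z g X w" if "is_mono \<C> X Y w"
    by (rule colim_mono_is_kernel[OF o w that])
  show "\<exists>Z\<in>Ob \<C>. \<exists>g\<in>Hom \<C> Z X. is_cokernel \<C> Z X g Y w" if "is_epi \<C> X Y w"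
    using op.colim_mono_is_kernel[of Y X w] o w that by (simp add: op_colim is_kernel_op is_mono_op)
qed

end

section \<open>Strict actions on a category\<close>

text \<open>The universal property of the image of a kernel is tested after applying the inverse functor.\<close>

lemma strict_iso_pres_kernel:
  assumes "lin_cat R \<A>" and F: "linear_ftor R \<A> \<A> F" and G: "linear_ftor R \<A> \<A> G"
    and GF_ob: "\<And>X. X \<in> Ob \<A> \<Longrightarrow> FOb G (FOb F X) = X"
    and FG_ob: "\<And>X. X \<in> Ob \<A> \<Longrightarrow> FOb F (FOb G X) = X"
    and GF_mor: "\<And>X Y f. \<lbrakk>X \<in> Ob \<A>; Y \<in> Ob \<A>; f \<in> Hom \<A> X Y\<rbrakk> \<Longrightarrow>
        FMor G (FOb F X) (FOb F Y) (FMor F X Y f) = f"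
    and FG_mor: "\<And>X Y f. \<lbrakk>X \<in> Ob \<A>; Y \<in> Ob \<A>; f \<in> Hom \<A> X Y\<rbrakk> \<Longrightarrow>
        FMor F (FOb G X) (FOb G Y) (FMor G X Y f) = f"
    and XY: "X \<in> Ob \<A>" "Y \<in> Ob \<A>" "f \<in> Hom \<A> X Y" and k: "is_kernel \<A> X Y f K i"
  shows "is_kernel \<A> (FOb F X) (FOb F Y) (FMor F X Y f) (FOb F K) (FMor F K X i)"
proof -
  interpret lin_cat R \<A> by fact
  note F' = linear_ftor_is_ftor[OF F] and G' = linear_ftor_is_ftor[OF G]
  have K: "K \<in> Ob \<A>" "i \<in> Hom \<A> K X" "Cmp \<A> K X Y f i = Zero \<A> K Y"
    using k by (auto simp: is_kernel_def)
  have fi: "Cmp \<A> (FOb F K) (FOb F X) (FOb F Y) (FMor F X Y f) (FMor F K X i) =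
      Zero \<A> (FOb F K) (FOb F Y)"
    using XY K by (simp add: ftor_cmp[OF F', symmetric] ftor_zero[OF F lin_cat_axioms lin_cat_axioms])
  have ex: "\<exists>!l. l \<in> Hom \<A> W (FOb F K) \<and> Cmp \<A> W (FOb F K) (FOb F X) (FMor F K X i) l = g"
    if W: "W \<in> Ob \<A>" and g: "g \<in> Hom \<A> W (FOb F X)"
      and z: "Cmp \<A> W (FOb F X) (FOb F Y) (FMor F X Y f) g = Zero \<A> W (FOb F Y)" for W g
  proof -
    have o: "FOb F X \<in> Ob \<A>" "FOb F Y \<in> Ob \<A>" "FOb F K \<in> Ob \<A>" "FOb G W \<in> Ob \<A>"
      using XY K W ftor_ob[OF F'] ftor_ob[OF G'] by auto
    let ?g = "FMor G W (FOb F X) g"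
    have g': "?g \<in> Hom \<A> (FOb G W) X"
      using ftor_mor[OF G' W o(1) g] XY by (simp add: GF_ob)
    have "Cmp \<A> (FOb G W) X Y f ?g =
        FMor G W (FOb F Y) (Cmp \<A> W (FOb F X) (FOb F Y) (FMor F X Y f) g)"
      using ftor_cmp[OF G' W o(1,2) g ftor_mor[OF F' XY]] XY by (simp add: GF_ob GF_mor)
    also have "\<dots> = Zero \<A> (FOb G W) Y"
      using W o XY by (simp add: z ftor_zero[OF G lin_cat_axioms lin_cat_axioms] GF_ob)
    finally have z': "Cmp \<A> (FOb G W) X Y f ?g = Zero \<A> (FOb G W) Y" .
    obtain l where l: "l \<in> Hom \<A> (FOb G W) K" "Cmp \<A> (FOb G W) K X i l = ?g"
      and uniq: "\<And>l'. l' \<in> Hom \<A> (FOb G W) K \<Longrightarrow> Cmp \<A> (FOb G W) K X i l' = ?g \<Longrightarrow> l' = l"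
      using k o(4) g' z' unfolding is_kernel_def by metis
    show ?thesis
    proof (rule ex1I[of _ "FMor F (FOb G W) K l"], intro conjI)
      show "FMor F (FOb G W) K l \<in> Hom \<A> W (FOb F K)"
        using ftor_mor[OF F' o(4) K(1) l(1)] W by (simp add: FG_ob)
      show "Cmp \<A> W (FOb F K) (FOb F X) (FMor F K X i) (FMor F (FOb G W) K l) = g"
        using ftor_cmp[OF F' o(4) K(1) XY(1) l(1) K(2)] l(2) FG_mor[OF W o(1) g] W XY
        by (simp add: FG_ob GF_ob)
    next
      fix l' assume l': "l' \<in> Hom \<A> W (FOb F K) \<and>
        Cmp \<A> W (FOb F K) (FOb F X) (FMor F K X i) l' = g"
      have "FMor G W (FOb F K) l' \<in> Hom \<A> (FOb G W) K"
        using ftor_mor[OF G' W o(3), of l'] l' K by (simp add: GF_ob)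
      moreover have "Cmp \<A> (FOb G W) K X i (FMor G W (FOb F K) l') = ?g"
        using ftor_cmp[OF G' W o(3,1), of l' "FMor F K X i"] l' ftor_mor[OF F' K(1) XY(1) K(2)] K XY
        by (simp add: GF_ob GF_mor)
      ultimately have "FMor G W (FOb F K) l' = l" by (rule uniq)
      then show "l' = FMor F (FOb G W) K l"
        using FG_mor[OF W o(3), of l'] l' K by (simp add: GF_ob)
    qed
  qed
  show ?thesis unfolding is_kernel_def
    using fi ex ftor_ob[OF F' K(1)] ftor_mor[OF F' K(1) XY(1) K(2)] by blast
qed

lemma FOb_mk_ftor: "X \<in> Ob \<A> \<Longrightarrow> FOb (mk_ftor \<A> fo fm) X = fo X"
  and FMor_mk_ftor: "\<lbrakk>X \<in> Ob \<A>; Y \<in> Ob \<A>; f \<in> Hom \<A> X Y\<rbrakk> \<Longrightarrow> FMor (mk_ftor \<A> fo fm) X Y f = fm X Y f"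
  by (simp_all add: mk_ftor_def)

lemma mk_ftor_cong:
  assumes "\<And>X. X \<in> Ob \<A> \<Longrightarrow> fo X = fo' X"
    and "\<And>X Y f. \<lbrakk>X \<in> Ob \<A>; Y \<in> Ob \<A>; f \<in> Hom \<A> X Y\<rbrakk> \<Longrightarrow> fm X Y f = fm' X Y f"
  shows "mk_ftor \<A> fo fm = mk_ftor \<A> fo' fm'"
  using assms by (simp add: mk_ftor_def fun_eq_iff restrict_def)

lemma (in lin_cat) id_nat_iso:
  assumes F: "is_ftor \<A> \<A> F"
  shows "is_nat_iso \<A> \<A> F F (\<lambda>X\<in>Ob \<A>. Idm \<A> (FOb F X))"
proof -
  note o = ftor_ob[OF F] and m = ftor_mor[OF F]
  have "is_iso \<A> (FOb F X) (FOb F X) (Idm \<A> (FOb F X))" if "X \<in> Ob \<A>" for X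
    unfolding is_iso_def using o[OF that] id_in id_left by blast
  then show ?thesis
    unfolding is_nat_iso_def is_nat_trans_def using o m
    by (simp add: id_in id_left[OF o o] id_right[OF o o])
qed

text \<open>The tensor unit, the tensor products and all constraints of a strict action are identities,
  so each coherence law compares two composites of identity transformations.\<close>

lemma (in lin_cat) strict_monoidal_of_strict_action:
  assumes G: "monoid G" and ftor: "\<And>h. h \<in> carrier G \<Longrightarrow> is_ftor \<A> \<A> (F h)"
    and S: "\<And>h. h \<in> carrier G \<Longrightarrow> F h \<in> S"
    and comp: "\<And>g h. \<lbrakk>g \<in> carrier G; h \<in> carrier G\<rbrakk> \<Longrightarrow> comp_ftor \<A> (F g) (F h) = F (g \<otimes>\<^bsub>G\<^esub> h)"
    and one: "F \<one>\<^bsub>G\<^esub> = id_ftor \<A>"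
    and N: "N = (Aut_lin R \<A>)\<lparr>Ob := S\<rparr>"
    and \<rho>: "\<rho> = \<lparr>FOb = (\<lambda>h\<in>carrier G. F h),
      FMor = (\<lambda>h h' x. if h \<in> carrier G \<and> h = h' then Idm N (F h) else undefined),
      MMu = (\<lambda>h h'. Idm N (F (h \<otimes>\<^bsub>G\<^esub> h'))), MEps = Idm N (F \<one>\<^bsub>G\<^esub>)\<rparr>"
  shows "strict_monoidal_ftor (disc_2group G) N \<rho>"
proof -
  interpret G: monoid G by fact
  have Idm: "Idm N K = (\<lambda>X\<in>Ob \<A>. Idm \<A> (FOb K X))" for K by (simp add: N Aut_lin_def)
  have hom: "Idm N (F h) \<in> Hom N (F h) (F h)" if "h \<in> carrier G" for h
    using id_nat_iso[OF ftor[OF that]] by (simp add: N Aut_lin_def)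
  have cmp: "Cmp N (F h) (F h) (F h) (Idm N (F h)) (Idm N (F h)) = Idm N (F h)"
    if "h \<in> carrier G" for h
    using ftor_ob[OF ftor[OF that]] by (simp add: N Aut_lin_def fun_eq_iff restrict_def id_in id_left)
  have iso: "is_iso N (F h) (F h) (Idm N (F h))" if "h \<in> carrier G" for h
    unfolding is_iso_def using hom[OF that] cmp[OF that] by blast
  have tob: "TOb N (F g) (F h) = F (g \<otimes>\<^bsub>G\<^esub> h)" if "g \<in> carrier G" "h \<in> carrier G" for g h
    using comp[OF that] by (simp add: N Aut_lin_def)
  have tunit: "TUnit N = F \<one>\<^bsub>G\<^esub>" by (simp add: N Aut_lin_def one)
  have tmor: "TMor N (F g) (F g) (F h) (F h) (Idm N (F g)) (Idm N (F h)) = Idm N (F (g \<otimes>\<^bsub>G\<^esub> h))"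
    if gh: "g \<in> carrier G" "h \<in> carrier G" for g h
  proof -
    have "Cmp \<A> (FOb (F g) (FOb (F h) X)) (FOb (F g) (FOb (F h) X)) (FOb (F g) (FOb (F h) X))
        (Idm \<A> (FOb (F g) (FOb (F h) X)))
        (FMor (F g) (FOb (F h) X) (FOb (F h) X) (Idm \<A> (FOb (F h) X))) =
      Idm \<A> (FOb (F (g \<otimes>\<^bsub>G\<^esub> h)) X)" if X: "X \<in> Ob \<A>" for X
    proof -
      have "FOb (F (g \<otimes>\<^bsub>G\<^esub> h)) X = FOb (F g) (FOb (F h) X)"
        using comp[OF gh, symmetric] X by (simp add: comp_ftor_def mk_ftor_def)
      then show ?thesis
        using ftor_ob[OF ftor[OF gh(1)] ftor_ob[OF ftor[OF gh(2)] X]] ftor_ob[OF ftor[OF gh(2)] X]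
        by (simp add: ftor_id[OF ftor[OF gh(1)]] id_in id_left)
    qed
    then show ?thesis
      using ftor_ob[OF ftor[OF gh(2)]] by (simp add: N Aut_lin_def fun_eq_iff restrict_def)
  qed
  have is_f: "is_ftor (disc_2group G) N \<rho>"
    using S hom cmp by (auto simp: is_ftor_def \<rho> disc_2group_def PiE_iff extensional_def N)
  show ?thesis
    unfolding strict_monoidal_ftor_def strong_monoidal_ftor_def
    using is_f
    by (simp add: \<rho> disc_2group_def tob tunit tmor cmp iso G.m_assoc)
qed

text \<open>The endofunctor of the colimit induced by functors \<open>Q h C\<close> from \<open>A C\<close> to \<open>A (\<kappa> h C)\<close>.\<close>

definition colim_act_ob ::
  "('h \<Rightarrow> 'c set \<Rightarrow> 'c set) \<Rightarrow> ('h \<Rightarrow> 'c set \<Rightarrow> ('o, 'm, 'o, 'm) ftor) \<Rightarrow> 'h \<Rightarrow>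
    'c set \<times> 'o \<Rightarrow> 'c set \<times> 'o" where
  "colim_act_ob \<kappa> Q h = (\<lambda>(C, X). (\<kappa> h C, FOb (Q h C) X))"

definition colim_act ::
  "'c set set \<Rightarrow> ('c set \<Rightarrow> ('r, 'o, 'm) lincat) \<Rightarrow> ('c set \<Rightarrow> 'c set \<Rightarrow> ('o, 'm, 'o, 'm) ftor) \<Rightarrow>
    ('h \<Rightarrow> 'c set \<Rightarrow> 'c set) \<Rightarrow> ('h \<Rightarrow> 'c set \<Rightarrow> ('o, 'm, 'o, 'm) ftor) \<Rightarrow> 'h \<Rightarrow>
    ('c set \<times> 'o, ('c set \<times> 'm) set, 'c set \<times> 'o, ('c set \<times> 'm) set) ftor" where
  "colim_act I A P \<kappa> Q h = mk_ftor (colim_cat I A P) (colim_act_ob \<kappa> Q h)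
     (\<lambda>Y Y' w. \<Union>{colim_class I A P (colim_act_ob \<kappa> Q h Y) (colim_act_ob \<kappa> Q h Y')
        (\<kappa> h D, FMor (Q h D) (FOb (P D (fst Y)) (snd Y)) (FOb (P D (fst Y')) (snd Y')) f)
        | D f. (D, f) \<in> w})"

text \<open>A group acts on the levels by \<open>\<kappa>\<close> and compatibly on the categories by \<open>Q\<close>. Each level \<open>C\<close> is itself a
  subgroup, and the last three assumptions say that it acts trivially on its own category; they are
  the source of the open stabilizers.\<close>

locale system_action = direct_system R I A P + G: group G
  for R :: "'r ring" and I :: "'g set set" and A :: "'g set \<Rightarrow> ('r, 'o, 'm) lincat"
    and P and G :: "('g, 'z) monoid_scheme" +
  fixes \<kappa> :: "'g \<Rightarrow> 'g set \<Rightarrow> 'g set" and Q :: "'g \<Rightarrow> 'g set \<Rightarrow> ('o, 'm, 'o, 'm) ftor"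
  assumes index_subgroup: "C \<in> I \<Longrightarrow> subgroup C G"
    and \<kappa>_in: "\<lbrakk>h \<in> carrier G; C \<in> I\<rbrakk> \<Longrightarrow> \<kappa> h C \<in> I"
    and \<kappa>_mono: "\<lbrakk>h \<in> carrier G; C \<in> I; D \<in> I; D \<subseteq> C\<rbrakk> \<Longrightarrow> \<kappa> h D \<subseteq> \<kappa> h C"
    and \<kappa>_mult: "\<lbrakk>g \<in> carrier G; h \<in> carrier G; C \<in> I\<rbrakk> \<Longrightarrow> \<kappa> (g \<otimes>\<^bsub>G\<^esub> h) C = \<kappa> g (\<kappa> h C)"
    and Q_lin: "\<lbrakk>h \<in> carrier G; C \<in> I\<rbrakk> \<Longrightarrow> linear_ftor R (A C) (A (\<kappa> h C)) (Q h C)"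
    and Q_mult_ob: "\<lbrakk>g \<in> carrier G; h \<in> carrier G; C \<in> I; X \<in> Ob (A C)\<rbrakk> \<Longrightarrow>
        FOb (Q (g \<otimes>\<^bsub>G\<^esub> h) C) X = FOb (Q g (\<kappa> h C)) (FOb (Q h C) X)"
    and Q_mult_mor: "\<lbrakk>g \<in> carrier G; h \<in> carrier G; C \<in> I; X \<in> Ob (A C); Y \<in> Ob (A C);
        f \<in> Hom (A C) X Y\<rbrakk> \<Longrightarrow>
        FMor (Q (g \<otimes>\<^bsub>G\<^esub> h) C) X Y f =
        FMor (Q g (\<kappa> h C)) (FOb (Q h C) X) (FOb (Q h C) Y) (FMor (Q h C) X Y f)"
    and Q_P_ob: "\<lbrakk>h \<in> carrier G; C \<in> I; D \<in> I; D \<subseteq> C; X \<in> Ob (A C)\<rbrakk> \<Longrightarrow>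
        FOb (P (\<kappa> h D) (\<kappa> h C)) (FOb (Q h C) X) = FOb (Q h D) (FOb (P D C) X)"
    and Q_P_mor: "\<lbrakk>h \<in> carrier G; C \<in> I; D \<in> I; D \<subseteq> C; X \<in> Ob (A C); Y \<in> Ob (A C);
        f \<in> Hom (A C) X Y\<rbrakk> \<Longrightarrow>
        FMor (P (\<kappa> h D) (\<kappa> h C)) (FOb (Q h C) X) (FOb (Q h C) Y) (FMor (Q h C) X Y f) =
        FMor (Q h D) (FOb (P D C) X) (FOb (P D C) Y) (FMor (P D C) X Y f)"
    and \<kappa>_fix: "\<lbrakk>C \<in> I; h \<in> C\<rbrakk> \<Longrightarrow> \<kappa> h C = C"
    and Q_fix_ob: "\<lbrakk>C \<in> I; h \<in> C; X \<in> Ob (A C)\<rbrakk> \<Longrightarrow> FOb (Q h C) X = X"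
    and Q_fix_mor: "\<lbrakk>C \<in> I; h \<in> C; X \<in> Ob (A C); Y \<in> Ob (A C); f \<in> Hom (A C) X Y\<rbrakk> \<Longrightarrow>
        FMor (Q h C) X Y f = f"
begin

abbreviation "act_ob \<equiv> colim_act_ob \<kappa> Q"
abbreviation "act \<equiv> colim_act I A P \<kappa> Q"
abbreviation "tr h D Y Y' f \<equiv> FMor (Q h D) (lev D Y) (lev D Y') f"

lemma one_mem: "C \<in> I \<Longrightarrow> \<one>\<^bsub>G\<^esub> \<in> C"
  using index_subgroup by (rule subgroup.one_closed)

lemma index_sub: "\<lbrakk>C \<in> I; h \<in> C\<rbrakk> \<Longrightarrow> h \<in> carrier G"
  using index_subgroup subgroup.subset by blast

lemma act_ob_below:
  assumes "h \<in> carrier G" "below D Y"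
  shows "below (\<kappa> h D) (act_ob h Y)" "lev (\<kappa> h D) (act_ob h Y) = FOb (Q h D) (lev D Y)"
proof -
  obtain C X where Y: "Y = (C, X)" by (cases Y)
  have C: "C \<in> I" "X \<in> Ob (A C)" "D \<in> I" "D \<subseteq> C" using assms by (auto simp: Y Ob_iff)
  show "below (\<kappa> h D) (act_ob h Y)"
    using C assms(1) ftor_ob[OF linear_ftor_is_ftor[OF Q_lin[OF assms(1) C(1)]] C(2)]
    by (simp add: Y colim_act_ob_def Ob_iff \<kappa>_in \<kappa>_mono)
  show "lev (\<kappa> h D) (act_ob h Y) = FOb (Q h D) (lev D Y)"
    using C assms(1) by (simp add: Y colim_act_ob_def Q_P_ob)
qed

lemma tr_hom: "\<lbrakk>h \<in> carrier G; below D Y; below D Y'; f \<in> lhom D Y Y'\<rbrakk> \<Longrightarrow>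
    tr h D Y Y' f \<in> lhom (\<kappa> h D) (act_ob h Y) (act_ob h Y')"
  using ftor_mor[OF linear_ftor_is_ftor[OF Q_lin[of h D]], of "lev D Y" "lev D Y'" f] lev_ob[of D]
  by (simp add: act_ob_below)

lemma tr_res:
  assumes "h \<in> carrier G" "below D Y" "below D Y'" "f \<in> lhom D Y Y'" "E \<in> I" "E \<subseteq> D"
  shows "res (\<kappa> h E) (\<kappa> h D) (act_ob h Y) (act_ob h Y') (tr h D Y Y' f) = tr h E Y Y' (res E D Y Y' f)"
  using Q_P_mor[of h D E "lev D Y" "lev D Y'" f] assms lev_ob[of D]
  by (simp add: act_ob_below lev_lev)

lemma act_ob_in: "\<lbrakk>h \<in> carrier G; Y \<in> Ob \<C>\<rbrakk> \<Longrightarrow> act_ob h Y \<in> Ob \<C>"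
  using act_ob_below(1)[of h "fst Y" Y] by (simp add: Ob_iff)

lemma FOb_act: "Y \<in> Ob \<C> \<Longrightarrow> FOb (act h) Y = act_ob h Y"
  by (simp add: colim_act_def FOb_mk_ftor)

lemma FMor_act:
  assumes h: "h \<in> carrier G" and b: "below D Y" "below D Y'" and f: "f \<in> lhom D Y Y'"
  shows "FMor (act h) Y Y' (cls Y Y' D f) = cls (act_ob h Y) (act_ob h Y') (\<kappa> h D) (tr h D Y Y' f)"
proof -
  let ?c = "cls (act_ob h Y) (act_ob h Y') (\<kappa> h D) (tr h D Y Y' f)"
  let ?S = "{cls (act_ob h Y) (act_ob h Y') (\<kappa> h E) (tr h E Y Y' f') | E f'. (E, f') \<in> cls Y Y' D f}"
  have Ob: "Y \<in> Ob \<C>" "Y' \<in> Ob \<C>" using b by auto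
  have "(D, f) \<in> cls Y Y' D f" using b f by (auto simp: mem_cls Ob)
  then have "?c \<in> ?S" by blast
  moreover have "s = ?c" if "s \<in> ?S" for s
  proof -
    obtain E f' where s: "s = cls (act_ob h Y) (act_ob h Y') (\<kappa> h E) (tr h E Y Y' f')"
      and m: "(E, f') \<in> cls Y Y' D f" using \<open>s \<in> ?S\<close> by blast
    obtain F where F: "F \<in> I" "F \<subseteq> D" "F \<subseteq> E" "res F D Y Y' f = res F E Y Y' f'"
      using m by (auto simp: mem_cls Ob)
    have E: "below E Y" "below E Y'" "f' \<in> lhom E Y Y'" using m by (auto simp: mem_cls Ob)
    have K: "\<kappa> h F \<in> I" "\<kappa> h F \<subseteq> \<kappa> h D" "\<kappa> h F \<subseteq> \<kappa> h E"
      using F b E h by (simp_all add: \<kappa>_in \<kappa>_mono)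
    have "res (\<kappa> h F) (\<kappa> h D) (act_ob h Y) (act_ob h Y') (tr h D Y Y' f) =
        res (\<kappa> h F) (\<kappa> h E) (act_ob h Y) (act_ob h Y') (tr h E Y Y' f')"
      using tr_res[OF h b f F(1,2)] tr_res[OF h E F(1,3)] F(4) by simp
    then have "\<exists>F'\<in>I. F' \<subseteq> \<kappa> h E \<inter> \<kappa> h D \<and>
        res F' (\<kappa> h E) (act_ob h Y) (act_ob h Y') (tr h E Y Y' f') =
        res F' (\<kappa> h D) (act_ob h Y) (act_ob h Y') (tr h D Y Y' f)"
      using K by (intro bexI[of _ "\<kappa> h F"]) simp_all
    then show ?thesis
      unfolding s cls_eq_iff[OF act_ob_below(1)[OF h E(1)] act_ob_below(1)[OF h E(2)] tr_hom[OF h E]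
        act_ob_below(1)[OF h b(1)] act_ob_below(1)[OF h b(2)] tr_hom[OF h b f]] .
  qed
  ultimately have "\<Union>?S = ?c" by blast
  then show ?thesis
    using cls_in[OF b f] Ob by (simp add: colim_act_def FMor_mk_ftor)
qed

lemma rep1:
  assumes "w \<in> Hom \<C> Y Y'" "Y \<in> Ob \<C>" "Y' \<in> Ob \<C>"
  obtains D f where "below D Y" "below D Y'" "f \<in> lhom D Y Y'" "w = cls Y Y' D f"
  using rep_below[OF assms] assms(2,3) by (metis order_refl)

lemma act_linear:
  assumes h: "h \<in> carrier G" shows "linear_ftor R \<C> \<C> (act h)"
proof -
  note Qf = linear_ftor_is_ftor[OF Q_lin[OF h]]
  have D0: "fst X \<in> I" if "X \<in> Ob \<C>" for X using that by (simp add: Ob_iff)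
  have ftor: "is_ftor \<C> \<C> (act h)"
    unfolding is_ftor_def
  proof (intro conjI ballI allI impI)
    show "FOb (act h) \<in> Ob \<C> \<rightarrow>\<^sub>E Ob \<C>"
      using h by (auto simp: FOb_act act_ob_in) (simp add: colim_act_def mk_ftor_def)
    show "FMor (act h) X Y f = undefined" if "X \<notin> Ob \<C> \<or> Y \<notin> Ob \<C>" for X Y f
      using that by (auto simp: colim_act_def mk_ftor_def)
  next
    fix X Y assume o: "X \<in> Ob \<C>" "Y \<in> Ob \<C>"
    have "FMor (act h) X Y w \<in> Hom \<C> (act_ob h X) (act_ob h Y)" if w: "w \<in> Hom \<C> X Y" for w
    proof -
      obtain D f where D: "below D X" "below D Y" "f \<in> lhom D X Y" "w = cls X Y D f"
        by (rule rep1[OF w o])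
      show ?thesis
        unfolding D(4) FMor_act[OF h D(1-3)] by (intro cls_in act_ob_below tr_hom h D)
    qed
    then show "FMor (act h) X Y \<in> Hom \<C> X Y \<rightarrow>\<^sub>E Hom \<C> (FOb (act h) X) (FOb (act h) Y)"
      using o by (intro PiE_I) (simp_all add: FOb_act, simp add: colim_act_def mk_ftor_def)
  next
    fix X assume X: "X \<in> Ob \<C>"
    have b: "below (fst X) X" using X by (simp add: D0)
    show "FMor (act h) X X (Idm \<C> X) = Idm \<C> (FOb (act h) X)"
      using b act_ob_below[OF h b] lin_cat.id_in[OF lcat lev_ob[OF b]] ftor_id[OF Qf lev_ob[OF b]] X
      by (simp add: Idm_cls[OF b] FMor_act[OF h] FOb_act Idm_cls[OF act_ob_below(1)[OF h b]])
  next
    fix X Y Z w w' assume o: "X \<in> Ob \<C>" "Y \<in> Ob \<C>" "Z \<in> Ob \<C>"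
      and w: "w \<in> Hom \<C> X Y" "w' \<in> Hom \<C> Y Z"
    obtain D f g where D: "below D X" "below D Y" "below D Z" "f \<in> lhom D X Y" "g \<in> lhom D Y Z"
      and e: "w = cls X Y D f" "w' = cls Y Z D g"
      by (rule common_level[OF w w(2) o(1,2) o(2,3) o(2,3) D0[OF o(1)]]) blast
    have c: "Cmp (A D) (lev D X) (lev D Y) (lev D Z) g f \<in> lhom D X Z"
      using D by (auto intro!: lin_cat.cmp_in[OF lcat] lev_ob)
    have "tr h D X Z (Cmp (A D) (lev D X) (lev D Y) (lev D Z) g f) =
      Cmp (A (\<kappa> h D)) (lev (\<kappa> h D) (act_ob h X)) (lev (\<kappa> h D) (act_ob h Y))
        (lev (\<kappa> h D) (act_ob h Z)) (tr h D Y Z g) (tr h D X Y f)"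
      using D h by (simp add: act_ob_below ftor_cmp[OF Qf lev_ob lev_ob lev_ob])
    then show "FMor (act h) X Z (Cmp \<C> X Y Z w' w) =
        Cmp \<C> (FOb (act h) X) (FOb (act h) Y) (FOb (act h) Z) (FMor (act h) Y Z w') (FMor (act h) X Y w)"
      using D h c o
      by (simp add: e Cmp_cls FMor_act FOb_act Cmp_cls[OF act_ob_below(1) act_ob_below(1) act_ob_below(1)] tr_hom)
  qed
  have add: "FMor (act h) X Y (Add \<C> X Y w w') =
      Add \<C> (FOb (act h) X) (FOb (act h) Y) (FMor (act h) X Y w) (FMor (act h) X Y w')"
    if o: "X \<in> Ob \<C>" "Y \<in> Ob \<C>" and w: "w \<in> Hom \<C> X Y" "w' \<in> Hom \<C> X Y" for X Y w w'
  proof -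
    obtain D f g where D: "below D X" "below D Y" "f \<in> lhom D X Y" "g \<in> lhom D X Y"
      and e: "w = cls X Y D f" "w' = cls X Y D g"
      by (rule common_level[OF w w(2) o o o D0[OF o(1)]]) blast
    have c: "Add (A D) (lev D X) (lev D Y) f g \<in> lhom D X Y"
      using D by (auto intro!: lin_cat.add_in[OF lcat] lev_ob)
    have "tr h D X Y (Add (A D) (lev D X) (lev D Y) f g) =
      Add (A (\<kappa> h D)) (lev (\<kappa> h D) (act_ob h X)) (lev (\<kappa> h D) (act_ob h Y))
        (tr h D X Y f) (tr h D X Y g)"
      using D h by (simp add: act_ob_below ftor_add[OF Q_lin lev_ob lev_ob])
    then show ?thesis
      using D h c o
      by (simp add: e Add_cls FMor_act FOb_act Add_cls[OF act_ob_below(1) act_ob_below(1)] tr_hom)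
  qed
  have scale: "FMor (act h) X Y (Scale \<C> X Y c w) =
      Scale \<C> (FOb (act h) X) (FOb (act h) Y) c (FMor (act h) X Y w)"
    if o: "X \<in> Ob \<C>" "Y \<in> Ob \<C>" and w: "w \<in> Hom \<C> X Y" and c: "c \<in> carrier R" for X Y w c
  proof -
    obtain D f where D: "below D X" "below D Y" "f \<in> lhom D X Y" and e: "w = cls X Y D f"
      by (rule rep1[OF w o])
    have c': "Scale (A D) (lev D X) (lev D Y) c f \<in> lhom D X Y"
      using D c by (auto intro!: lin_cat.scale_in[OF lcat] lev_ob)
    have "tr h D X Y (Scale (A D) (lev D X) (lev D Y) c f) =
      Scale (A (\<kappa> h D)) (lev (\<kappa> h D) (act_ob h X)) (lev (\<kappa> h D) (act_ob h Y)) c (tr h D X Y f)"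
      using D h c by (simp add: act_ob_below ftor_scale[OF Q_lin lev_ob lev_ob])
    then show ?thesis
      using D h c c' o
      by (simp add: e Scale_cls FMor_act FOb_act Scale_cls[OF act_ob_below(1) act_ob_below(1)] tr_hom)
  qed
  show ?thesis unfolding linear_ftor_def using ftor add scale by blast
qed

lemma act_ob_mult:
  "\<lbrakk>g \<in> carrier G; h \<in> carrier G; Y \<in> Ob \<C>\<rbrakk> \<Longrightarrow> act_ob g (act_ob h Y) = act_ob (g \<otimes>\<^bsub>G\<^esub> h) Y"
  by (cases Y) (simp add: colim_act_ob_def Ob_iff \<kappa>_mult Q_mult_ob)

lemma act_mult:
  assumes gh: "g \<in> carrier G" "h \<in> carrier G"
  shows "comp_ftor \<C> (act g) (act h) = act (g \<otimes>\<^bsub>G\<^esub> h)"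
proof -
  have "FMor (act g) (act_ob h Y) (act_ob h Y') (FMor (act h) Y Y' w) = FMor (act (g \<otimes>\<^bsub>G\<^esub> h)) Y Y' w"
    if o: "Y \<in> Ob \<C>" "Y' \<in> Ob \<C>" and w: "w \<in> Hom \<C> Y Y'" for Y Y' w
  proof -
    obtain D f where D: "below D Y" "below D Y'" "f \<in> lhom D Y Y'" and e: "w = cls Y Y' D f"
      by (rule rep1[OF w o])
    have gh': "g \<otimes>\<^bsub>G\<^esub> h \<in> carrier G" using gh by simp
    have "tr g (\<kappa> h D) (act_ob h Y) (act_ob h Y') (tr h D Y Y' f) = tr (g \<otimes>\<^bsub>G\<^esub> h) D Y Y' f"
      using D gh lev_ob[OF D(1)] lev_ob[OF D(2)] by (simp add: act_ob_below Q_mult_mor)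
    then show ?thesis
      using D gh o by (simp add: e FMor_act[OF gh(2)] FMor_act[OF gh']
          FMor_act[OF gh(1) act_ob_below(1) act_ob_below(1)] tr_hom act_ob_mult \<kappa>_mult)
  qed
  then show ?thesis
    unfolding comp_ftor_def colim_act_def[of _ _ _ _ _ "g \<otimes>\<^bsub>G\<^esub> h"]
    by (intro mk_ftor_cong) (simp_all add: FOb_act act_ob_in act_ob_mult gh FMor_mk_ftor colim_act_def[of _ _ _ _ _ "g \<otimes>\<^bsub>G\<^esub> h"])
qed

lemma act_ob_fix: "\<lbrakk>Y \<in> Ob \<C>; h \<in> fst Y\<rbrakk> \<Longrightarrow> act_ob h Y = Y"
  by (cases Y) (simp add: colim_act_ob_def Ob_iff \<kappa>_fix Q_fix_ob)

lemma act_mor_fix: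
  assumes D: "below D Y" "below D Y'" "f \<in> lhom D Y Y'" and h: "h \<in> D"
  shows "FMor (act h) Y Y' (cls Y Y' D f) = cls Y Y' D f"
proof -
  have h': "h \<in> carrier G" "act_ob h Y = Y" "act_ob h Y' = Y'"
    using D h by (auto intro: index_sub act_ob_fix)
  show ?thesis
    unfolding FMor_act[OF h'(1) D] using h' D h by (simp add: \<kappa>_fix Q_fix_mor lev_ob)
qed

lemma act_one: "act \<one>\<^bsub>G\<^esub> = id_ftor \<C>"
proof -
  have "FMor (act \<one>\<^bsub>G\<^esub>) Y Y' w = w" if o: "Y \<in> Ob \<C>" "Y' \<in> Ob \<C>" and w: "w \<in> Hom \<C> Y Y'" for Y Y' w
    by (rule rep1[OF w o]) (simp add: act_mor_fix one_mem)
  then show ?thesis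
    unfolding id_ftor_def colim_act_def[of _ _ _ _ _ "\<one>\<^bsub>G\<^esub>"]
    by (intro mk_ftor_cong)
      (simp_all add: act_ob_fix one_mem Ob_iff FMor_mk_ftor colim_act_def[of _ _ _ _ _ "\<one>\<^bsub>G\<^esub>"])
qed

lemma act_inverse:
  assumes h: "h \<in> carrier G" "h' \<in> carrier G" "h \<otimes>\<^bsub>G\<^esub> h' = \<one>\<^bsub>G\<^esub>"
  shows "X \<in> Ob \<C> \<Longrightarrow> FOb (act h) (FOb (act h') X) = X"
    and "\<lbrakk>X \<in> Ob \<C>; Y \<in> Ob \<C>; f \<in> Hom \<C> X Y\<rbrakk> \<Longrightarrow>
      FMor (act h) (FOb (act h') X) (FOb (act h') Y) (FMor (act h') X Y f) = f"
proof -
  have e: "comp_ftor \<C> (act h) (act h') = id_ftor \<C>"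
    using act_mult[OF h(1,2)] h(3) act_one by simp
  show "FOb (act h) (FOb (act h') X) = X" if "X \<in> Ob \<C>"
    using that arg_cong[OF e, of "\<lambda>F. FOb F X"] by (simp add: comp_ftor_def id_ftor_def FOb_mk_ftor)
  show "FMor (act h) (FOb (act h') X) (FOb (act h') Y) (FMor (act h') X Y f) = f"
    if "X \<in> Ob \<C>" "Y \<in> Ob \<C>" "f \<in> Hom \<C> X Y"
    using that arg_cong[OF e, of "\<lambda>F. FMor F X Y f"] by (simp add: comp_ftor_def id_ftor_def FMor_mk_ftor)
qed

lemma act_autoequivalence:
  assumes h: "h \<in> carrier G" shows "autoequivalence \<C> (act h)"
proof -
  have i: "inv\<^bsub>G\<^esub> h \<in> carrier G" using h by simp
  have id: "is_ftor \<C> \<C> (id_ftor \<C>)"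
    using linear_ftor_is_ftor[OF act_linear[OF G.one_closed]] by (simp add: act_one)
  have "comp_ftor \<C> (act (inv\<^bsub>G\<^esub> h)) (act h) = id_ftor \<C>" "comp_ftor \<C> (act h) (act (inv\<^bsub>G\<^esub> h)) = id_ftor \<C>"
    using h i by (simp_all add: act_mult act_one)
  then show ?thesis
    unfolding autoequivalence_def
    using colim.id_nat_iso[OF id] linear_ftor_is_ftor[OF act_linear[OF h]]
      linear_ftor_is_ftor[OF act_linear[OF i]] by metis
qed

text \<open>The functor is an isomorphism of categories, with inverse given by the inverse group element, and
  therefore preserves all kernels and cokernels.\<close>

lemma act_exact:
  assumes h: "h \<in> carrier G" shows "exact_ftor \<C> \<C> (act h)"
  unfolding exact_ftor_def short_exact_def
proof (intro ballI impI conjI; elim conjE)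
  fix X Y Z f g assume o: "X \<in> Ob \<C>" "Y \<in> Ob \<C>" "Z \<in> Ob \<C>" "f \<in> Hom \<C> X Y" "g \<in> Hom \<C> Y Z"
    and k: "is_kernel \<C> Y Z g X f" and c: "is_cokernel \<C> X Y f Z g"
  have i: "inv\<^bsub>G\<^esub> h \<in> carrier G" using h by simp
  have hi: "h \<otimes>\<^bsub>G\<^esub> inv\<^bsub>G\<^esub> h = \<one>\<^bsub>G\<^esub>" "inv\<^bsub>G\<^esub> h \<otimes>\<^bsub>G\<^esub> h = \<one>\<^bsub>G\<^esub>" using h by simp_all
  note inv = act_inverse[OF h i hi(1)] act_inverse[OF i h hi(2)]
  show "is_kernel \<C> (FOb (act h) Y) (FOb (act h) Z) (FMor (act h) Y Z g) (FOb (act h) X) (FMor (act h) X Y f)"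
    by (rule strict_iso_pres_kernel[OF colim.lin_cat_axioms act_linear[OF h] act_linear[OF i] inv(3,1,4,2) o(2,3,5) k])
  have op: "lin_cat R (op_cat \<C>)" by unfold_locales (rule linear_category_op[OF linear_colim])
  have "is_kernel (op_cat \<C>) (FOb (op_ftor (act h)) Y) (FOb (op_ftor (act h)) X)
      (FMor (op_ftor (act h)) Y X f) (FOb (op_ftor (act h)) Z) (FMor (op_ftor (act h)) Z Y g)"
    by (rule strict_iso_pres_kernel[OF op linear_ftor_op[OF act_linear[OF h]] linear_ftor_op[OF act_linear[OF i]]])
      (use inv o c in \<open>simp_all add: is_kernel_op\<close>)
  then show "is_cokernel \<C> (FOb (act h) X) (FOb (act h) Y) (FMor (act h) X Y f) (FOb (act h) Z) (FMor (act h) Y Z g)"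
    by (simp add: is_kernel_op)
qed

context
  fixes \<rho> :: "('g, 'g set \<times> 'o, ('g set \<times> 'm) set) two_rep"
  assumes \<rho>: "\<rho> = (let N = Aut_ex R \<C> in \<lparr>FOb = (\<lambda>h\<in>carrier G. act h),
      FMor = (\<lambda>h h' x. if h \<in> carrier G \<and> h = h' then Idm N (act h) else undefined),
      MMu = (\<lambda>h h'. Idm N (act (h \<otimes>\<^bsub>G\<^esub> h'))), MEps = Idm N (act \<one>\<^bsub>G\<^esub>)\<rparr>)"
begin

lemma act_strict_monoidal:
  assumes "\<And>h. h \<in> carrier G \<Longrightarrow> act h \<in> S" and N: "N = (Aut_lin R \<C>)\<lparr>Ob := S\<rparr>"
  shows "strict_monoidal_ftor (disc_2group G) N \<rho>"
proof (rule colim.strict_monoidal_of_strict_action[OF G.is_monoid _ assms(1) act_mult act_one N])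
  have Idm: "Idm N = Idm (Aut_ex R \<C>)" by (simp add: N Aut_ex_def)
  show "\<rho> = \<lparr>FOb = (\<lambda>h\<in>carrier G. act h),
      FMor = (\<lambda>h h' x. if h \<in> carrier G \<and> h = h' then Idm N (act h) else undefined),
      MMu = (\<lambda>h h'. Idm N (act (h \<otimes>\<^bsub>G\<^esub> h'))), MEps = Idm N (act \<one>\<^bsub>G\<^esub>)\<rparr>"
    unfolding \<rho> Let_def Idm ..
qed (simp_all add: linear_ftor_is_ftor[OF act_linear])

lemma act_strict_rep: "strict_two_representation G R \<C> \<rho>"
  unfolding strict_two_representation_def
  by (rule act_strict_monoidal[of "Ob (Aut_lin R \<C>)"])
    (simp_all add: Aut_lin_def act_linear act_autoequivalence)

lemma act_exact_rep: "exact_two_representation G R \<C> \<rho>"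
proof -
  have "strict_monoidal_ftor (disc_2group G) (Aut_ex R \<C>) \<rho>"
    by (rule act_strict_monoidal[OF _ Aut_ex_def])
      (simp add: Aut_lin_def act_linear act_autoequivalence act_exact)
  then show ?thesis
    using act_strict_rep unfolding exact_two_representation_def two_representation_def
      strict_two_representation_def strict_monoidal_ftor_def by blast
qed

lemma stabilizer_ob_eq: "Y \<in> Ob \<C> \<Longrightarrow> stabilizer_ob G \<rho> Y = {h \<in> carrier G. act_ob h Y = Y}"
  by (auto simp: stabilizer_ob_def \<rho> Let_def FOb_act)

lemma stabilizer_mor_eq: "\<lbrakk>Y \<in> Ob \<C>; Y' \<in> Ob \<C>\<rbrakk> \<Longrightarrow> stabilizer_mor G \<rho> Y Y' w =
    {h \<in> carrier G. act_ob h Y = Y \<and> act_ob h Y' = Y' \<and> FMor (act h) Y Y' w = w}"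
  by (auto simp: stabilizer_mor_def \<rho> Let_def FOb_act)

lemma stabilizer_ob_open:
  assumes Y: "Y \<in> Ob \<C>"
  shows "subgroup (stabilizer_ob G \<rho> Y) G" "\<exists>C\<in>I. C \<subseteq> stabilizer_ob G \<rho> Y"
proof -
  show "subgroup (stabilizer_ob G \<rho> Y) G"
    unfolding stabilizer_ob_eq[OF Y]
  proof (rule G.subgroupI)
    have "\<one>\<^bsub>G\<^esub> \<in> fst Y" using Y by (auto simp: Ob_iff one_mem)
    then show "{h \<in> carrier G. act_ob h Y = Y} \<noteq> {}" using act_ob_fix[OF Y] by blast
    show "inv\<^bsub>G\<^esub> h \<in> {h \<in> carrier G. act_ob h Y = Y}" if "h \<in> {h \<in> carrier G. act_ob h Y = Y}" for h
      using that act_ob_mult[of "inv\<^bsub>G\<^esub> h" h Y] Y act_ob_fix[OF Y \<open>\<one>\<^bsub>G\<^esub> \<in> fst Y\<close>] by simp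
    show "g \<otimes>\<^bsub>G\<^esub> h \<in> {h \<in> carrier G. act_ob h Y = Y}"
      if "g \<in> {h \<in> carrier G. act_ob h Y = Y}" "h \<in> {h \<in> carrier G. act_ob h Y = Y}" for g h
      using that act_ob_mult[of g h Y] Y by simp
  qed auto
  have "fst Y \<in> I" using Y by (simp add: Ob_iff)
  then show "\<exists>C\<in>I. C \<subseteq> stabilizer_ob G \<rho> Y"
    unfolding stabilizer_ob_eq[OF Y] using act_ob_fix[OF Y] index_sub by blast
qed

text \<open>A morphism represented at level \<open>D\<close> is fixed by all elements of \<open>D\<close>.\<close>

lemma stabilizer_mor_open:
  assumes Y: "Y \<in> Ob \<C>" "Y' \<in> Ob \<C>" and w: "w \<in> Hom \<C> Y Y'"
  shows "subgroup (stabilizer_mor G \<rho> Y Y' w) G" "\<exists>C\<in>I. C \<subseteq> stabilizer_mor G \<rho> Y Y' w"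
proof -
  let ?S = "{h \<in> carrier G. act_ob h Y = Y \<and> act_ob h Y' = Y' \<and> FMor (act h) Y Y' w = w}"
  obtain D f where D: "below D Y" "below D Y'" "f \<in> lhom D Y Y'" and e: "w = cls Y Y' D f"
    by (rule rep1[OF w Y])
  have "D \<subseteq> ?S"
    using act_mor_fix[OF D] act_ob_fix[OF Y(1)] act_ob_fix[OF Y(2)] D index_sub unfolding e by blast
  then show "\<exists>C\<in>I. C \<subseteq> stabilizer_mor G \<rho> Y Y' w"
    unfolding stabilizer_mor_eq[OF Y] using D by blast
  have mult: "FMor (act (g \<otimes>\<^bsub>G\<^esub> h)) Y Y' w = FMor (act g) (act_ob h Y) (act_ob h Y') (FMor (act h) Y Y' w)"
    if "g \<in> carrier G" "h \<in> carrier G" for g h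
    using arg_cong[OF act_mult[OF that], of "\<lambda>F. FMor F Y Y' w"] Y w
    by (simp add: comp_ftor_def FMor_mk_ftor FOb_act)
  have one: "\<one>\<^bsub>G\<^esub> \<in> ?S" using \<open>D \<subseteq> ?S\<close> D one_mem by blast
  show "subgroup (stabilizer_mor G \<rho> Y Y' w) G"
    unfolding stabilizer_mor_eq[OF Y]
  proof (rule G.subgroupI)
    show "?S \<noteq> {}" using one by blast
    show "inv\<^bsub>G\<^esub> h \<in> ?S" if h: "h \<in> ?S" for h
      using h one act_ob_mult[of "inv\<^bsub>G\<^esub> h" h, OF _ _ Y(1)]
        act_ob_mult[of "inv\<^bsub>G\<^esub> h" h, OF _ _ Y(2)] mult[of "inv\<^bsub>G\<^esub> h" h] by simp
    show "g \<otimes>\<^bsub>G\<^esub> h \<in> ?S" if gh: "g \<in> ?S" "h \<in> ?S" for g h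
      using gh act_ob_mult[of g h, OF _ _ Y(1)] act_ob_mult[of g h, OF _ _ Y(2)] mult[of g h] by simp
  qed auto
qed

end

end

section \<open>The doubled group and its congruence subgroups\<close>

lemma GL_simps [simp]: "carrier GL = {A. invertible A}" "A \<otimes>\<^bsub>GL\<^esub> B = A ** B" "\<one>\<^bsub>GL\<^esub> = mat 1"
  by (simp_all add: GL_def)

lemma invertible_mat_1: "invertible (mat 1 :: 'a::field ^ 'n ^ 'n)"
  unfolding invertible_def by (intro exI[of _ "mat 1"]) simp

lemma GL_group: "group (GL :: ('a::field ^ 'n ^ 'n) monoid)"
proof (rule groupI)
  fix A :: "'a ^ 'n ^ 'n" assume "A \<in> carrier GL"
  then obtain B where "A ** B = mat 1" "B ** A = mat 1" by (auto simp: invertible_def)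
  then show "\<exists>B\<in>carrier GL. B \<otimes>\<^bsub>GL\<^esub> A = \<one>\<^bsub>GL\<^esub>"
    by (intro bexI[of _ B]) (auto simp: invertible_def)
qed (auto simp: invertible_mult matrix_mul_assoc invertible_mat_1)

lemma GH_group: "group (GH :: ('k::field, 'n::finite) dbl monoid)"
  unfolding GH_def by (intro DirProd_group GL_group)

text \<open>\<open>vt_ge d x\<close> says \<open>v\<^sub>t(x) \<ge> d\<close>, where \<open>v\<^sub>t(0) = \<infinity>\<close>.\<close>

definition vt_ge :: "int \<Rightarrow> 'a::field fls \<Rightarrow> bool" where
  "vt_ge d x \<longleftrightarrow> (\<forall>n<d. fls_nth x n = 0)"

lemma vt_ge_iff: "vt_ge d x \<longleftrightarrow> x = 0 \<or> d \<le> fls_subdegree x"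
  unfolding vt_ge_def using fls_subdegree_geI[of x d] fls_eq0_below_subdegree[of _ x] by fastforce

lemma vt_ge_0 [simp]: "vt_ge d 0"
  and vt_ge_1: "vt_ge 0 1"
  and vt_ge_add: "\<lbrakk>vt_ge d x; vt_ge d y\<rbrakk> \<Longrightarrow> vt_ge d (x + y)"
  and vt_ge_diff: "\<lbrakk>vt_ge d x; vt_ge d y\<rbrakk> \<Longrightarrow> vt_ge d (x - y)"
  and vt_ge_mono: "\<lbrakk>vt_ge e x; d \<le> e\<rbrakk> \<Longrightarrow> vt_ge d x"
  by (auto simp: vt_ge_def)

lemma vt_ge_mult: "\<lbrakk>vt_ge d x; vt_ge e y\<rbrakk> \<Longrightarrow> vt_ge (d + e) (x * y)"
  by (cases "x = 0 \<or> y = 0") (auto simp: vt_ge_iff fls_subdegree_mult)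

lemma vt_ge_sum: "(\<And>i. i \<in> S \<Longrightarrow> vt_ge d (f i)) \<Longrightarrow> vt_ge d (sum f S)"
  by (induction S rule: infinite_finite_induct) (auto simp: vt_ge_add)

lemma O2_iff: "x \<in> O2 \<longleftrightarrow> vt_ge 0 x \<and> vt_ge 0 (fls_nth x 0)"
proof
  assume "x \<in> O2"
  then obtain a g where x: "x = fls_const (fps_to_fls a) + unif_t * fps_to_fls g"
    by (auto simp: O2_def)
  have "fls_nth x n = 0" if "n < 0" for n using that by (simp add: x unif_t_def fls_X_times_conv_shift)
  moreover have "fls_nth x 0 = fps_to_fls a" by (simp add: x unif_t_def fls_X_times_conv_shift)
  ultimately show "vt_ge 0 x \<and> vt_ge 0 (fls_nth x 0)" by (simp add: vt_ge_def)
next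
  assume x: "vt_ge 0 x \<and> vt_ge 0 (fls_nth x 0)"
  let ?a = "fls_regpart (fls_nth x 0)" and ?g = "fls_regpart (fls_shift 1 x)"
  have "fps_to_fls ?a = fls_nth x 0" using x by (auto simp: vt_ge_iff)
  then have "x = fls_const (fps_to_fls ?a) + unif_t * fps_to_fls ?g"
    using x by (intro fls_eqI) (auto simp: unif_t_def fls_X_times_conv_shift vt_ge_def)
  then show "x \<in> O2" unfolding O2_def by blast
qed

lemma O2_vt_ge: "x \<in> O2 \<Longrightarrow> vt_ge 0 x"
  and vt_ge_1_O2: "vt_ge 1 x \<Longrightarrow> x \<in> O2"
  by (auto simp: O2_iff vt_ge_def)

lemma fls_nth_0_mult: "\<lbrakk>vt_ge 0 x; vt_ge 0 y\<rbrakk> \<Longrightarrow> fls_nth (x * y) 0 = fls_nth x 0 * fls_nth y 0"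
proof -
  assume "vt_ge 0 x" "vt_ge 0 y"
  then have "x = fps_to_fls (fls_regpart x)" "y = fps_to_fls (fls_regpart y)"
    by (auto simp: vt_ge_iff)
  then have "x * y = fps_to_fls (fls_regpart x * fls_regpart y)"
    by (metis fls_times_fps_to_fls)
  then show ?thesis by simp
qed

lemma O2_0: "0 \<in> O2" and O2_1: "1 \<in> O2"
  and O2_add: "\<lbrakk>x \<in> O2; y \<in> O2\<rbrakk> \<Longrightarrow> x + y \<in> O2"
  and O2_diff: "\<lbrakk>x \<in> O2; y \<in> O2\<rbrakk> \<Longrightarrow> x - y \<in> O2"
  by (auto simp: O2_iff vt_ge_add vt_ge_diff vt_ge_1)

lemma O2_mult: "\<lbrakk>x \<in> O2; y \<in> O2\<rbrakk> \<Longrightarrow> x * y \<in> O2"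
  using vt_ge_mult[of 0 x 0 y] vt_ge_mult[of 0 "fls_nth x 0" 0 "fls_nth y 0"]
  by (simp add: O2_iff fls_nth_0_mult)

lemma O2_sum: "(\<And>i. i \<in> S \<Longrightarrow> f i \<in> O2) \<Longrightarrow> sum f S \<in> O2"
  by (induction S rule: infinite_finite_induct) (auto simp: O2_add O2_0)

lemma O2_power: "x \<in> O2 \<Longrightarrow> x ^ n \<in> O2"
  by (induction n) (auto simp: O2_1 O2_mult)

lemma unif_O2: "unif_u \<in> O2" "unif_t \<in> O2"
  by (auto simp: O2_iff unif_u_def unif_t_def vt_ge_def)

lemma vt_ge_unif: "1 \<le> j \<Longrightarrow> vt_ge 1 (unif_u ^ i * unif_t ^ j)"
  by (auto simp: vt_ge_iff unif_u_def unif_t_def fls_subdegree_pow)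

lemma matrix_mult_add_rdistrib: "(A + B) ** C = A ** C + B ** (C :: 'a::semiring_1 ^ 'n ^ 'm)"
  by (simp add: vec_eq_iff matrix_matrix_mult_def distrib_right sum.distrib)

definition vt_ge_mat :: "int \<Rightarrow> 'a::field fls ^ 'n ^ 'm \<Rightarrow> bool" where
  "vt_ge_mat d X \<longleftrightarrow> (\<forall>r s. vt_ge d (X $ r $ s))"

text \<open>If \<open>X\<close> is divisible by \<open>t\<close>, every solution of \<open>v = b - X v\<close> is as divisible by \<open>t\<close> as \<open>b\<close>:
  any weaker bound valid for \<open>v\<close> improves by one, because \<open>X v\<close> satisfies the improved bound.\<close>

lemma vt_ge_fixpoint:
  fixes X :: "'a::field fls ^ 'n ^ 'n"
  assumes X: "vt_ge_mat 1 X" and v: "v = b - X *v v" and b: "\<And>r. vt_ge N (b $ r)"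
  shows "vt_ge N (v $ r)"
proof -
  have step: "\<forall>r. vt_ge (d + 1) (v $ r)" if d: "\<forall>r. vt_ge d (v $ r)" and le: "d + 1 \<le> N" for d
  proof
    fix r
    have e: "v $ r = b $ r - (\<Sum>s\<in>UNIV. X $ r $ s * v $ s)"
      using arg_cong[OF v, of "\<lambda>w. w $ r"] by (simp add: matrix_vector_mult_def)
    have "vt_ge (d + 1) (X $ r $ s * v $ s)" for s
      using vt_ge_mult[of 1 "X $ r $ s" d "v $ s"] X d by (simp add: vt_ge_mat_def add.commute)
    then have "vt_ge (d + 1) (b $ r - (\<Sum>s\<in>UNIV. X $ r $ s * v $ s))"
      by (intro vt_ge_diff vt_ge_sum vt_ge_mono[OF b le])
    then show "vt_ge (d + 1) (v $ r)" by (simp only: e[symmetric])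
  qed
  define d0 where "d0 = min N (Min (range (\<lambda>r. fls_subdegree (v $ r))))"
  have "vt_ge d0 (v $ r)" for r
    unfolding d0_def vt_ge_iff by (rule disjI2) (simp add: min.coboundedI2)
  then have "\<forall>r. vt_ge (d0 + int n) (v $ r)" if "d0 + int n \<le> N" for n
    using that step[of "d0 + int m" for m] by (induction n) (auto simp: algebra_simps)
  from this[of "nat (N - d0)"] show ?thesis by (simp add: d0_def)
qed

text \<open>The kernel of \<open>1 + X\<close> consists of vectors divisible by every
  power of \<open>t\<close>, and the columns of the inverse solve \<open>v = e - X v\<close>.\<close>

lemma one_plus_t_invertible:
  fixes X :: "'a::field fls ^ 'n ^ 'n"
  assumes X: "vt_ge_mat 1 X"
  obtains B where "(mat 1 + X) ** B = mat 1" "B ** (mat 1 + X) = mat 1" "B = mat 1 - X ** B" "vt_ge_mat 0 B"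
proof -
  have "v = 0" if "(mat 1 + X) *v v = 0" for v
  proof -
    have "v + X *v v = 0" using that by (simp add: matrix_vector_mult_add_rdistrib)
    then have v: "v = 0 - X *v v" by (rule eq_diff_eq[THEN iffD2])
    have "vt_ge N (v $ r)" for N r by (rule vt_ge_fixpoint[OF X v]) simp
    then have "fls_nth (v $ r) n = 0" for r n unfolding vt_ge_def by (metis less_add_one)
    then show "v = 0" by (simp add: vec_eq_iff fls_eq_iff)
  qed
  then obtain B where B: "B ** (mat 1 + X) = mat 1" using matrix_left_invertible_ker by blast
  then have B': "(mat 1 + X) ** B = mat 1" by (simp add: matrix_left_right_inverse)
  then have eq: "B = mat 1 - X ** B" unfolding matrix_mult_add_rdistrib matrix_mul_lid by (rule eq_diff_eq[THEN iffD2])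
  have "vt_ge 0 (B $ r $ s)" for r s
  proof -
    have "B $ r $ s = mat 1 $ r $ s - (\<Sum>k\<in>UNIV. X $ r $ k * B $ k $ s)" for r
      using arg_cong[OF eq, of "\<lambda>B. B $ r $ s"]
      unfolding vector_minus_component matrix_matrix_mult_def vec_lambda_beta .
    then have col: "(\<chi> r. B $ r $ s) = (\<chi> r. mat 1 $ r $ s) - X *v (\<chi> r. B $ r $ s)"
      unfolding vec_eq_iff matrix_vector_mult_def vector_minus_component vec_lambda_beta by blast
    show ?thesis using vt_ge_fixpoint[OF X col, of 0 r] by (simp add: mat_def vt_ge_1)
  qed
  then show thesis using that B B' eq by (simp add: vt_ge_mat_def)
qed

lemma congr_K_eq: "congr_K i j =
    {mat 1 + (\<chi> r s. unif_u ^ i * unif_t ^ j * M $ r $ s) | M. \<forall>r s. M $ r $ s \<in> O2}"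
  by (simp add: congr_K_def map_matrix_def)

text \<open>For \<open>X = u\<^sup>i t\<^sup>j M\<close> the inverse \<open>B\<close> of \<open>1 + X\<close> satisfies \<open>B = 1 - X B = 1 - u\<^sup>i t\<^sup>j (M B)\<close>. It is congruent
  to \<open>1\<close> modulo \<open>t\<close>, so \<open>B\<close>, and with it \<open>M B\<close>, has entries in \<open>O2\<close>.\<close>

lemma congr_K_subgroup:
  assumes j: "1 \<le> j"
  shows "subgroup (congr_K i j :: ('k::field fls fls ^ 'n ^ 'n) set) GL"
proof -
  let ?c = "unif_u ^ i * unif_t ^ j :: 'k fls fls"
  let ?O = "{M :: 'k fls fls ^ 'n ^ 'n. \<forall>r s. M $ r $ s \<in> O2}"
  define S where "S M = (\<chi> r s. ?c * M $ r $ s)" for M :: "'k fls fls ^ 'n ^ 'n"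
  have K: "congr_K i j = {mat 1 + S M | M. M \<in> ?O}" by (simp add: congr_K_eq S_def)
  have c: "?c \<in> O2" by (intro O2_mult O2_power unif_O2)
  have SO: "S M \<in> ?O" if "M \<in> ?O" for M using that c by (simp add: S_def O2_mult)
  have mO: "M ** M' \<in> ?O" if "M \<in> ?O" "M' \<in> ?O" for M M'
    using that by (auto simp: matrix_matrix_mult_def intro!: O2_sum O2_mult)
  have S_mult: "S M ** B = S (M ** B)" for M B
    by (simp add: S_def matrix_matrix_mult_def vec_eq_iff sum_distrib_left mult.assoc)
  have S_add: "S M + S M' = S (M + M')" and S_neg: "- S M = S (- M)" for M M'
    by (simp_all add: S_def vec_eq_iff distrib_left)
  have vS: "vt_ge_mat 1 (S M)" if "M \<in> ?O" for M
    using vt_ge_mult[OF vt_ge_unif[OF j] O2_vt_ge] that by (auto simp: S_def vt_ge_mat_def)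
  have inverse: "\<exists>B\<in>congr_K i j. A ** B = mat 1 \<and> B ** A = mat 1" if "A \<in> congr_K i j"
    for A :: "'k fls fls ^ 'n ^ 'n"
  proof -
    obtain M where M: "M \<in> ?O" "A = mat 1 + S M" using \<open>A \<in> congr_K i j\<close> unfolding K by blast
    obtain B where B: "A ** B = mat 1" "B ** A = mat 1" "B = mat 1 - S M ** B" "vt_ge_mat 0 B"
      by (rule one_plus_t_invertible[OF vS[OF M(1)]]) (simp add: M(2))
    have "vt_ge 1 ((S M ** B) $ r $ s)" for r s
      using vS[OF M(1)] B(4)
      by (auto simp: matrix_matrix_mult_def vt_ge_mat_def
          intro!: vt_ge_sum vt_ge_mult[of 1 _ 0, simplified])
    moreover have "mat 1 $ r $ s \<in> O2" for r s :: 'n by (simp add: mat_def O2_0 O2_1)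
    ultimately have "mat 1 $ r $ s - (S M ** B) $ r $ s \<in> O2" for r s
      by (metis O2_diff vt_ge_1_O2)
    then have "(mat 1 - S M ** B) $ r $ s \<in> O2" for r s by (simp only: vector_minus_component)
    then have "B $ r $ s \<in> O2" for r s using B(3) by metis
    then have "- (M ** B) \<in> ?O" using mO[OF M(1), of B] O2_diff[OF O2_0] by fastforce
    moreover have "B = mat 1 + S (- (M ** B))"
      using B(3) by (simp add: S_mult S_neg[symmetric])
    ultimately show ?thesis using B(1,2) unfolding K by blast
  qed
  show ?thesis
  proof (rule group.subgroupI[OF GL_group])
    show "congr_K i j \<subseteq> carrier (GL :: ('k fls fls ^ 'n ^ 'n) monoid)"
      using inverse by (auto simp: invertible_def)
    have "0 \<in> ?O" using O2_0 by simp
    then have "mat 1 + S 0 \<in> congr_K i j" unfolding K by blast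
    then show "congr_K i j \<noteq> ({} :: ('k fls fls ^ 'n ^ 'n) set)" by blast
    show "inv\<^bsub>GL\<^esub> A \<in> congr_K i j" if A: "A \<in> congr_K i j" for A :: "'k fls fls ^ 'n ^ 'n"
    proof -
      obtain B where B: "B \<in> congr_K i j" "A ** B = mat 1" "B ** A = mat 1" using inverse[OF A] by blast
      then have "inv\<^bsub>GL\<^esub> A = B"
        by (intro group.inv_equality[OF GL_group]) (auto simp: invertible_def)
      then show ?thesis using B by simp
    qed
    show "A \<otimes>\<^bsub>GL\<^esub> A' \<in> congr_K i j" if A: "A \<in> congr_K i j" "A' \<in> congr_K i j"
      for A A' :: "'k fls fls ^ 'n ^ 'n"
    proof -
      obtain M M' where M: "M \<in> ?O" "A = mat 1 + S M" "M' \<in> ?O" "A' = mat 1 + S M'"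
        using A by (auto simp: K)
      have "A ** A' = mat 1 + S (M + (M' + M ** S M'))"
        by (simp add: M matrix_add_ldistrib matrix_mult_add_rdistrib S_mult S_add[symmetric] add_ac)
      moreover have "M + (M' + M ** S M') \<in> ?O"
        using M mO[OF M(1) SO[OF M(3)]] by (simp add: O2_add)
      ultimately show ?thesis unfolding K by auto
    qed
  qed
qed

lemma C_dbl_subgroup: "1 \<le> j \<Longrightarrow> subgroup (C_dbl i j) GH"
  unfolding C_dbl_def GH_def by (intro DirProd_subgroups GL_group congr_K_subgroup)

subsection \<open>Conjugates, cosets and the basic subgroups\<close>

interpretation GH: group "GH :: ('k::field, 'n::finite) dbl monoid" by (rule GH_group)

lemma conj_set_eq: "conj_set h C = (\<lambda>x. h \<otimes>\<^bsub>GH\<^esub> x \<otimes>\<^bsub>GH\<^esub> inv\<^bsub>GH\<^esub> h) ` C"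
  by (auto simp: conj_set_def l_coset_def r_coset_def)

lemma conj_set_subgroup:
  assumes h: "h \<in> carrier GH" and C: "subgroup C GH"
  shows "subgroup (conj_set h C) GH"
proof -
  have "(\<lambda>x. h \<otimes>\<^bsub>GH\<^esub> x \<otimes>\<^bsub>GH\<^esub> inv\<^bsub>GH\<^esub> h) \<in> hom GH GH"
    using h by (intro homI) (simp_all add: GH.m_assoc[symmetric], simp add: GH.m_assoc)
  then interpret group_hom GH GH "\<lambda>x. h \<otimes>\<^bsub>GH\<^esub> x \<otimes>\<^bsub>GH\<^esub> inv\<^bsub>GH\<^esub> h"
    by (intro group_hom.intro GH_group group_hom_axioms.intro)
  show ?thesis unfolding conj_set_eq by (rule subgroup_img_is_subgroup[OF C])
qed

lemma conj_set_mult: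
  assumes "g \<in> carrier GH" "h \<in> carrier GH" "C \<subseteq> carrier GH"
  shows "conj_set (g \<otimes>\<^bsub>GH\<^esub> h) C = conj_set g (conj_set h C)"
  unfolding conj_set_eq image_image
  using assms by (intro image_cong) (auto simp: GH.m_assoc GH.inv_mult_group)

lemma conj_set_fix:
  assumes C: "subgroup C GH" and h: "h \<in> C" shows "conj_set h C = C"
proof
  have s: "C \<subseteq> carrier GH" by (rule subgroup.subset[OF C])
  show "conj_set h C \<subseteq> C"
    unfolding conj_set_eq using C h by (auto simp: subgroup.m_closed subgroup.m_inv_closed)
  show "C \<subseteq> conj_set h C"
  proof
    fix x assume x: "x \<in> C"
    have "x = h \<otimes>\<^bsub>GH\<^esub> (inv\<^bsub>GH\<^esub> h \<otimes>\<^bsub>GH\<^esub> x \<otimes>\<^bsub>GH\<^esub> h) \<otimes>\<^bsub>GH\<^esub> inv\<^bsub>GH\<^esub> h"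
      using x h s by (simp add: GH.m_assoc subsetD) (simp add: GH.m_assoc[symmetric] subsetD)
    then show "x \<in> conj_set h C"
      unfolding conj_set_eq using x h C by (auto simp: subgroup.m_closed subgroup.m_inv_closed)
  qed
qed

text \<open>Conjugation is injective on the group, hence commutes with intersections.\<close>

lemma conj_set_Inter:
  assumes h: "h \<in> carrier GH" and K: "\<K> \<noteq> {}" "\<And>C. C \<in> \<K> \<Longrightarrow> C \<subseteq> carrier GH"
  shows "conj_set h (\<Inter>\<K>) = \<Inter>(conj_set h ` \<K>)"
proof -
  have "inj_on (\<lambda>x. h \<otimes>\<^bsub>GH\<^esub> x \<otimes>\<^bsub>GH\<^esub> inv\<^bsub>GH\<^esub> h) (carrier GH)"
    using h by (auto simp: inj_on_def)
  from image_INT[OF this, of \<K> id] K show ?thesis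
    unfolding conj_set_eq by auto
qed

abbreviation CH_gens :: "('k::field, 'n::finite) dbl set set" where
  "CH_gens \<equiv> {conj_set h (C_dbl i j) | h i j. h \<in> carrier GH \<and> 1 \<le> i \<and> 1 \<le> j}"

lemma CH_gens_subgroup: assumes "C \<in> CH_gens" shows "subgroup C GH"
proof -
  obtain h i j where "C = conj_set h (C_dbl i j)" "h \<in> carrier GH" "1 \<le> j" using assms by blast
  then show ?thesis by (simp add: conj_set_subgroup C_dbl_subgroup)
qed

lemma CH_subgroup: assumes "C \<in> CH" shows "subgroup C GH"
proof -
  obtain \<K> where K: "C = \<Inter>\<K>" "\<K> \<noteq> {}" "\<K> \<subseteq> CH_gens" using assms by (auto simp: CH_def)
  show ?thesis unfolding K(1) using K(2,3) CH_gens_subgroup by (intro GH.subgroups_Inter) blast+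
qed

lemma CH_nonempty: "CH \<noteq> {}"
proof -
  have "conj_set \<one>\<^bsub>GH\<^esub> (C_dbl 1 1) \<in> CH_gens" using GH.one_closed by blast
  then have "\<Inter>{conj_set \<one>\<^bsub>GH\<^esub> (C_dbl 1 1)} \<in> CH"
    unfolding CH_def by (intro CollectI exI[of _ "{conj_set \<one>\<^bsub>GH\<^esub> (C_dbl 1 1)}"]) auto
  then show ?thesis by blast
qed

lemma CH_inter: assumes "C \<in> CH" "D \<in> CH" shows "C \<inter> D \<in> CH"
proof -
  obtain \<K> \<L> where "C = \<Inter>\<K>" "finite \<K>" "\<K> \<noteq> {}" "\<K> \<subseteq> CH_gens"
    "D = \<Inter>\<L>" "finite \<L>" "\<L> \<noteq> {}" "\<L> \<subseteq> CH_gens" using assms by (auto simp: CH_def)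
  then show ?thesis unfolding CH_def by (intro CollectI exI[of _ "\<K> \<union> \<L>"]) auto
qed

lemma CH_conj: assumes h: "h \<in> carrier GH" and C: "C \<in> CH" shows "conj_set h C \<in> CH"
proof -
  obtain \<K> where K: "C = \<Inter>\<K>" "finite \<K>" "\<K> \<noteq> {}" "\<K> \<subseteq> CH_gens" using C by (auto simp: CH_def)
  have s: "D \<subseteq> carrier GH" if "D \<in> \<K>" for D
    using subgroup.subset[OF CH_gens_subgroup] K(4) that by blast
  have "conj_set h D \<in> CH_gens" if "D \<in> \<K>" for D
  proof -
    obtain g i j where D: "D = conj_set g (C_dbl i j)" "g \<in> carrier GH" "1 \<le> i" "1 \<le> j"
      using K(4) \<open>D \<in> \<K>\<close> by blast
    have "conj_set h D = conj_set (h \<otimes>\<^bsub>GH\<^esub> g) (C_dbl i j)"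
      using conj_set_mult[OF h D(2) subgroup.subset[OF C_dbl_subgroup[OF D(4)]]] by (simp add: D(1))
    then show ?thesis using D h by blast
  qed
  then have "conj_set h ` \<K> \<subseteq> CH_gens" by (rule image_subsetI)
  moreover have "conj_set h C = \<Inter>(conj_set h ` \<K>)"
    unfolding K(1) using K(3) s by (rule conj_set_Inter[OF h])
  ultimately show ?thesis
    unfolding CH_def using K(2,3) by (intro CollectI exI[of _ "conj_set h ` \<K>"]) simp
qed

lemma SC_E:
  assumes "s \<in> SC C" obtains g where "g \<in> carrier GH" "s = g <#\<^bsub>GH\<^esub> C"
  using assms by (auto simp: SC_def)

lemma SC_I: "g \<in> carrier GH \<Longrightarrow> g <#\<^bsub>GH\<^esub> C \<in> SC C"
  unfolding SC_def by blast

lemma SC_sub: "\<lbrakk>s \<in> SC C; C \<subseteq> carrier GH\<rbrakk> \<Longrightarrow> s \<subseteq> carrier GH"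
  by (erule SC_E) (simp add: GH.l_coset_subset_G)

lemma lcos_mult:
  "\<lbrakk>g \<in> carrier GH; subgroup C GH; subgroup D GH; D \<subseteq> C\<rbrakk> \<Longrightarrow> (g <#\<^bsub>GH\<^esub> D) <#>\<^bsub>GH\<^esub> C = g <#\<^bsub>GH\<^esub> C"
proof -
  assume g: "g \<in> carrier GH" and C: "subgroup C GH" and D: "subgroup D GH" "D \<subseteq> C"
  have "D <#>\<^bsub>GH\<^esub> C = C"
  proof
    show "D <#>\<^bsub>GH\<^esub> C \<subseteq> C" using C D by (auto simp: set_mult_def subgroup.m_closed)
    show "C \<subseteq> D <#>\<^bsub>GH\<^esub> C"
      using subgroup.one_closed[OF D(1)] subgroup.subset[OF C] by (force simp: set_mult_def)
  qed
  then show ?thesis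
    using GH.setmult_lcos_assoc[OF subgroup.subset[OF D(1)] subgroup.subset[OF C] g] by simp
qed

lemma SC_left:
  assumes "C \<subseteq> carrier GH" "s \<in> SC C" "b \<in> carrier GH" shows "b <#\<^bsub>GH\<^esub> s \<in> SC C"
  using assms(2) by (rule SC_E) (simp add: GH.lcos_m_assoc assms SC_I)

lemma proj_SC:
  assumes "subgroup C GH" "subgroup D GH" "D \<subseteq> C" "s \<in> SC D"
  shows "s <#>\<^bsub>GH\<^esub> C \<in> SC C"
  using assms(4) by (rule SC_E) (simp add: lcos_mult assms SC_I)

lemma proj_left:
  assumes "subgroup C GH" "subgroup D GH" "D \<subseteq> C" "s \<in> SC D" "b \<in> carrier GH"
  shows "b <#\<^bsub>GH\<^esub> (s <#>\<^bsub>GH\<^esub> C) = (b <#\<^bsub>GH\<^esub> s) <#>\<^bsub>GH\<^esub> C"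
  using assms SC_sub[OF assms(4)] by (simp add: GH.setmult_lcos_assoc subgroup.subset)

lemma proj_self: "\<lbrakk>subgroup C GH; s \<in> SC C\<rbrakk> \<Longrightarrow> s <#>\<^bsub>GH\<^esub> C = s"
  by (erule SC_E) (simp add: lcos_mult)

lemma proj_proj:
  assumes "subgroup C GH" "subgroup D GH" "subgroup E GH" "E \<subseteq> D" "D \<subseteq> C" "s \<in> SC E"
  shows "(s <#>\<^bsub>GH\<^esub> D) <#>\<^bsub>GH\<^esub> C = s <#>\<^bsub>GH\<^esub> C"
proof -
  have "E \<subseteq> C" using assms by blast
  show ?thesis using assms(6) by (rule SC_E) (simp add: lcos_mult assms \<open>E \<subseteq> C\<close>)
qed

lemma lcos_conj_right:
  assumes "g \<in> carrier GH" "h \<in> carrier GH" "C \<subseteq> carrier GH"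
  shows "(g <#\<^bsub>GH\<^esub> conj_set h C) #>\<^bsub>GH\<^esub> h = (g \<otimes>\<^bsub>GH\<^esub> h) <#\<^bsub>GH\<^esub> C"
proof -
  have "g \<otimes>\<^bsub>GH\<^esub> (h \<otimes>\<^bsub>GH\<^esub> x \<otimes>\<^bsub>GH\<^esub> inv\<^bsub>GH\<^esub> h) \<otimes>\<^bsub>GH\<^esub> h = g \<otimes>\<^bsub>GH\<^esub> h \<otimes>\<^bsub>GH\<^esub> x" if "x \<in> C" for x
    using assms that by (simp add: GH.m_assoc subsetD)
  then show ?thesis
    unfolding conj_set_eq l_coset_def r_coset_def by (auto 0 3)
qed

lemma right_SC:
  assumes "h \<in> carrier GH" "C \<subseteq> carrier GH" "s \<in> SC (conj_set h C)" shows "s #>\<^bsub>GH\<^esub> h \<in> SC C"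
  using assms(3) by (rule SC_E) (simp add: lcos_conj_right assms SC_I)

lemma right_left:
  assumes "h \<in> carrier GH" "b \<in> carrier GH" "s \<subseteq> carrier GH"
  shows "b <#\<^bsub>GH\<^esub> (s #>\<^bsub>GH\<^esub> h) = (b <#\<^bsub>GH\<^esub> s) #>\<^bsub>GH\<^esub> h"
  using assms by (simp add: GH.rcos_assoc_lcos GH.coset_assoc)

lemma right_right:
  assumes "g \<in> carrier GH" "h \<in> carrier GH" "s \<subseteq> carrier GH"
  shows "(s #>\<^bsub>GH\<^esub> g) #>\<^bsub>GH\<^esub> h = s #>\<^bsub>GH\<^esub> (g \<otimes>\<^bsub>GH\<^esub> h)"
  using assms by (simp add: GH.coset_mult_assoc)

lemma right_fix:
  assumes "subgroup C GH" "h \<in> C" "s \<in> SC C" shows "s #>\<^bsub>GH\<^esub> h = s"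
proof -
  obtain g where g: "g \<in> carrier GH" "s = g <#\<^bsub>GH\<^esub> C" using assms(3) by (rule SC_E)
  have h: "h \<in> carrier GH" using subgroup.subset[OF assms(1)] assms(2) by blast
  have "C #>\<^bsub>GH\<^esub> h = C" using h assms by (simp add: GH.coset_join2)
  then show ?thesis
    using GH.coset_assoc[OF g(1) h subgroup.subset[OF assms(1)]] by (simp add: g)
qed

lemma right_proj:
  assumes "h \<in> carrier GH" "subgroup C GH" "subgroup D GH" "D \<subseteq> C" "s \<in> SC (conj_set h D)"
  shows "(s <#>\<^bsub>GH\<^esub> conj_set h C) #>\<^bsub>GH\<^esub> h = (s #>\<^bsub>GH\<^esub> h) <#>\<^bsub>GH\<^esub> C"
proof -
  obtain g where g: "g \<in> carrier GH" "s = g <#\<^bsub>GH\<^esub> conj_set h D" using assms(5) by (rule SC_E)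
  have "conj_set h D \<subseteq> conj_set h C" using assms(4) by (auto simp: conj_set_eq)
  then show ?thesis
    using g assms by (simp add: lcos_mult conj_set_subgroup lcos_conj_right subgroup.subset)
qed

lemma borel_mult:
  assumes "A \<in> borel" "B \<in> borel" shows "A ** B \<in> borel"
proof -
  have "A $ i $ k * B $ k $ j = 0" if "j < i" for i j k
    using that assms by (cases "k < i") (auto simp: borel_def)
  then have "(A ** B) $ i $ j = 0" if "j < i" for i j
  proof -
    have "(\<Sum>k\<in>UNIV. A $ i $ k * B $ k $ j) = 0"
      by (rule sum.neutral) (use \<open>\<And>j i k. j < i \<Longrightarrow> A $ i $ k * B $ k $ j = 0\<close> that in blast)
    then show ?thesis by (simp add: matrix_matrix_mult_def)
  qed
  moreover have "invertible (A ** B)" using assms by (simp add: borel_def invertible_mult)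
  ultimately show ?thesis by (simp add: borel_def)
qed

lemma BH_sub: "BH \<subseteq> carrier GH"
  and BH_one: "\<one>\<^bsub>GH\<^esub> \<in> BH"
  and BH_mult: "\<lbrakk>b \<in> BH; b' \<in> BH\<rbrakk> \<Longrightarrow> b \<otimes>\<^bsub>GH\<^esub> b' \<in> BH"
proof -
  have one: "mat 1 \<in> borel" using invertible_mat_1 by (simp add: borel_def mat_def)
  show "BH \<subseteq> carrier GH" by (auto simp: BH_def GH_def borel_def)
  show "\<one>\<^bsub>GH\<^esub> \<in> BH" using one by (simp add: BH_def GH_def)
  show "b \<otimes>\<^bsub>GH\<^esub> b' \<in> BH" if "b \<in> BH" "b' \<in> BH"
    using that by (auto simp: BH_def GH_def borel_mult)
qed

section \<open>Small vector spaces\<close>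

lemma Lam_simps [simp]: "carrier Lam = UNIV" "mult Lam = (*)" "one Lam = 1" "zero Lam = 0" "add Lam = (+)"
  by (simp_all add: Lam_def)

lemma Lam_cring: "cring Lam"
proof (rule cringI)
  show "abelian_group Lam"
    by (rule abelian_groupI) (auto simp: algebra_simps intro: exI[of _ "- x" for x])
  show "comm_monoid Lam" by unfold_locales (auto simp: mult_ac)
qed (simp add: distrib_right)

lemma Lam_minus_one [simp]: "\<ominus>\<^bsub>Lam\<^esub> 1 = - 1"
proof -
  interpret cring Lam by (rule Lam_cring)
  show ?thesis by (rule minus_equality) simp_all
qed

text \<open>Linearity without the condition, part of \<^const>\<open>lin_maps\<close>, that the map be undefined outside the
  carrier; composites and restrictions are simpler to handle in this form.\<close>

definition lin :: "(lam, 'a) module \<Rightarrow> (lam, 'b) module \<Rightarrow> ('a \<Rightarrow> 'b) \<Rightarrow> bool" where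
  "lin M N f \<longleftrightarrow> (\<forall>x\<in>carrier M. f x \<in> carrier N) \<and>
     (\<forall>x\<in>carrier M. \<forall>y\<in>carrier M. f (x \<oplus>\<^bsub>M\<^esub> y) = f x \<oplus>\<^bsub>N\<^esub> f y) \<and>
     (\<forall>c. \<forall>x\<in>carrier M. f (c \<odot>\<^bsub>M\<^esub> x) = c \<odot>\<^bsub>N\<^esub> f x)"

lemma lin_maps_iff: "f \<in> lin_maps M N \<longleftrightarrow> lin M N f \<and> f \<in> extensional (carrier M)"
  by (auto simp: lin_maps_def lin_def PiE_def)

lemma
  assumes "lin M N f"
  shows lin_in: "x \<in> carrier M \<Longrightarrow> f x \<in> carrier N"
    and lin_add: "\<lbrakk>x \<in> carrier M; y \<in> carrier M\<rbrakk> \<Longrightarrow> f (x \<oplus>\<^bsub>M\<^esub> y) = f x \<oplus>\<^bsub>N\<^esub> f y"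
    and lin_smult: "x \<in> carrier M \<Longrightarrow> f (c \<odot>\<^bsub>M\<^esub> x) = c \<odot>\<^bsub>N\<^esub> f x"
  using assms by (auto simp: lin_def)

lemma lin_maps_lin: "f \<in> lin_maps M N \<Longrightarrow> lin M N f"
  by (simp add: lin_maps_iff)

lemma lin_cong:
  assumes "module Lam M" "\<And>x. x \<in> carrier M \<Longrightarrow> f x = g x" shows "lin M N f \<longleftrightarrow> lin M N g"
proof -
  interpret M: module Lam M by fact
  have "c \<odot>\<^bsub>M\<^esub> x \<in> carrier M" if "x \<in> carrier M" for c x using that by (intro M.smult_closed) auto
  then show ?thesis using assms(2) by (simp add: lin_def M.a_closed)
qed

lemma restrict_lin_maps:
  "\<lbrakk>module Lam M; lin M N f\<rbrakk> \<Longrightarrow> (\<lambda>x\<in>carrier M. f x) \<in> lin_maps M N"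
  using lin_cong[of M f "\<lambda>x\<in>carrier M. f x" N] by (simp add: lin_maps_iff)

lemma lin_maps_eqI:
  "\<lbrakk>f \<in> lin_maps M N; g \<in> lin_maps M N; \<And>x. x \<in> carrier M \<Longrightarrow> f x = g x\<rbrakk> \<Longrightarrow> f = g"
  by (auto simp: lin_maps_iff intro: extensionalityI)

lemma lin_comp: "\<lbrakk>lin M N f; lin N P g\<rbrakk> \<Longrightarrow> lin M P (\<lambda>x. g (f x))"
  by (simp add: lin_def)

lemma smult_in: "\<lbrakk>module Lam M; x \<in> carrier M\<rbrakk> \<Longrightarrow> c \<odot>\<^bsub>M\<^esub> x \<in> carrier M"
  and add_in: "\<lbrakk>module Lam M; x \<in> carrier M; y \<in> carrier M\<rbrakk> \<Longrightarrow> x \<oplus>\<^bsub>M\<^esub> y \<in> carrier M"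
  and zero_in: "module Lam M \<Longrightarrow> \<zero>\<^bsub>M\<^esub> \<in> carrier M"
  and smult_smult: "\<lbrakk>module Lam M; x \<in> carrier M\<rbrakk> \<Longrightarrow> c \<odot>\<^bsub>M\<^esub> (d \<odot>\<^bsub>M\<^esub> x) = (c * d) \<odot>\<^bsub>M\<^esub> x"
  and smult_one: "\<lbrakk>module Lam M; x \<in> carrier M\<rbrakk> \<Longrightarrow> 1 \<odot>\<^bsub>M\<^esub> x = x"
  and smult_zero: "\<lbrakk>module Lam M; x \<in> carrier M\<rbrakk> \<Longrightarrow> 0 \<odot>\<^bsub>M\<^esub> x = \<zero>\<^bsub>M\<^esub>"
  and smult_add_left: "\<lbrakk>module Lam M; x \<in> carrier M\<rbrakk> \<Longrightarrow> (c + d) \<odot>\<^bsub>M\<^esub> x = c \<odot>\<^bsub>M\<^esub> x \<oplus>\<^bsub>M\<^esub> d \<odot>\<^bsub>M\<^esub> x"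
  and smult_add_right: "\<lbrakk>module Lam M; x \<in> carrier M; y \<in> carrier M\<rbrakk> \<Longrightarrow>
        c \<odot>\<^bsub>M\<^esub> (x \<oplus>\<^bsub>M\<^esub> y) = c \<odot>\<^bsub>M\<^esub> x \<oplus>\<^bsub>M\<^esub> c \<odot>\<^bsub>M\<^esub> y"
  using module.smult_closed[of Lam M c x] module.smult_assoc1[of Lam M c d x, symmetric]
    module.smult_one[of Lam M x] module.smult_l_null[of Lam M x] module.smult_l_distr[of Lam M c d x]
    module.smult_r_distr[of Lam M c x y] abelian_monoid.a_closed[of M x y] abelian_monoid.zero_closed[of M]
  by (auto simp: module_def abelian_group_def)

lemma lin_zero: assumes "module Lam M" "module Lam N" "lin M N f" shows "f \<zero>\<^bsub>M\<^esub> = \<zero>\<^bsub>N\<^esub>"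
  using lin_smult[OF assms(3), of "\<zero>\<^bsub>M\<^esub>" 0] assms lin_in[OF assms(3)] by (simp add: zero_in smult_zero)

abbreviation msub :: "(lam, 'a) module \<Rightarrow> 'a \<Rightarrow> 'a \<Rightarrow> 'a" where
  "msub M x y \<equiv> x \<oplus>\<^bsub>M\<^esub> ((- 1) \<odot>\<^bsub>M\<^esub> y)"

lemma msub_eq: assumes "module Lam M" "x \<in> carrier M" "y \<in> carrier M" shows "msub M x y = x \<ominus>\<^bsub>M\<^esub> y"
proof -
  interpret M: module Lam M by fact
  show ?thesis using M.smult_l_minus[of 1 y] assms by (simp add: a_minus_def smult_one)
qed

lemma msub_in: "\<lbrakk>module Lam M; x \<in> carrier M; y \<in> carrier M\<rbrakk> \<Longrightarrow> msub M x y \<in> carrier M"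
  by (simp add: add_in smult_in)

lemma msub_zero_iff:
  assumes "module Lam M" "x \<in> carrier M" "y \<in> carrier M" shows "msub M x y = \<zero>\<^bsub>M\<^esub> \<longleftrightarrow> x = y"
proof -
  interpret M: module Lam M by fact
  have "x \<oplus>\<^bsub>M\<^esub> (\<ominus>\<^bsub>M\<^esub> y) = \<zero>\<^bsub>M\<^esub> \<longleftrightarrow> x = y"
    using assms by (metis M.r_neg M.minus_equality M.add.inv_closed M.minus_minus M.a_comm)
  then show ?thesis using assms by (simp add: msub_eq a_minus_def)
qed

lemma lin_msub: "\<lbrakk>module Lam M; lin M N f; x \<in> carrier M; y \<in> carrier M\<rbrakk> \<Longrightarrow> f (msub M x y) = msub N (f x) (f y)"
  by (simp add: lin_add smult_in lin_smult)

lemma lin_inj_iff: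
  assumes "module Lam M" "module Lam N" "lin M N f"
  shows "inj_on f (carrier M) \<longleftrightarrow> (\<forall>x\<in>carrier M. f x = \<zero>\<^bsub>N\<^esub> \<longrightarrow> x = \<zero>\<^bsub>M\<^esub>)"
proof
  assume "inj_on f (carrier M)"
  then show "\<forall>x\<in>carrier M. f x = \<zero>\<^bsub>N\<^esub> \<longrightarrow> x = \<zero>\<^bsub>M\<^esub>"
    using lin_zero[OF assms] zero_in[OF assms(1)] by (metis inj_onD)
next
  assume k: "\<forall>x\<in>carrier M. f x = \<zero>\<^bsub>N\<^esub> \<longrightarrow> x = \<zero>\<^bsub>M\<^esub>"
  show "inj_on f (carrier M)"
  proof (rule inj_onI)
    fix x y assume xy: "x \<in> carrier M" "y \<in> carrier M" "f x = f y"
    have "f (msub M x y) = \<zero>\<^bsub>N\<^esub>"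
      using lin_msub[OF assms(1,3) xy(1,2)] msub_zero_iff[OF assms(2) lin_in[OF assms(3) xy(1)] lin_in[OF assms(3) xy(2)]] xy(3)
      by simp
    then show "x = y" using k msub_in[OF assms(1) xy(1,2)] msub_zero_iff[OF assms(1) xy(1,2)] by blast
  qed
qed

lemma lin_inv_into:
  assumes M: "module Lam M" and f: "lin M N f" and b: "bij_betw f (carrier M) (carrier N)"
  shows "lin N M (inv_into (carrier M) f)"
proof -
  let ?g = "inv_into (carrier M) f"
  have inv: "?g (f x) = x" if "x \<in> carrier M" for x
    using b that by (simp add: bij_betw_def inv_into_f_f)
  have surj: "\<exists>x\<in>carrier M. y = f x" if "y \<in> carrier N" for y
    using b that by (auto simp: bij_betw_def)
  have "?g y \<in> carrier M" if "y \<in> carrier N" for y using surj[OF that] inv by auto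
  moreover have "?g (y \<oplus>\<^bsub>N\<^esub> y') = ?g y \<oplus>\<^bsub>M\<^esub> ?g y'" if "y \<in> carrier N" "y' \<in> carrier N" for y y'
    using surj[OF that(1)] surj[OF that(2)] inv by (auto simp: lin_add[OF f, symmetric] add_in[OF M])
  moreover have "?g (c \<odot>\<^bsub>N\<^esub> y) = c \<odot>\<^bsub>M\<^esub> ?g y" if "y \<in> carrier N" for y c
    using surj[OF that] inv by (auto simp: lin_smult[OF f, symmetric] smult_in[OF M])
  ultimately show ?thesis by (simp add: lin_def)
qed

lemma Vect_simps [simp]:
  "M \<in> Ob (Vect elts) \<longleftrightarrow> module Lam M \<and> carrier M \<in> range elts"
  "Hom (Vect elts) = lin_maps" "Idm (Vect elts) M = (\<lambda>x\<in>carrier M. x)"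
  "Cmp (Vect elts) M N P g f = compose (carrier M) g f"
  "Zero (Vect elts) M N = (\<lambda>x\<in>carrier M. \<zero>\<^bsub>N\<^esub>)"
  "Add (Vect elts) M N f f' = (\<lambda>x\<in>carrier M. f x \<oplus>\<^bsub>N\<^esub> f' x)"
  "Scale (Vect elts) M N c f = (\<lambda>x\<in>carrier M. c \<odot>\<^bsub>N\<^esub> f x)"
  by (simp_all add: Vect_def)

lemma compose_lin_maps:
  assumes "module Lam M" "f \<in> lin_maps M N" "g \<in> lin_maps N P"
  shows "compose (carrier M) g f \<in> lin_maps M P"
  unfolding compose_def
  by (rule restrict_lin_maps[OF assms(1) lin_comp[OF assms(2,3)[THEN lin_maps_lin]]])

lemma id_lin_maps: "module Lam M \<Longrightarrow> (\<lambda>x\<in>carrier M. x) \<in> lin_maps M M"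
  by (intro restrict_lin_maps) (auto simp: lin_def)


section \<open>Tensoring with a line\<close>

text \<open>For the line \<open>L\<^sub>b = \<Lambda> e\<^sub>b\<close>, the space \<open>V\<close> itself, with \<open>x \<otimes> v = x(b) v\<close>, is a tensor product
  \<open>L\<^sub>b \<otimes> V\<close>. Hence the chosen tensor product exists and \<open>v \<mapsto> e\<^sub>b \<otimes> v\<close> is an isomorphism from \<open>V\<close>.\<close>

lemma line_simps [simp]:
  "carrier (line b) = {x. \<forall>c. c \<noteq> b \<longrightarrow> x c = 0}" "add (line b) = (\<lambda>x y c. x c + y c)"
  "smult (line b) = (\<lambda>a x c. a * x c)"
  by (simp_all add: line_def)

lemma line_basis_in: "line_basis b \<in> carrier (line b)"
  and line_basis_at [simp]: "line_basis b b = 1"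
  by (simp_all add: line_basis_def)

lemma line_expand: "x \<in> carrier (line b) \<Longrightarrow> x = x b \<odot>\<^bsub>line b\<^esub> line_basis b"
  by (auto simp: line_basis_def fun_eq_iff)

lemma bilinear_line:
  assumes "\<beta> \<in> bilinear_maps (line b) V Q" "x \<in> carrier (line b)" "v \<in> carrier V"
  shows "\<beta> x v = x b \<odot>\<^bsub>Q\<^esub> \<beta> (line_basis b) v"
proof -
  have "\<beta> (x b \<odot>\<^bsub>line b\<^esub> line_basis b) v = x b \<odot>\<^bsub>Q\<^esub> \<beta> (line_basis b) v"
    using assms(1,3) line_basis_in[of b] unfolding bilinear_maps_def by blast
  then show ?thesis using line_expand[OF assms(2)] by simp
qed

lemma bilinear_lin: "\<lbrakk>\<beta> \<in> bilinear_maps (line b) V Q; x \<in> carrier (line b)\<rbrakk> \<Longrightarrow> lin V Q (\<beta> x)"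
  unfolding bilinear_maps_def lin_def by blast

lemma bilinear_line_of_lin:
  assumes "module Lam Q" "lin V Q h" shows "(\<lambda>x v. x b \<odot>\<^bsub>Q\<^esub> h v) \<in> bilinear_maps (line b) V Q"
  using assms unfolding bilinear_maps_def
  by (simp add: smult_in lin_in smult_add_left smult_add_right lin_add lin_smult smult_smult mult.commute)

lemma line_tensor_product:
  assumes V: "V \<in> Ob (Vect elts)"
  shows "is_tensor_product elts (line b) V V (\<lambda>x v. x b \<odot>\<^bsub>V\<^esub> v)"
proof -
  have mV: "module Lam V" using V by simp
  have "\<exists>!g. g \<in> lin_maps V Q \<and> (\<forall>x\<in>carrier (line b). \<forall>v\<in>carrier V. g (x b \<odot>\<^bsub>V\<^esub> v) = \<beta> x v)"
    if Q: "Q \<in> Ob (Vect elts)" and \<beta>: "\<beta> \<in> bilinear_maps (line b) V Q" for Q \<beta>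
  proof (rule ex1I[of _ "\<lambda>v\<in>carrier V. \<beta> (line_basis b) v"], intro conjI ballI)
    note l = bilinear_lin[OF \<beta> line_basis_in]
    show "(\<lambda>v\<in>carrier V. \<beta> (line_basis b) v) \<in> lin_maps V Q" by (rule restrict_lin_maps[OF mV l])
    show "(\<lambda>v\<in>carrier V. \<beta> (line_basis b) v) (x b \<odot>\<^bsub>V\<^esub> v) = \<beta> x v"
      if "x \<in> carrier (line b)" "v \<in> carrier V" for x v
      using bilinear_line[OF \<beta> that] that mV by (simp add: smult_in lin_smult[OF l])
    fix g assume g: "g \<in> lin_maps V Q \<and> (\<forall>x\<in>carrier (line b). \<forall>v\<in>carrier V. g (x b \<odot>\<^bsub>V\<^esub> v) = \<beta> x v)"
    then have "g v = \<beta> (line_basis b) v" if "v \<in> carrier V" for v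
      using that line_basis_in[of b] mV by (metis line_basis_at smult_one)
    then show "g = (\<lambda>v\<in>carrier V. \<beta> (line_basis b) v)"
      using g restrict_lin_maps[OF mV l] by (intro lin_maps_eqI[of g V Q]) auto
  qed
  moreover have "(\<lambda>x v. x b \<odot>\<^bsub>V\<^esub> v) \<in> bilinear_maps (line b) V V"
    using bilinear_line_of_lin[OF mV, of V "\<lambda>v. v" b] by (simp add: lin_def)
  ultimately show ?thesis unfolding is_tensor_product_def using V by blast
qed

abbreviation "LT elts b V \<equiv> tensor_space elts (line b) V"
abbreviation "lt elts b V x v \<equiv> tensor_elem elts (line b) V x v"
abbreviation "ten elts b V \<equiv> tensor_elem elts (line b) V (line_basis b)"

lemma LT_tensor_product:
  assumes "V \<in> Ob (Vect elts)"
  shows "is_tensor_product elts (line b) V (LT elts b V) (tensor_elem elts (line b) V)"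
proof -
  have "case tensor_choice elts (line b) V of (P, \<tau>) \<Rightarrow> is_tensor_product elts (line b) V P \<tau>"
    unfolding tensor_choice_def by (rule someI[of _ "(V, \<lambda>x v. x b \<odot>\<^bsub>V\<^esub> v)"]) (simp add: line_tensor_product[OF assms])
  then show ?thesis by (simp add: tensor_space_def tensor_elem_def case_prod_beta)
qed

context
  fixes elts :: "'v \<Rightarrow> 'v set" and b :: "('k::field, 'n::finite) dbl" and V :: "(lam, 'v) module"
  assumes V: "V \<in> Ob (Vect elts)"
begin

lemma LT_ob: "LT elts b V \<in> Ob (Vect elts)"
  by (rule conjunct1[OF LT_tensor_product[OF V, unfolded is_tensor_product_def]])

lemma lt_bilinear: "tensor_elem elts (line b) V \<in> bilinear_maps (line b) V (LT elts b V)"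
  by (rule conjunct1[OF conjunct2[OF LT_tensor_product[OF V, unfolded is_tensor_product_def]]])

lemma ten_lin: "lin V (LT elts b V) (ten elts b V)"
  by (rule bilinear_lin[OF lt_bilinear line_basis_in])

lemma lt_expand: "\<lbrakk>x \<in> carrier (line b); v \<in> carrier V\<rbrakk> \<Longrightarrow> lt elts b V x v = x b \<odot>\<^bsub>LT elts b V\<^esub> ten elts b V v"
  by (rule bilinear_line[OF lt_bilinear])

lemma LT_universal:
  assumes "Q \<in> Ob (Vect elts)" "\<beta> \<in> bilinear_maps (line b) V Q"
  shows "\<exists>!g. g \<in> lin_maps (LT elts b V) Q \<and> (\<forall>x\<in>carrier (line b). \<forall>v\<in>carrier V. g (lt elts b V x v) = \<beta> x v)"
  using LT_tensor_product[OF V, of b, unfolded is_tensor_product_def] assms by blast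

lemma ten_bij: "bij_betw (ten elts b V) (carrier V) (carrier (LT elts b V))"
proof -
  let ?T = "LT elts b V"
  have mV: "module Lam V" and mT: "module Lam ?T" using V LT_ob by simp_all
  have "(\<lambda>x v. x b \<odot>\<^bsub>V\<^esub> v) \<in> bilinear_maps (line b) V V"
    using bilinear_line_of_lin[OF mV, of V "\<lambda>v. v" b] by (simp add: lin_def)
  then obtain g where g: "g \<in> lin_maps ?T V"
    and gt: "\<And>x v. \<lbrakk>x \<in> carrier (line b); v \<in> carrier V\<rbrakk> \<Longrightarrow> g (lt elts b V x v) = x b \<odot>\<^bsub>V\<^esub> v"
    using LT_universal[OF V] by blast
  have gten: "g (ten elts b V v) = v" if "v \<in> carrier V" for v
    using gt[OF line_basis_in that] that mV by (simp add: smult_one)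
  \<comment> \<open>The composite \<open>L \<otimes> V \<rightarrow> V \<rightarrow> L \<otimes> V\<close> and the identity agree on pure tensors.\<close>
  have c: "compose (carrier ?T) (\<lambda>v\<in>carrier V. ten elts b V v) g \<in> lin_maps ?T ?T"
    by (rule compose_lin_maps[OF mT g restrict_lin_maps[OF mV ten_lin]])
  have ct: "compose (carrier ?T) (\<lambda>v\<in>carrier V. ten elts b V v) g (lt elts b V x v) = lt elts b V x v"
    if "x \<in> carrier (line b)" "v \<in> carrier V" for x v
    using that lt_expand[OF that] gt[OF that] lin_in[OF ten_lin] mT mV
    by (simp add: compose_eq smult_in lin_smult[OF ten_lin])
  have idt: "(\<lambda>w\<in>carrier ?T. w) (lt elts b V x v) = lt elts b V x v"
    if "x \<in> carrier (line b)" "v \<in> carrier V" for x v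
    using lt_expand[OF that] lin_in[OF ten_lin that(2)] mT by (simp add: smult_in)
  have "compose (carrier ?T) (\<lambda>v\<in>carrier V. ten elts b V v) g = (\<lambda>w\<in>carrier ?T. w)"
    using LT_universal[OF LT_ob lt_bilinear] c ct id_lin_maps[OF mT] idt by blast
  then have cw: "compose (carrier ?T) (\<lambda>v\<in>carrier V. ten elts b V v) g w = (\<lambda>w\<in>carrier ?T. w) w" for w
    by simp
  have teng: "ten elts b V (g w) = w" if "w \<in> carrier ?T" for w
    using cw[of w] that lin_in[OF lin_maps_lin[OF g] that] by (simp add: compose_eq)
  show ?thesis
    by (rule bij_betw_byWitness[of _ g]) (auto simp: gten teng lin_in[OF ten_lin] lin_in[OF lin_maps_lin[OF g]])
qed

lemma LT_cases: assumes "w \<in> carrier (LT elts b V)" obtains v where "v \<in> carrier V" "w = ten elts b V v"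
  using ten_bij assms by (auto simp: bij_betw_def)

lemma LT_eqI:
  "\<lbrakk>f \<in> lin_maps (LT elts b V) Q; g \<in> lin_maps (LT elts b V) Q;
    \<And>v. v \<in> carrier V \<Longrightarrow> f (ten elts b V v) = g (ten elts b V v)\<rbrakk> \<Longrightarrow> f = g"
  by (erule lin_maps_eqI, assumption) (metis LT_cases)

lemma LT_extend:
  assumes "lin V Q h"
  obtains g where "g \<in> lin_maps (LT elts b V) Q" "\<And>v. v \<in> carrier V \<Longrightarrow> g (ten elts b V v) = h v"
proof -
  let ?T = "LT elts b V" and ?i = "inv_into (carrier V) (ten elts b V)"
  have mV: "module Lam V" and mT: "module Lam ?T" using V LT_ob by simp_all
  have "?i (ten elts b V v) = v" if "v \<in> carrier V" for v
    using that ten_bij by (simp add: bij_betw_def inv_into_f_f)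
  then show thesis
    using that[OF restrict_lin_maps[OF mT lin_comp[OF lin_inv_into[OF mV ten_lin ten_bij] assms]]]
      lin_in[OF ten_lin] by simp
qed

text \<open>A linear map out of \<open>L\<^sub>b \<otimes> V\<close> that is prescribed on pure tensors by a bilinear expression is
  already characterized by its values on the tensors \<open>e\<^sub>b \<otimes> v\<close>.\<close>

lemma lin_LT_pure:
  assumes Q: "module Lam Q" and g: "g \<in> lin_maps (LT elts b V) Q"
    and e: "\<And>v. v \<in> carrier V \<Longrightarrow> g (ten elts b V v) = h v"
    and x: "x \<in> carrier (line b)" "v \<in> carrier V"
  shows "g (lt elts b V x v) = x b \<odot>\<^bsub>Q\<^esub> h v"
  using lt_expand[OF x] lin_smult[OF lin_maps_lin[OF g] lin_in[OF ten_lin x(2)]] e[OF x(2)] by simp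

end

lemma tensor_id_map:
  assumes V: "V \<in> Ob (Vect elts)" and W: "W \<in> Ob (Vect elts)" and f: "f \<in> lin_maps V W"
  shows "tensor_id_map elts (line b) V W f \<in> lin_maps (LT elts b V) (LT elts b W)"
    and "v \<in> carrier V \<Longrightarrow> tensor_id_map elts (line b) V W f (ten elts b V v) = ten elts b W (f v)"
proof -
  have mW: "module Lam (LT elts b W)" using LT_ob[OF W, of b] by simp
  let ?Q = "\<lambda>g. g \<in> lin_maps (LT elts b V) (LT elts b W) \<and>
    (\<forall>x\<in>carrier (line b). \<forall>v\<in>carrier V. g (lt elts b V x v) = lt elts b W x (f v))"
  obtain g where g: "g \<in> lin_maps (LT elts b V) (LT elts b W)"
    and gt: "\<And>v. v \<in> carrier V \<Longrightarrow> g (ten elts b V v) = ten elts b W (f v)"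
    by (rule LT_extend[where b = b, OF V lin_comp[OF lin_maps_lin[OF f] ten_lin[where b = b, OF W]]]) blast
  have Qg: "?Q g"
  proof (intro conjI ballI g)
    fix x v assume x: "x \<in> carrier (line b)" "v \<in> carrier V"
    show "g (lt elts b V x v) = lt elts b W x (f v)"
      using lin_LT_pure[OF V mW g gt x] lt_expand[OF W x(1) lin_in[OF lin_maps_lin[OF f] x(2)]] by simp
  qed
  have "g' = g" if "?Q g'" for g'
    by (rule LT_eqI[OF V]) (use that Qg line_basis_in[of b] in auto)
  then have "tensor_id_map elts (line b) V W f = g"
    unfolding tensor_id_map_def using Qg by (intro the_equality) blast+
  then show "tensor_id_map elts (line b) V W f \<in> lin_maps (LT elts b V) (LT elts b W)"
    "v \<in> carrier V \<Longrightarrow> tensor_id_map elts (line b) V W f (ten elts b V v) = ten elts b W (f v)"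
    using g gt by simp_all
qed


section \<open>Equivariant families as families with an action\<close>

abbreviation "sh b s \<equiv> inv\<^bsub>GH\<^esub> b <#\<^bsub>GH\<^esub> s"

text \<open>The map \<open>\<epsilon>\<^sub>b\<close> of an equivariant family, composed with the isomorphism \<open>v \<mapsto> e\<^sub>b \<otimes> v\<close>.\<close>

definition act :: "('v \<Rightarrow> 'v set) \<Rightarrow> ('k::field, 'n::finite, 'v) lvl_ob \<Rightarrow>
    ('k, 'n) dbl \<Rightarrow> ('k, 'n) dbl set \<Rightarrow> 'v \<Rightarrow> 'v" where
  "act elts X b s v = snd X b s (ten elts b (fst X (sh b s)) v)"

text \<open>The action maps \<open>V\<^bsub>b\<inverse>s\<^esub> \<rightarrow> V\<^sub>s\<close> of an equivariant family compose up to the cocycle.\<close>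

definition is_action :: "('n::{finite, linorder} \<Rightarrow> lam) \<Rightarrow> ('k::field, 'n) dbl set \<Rightarrow>
    ('k, 'n, 'v) fam \<Rightarrow> (('k, 'n) dbl \<Rightarrow> ('k, 'n, 'v) fmor) \<Rightarrow> bool" where
  "is_action \<alpha> C V \<theta> \<longleftrightarrow>
     (\<forall>b\<in>BH. \<forall>s\<in>SC C. lin (V (sh b s)) (V s) (\<theta> b s) \<and>
        bij_betw (\<theta> b s) (carrier (V (sh b s))) (carrier (V s))) \<and>
     (\<forall>b\<in>BH. \<forall>b'\<in>BH. \<forall>s\<in>SC C. \<forall>v\<in>carrier (V (sh b' (sh b s))).
        \<theta> b s (\<theta> b' (sh b s) v) = sigma \<alpha> b b' \<odot>\<^bsub>V s\<^esub> \<theta> (b \<otimes>\<^bsub>GH\<^esub> b') s v) \<and>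
     (\<forall>s\<in>SC C. \<forall>v\<in>carrier (V s). \<theta> \<one>\<^bsub>GH\<^esub> s v = v)"

lemma VC_simps [simp]:
  "Ob (VC elts C) = SC C \<rightarrow>\<^sub>E Ob (Vect elts)"
  "Hom (VC elts C) V W = (\<Pi>\<^sub>E s\<in>SC C. lin_maps (V s) (W s))"
  "Idm (VC elts C) V = (\<lambda>s\<in>SC C. \<lambda>x\<in>carrier (V s). x)"
  "Cmp (VC elts C) U V W g f = (\<lambda>s\<in>SC C. compose (carrier (U s)) (g s) (f s))"
  "Zero (VC elts C) V W = (\<lambda>s\<in>SC C. \<lambda>x\<in>carrier (V s). \<zero>\<^bsub>W s\<^esub>)"
  "Add (VC elts C) V W f f' = (\<lambda>s\<in>SC C. \<lambda>x\<in>carrier (V s). f s x \<oplus>\<^bsub>W s\<^esub> f' s x)"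
  "Scale (VC elts C) V W c f = (\<lambda>s\<in>SC C. \<lambda>x\<in>carrier (V s). c \<odot>\<^bsub>W s\<^esub> f s x)"
  by (simp_all add: VC_def family_cat_def)

locale level =
  fixes elts :: "'v \<Rightarrow> 'v set" and \<alpha> :: "'n::{finite, linorder} \<Rightarrow> lam"
    and C :: "('k::field, 'n) dbl set"
  assumes C: "subgroup C GH"
begin

lemma sh_in: "\<lbrakk>b \<in> BH; s \<in> SC C\<rbrakk> \<Longrightarrow> sh b s \<in> SC C"
  using BH_sub by (intro SC_left[OF subgroup.subset[OF C]]) auto

lemma sh_mult:
  assumes "b \<in> BH" "b' \<in> BH" "s \<in> SC C" shows "sh (b \<otimes>\<^bsub>GH\<^esub> b') s = sh b' (sh b s)"
proof -
  have "b \<in> carrier GH" "b' \<in> carrier GH" using assms BH_sub by auto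
  then show ?thesis
    using SC_sub[OF assms(3) subgroup.subset[OF C]] by (simp add: GH.inv_mult_group GH.lcos_m_assoc)
qed

lemma sh_one: "s \<in> SC C \<Longrightarrow> sh \<one>\<^bsub>GH\<^esub> s = s" "s \<in> SC C \<Longrightarrow> \<one>\<^bsub>GH\<^esub> <#\<^bsub>GH\<^esub> s = s"
  using SC_sub[OF _ subgroup.subset[OF C]] by (simp_all add: GH.lcos_mult_one)

context
  fixes V assumes V: "V \<in> Ob (VC elts C)"
begin

lemma fam: "s \<in> SC C \<Longrightarrow> V s \<in> Ob (Vect elts)"
  using V by (simp add: PiE_iff)

lemma T_ob: "FOb (T_ftor elts C b) V = (\<lambda>s\<in>SC C. LT elts b (V (sh b s)))"
  using V by (simp add: T_ftor_def FOb_mk_ftor)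

lemma T_ob_in: "b \<in> BH \<Longrightarrow> FOb (T_ftor elts C b) V \<in> Ob (VC elts C)"
  unfolding T_ob VC_simps using LT_ob[OF fam[OF sh_in]] by (intro restrict_PiE[THEN iffD2] Pi_I)

lemma mu_T:
  assumes b: "b \<in> BH" "b' \<in> BH" and s: "s \<in> SC C"
  shows "mu_T elts \<alpha> C b b' V s \<in>
      lin_maps (LT elts b (LT elts b' (V (sh b' (sh b s))))) (LT elts (b \<otimes>\<^bsub>GH\<^esub> b') (V (sh b' (sh b s))))"
    and "v \<in> carrier (V (sh b' (sh b s))) \<Longrightarrow>
      mu_T elts \<alpha> C b b' V s (ten elts b (LT elts b' (V (sh b' (sh b s)))) (ten elts b' (V (sh b' (sh b s))) v)) =
      sigma \<alpha> b b' \<odot>\<^bsub>LT elts (b \<otimes>\<^bsub>GH\<^esub> b') (V (sh b' (sh b s)))\<^esub> ten elts (b \<otimes>\<^bsub>GH\<^esub> b') (V (sh b' (sh b s))) v"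
proof -
  let ?bb = "b \<otimes>\<^bsub>GH\<^esub> b'"
  define M where "M = V (sh b' (sh b s))"
  define N where "N = LT elts b' M"
  have M: "M \<in> Ob (Vect elts)" unfolding M_def using b s by (intro fam sh_in)
  have N: "N \<in> Ob (Vect elts)" unfolding N_def by (rule LT_ob[OF M])
  have Q: "LT elts ?bb M \<in> Ob (Vect elts)" by (rule LT_ob[OF M])
  then have mQ: "module Lam (LT elts ?bb M)" by simp
  have mM: "module Lam M" using M by simp
  define P where "P g \<longleftrightarrow> g \<in> lin_maps (LT elts b N) (LT elts ?bb M) \<and>
    (\<forall>x\<in>carrier (line b). \<forall>y\<in>carrier (line b'). \<forall>v\<in>carrier M.
      g (lt elts b N x (lt elts b' M y v)) = lt elts ?bb M (line_mult \<alpha> b b' x y) v)" for g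
  have mu: "mu_T elts \<alpha> C b b' V s = (THE g. P g)"
  proof -
    have e: "FOb (T_ftor elts C b') V (sh b s) = N" using s b by (simp add: T_ob sh_in M_def N_def)
    have "FOb (T_ftor elts C b) (FOb (T_ftor elts C b') V) s = LT elts b N"
      using s T_ob_in[OF b(2)] e by (simp add: T_ftor_def[of _ _ b] FOb_mk_ftor)
    moreover have "FOb (T_ftor elts C ?bb) V s = LT elts ?bb M"
      using s b by (simp add: T_ob M_def sh_mult)
    ultimately show ?thesis
      using s e by (simp add: mu_T_def Let_def P_def M_def[symmetric])
  qed
  have l: "lin M (LT elts ?bb M) (\<lambda>v. sigma \<alpha> b b' \<odot>\<^bsub>LT elts ?bb M\<^esub> ten elts ?bb M v)"
    using ten_lin[OF M, of ?bb] mQ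
    by (simp add: lin_def smult_in smult_add_right smult_smult mult.commute)
  obtain h where h: "h \<in> lin_maps N (LT elts ?bb M)"
    and ht: "\<And>v. v \<in> carrier M \<Longrightarrow> h (ten elts b' M v) = sigma \<alpha> b b' \<odot>\<^bsub>LT elts ?bb M\<^esub> ten elts ?bb M v"
    unfolding N_def by (rule LT_extend[where b = b', OF M l]) blast
  obtain g where g: "g \<in> lin_maps (LT elts b N) (LT elts ?bb M)"
    and gt: "\<And>w. w \<in> carrier N \<Longrightarrow> g (ten elts b N w) = h w"
    by (rule LT_extend[where b = b, OF N lin_maps_lin[OF h]]) blast
  have tN: "ten elts b' M v \<in> carrier N" if "v \<in> carrier M" for v
    unfolding N_def by (rule lin_in[OF ten_lin[OF M] that])
  have gtt: "g (ten elts b N (ten elts b' M v)) = sigma \<alpha> b b' \<odot>\<^bsub>LT elts ?bb M\<^esub> ten elts ?bb M v"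
    if "v \<in> carrier M" for v
    using gt[OF tN[OF that]] ht[OF that] by simp
  have "P g" unfolding P_def
  proof (intro conjI ballI)
    fix x y v assume x: "x \<in> carrier (line b)" and y: "y \<in> carrier (line b')" and v: "v \<in> carrier M"
    have yv: "lt elts b' M y v \<in> carrier N"
      using lt_expand[OF M y v] tN[OF v] N by (simp add: N_def[symmetric] smult_in)
    have "g (lt elts b N x (lt elts b' M y v)) = x b \<odot>\<^bsub>LT elts ?bb M\<^esub> h (lt elts b' M y v)"
      by (rule lin_LT_pure[OF N mQ g gt x yv])
    also have "h (lt elts b' M y v) = y b' \<odot>\<^bsub>LT elts ?bb M\<^esub> (sigma \<alpha> b b' \<odot>\<^bsub>LT elts ?bb M\<^esub> ten elts ?bb M v)"
      by (rule lin_LT_pure[OF M mQ h[unfolded N_def] ht y v])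
    also have "x b \<odot>\<^bsub>LT elts ?bb M\<^esub> \<dots> = (x b * y b' * sigma \<alpha> b b') \<odot>\<^bsub>LT elts ?bb M\<^esub> ten elts ?bb M v"
      using mQ lin_in[OF ten_lin[OF M, of ?bb] v] by (simp add: smult_smult smult_in mult.assoc)
    also have "\<dots> = lt elts ?bb M (line_mult \<alpha> b b' x y) v"
      using lt_expand[OF M, of "line_mult \<alpha> b b' x y" ?bb v] v by (simp add: line_mult_def line_basis_def)
    finally show "g (lt elts b N x (lt elts b' M y v)) = lt elts ?bb M (line_mult \<alpha> b b' x y) v" .
  qed (rule g)
  moreover have "g' = g" if "P g'" for g'
  proof (rule LT_eqI[OF N _ g])
    show "g' \<in> lin_maps (LT elts b N) (LT elts ?bb M)" using that by (simp add: P_def)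
    fix w assume "w \<in> carrier N"
    then obtain v where v: "v \<in> carrier M" "w = ten elts b' M v" unfolding N_def by (rule LT_cases[OF M])
    then show "g' (ten elts b N w) = g (ten elts b N w)"
      using that \<open>P g\<close> line_basis_in[of b] line_basis_in[of b'] by (simp only: P_def)
  qed
  ultimately have "mu_T elts \<alpha> C b b' V s = g" unfolding mu by (rule the_equality)
  then show "mu_T elts \<alpha> C b b' V s \<in>
      lin_maps (LT elts b (LT elts b' (V (sh b' (sh b s))))) (LT elts (b \<otimes>\<^bsub>GH\<^esub> b') (V (sh b' (sh b s))))"
    "v \<in> carrier (V (sh b' (sh b s))) \<Longrightarrow>
      mu_T elts \<alpha> C b b' V s (ten elts b (LT elts b' (V (sh b' (sh b s)))) (ten elts b' (V (sh b' (sh b s))) v)) =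
      sigma \<alpha> b b' \<odot>\<^bsub>LT elts (b \<otimes>\<^bsub>GH\<^esub> b') (V (sh b' (sh b s)))\<^esub> ten elts (b \<otimes>\<^bsub>GH\<^esub> b') (V (sh b' (sh b s))) v"
    using g gtt by (simp_all only: M_def N_def)
qed

lemma unit_T:
  assumes s: "s \<in> SC C"
  shows "unit_T elts C V s \<in> lin_maps (LT elts (\<one>\<^bsub>GH\<^esub> :: ('k, 'n) dbl) (V s)) (V s)"
    and "v \<in> carrier (V s) \<Longrightarrow> unit_T elts C V s (ten elts (\<one>\<^bsub>GH\<^esub> :: ('k, 'n) dbl) (V s) v) = v"
proof -
  let ?e = "\<one>\<^bsub>GH\<^esub> :: ('k, 'n) dbl"
  obtain g where g: "g \<in> lin_maps (LT elts ?e (V s)) (V s)"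
    and gt: "\<And>v. v \<in> carrier (V s) \<Longrightarrow> g (ten elts ?e (V s) v) = v"
    by (rule LT_extend[OF fam[OF s], of "V s" "\<lambda>v. v" ?e]) (auto simp: lin_def)
  have "(THE g. g \<in> lin_maps (LT elts ?e (V s)) (V s) \<and> (\<forall>v\<in>carrier (V s). g (ten elts ?e (V s) v) = v)) = g"
    using g gt by (intro the_equality) (auto intro!: LT_eqI[OF fam[OF s]])
  then have "unit_T elts C V s = g" using s by (simp add: unit_T_def Let_def T_ob sh_one)
  then show "unit_T elts C V s \<in> lin_maps (LT elts ?e (V s)) (V s)"
    "v \<in> carrier (V s) \<Longrightarrow> unit_T elts C V s (ten elts ?e (V s) v) = v" using g gt by simp_all
qed

end

lemma T_mor:
  assumes V: "V \<in> Ob (VC elts C)" and W: "W \<in> Ob (VC elts C)" and f: "f \<in> Hom (VC elts C) V W"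
    and b: "b \<in> BH" and s: "s \<in> SC C"
  shows "FMor (T_ftor elts C b) V W f s \<in> lin_maps (LT elts b (V (sh b s))) (LT elts b (W (sh b s)))"
    and "v \<in> carrier (V (sh b s)) \<Longrightarrow>
      FMor (T_ftor elts C b) V W f s (ten elts b (V (sh b s)) v) = ten elts b (W (sh b s)) (f (sh b s) v)"
proof -
  have "FMor (T_ftor elts C b) V W f s = tensor_id_map elts (line b) (V (sh b s)) (W (sh b s)) (f (sh b s))"
    using V W f s by (simp add: T_ftor_def FMor_mk_ftor)
  moreover have "f (sh b s) \<in> lin_maps (V (sh b s)) (W (sh b s))" using f sh_in[OF b s] by auto
  ultimately show "FMor (T_ftor elts C b) V W f s \<in> lin_maps (LT elts b (V (sh b s))) (LT elts b (W (sh b s)))"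
    "v \<in> carrier (V (sh b s)) \<Longrightarrow>
      FMor (T_ftor elts C b) V W f s (ten elts b (V (sh b s)) v) = ten elts b (W (sh b s)) (f (sh b s) v)"
    using tensor_id_map[OF fam[OF V sh_in[OF b s]] fam[OF W sh_in[OF b s]]] by simp_all
qed

lemma VC_iso_iff:
  assumes V: "V \<in> Ob (VC elts C)" and W: "W \<in> Ob (VC elts C)"
  shows "is_iso (VC elts C) V W f \<longleftrightarrow> f \<in> Hom (VC elts C) V W \<and>
    (\<forall>s\<in>SC C. bij_betw (f s) (carrier (V s)) (carrier (W s)))"
proof (intro iffI conjI ballI; (elim conjE)?)
  assume i: "is_iso (VC elts C) V W f"
  show "f \<in> Hom (VC elts C) V W" using i by (simp add: is_iso_def)
  fix s assume s: "s \<in> SC C"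
  obtain g where f: "f \<in> Hom (VC elts C) V W" and g: "g \<in> Hom (VC elts C) W V"
    and gf: "Cmp (VC elts C) V W V g f = Idm (VC elts C) V"
    and fg: "Cmp (VC elts C) W V W f g = Idm (VC elts C) W"
    using i by (auto simp: is_iso_def)
  have fs: "lin (V s) (W s) (f s)" and gs: "lin (W s) (V s) (g s)"
    using f g s by (auto intro!: lin_maps_lin)
  have "g s (f s x) = x" if "x \<in> carrier (V s)" for x
    using fun_cong[OF fun_cong[OF gf, of s], of x] s that by (simp add: compose_eq)
  moreover have "f s (g s x) = x" if "x \<in> carrier (W s)" for x
    using fun_cong[OF fun_cong[OF fg, of s], of x] s that by (simp add: compose_eq)
  ultimately show "bij_betw (f s) (carrier (V s)) (carrier (W s))"
    by (intro bij_betw_byWitness[of _ "g s"]) (auto simp: lin_in[OF fs] lin_in[OF gs])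
next
  assume f: "f \<in> Hom (VC elts C) V W" and b: "\<forall>s\<in>SC C. bij_betw (f s) (carrier (V s)) (carrier (W s))"
  define g where "g = (\<lambda>s\<in>SC C. \<lambda>y\<in>carrier (W s). inv_into (carrier (V s)) (f s) y)"
  have fs: "lin (V s) (W s) (f s)" if "s \<in> SC C" for s using f that by (auto intro!: lin_maps_lin)
  have mod: "module Lam (V s)" "module Lam (W s)" if "s \<in> SC C" for s
    using V W that by (auto simp: PiE_iff)
  have "g \<in> Hom (VC elts C) W V"
    unfolding g_def VC_simps
    by (intro restrict_PiE[THEN iffD2] Pi_I restrict_lin_maps lin_inv_into mod fs b[rule_format])
  moreover have "compose (carrier (V s)) (g s) (f s) = (\<lambda>x\<in>carrier (V s). x)"
    "compose (carrier (W s)) (f s) (g s) = (\<lambda>x\<in>carrier (W s). x)" if s: "s \<in> SC C" for s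
    using b s lin_in[OF fs[OF s]]
    by (auto simp: g_def compose_def bij_betw_def inv_into_f_f f_inv_into_f intro!: restrict_ext)
  ultimately show "is_iso (VC elts C) V W f"
    unfolding is_iso_def using f by (intro conjI bexI[of _ g]) (simp_all cong: restrict_cong)
qed

lemma IC_simps:
  "Hom (IC elts \<alpha> C) X Y = {f \<in> Hom (VC elts C) (fst X) (fst Y). \<forall>b\<in>BH.
     Cmp (VC elts C) (FOb (T_ftor elts C b) (fst X)) (fst X) (fst Y) f (snd X b) =
     Cmp (VC elts C) (FOb (T_ftor elts C b) (fst X)) (FOb (T_ftor elts C b) (fst Y)) (fst Y)
       (snd Y b) (FMor (T_ftor elts C b) (fst X) (fst Y) f)}"
  "Idm (IC elts \<alpha> C) X = Idm (VC elts C) (fst X)"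
  "Cmp (IC elts \<alpha> C) X Y Z = Cmp (VC elts C) (fst X) (fst Y) (fst Z)"
  "Zero (IC elts \<alpha> C) X Y = Zero (VC elts C) (fst X) (fst Y)"
  "Add (IC elts \<alpha> C) X Y = Add (VC elts C) (fst X) (fst Y)"
  "Scale (IC elts \<alpha> C) X Y = Scale (VC elts C) (fst X) (fst Y)"
  by (simp_all add: IC_def Let_def case_prod_beta)

text \<open>All conditions on an equivariant family are identities between linear maps out of tensor
  products with lines; evaluated at \<open>e\<^sub>b \<otimes> v\<close> they become conditions on the action maps.\<close>

lemma IC_ob_iff:
  "X \<in> Ob (IC elts \<alpha> C) \<longleftrightarrow> fst X \<in> Ob (VC elts C) \<and>
    snd X \<in> (\<Pi>\<^sub>E b\<in>BH. \<Pi>\<^sub>E s\<in>SC C. lin_maps (LT elts b (fst X (sh b s))) (fst X s)) \<and>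
    is_action \<alpha> C (fst X) (act elts X)"
proof -
  obtain V \<epsilon> where X: "X = (V, \<epsilon>)" by (cases X)
  have "(V, \<epsilon>) \<in> Ob (IC elts \<alpha> C) \<longleftrightarrow> V \<in> Ob (VC elts C) \<and>
      \<epsilon> \<in> (\<Pi>\<^sub>E b\<in>BH. \<Pi>\<^sub>E s\<in>SC C. lin_maps (LT elts b (V (sh b s))) (V s)) \<and>
      is_action \<alpha> C V (act elts (V, \<epsilon>))"
  proof (cases "V \<in> Ob (VC elts C) \<and> \<epsilon> \<in> (\<Pi>\<^sub>E b\<in>BH. \<Pi>\<^sub>E s\<in>SC C. lin_maps (LT elts b (V (sh b s))) (V s))")
    case False
    then show ?thesis
      by (auto simp: IC_def Let_def is_iso_def T_ob PiE_iff)
  next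
    case True
    then have V: "V \<in> Ob (VC elts C)"
      and \<epsilon>: "\<epsilon> \<in> (\<Pi>\<^sub>E b\<in>BH. \<Pi>\<^sub>E s\<in>SC C. lin_maps (LT elts b (V (sh b s))) (V s))" by blast+
    let ?T = "T_ftor elts C" and ?\<theta> = "act elts (V, \<epsilon>)"
    have \<epsilon>bs: "\<epsilon> b s \<in> lin_maps (LT elts b (V (sh b s))) (V s)" if "b \<in> BH" "s \<in> SC C" for b s
      using \<epsilon> that by auto
    have \<epsilon>b: "\<epsilon> b \<in> Hom (VC elts C) (FOb (?T b) V) V" if "b \<in> BH" for b
      using \<epsilon> that by (auto simp: T_ob[OF V] PiE_iff)
    have mV: "module Lam (V s)" if "s \<in> SC C" for s using fam[OF V that] by simp
    have mT: "module Lam (LT elts b (V s))" if "s \<in> SC C" for b s using LT_ob[OF fam[OF V that], of b] by simp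
    have \<theta>: "?\<theta> b s v = \<epsilon> b s (ten elts b (V (sh b s)) v)" for b s v by (simp add: act_def)
    have \<theta>_lin: "lin (V (sh b s)) (V s) (?\<theta> b s)" if "b \<in> BH" "s \<in> SC C" for b s
      unfolding \<theta> by (rule lin_comp[OF ten_lin[OF fam[OF V sh_in[OF that]]] lin_maps_lin[OF \<epsilon>bs[OF that]]])
    have iso: "is_iso (VC elts C) (FOb (?T b) V) V (\<epsilon> b) \<longleftrightarrow>
        (\<forall>s\<in>SC C. bij_betw (?\<theta> b s) (carrier (V (sh b s))) (carrier (V s)))" if b: "b \<in> BH" for b
    proof -
      have "bij_betw (\<epsilon> b s) (carrier (LT elts b (V (sh b s)))) (carrier (V s)) \<longleftrightarrow>
          bij_betw (?\<theta> b s) (carrier (V (sh b s))) (carrier (V s))" if s: "s \<in> SC C" for s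
        using bij_betw_comp_iff[OF ten_bij[OF fam[OF V sh_in[OF b s]], of b], of "\<epsilon> b s" "carrier (V s)"]
        by (simp add: \<theta> comp_def cong: bij_betw_cong)
      then show ?thesis
        unfolding VC_iso_iff[OF T_ob_in[OF V b] V] using \<epsilon>b[OF b] by (simp add: T_ob[OF V])
    qed
    have mult: "Cmp (VC elts C) (FOb (?T b) (FOb (?T b') V)) (FOb (?T (b \<otimes>\<^bsub>GH\<^esub> b')) V) V
          (\<epsilon> (b \<otimes>\<^bsub>GH\<^esub> b')) (mu_T elts \<alpha> C b b' V) =
        Cmp (VC elts C) (FOb (?T b) (FOb (?T b') V)) (FOb (?T b) V) V (\<epsilon> b) (FMor (?T b) (FOb (?T b') V) V (\<epsilon> b'))
      \<longleftrightarrow> (\<forall>s\<in>SC C. \<forall>v\<in>carrier (V (sh b' (sh b s))).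
        ?\<theta> b s (?\<theta> b' (sh b s) v) = sigma \<alpha> b b' \<odot>\<^bsub>V s\<^esub> ?\<theta> (b \<otimes>\<^bsub>GH\<^esub> b') s v)"
      (is "?l = ?r \<longleftrightarrow> _") if b: "b \<in> BH" "b' \<in> BH" for b b'
    proof -
      let ?bb = "b \<otimes>\<^bsub>GH\<^esub> b'"
      have bb: "?bb \<in> BH" using b by (rule BH_mult)
      note T' = T_ob_in[OF V b(2)]
      have at: "?l s = ?r s \<longleftrightarrow> (\<forall>v\<in>carrier (V (sh b' (sh b s))).
          ?\<theta> b s (?\<theta> b' (sh b s) v) = sigma \<alpha> b b' \<odot>\<^bsub>V s\<^esub> ?\<theta> ?bb s v)" if s: "s \<in> SC C" for s
      proof -
        define M where "M = V (sh b' (sh b s))"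
        define N where "N = LT elts b' M"
        have sb: "sh b s \<in> SC C" "sh b' (sh b s) \<in> SC C" using sh_in b s by auto
        have M: "M \<in> Ob (Vect elts)" unfolding M_def using sb by (intro fam[OF V])
        have N: "N \<in> Ob (Vect elts)" unfolding N_def by (rule LT_ob[OF M])
        have mLN: "module Lam (LT elts b N)" using LT_ob[OF N, of b] by simp
        have T's: "FOb (?T b') V (sh b s) = N" using sb by (simp add: T_ob[OF V] N_def M_def)
        have TT: "FOb (?T b) (FOb (?T b') V) s = LT elts b N"
          using s by (simp add: T_ob[OF T'] T's)
        note mu = mu_T[OF V b s, folded M_def, folded N_def]
        have \<epsilon>bb: "\<epsilon> ?bb s \<in> lin_maps (LT elts ?bb M) (V s)"
          using \<epsilon>bs[OF bb s] by (simp add: sh_mult[OF b s] M_def)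
        have Tm: "FMor (?T b) (FOb (?T b') V) V (\<epsilon> b') s \<in> lin_maps (LT elts b N) (LT elts b (V (sh b s)))"
          "w \<in> carrier N \<Longrightarrow> FMor (?T b) (FOb (?T b') V) V (\<epsilon> b') s (ten elts b N w) =
            ten elts b (V (sh b s)) (\<epsilon> b' (sh b s) w)" for w
          using T_mor[OF T' V \<epsilon>b[OF b(2)] b(1) s, unfolded T's] by auto
        have l: "?l s \<in> lin_maps (LT elts b N) (V s)" "?r s \<in> lin_maps (LT elts b N) (V s)"
          using s compose_lin_maps[OF mLN mu(1) \<epsilon>bb] compose_lin_maps[OF mLN Tm(1) \<epsilon>bs[OF b(1) s]]
          by (simp_all add: TT)
        have tN: "ten elts b' M v \<in> carrier N" if "v \<in> carrier M" for v
          unfolding N_def by (rule lin_in[OF ten_lin[OF M] that])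
        have tLN: "ten elts b N w \<in> carrier (LT elts b N)" if "w \<in> carrier N" for w
          by (rule lin_in[OF ten_lin[OF N] that])
        have lv: "?l s (ten elts b N (ten elts b' M v)) = sigma \<alpha> b b' \<odot>\<^bsub>V s\<^esub> ?\<theta> ?bb s v"
          if v: "v \<in> carrier M" for v
          using s mu(2)[OF v] tLN[OF tN[OF v]] lin_smult[OF lin_maps_lin[OF \<epsilon>bb] lin_in[OF ten_lin[OF M] v]]
          by (simp add: TT compose_eq \<theta> sh_mult[OF b s] M_def[symmetric])
        have rv: "?r s (ten elts b N (ten elts b' M v)) = ?\<theta> b s (?\<theta> b' (sh b s) v)"
          if v: "v \<in> carrier M" for v
          using s tLN[OF tN[OF v]] Tm(2)[OF tN[OF v]] by (simp add: TT compose_eq \<theta> M_def[symmetric])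
        show ?thesis
          unfolding M_def[symmetric]
        proof
          assume "?l s = ?r s"
          then show "\<forall>v\<in>carrier M. ?\<theta> b s (?\<theta> b' (sh b s) v) = sigma \<alpha> b b' \<odot>\<^bsub>V s\<^esub> ?\<theta> ?bb s v"
            using lv rv by metis
        next
          assume e: "\<forall>v\<in>carrier M. ?\<theta> b s (?\<theta> b' (sh b s) v) = sigma \<alpha> b b' \<odot>\<^bsub>V s\<^esub> ?\<theta> ?bb s v"
          show "?l s = ?r s"
          proof (rule LT_eqI[OF N l])
            fix w assume "w \<in> carrier N"
            then obtain v where v: "v \<in> carrier M" "w = ten elts b' M v"
              unfolding N_def by (rule LT_cases[OF M])
            show "?l s (ten elts b N w) = ?r s (ten elts b N w)"
              unfolding v(2) lv[OF v(1)] rv[OF v(1)] using e v(1) by simp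
          qed
        qed
      qed
      have "?l = ?r \<longleftrightarrow> (\<forall>s\<in>SC C. ?l s = ?r s)"
        by (auto simp: fun_eq_iff restrict_def)
      then show ?thesis using at by blast
    qed
    have unit: "\<epsilon> \<one>\<^bsub>GH\<^esub> = unit_T elts C V \<longleftrightarrow> (\<forall>s\<in>SC C. \<forall>v\<in>carrier (V s). ?\<theta> \<one>\<^bsub>GH\<^esub> s v = v)"
    proof -
      have "\<epsilon> \<one>\<^bsub>GH\<^esub> = unit_T elts C V \<longleftrightarrow> (\<forall>s\<in>SC C. \<epsilon> \<one>\<^bsub>GH\<^esub> s = unit_T elts C V s)"
        using \<epsilon>b[OF BH_one] by (auto simp: unit_T_def Let_def PiE_iff intro: extensionalityI)
      moreover have "\<epsilon> \<one>\<^bsub>GH\<^esub> s = unit_T elts C V s \<longleftrightarrow> (\<forall>v\<in>carrier (V s). ?\<theta> \<one>\<^bsub>GH\<^esub> s v = v)"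
        if s: "s \<in> SC C" for s
      proof
        assume "\<epsilon> \<one>\<^bsub>GH\<^esub> s = unit_T elts C V s"
        then show "\<forall>v\<in>carrier (V s). ?\<theta> \<one>\<^bsub>GH\<^esub> s v = v"
          using unit_T(2)[OF V s] s by (simp add: \<theta> sh_one)
      next
        assume e: "\<forall>v\<in>carrier (V s). ?\<theta> \<one>\<^bsub>GH\<^esub> s v = v"
        show "\<epsilon> \<one>\<^bsub>GH\<^esub> s = unit_T elts C V s"
          by (rule LT_eqI[OF fam[OF V s] _ unit_T(1)[OF V s]])
            (use e \<epsilon>bs[OF BH_one s] s unit_T(2)[OF V s] in \<open>simp_all add: \<theta> sh_one\<close>)
      qed
      ultimately show ?thesis by blast
    qed
    have ext: "\<epsilon> \<in> extensional BH" using \<epsilon> by (auto simp: PiE_iff)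
    show ?thesis
      unfolding is_action_def using V \<epsilon> ext iso mult unit \<theta>_lin
      by (simp add: IC_def Let_def cong: ball_cong)
  qed
  then show ?thesis by (simp add: X)
qed

lemma
  assumes X: "X \<in> Ob (IC elts \<alpha> C)"
  shows IC_fam: "fst X \<in> Ob (VC elts C)"
    and IC_space: "s \<in> SC C \<Longrightarrow> fst X s \<in> Ob (Vect elts)"
    and IC_mod: "s \<in> SC C \<Longrightarrow> module Lam (fst X s)"
    and act_lin: "\<lbrakk>b \<in> BH; s \<in> SC C\<rbrakk> \<Longrightarrow> lin (fst X (sh b s)) (fst X s) (act elts X b s)"
    and act_bij: "\<lbrakk>b \<in> BH; s \<in> SC C\<rbrakk> \<Longrightarrow>
        bij_betw (act elts X b s) (carrier (fst X (sh b s))) (carrier (fst X s))"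
    and act_mult: "\<lbrakk>b \<in> BH; b' \<in> BH; s \<in> SC C; v \<in> carrier (fst X (sh b' (sh b s)))\<rbrakk> \<Longrightarrow>
        act elts X b s (act elts X b' (sh b s) v) =
        sigma \<alpha> b b' \<odot>\<^bsub>fst X s\<^esub> act elts X (b \<otimes>\<^bsub>GH\<^esub> b') s v"
    and act_one: "\<lbrakk>s \<in> SC C; v \<in> carrier (fst X s)\<rbrakk> \<Longrightarrow> act elts X \<one>\<^bsub>GH\<^esub> s v = v"
proof -
  note X' = X[unfolded IC_ob_iff is_action_def]
  show "fst X \<in> Ob (VC elts C)" using X' by blast
  then show "s \<in> SC C \<Longrightarrow> fst X s \<in> Ob (Vect elts)" by (rule fam)
  then show "s \<in> SC C \<Longrightarrow> module Lam (fst X s)" by simp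
  show "\<lbrakk>b \<in> BH; s \<in> SC C\<rbrakk> \<Longrightarrow> lin (fst X (sh b s)) (fst X s) (act elts X b s)"
    "\<lbrakk>b \<in> BH; s \<in> SC C\<rbrakk> \<Longrightarrow> bij_betw (act elts X b s) (carrier (fst X (sh b s))) (carrier (fst X s))"
    "\<lbrakk>b \<in> BH; b' \<in> BH; s \<in> SC C; v \<in> carrier (fst X (sh b' (sh b s)))\<rbrakk> \<Longrightarrow>
        act elts X b s (act elts X b' (sh b s) v) =
        sigma \<alpha> b b' \<odot>\<^bsub>fst X s\<^esub> act elts X (b \<otimes>\<^bsub>GH\<^esub> b') s v"
    "\<lbrakk>s \<in> SC C; v \<in> carrier (fst X s)\<rbrakk> \<Longrightarrow> act elts X \<one>\<^bsub>GH\<^esub> s v = v"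
    using X' by blast+
qed

lemma IC_of_action:
  assumes V: "V \<in> Ob (VC elts C)" and \<theta>: "is_action \<alpha> C V \<theta>"
  obtains X where "X \<in> Ob (IC elts \<alpha> C)" "fst X = V"
    "\<And>b s v. \<lbrakk>b \<in> BH; s \<in> SC C; v \<in> carrier (V (sh b s))\<rbrakk> \<Longrightarrow> act elts X b s v = \<theta> b s v"
proof -
  have "\<exists>g. g \<in> lin_maps (LT elts b (V (sh b s))) (V s) \<and>
      (\<forall>v\<in>carrier (V (sh b s)). g (ten elts b (V (sh b s)) v) = \<theta> b s v)"
    if "b \<in> BH" "s \<in> SC C" for b :: "('k, 'n) dbl" and s
  proof -
    have "lin (V (sh b s)) (V s) (\<theta> b s)" using \<theta> that unfolding is_action_def by blast
    then show ?thesis by (rule LT_extend[where b = b, OF fam[OF V sh_in[OF that]]]) blast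
  qed
  then obtain g where g: "\<And>b s. \<lbrakk>b \<in> BH; s \<in> SC C\<rbrakk> \<Longrightarrow> g b s \<in> lin_maps (LT elts b (V (sh b s))) (V s) \<and>
      (\<forall>v\<in>carrier (V (sh b s)). g b s (ten elts b (V (sh b s)) v) = \<theta> b s v)" by metis
  define X where "X = (V, \<lambda>b\<in>BH. \<lambda>s\<in>SC C. g b s)"
  have fX: "fst X = V" by (simp add: X_def)
  have a: "act elts X b s v = \<theta> b s v" if "b \<in> BH" "s \<in> SC C" "v \<in> carrier (V (sh b s))"
    for b :: "('k, 'n) dbl" and s v
    using g[OF that(1,2)] that by (simp add: act_def X_def)
  have "is_action \<alpha> C V (act elts X)"
    unfolding is_action_def
  proof (intro conjI ballI)
    fix b :: "('k, 'n) dbl" and s assume b: "b \<in> BH" "s \<in> SC C"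
    have m: "module Lam (V (sh b s))" using fam[OF V sh_in[OF b]] by simp
    show "lin (V (sh b s)) (V s) (act elts X b s)"
    proof -
      have "lin (V (sh b s)) (V s) (act elts X b s) \<longleftrightarrow> lin (V (sh b s)) (V s) (\<theta> b s)"
        by (rule lin_cong[OF m a[OF b]])
      then show ?thesis using \<theta> b unfolding is_action_def by blast
    qed
    show "bij_betw (act elts X b s) (carrier (V (sh b s))) (carrier (V s))"
    proof -
      have "bij_betw (act elts X b s) (carrier (V (sh b s))) (carrier (V s)) \<longleftrightarrow>
          bij_betw (\<theta> b s) (carrier (V (sh b s))) (carrier (V s))"
        by (rule bij_betw_cong[OF a[OF b]])
      then show ?thesis using \<theta> b unfolding is_action_def by blast
    qed
  next
    fix b b' :: "('k, 'n) dbl" and s v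
    assume b: "b \<in> BH" "b' \<in> BH" "s \<in> SC C" and v: "v \<in> carrier (V (sh b' (sh b s)))"
    have s': "sh b s \<in> SC C" using b by (simp add: sh_in)
    have "lin (V (sh b' (sh b s))) (V (sh b s)) (\<theta> b' (sh b s))"
      using \<theta> b(2) s' unfolding is_action_def by blast
    then have "\<theta> b' (sh b s) v \<in> carrier (V (sh b s))" using v by (rule lin_in)
    moreover have "v \<in> carrier (V (sh (b \<otimes>\<^bsub>GH\<^esub> b') s))" using v by (simp add: sh_mult[OF b])
    ultimately show "act elts X b s (act elts X b' (sh b s) v) =
        sigma \<alpha> b b' \<odot>\<^bsub>V s\<^esub> act elts X (b \<otimes>\<^bsub>GH\<^esub> b') s v"
      using \<theta> b v s' unfolding is_action_def by (simp add: a BH_mult)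
  next
    fix s v assume "s \<in> SC C" "v \<in> carrier (V s)"
    then show "act elts X \<one>\<^bsub>GH\<^esub> s v = v"
      using a[OF BH_one, of s v] \<theta> unfolding is_action_def by (simp add: sh_one)
  qed
  moreover have "snd X \<in> (\<Pi>\<^sub>E b\<in>BH. \<Pi>\<^sub>E s\<in>SC C. lin_maps (LT elts b (V (sh b s))) (V s))"
    using g by (simp add: X_def)
  ultimately have "X \<in> Ob (IC elts \<alpha> C)" using V by (simp only: IC_ob_iff fX)
  then show thesis using fX a by (rule that)
qed

lemma IC_hom_iff:
  assumes X: "X \<in> Ob (IC elts \<alpha> C)" and Y: "Y \<in> Ob (IC elts \<alpha> C)"
  shows "f \<in> Hom (IC elts \<alpha> C) X Y \<longleftrightarrow> f \<in> (\<Pi>\<^sub>E s\<in>SC C. lin_maps (fst X s) (fst Y s)) \<and>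
    (\<forall>b\<in>BH. \<forall>s\<in>SC C. \<forall>v\<in>carrier (fst X (sh b s)). f s (act elts X b s v) = act elts Y b s (f (sh b s) v))"
proof (cases "f \<in> (\<Pi>\<^sub>E s\<in>SC C. lin_maps (fst X s) (fst Y s))")
  case True
  let ?T = "T_ftor elts C"
  note VX = IC_fam[OF X] and VY = IC_fam[OF Y]
  have f: "f \<in> Hom (VC elts C) (fst X) (fst Y)" using True by simp
  have \<epsilon>: "snd Z b s \<in> lin_maps (LT elts b (fst Z (sh b s))) (fst Z s)"
    if "Z \<in> Ob (IC elts \<alpha> C)" "b \<in> BH" "s \<in> SC C" for Z b s
    using that by (auto simp: IC_ob_iff)
  have "Cmp (VC elts C) (FOb (?T b) (fst X)) (fst X) (fst Y) f (snd X b) =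
      Cmp (VC elts C) (FOb (?T b) (fst X)) (FOb (?T b) (fst Y)) (fst Y) (snd Y b) (FMor (?T b) (fst X) (fst Y) f)
    \<longleftrightarrow> (\<forall>s\<in>SC C. \<forall>v\<in>carrier (fst X (sh b s)). f s (act elts X b s v) = act elts Y b s (f (sh b s) v))"
    (is "?l = ?r \<longleftrightarrow> _") if b: "b \<in> BH" for b
  proof -
    have at: "?l s = ?r s \<longleftrightarrow> (\<forall>v\<in>carrier (fst X (sh b s)). f s (act elts X b s v) = act elts Y b s (f (sh b s) v))"
      if s: "s \<in> SC C" for s
    proof -
      define M where "M = fst X (sh b s)"
      have M: "M \<in> Ob (Vect elts)" unfolding M_def by (rule IC_space[OF X sh_in[OF b s]])
      have mL: "module Lam (LT elts b M)" using LT_ob[OF M, of b] by simp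
      have fs: "f s \<in> lin_maps (fst X s) (fst Y s)" using True s by auto
      note \<epsilon>X = \<epsilon>[OF X b s, folded M_def] and \<epsilon>Y = \<epsilon>[OF Y b s]
      note Tm = T_mor[OF VX VY f b s, folded M_def]
      have TX: "FOb (?T b) (fst X) s = LT elts b M" using s by (simp add: T_ob[OF VX] M_def)
      have l: "?l s \<in> lin_maps (LT elts b M) (fst Y s)" "?r s \<in> lin_maps (LT elts b M) (fst Y s)"
        using s compose_lin_maps[OF mL \<epsilon>X fs] compose_lin_maps[OF mL Tm(1) \<epsilon>Y] by (simp_all add: TX)
      have t: "ten elts b M v \<in> carrier (LT elts b M)" if "v \<in> carrier M" for v
        by (rule lin_in[OF ten_lin[OF M] that])
      have lv: "?l s (ten elts b M v) = f s (act elts X b s v)" if "v \<in> carrier M" for v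
        using s t[OF that] by (simp add: TX compose_eq act_def M_def)
      have rv: "?r s (ten elts b M v) = act elts Y b s (f (sh b s) v)" if "v \<in> carrier M" for v
        using s t[OF that] Tm(2)[OF that] by (simp add: TX compose_eq act_def)
      show ?thesis
        unfolding M_def[symmetric] using LT_eqI[OF M l] lv rv by metis
    qed
    have "?l = ?r \<longleftrightarrow> (\<forall>s\<in>SC C. ?l s = ?r s)" by (auto simp: fun_eq_iff restrict_def)
    then show ?thesis using at by blast
  qed
  then show ?thesis using f True by (simp add: IC_simps cong: ball_cong)
qed (simp add: IC_simps)

end

section \<open>The fixed-level category is abelian\<close>

lemma lin_factor:
  assumes N: "module Lam N" and Q: "module Lam Q" and P: "module Lam P"
    and p: "lin N Q p" and surj: "p ` carrier N = carrier Q" and g: "lin N P g"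
    and k: "\<And>y. \<lbrakk>y \<in> carrier N; p y = \<zero>\<^bsub>Q\<^esub>\<rbrakk> \<Longrightarrow> g y = \<zero>\<^bsub>P\<^esub>"
  obtains h where "lin Q P h" "\<And>y. y \<in> carrier N \<Longrightarrow> h (p y) = g y"
proof -
  define h where "h q = g (inv_into (carrier N) p q)" for q
  have eq: "g y = g y'" if y: "y \<in> carrier N" "y' \<in> carrier N" and e: "p y = p y'" for y y'
  proof -
    have "p (msub N y y') = \<zero>\<^bsub>Q\<^esub>"
      unfolding lin_msub[OF N p y] using e msub_zero_iff[OF Q lin_in[OF p y(1)] lin_in[OF p y(2)]] by simp
    then have "msub P (g y) (g y') = \<zero>\<^bsub>P\<^esub>"
      using k[OF msub_in[OF N y]] lin_msub[OF N g y] by simp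
    then show ?thesis using msub_zero_iff[OF P lin_in[OF g y(1)] lin_in[OF g y(2)]] by blast
  qed
  have hp: "h (p y) = g y" if "y \<in> carrier N" for y
    unfolding h_def using that by (intro eq inv_into_into f_inv_into_f) auto
  have ex: "\<exists>y\<in>carrier N. q = p y" if "q \<in> carrier Q" for q using that surj by auto
  have "h q \<in> carrier P" if "q \<in> carrier Q" for q
    using ex[OF that] hp lin_in[OF g] by auto
  moreover have "h (q \<oplus>\<^bsub>Q\<^esub> q') = h q \<oplus>\<^bsub>P\<^esub> h q'" if q: "q \<in> carrier Q" "q' \<in> carrier Q" for q q'
  proof -
    obtain y y' where y: "y \<in> carrier N" "q = p y" "y' \<in> carrier N" "q' = p y'"
      using ex[OF q(1)] ex[OF q(2)] by blast
    then have "q \<oplus>\<^bsub>Q\<^esub> q' = p (y \<oplus>\<^bsub>N\<^esub> y')" by (simp add: lin_add[OF p])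
    then show ?thesis using y by (simp only: hp add_in[OF N] lin_add[OF g])
  qed
  moreover have "h (c \<odot>\<^bsub>Q\<^esub> q) = c \<odot>\<^bsub>P\<^esub> h q" if q: "q \<in> carrier Q" for q c
  proof -
    obtain y where y: "y \<in> carrier N" "q = p y" using ex[OF q] by blast
    then have "c \<odot>\<^bsub>Q\<^esub> q = p (c \<odot>\<^bsub>N\<^esub> y)" by (simp add: lin_smult[OF p])
    then show ?thesis using y by (simp only: hp smult_in[OF N] lin_smult[OF g])
  qed
  ultimately have "lin Q P h" by (simp add: lin_def)
  then show thesis using hp by (rule that)
qed

lemma lin_lift:
  assumes W: "module Lam W" and K: "module Lam K"
    and i: "lin K X i" and inj: "inj_on i (carrier K)" and g: "lin W X g"
    and im: "\<And>w. w \<in> carrier W \<Longrightarrow> g w \<in> i ` carrier K"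
  obtains h where "lin W K h" "\<And>w. w \<in> carrier W \<Longrightarrow> i (h w) = g w"
proof -
  define h where "h w = inv_into (carrier K) i (g w)" for w
  have h: "h w \<in> carrier K" "i (h w) = g w" if "w \<in> carrier W" for w
    using im[OF that] by (auto simp: h_def inv_into_into f_inv_into_f)
  have "h (w \<oplus>\<^bsub>W\<^esub> w') = h w \<oplus>\<^bsub>K\<^esub> h w'" if "w \<in> carrier W" "w' \<in> carrier W" for w w'
    using that h[of w] h[of w'] h[of "w \<oplus>\<^bsub>W\<^esub> w'"]
    by (intro inj_onD[OF inj]) (simp_all add: add_in W K lin_add[OF i] lin_add[OF g])
  moreover have "h (c \<odot>\<^bsub>W\<^esub> w) = c \<odot>\<^bsub>K\<^esub> h w" if "w \<in> carrier W" for w c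
    using that h[of w] h[of "c \<odot>\<^bsub>W\<^esub> w"]
    by (intro inj_onD[OF inj]) (simp_all add: smult_in W K lin_smult[OF i] lin_smult[OF g])
  ultimately have "lin W K h" using h by (simp add: lin_def)
  then show thesis using h(2) by (rule that)
qed

lemma Vect_moduleI:
  assumes "\<And>x y. \<lbrakk>x \<in> carrier M; y \<in> carrier M\<rbrakk> \<Longrightarrow> x \<oplus>\<^bsub>M\<^esub> y \<in> carrier M"
    and "\<zero>\<^bsub>M\<^esub> \<in> carrier M"
    and "\<And>c x. x \<in> carrier M \<Longrightarrow> c \<odot>\<^bsub>M\<^esub> x \<in> carrier M"
    and "\<And>x y z. \<lbrakk>x \<in> carrier M; y \<in> carrier M; z \<in> carrier M\<rbrakk> \<Longrightarrow>
      (x \<oplus>\<^bsub>M\<^esub> y) \<oplus>\<^bsub>M\<^esub> z = x \<oplus>\<^bsub>M\<^esub> (y \<oplus>\<^bsub>M\<^esub> z)"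
    and "\<And>x y. \<lbrakk>x \<in> carrier M; y \<in> carrier M\<rbrakk> \<Longrightarrow> x \<oplus>\<^bsub>M\<^esub> y = y \<oplus>\<^bsub>M\<^esub> x"
    and "\<And>x. x \<in> carrier M \<Longrightarrow> \<zero>\<^bsub>M\<^esub> \<oplus>\<^bsub>M\<^esub> x = x"
    and "\<And>x. x \<in> carrier M \<Longrightarrow> ((- 1) \<odot>\<^bsub>M\<^esub> x) \<oplus>\<^bsub>M\<^esub> x = \<zero>\<^bsub>M\<^esub>"
    and "\<And>c d x. x \<in> carrier M \<Longrightarrow> (c + d) \<odot>\<^bsub>M\<^esub> x = c \<odot>\<^bsub>M\<^esub> x \<oplus>\<^bsub>M\<^esub> d \<odot>\<^bsub>M\<^esub> x"
    and "\<And>c x y. \<lbrakk>x \<in> carrier M; y \<in> carrier M\<rbrakk> \<Longrightarrow> c \<odot>\<^bsub>M\<^esub> (x \<oplus>\<^bsub>M\<^esub> y) = c \<odot>\<^bsub>M\<^esub> x \<oplus>\<^bsub>M\<^esub> c \<odot>\<^bsub>M\<^esub> y"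
    and "\<And>c d x. x \<in> carrier M \<Longrightarrow> (c * d) \<odot>\<^bsub>M\<^esub> x = c \<odot>\<^bsub>M\<^esub> (d \<odot>\<^bsub>M\<^esub> x)"
    and "\<And>x. x \<in> carrier M \<Longrightarrow> 1 \<odot>\<^bsub>M\<^esub> x = x"
  shows "module Lam (M :: (lam, 'a) module)"
proof (intro moduleI abelian_groupI Lam_cring)
  show "\<exists>y\<in>carrier M. y \<oplus>\<^bsub>M\<^esub> x = \<zero>\<^bsub>M\<^esub>" if "x \<in> carrier M" for x
    using assms(3,7) that by blast
  show "x \<oplus>\<^bsub>M\<^esub> y = y \<oplus>\<^bsub>M\<^esub> x" if "x \<in> carrier M" "y \<in> carrier M" for x y
    using assms(5) that by blast
qed (simp_all add: assms(1-4,6,8-))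

lemma neg_add:
  assumes "module Lam M" "x \<in> carrier M" shows "((- 1) \<odot>\<^bsub>M\<^esub> x) \<oplus>\<^bsub>M\<^esub> x = \<zero>\<^bsub>M\<^esub>"
  using smult_add_left[OF assms, of "- 1" 1] assms by (simp add: smult_one smult_zero)

lemma
  assumes "module Lam M"
  shows vadd_assoc: "\<lbrakk>x \<in> carrier M; y \<in> carrier M; z \<in> carrier M\<rbrakk> \<Longrightarrow>
      (x \<oplus>\<^bsub>M\<^esub> y) \<oplus>\<^bsub>M\<^esub> z = x \<oplus>\<^bsub>M\<^esub> (y \<oplus>\<^bsub>M\<^esub> z)"
    and vadd_comm: "\<lbrakk>x \<in> carrier M; y \<in> carrier M\<rbrakk> \<Longrightarrow> x \<oplus>\<^bsub>M\<^esub> y = y \<oplus>\<^bsub>M\<^esub> x"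
    and vadd_lcomm: "\<lbrakk>x \<in> carrier M; y \<in> carrier M; z \<in> carrier M\<rbrakk> \<Longrightarrow>
      x \<oplus>\<^bsub>M\<^esub> (y \<oplus>\<^bsub>M\<^esub> z) = y \<oplus>\<^bsub>M\<^esub> (x \<oplus>\<^bsub>M\<^esub> z)"
    and vadd_zero: "x \<in> carrier M \<Longrightarrow> \<zero>\<^bsub>M\<^esub> \<oplus>\<^bsub>M\<^esub> x = x"
    and vadd_zero_right: "x \<in> carrier M \<Longrightarrow> x \<oplus>\<^bsub>M\<^esub> \<zero>\<^bsub>M\<^esub> = x"
    and vsmult_zero: "c \<odot>\<^bsub>M\<^esub> \<zero>\<^bsub>M\<^esub> = \<zero>\<^bsub>M\<^esub>"
proof -
  interpret M: module Lam M by fact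
  show "\<lbrakk>x \<in> carrier M; y \<in> carrier M; z \<in> carrier M\<rbrakk> \<Longrightarrow>
      (x \<oplus>\<^bsub>M\<^esub> y) \<oplus>\<^bsub>M\<^esub> z = x \<oplus>\<^bsub>M\<^esub> (y \<oplus>\<^bsub>M\<^esub> z)" by (rule M.a_assoc)
  show "\<lbrakk>x \<in> carrier M; y \<in> carrier M\<rbrakk> \<Longrightarrow> x \<oplus>\<^bsub>M\<^esub> y = y \<oplus>\<^bsub>M\<^esub> x" by (rule M.a_comm)
  show "\<lbrakk>x \<in> carrier M; y \<in> carrier M; z \<in> carrier M\<rbrakk> \<Longrightarrow>
      x \<oplus>\<^bsub>M\<^esub> (y \<oplus>\<^bsub>M\<^esub> z) = y \<oplus>\<^bsub>M\<^esub> (x \<oplus>\<^bsub>M\<^esub> z)" by (rule M.a_lcomm)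
  show "x \<in> carrier M \<Longrightarrow> \<zero>\<^bsub>M\<^esub> \<oplus>\<^bsub>M\<^esub> x = x" by (rule M.l_zero)
  show "x \<in> carrier M \<Longrightarrow> x \<oplus>\<^bsub>M\<^esub> \<zero>\<^bsub>M\<^esub> = x" by (rule M.r_zero)
  show "c \<odot>\<^bsub>M\<^esub> \<zero>\<^bsub>M\<^esub> = \<zero>\<^bsub>M\<^esub>" using M.smult_r_null[of c] by simp
qed

context grothendieck_universe
begin

lemma Vect_kernel:
  assumes M: "M \<in> Ob (Vect elts)" and N: "module Lam N" and f: "lin M N f"
  shows "M\<lparr>carrier := {x \<in> carrier M. f x = \<zero>\<^bsub>N\<^esub>}\<rparr> \<in> Ob (Vect elts)"
proof -
  let ?K = "M\<lparr>carrier := {x \<in> carrier M. f x = \<zero>\<^bsub>N\<^esub>}\<rparr>"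
  have m: "module Lam M" using M by simp
  obtain a where "carrier M = elts a" using M by auto
  then have "carrier ?K \<in> range elts" by (intro subsets[of _ a]) auto
  moreover have "module Lam ?K"
    by (rule Vect_moduleI)
      (auto simp: add_in[OF m] zero_in[OF m] smult_in[OF m] lin_add[OF f] lin_smult[OF f] lin_zero[OF m N f]
        vadd_assoc[OF m] vadd_zero[OF m] neg_add[OF m] smult_add_left[OF m] smult_add_right[OF m]
        smult_smult[OF m] smult_one[OF m] vadd_zero[OF N] zero_in[OF N] vsmult_zero[OF N] intro: vadd_comm[OF m])
  ultimately show ?thesis by simp
qed

text \<open>The quotient by the image of \<open>f\<close> is carried by a set of representatives of the cosets, a
  subset of \<open>N\<close> and hence small.\<close>

lemma Vect_quotient:
  assumes M: "module Lam M" and N: "N \<in> Ob (Vect elts)" and f: "lin M N f"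
  obtains Q p where "Q \<in> Ob (Vect elts)" "lin N Q p" "p ` carrier N = carrier Q"
    "{y \<in> carrier N. p y = \<zero>\<^bsub>Q\<^esub>} = f ` carrier M"
proof -
  have n: "module Lam N" and sm: "carrier N \<in> range elts" using N by auto
  define E where "E x y \<longleftrightarrow> y \<in> carrier N \<and> (\<exists>m\<in>carrier M. y = x \<oplus>\<^bsub>N\<^esub> f m)" for x y
  define r where "r x = (SOME y. E x y)" for x
  have fM: "f m \<in> carrier N" if "m \<in> carrier M" for m using lin_in[OF f that] .
  have E_refl: "E x x" if "x \<in> carrier N" for x
    unfolding E_def using that lin_zero[OF M n f] zero_in[OF M] vadd_zero_right[OF n that] by metis
  have E_sym: "E y x" if x: "x \<in> carrier N" and e: "E x y" for x y
  proof -
    obtain m where m: "m \<in> carrier M" "y = x \<oplus>\<^bsub>N\<^esub> f m" using e by (auto simp: E_def)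
    have c: "(- 1) \<odot>\<^bsub>N\<^esub> f m \<in> carrier N" using fM[OF m(1)] n by (simp add: smult_in)
    have "y \<oplus>\<^bsub>N\<^esub> f ((- 1) \<odot>\<^bsub>M\<^esub> m) = x \<oplus>\<^bsub>N\<^esub> (((- 1) \<odot>\<^bsub>N\<^esub> f m) \<oplus>\<^bsub>N\<^esub> f m)"
      using m x fM[OF m(1)] c by (simp add: lin_smult[OF f] vadd_assoc[OF n] vadd_comm[OF n, of "f m"])
    also have "\<dots> = x" using x fM[OF m(1)] by (simp add: neg_add[OF n] vadd_zero_right[OF n])
    finally show ?thesis using x m M unfolding E_def by (metis smult_in)
  qed
  have E_trans: "E x z" if x: "x \<in> carrier N" and e: "E x y" "E y z" for x y z
  proof -
    obtain m m' where m: "m \<in> carrier M" "y = x \<oplus>\<^bsub>N\<^esub> f m" "m' \<in> carrier M" "z = y \<oplus>\<^bsub>N\<^esub> f m'"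
      using e by (auto simp: E_def)
    have "z = x \<oplus>\<^bsub>N\<^esub> f (m \<oplus>\<^bsub>M\<^esub> m')" using m x fM by (simp add: lin_add[OF f] vadd_assoc[OF n])
    then show ?thesis using e m M unfolding E_def by (metis add_in)
  qed
  have E_in: "y \<in> carrier N" if "E x y" for x y using that by (simp add: E_def)
  have Er: "E x (r x)" if "x \<in> carrier N" for x unfolding r_def by (rule someI[of "E x", OF E_refl[OF that]])
  have r_in: "r x \<in> carrier N" if "x \<in> carrier N" for x using Er[OF that] by (rule E_in)
  have r_eq: "r x = r y" if "x \<in> carrier N" "E x y" for x y
  proof -
    have "E x = E y" using that E_sym E_trans E_in by (intro ext) metis
    then show ?thesis by (simp add: r_def)
  qed
  have rr: "r (r x) = r x" if "x \<in> carrier N" for x using r_eq[OF that Er[OF that]] by simp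
  have E_add: "E (x \<oplus>\<^bsub>N\<^esub> y) (x' \<oplus>\<^bsub>N\<^esub> y')" if xy: "x \<in> carrier N" "y \<in> carrier N" and e: "E x x'" "E y y'" for x x' y y'
  proof -
    obtain m m' where m: "m \<in> carrier M" "x' = x \<oplus>\<^bsub>N\<^esub> f m" "m' \<in> carrier M" "y' = y \<oplus>\<^bsub>N\<^esub> f m'"
      using e by (auto simp: E_def)
    have "x' \<oplus>\<^bsub>N\<^esub> y' = (x \<oplus>\<^bsub>N\<^esub> y) \<oplus>\<^bsub>N\<^esub> f (m \<oplus>\<^bsub>M\<^esub> m')"
      using m xy fM[OF m(1)] fM[OF m(3)]
      by (simp add: lin_add[OF f] vadd_assoc[OF n] add_in[OF n] vadd_lcomm[OF n, of "f m" y])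
    then show ?thesis using e m M n unfolding E_def by (metis add_in)
  qed
  have E_smult: "E (c \<odot>\<^bsub>N\<^esub> x) (c \<odot>\<^bsub>N\<^esub> x')" if x: "x \<in> carrier N" and e: "E x x'" for c x x'
  proof -
    obtain m where m: "m \<in> carrier M" "x' = x \<oplus>\<^bsub>N\<^esub> f m" using e by (auto simp: E_def)
    have "c \<odot>\<^bsub>N\<^esub> x' = (c \<odot>\<^bsub>N\<^esub> x) \<oplus>\<^bsub>N\<^esub> f (c \<odot>\<^bsub>M\<^esub> m)"
      using m x fM[OF m(1)] by (simp add: lin_smult[OF f] smult_add_right[OF n])
    then show ?thesis using e m M n unfolding E_def by (metis smult_in)
  qed
  define Q :: "(lam, 'v) module" where "Q = \<lparr>carrier = r ` carrier N, mult = undefined, one = undefined, zero = r \<zero>\<^bsub>N\<^esub>,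
    add = (\<lambda>u v. r (u \<oplus>\<^bsub>N\<^esub> v)), smult = (\<lambda>c u. r (c \<odot>\<^bsub>N\<^esub> u))\<rparr>"
  have Qs: "carrier Q = r ` carrier N" "\<zero>\<^bsub>Q\<^esub> = r \<zero>\<^bsub>N\<^esub>" "u \<oplus>\<^bsub>Q\<^esub> v = r (u \<oplus>\<^bsub>N\<^esub> v)"
    "c \<odot>\<^bsub>Q\<^esub> u = r (c \<odot>\<^bsub>N\<^esub> u)" for u v c
    by (simp_all add: Q_def)
  have radd: "r (r x \<oplus>\<^bsub>N\<^esub> r y) = r (x \<oplus>\<^bsub>N\<^esub> y)" if "x \<in> carrier N" "y \<in> carrier N" for x y
    using r_eq[OF add_in[OF n that] E_add[OF that Er[OF that(1)] Er[OF that(2)]]] by simp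
  have rsmult: "r (c \<odot>\<^bsub>N\<^esub> r x) = r (c \<odot>\<^bsub>N\<^esub> x)" if "x \<in> carrier N" for c x
    using r_eq[OF smult_in[OF n that] E_smult[OF that Er[OF that]]] by simp
  note cl = add_in[OF n] smult_in[OF n] zero_in[OF n]
  have Qadd: "r x \<oplus>\<^bsub>Q\<^esub> r y = r (x \<oplus>\<^bsub>N\<^esub> y)" if "x \<in> carrier N" "y \<in> carrier N" for x y
    using that by (simp add: Qs radd)
  have Qsm: "c \<odot>\<^bsub>Q\<^esub> r x = r (c \<odot>\<^bsub>N\<^esub> x)" if "x \<in> carrier N" for x c
    using that by (simp add: Qs rsmult)
  have "module Lam Q"
  proof (rule Vect_moduleI)
    show "\<zero>\<^bsub>Q\<^esub> \<in> carrier Q" by (simp add: Qs(1,2) cl)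
  qed (auto simp: Qs(1,2) Qadd Qsm cl vadd_assoc[OF n] vadd_zero[OF n] neg_add[OF n] smult_add_left[OF n]
      smult_add_right[OF n] smult_smult[OF n] smult_one[OF n] intro!: arg_cong[where f = r] vadd_comm[OF n])
  moreover have "carrier Q \<subseteq> carrier N" using r_in by (auto simp: Qs)
  then have "carrier Q \<in> range elts" using sm subsets by (metis imageE)
  ultimately have "Q \<in> Ob (Vect elts)" by simp
  moreover have "lin N Q r" by (simp add: lin_def Qs(1) Qadd Qsm)
  moreover have "{y \<in> carrier N. r y = \<zero>\<^bsub>Q\<^esub>} = f ` carrier M"
  proof (intro equalityI subsetI)
    fix y assume "y \<in> {y \<in> carrier N. r y = \<zero>\<^bsub>Q\<^esub>}"
    then have y: "y \<in> carrier N" "r y = r \<zero>\<^bsub>N\<^esub>" by (auto simp: Qs)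
    have "E y (r \<zero>\<^bsub>N\<^esub>)" using Er[OF y(1)] y(2) by simp
    moreover have "E (r \<zero>\<^bsub>N\<^esub>) \<zero>\<^bsub>N\<^esub>" by (rule E_sym[OF zero_in[OF n] Er[OF zero_in[OF n]]])
    ultimately have "E \<zero>\<^bsub>N\<^esub> y" using y(1) E_trans E_sym by blast
    then show "y \<in> f ` carrier M" using fM by (auto simp: E_def vadd_zero[OF n])
  next
    fix y assume "y \<in> f ` carrier M"
    then obtain m where m: "m \<in> carrier M" "y = f m" by blast
    then have "E \<zero>\<^bsub>N\<^esub> y" unfolding E_def m(2) using fM[OF m(1)] vadd_zero[OF n fM[OF m(1)]] m(1) by metis
    then show "y \<in> {y \<in> carrier N. r y = \<zero>\<^bsub>Q\<^esub>}"
      using r_eq[OF zero_in[OF n]] fM[OF m(1)] by (simp add: Qs m(2))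
  qed
  ultimately show thesis by (intro that[of Q r]) (simp_all add: Qs)
qed

lemma Vect_zero: obtains Z where "Z \<in> Ob (Vect elts)" "carrier Z = {\<zero>\<^bsub>Z\<^esub>}"
proof -
  define x :: 'v where "x = undefined"
  define Z :: "(lam, 'v) module" where "Z = \<lparr>carrier = {x}, mult = undefined, one = undefined, zero = x,
    add = (\<lambda>u v. x), smult = (\<lambda>c u. x)\<rparr>"
  have "module Lam Z" by (rule Vect_moduleI) (simp_all add: Z_def)
  moreover have "carrier Z \<in> range elts" using pairing[of x x] by (simp add: Z_def)
  ultimately show thesis using that[of Z] by (simp add: Z_def)
qed

text \<open>Kuratowski pairs, which embed the product of two small sets in the universe.\<close>

definition code :: "'v set \<Rightarrow> 'v" where "code = inv_into UNIV elts"

lemma elts_code: "S \<in> range elts \<Longrightarrow> elts (code S) = S"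
  by (simp add: code_def f_inv_into_f)

definition opair :: "'v \<Rightarrow> 'v \<Rightarrow> 'v" where "opair x y = code {code {x}, code {x, y}}"

lemma opair_eq_iff: "opair x y = opair x' y' \<longleftrightarrow> x = x' \<and> y = y'"
proof
  assume "opair x y = opair x' y'"
  then have "elts (opair x y) = elts (opair x' y')" by simp
  then have e: "{code {x}, code {x, y}} = {code {x'}, code {x', y'}}"
    by (simp add: opair_def elts_code pairing)
  have s: "{z} \<in> range elts" for z using pairing[of z z] by simp
  have "elts ` {code {x}, code {x, y}} = {{x}, {x, y}}" "elts ` {code {x'}, code {x', y'}} = {{x'}, {x', y'}}"
    by (simp_all add: elts_code pairing s)
  then have "{{x}, {x, y}} = {{x'}, {x', y'}}" unfolding e by simp
  then show "x = x' \<and> y = y'" by (auto simp: doubleton_eq_iff)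
qed simp

lemma product_small:
  assumes "S \<in> range elts" "T \<in> range elts" shows "(\<lambda>(x, y). opair x y) ` (S \<times> T) \<in> range elts"
proof -
  obtain a b where ab: "S = elts a" "T = elts b" using assms by blast
  obtain c where c: "elts c = {a, b}" using pairing[of a b] by (metis imageE)
  obtain u where u: "elts u = S \<union> T" using family_union[of "\<lambda>i. i" c] by (auto simp: c ab)
  obtain p where p: "elts p = {x. elts x \<subseteq> elts u}" using powerset[of u] by (metis imageE)
  obtain q where q: "elts q = {x. elts x \<subseteq> elts p}" using powerset[of p] by (metis imageE)
  have s: "{z} \<in> range elts" for z using pairing[of z z] by simp
  have "opair x y \<in> elts q" if "x \<in> S" "y \<in> T" for x y
    using that by (simp add: q p u opair_def elts_code pairing s)
  then show ?thesis by (intro subsets[of _ q]) auto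
qed

definition unpair :: "'v \<Rightarrow> 'v \<times> 'v" where "unpair = inv_into UNIV (\<lambda>(x, y). opair x y)"

lemma unpair [simp]: "unpair (opair x y) = (x, y)"
proof -
  have "inj (\<lambda>(x, y). opair x y)" by (auto simp: inj_def opair_eq_iff)
  from inv_f_f[OF this, of "(x, y)"] show ?thesis by (simp add: unpair_def)
qed

definition vprod :: "(lam, 'v) module \<Rightarrow> (lam, 'v) module \<Rightarrow> (lam, 'v) module" where
  "vprod M N = \<lparr>carrier = (\<lambda>(x, y). opair x y) ` (carrier M \<times> carrier N),
    mult = undefined, one = undefined, zero = opair \<zero>\<^bsub>M\<^esub> \<zero>\<^bsub>N\<^esub>,
    add = (\<lambda>u v. opair (fst (unpair u) \<oplus>\<^bsub>M\<^esub> fst (unpair v)) (snd (unpair u) \<oplus>\<^bsub>N\<^esub> snd (unpair v))),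
    smult = (\<lambda>c u. opair (c \<odot>\<^bsub>M\<^esub> fst (unpair u)) (c \<odot>\<^bsub>N\<^esub> snd (unpair u)))\<rparr>"

lemma vprod_simps:
  "u \<in> carrier (vprod M N) \<longleftrightarrow> (\<exists>x\<in>carrier M. \<exists>y\<in>carrier N. u = opair x y)"
  "\<zero>\<^bsub>vprod M N\<^esub> = opair \<zero>\<^bsub>M\<^esub> \<zero>\<^bsub>N\<^esub>"
  "opair x y \<oplus>\<^bsub>vprod M N\<^esub> opair x' y' = opair (x \<oplus>\<^bsub>M\<^esub> x') (y \<oplus>\<^bsub>N\<^esub> y')"
  "c \<odot>\<^bsub>vprod M N\<^esub> opair x y = opair (c \<odot>\<^bsub>M\<^esub> x) (c \<odot>\<^bsub>N\<^esub> y)"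
  by (auto simp: vprod_def)

lemma vprod_ob:
  assumes M: "M \<in> Ob (Vect elts)" and N: "N \<in> Ob (Vect elts)"
  shows "vprod M N \<in> Ob (Vect elts)"
proof -
  have m: "module Lam M" and n: "module Lam N" using M N by auto
  have "module Lam (vprod M N)"
    by (rule Vect_moduleI)
      (auto simp: vprod_simps opair_eq_iff add_in[OF m] smult_in[OF m] zero_in[OF m] vadd_assoc[OF m]
        vadd_zero[OF m] neg_add[OF m] smult_add_left[OF m] smult_add_right[OF m] smult_smult[OF m]
        smult_one[OF m] add_in[OF n] smult_in[OF n] zero_in[OF n] vadd_assoc[OF n] vadd_zero[OF n]
        neg_add[OF n] smult_add_left[OF n] smult_add_right[OF n] smult_smult[OF n] smult_one[OF n]
        intro: vadd_comm[OF m] vadd_comm[OF n])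
  moreover have "carrier (vprod M N) \<in> range elts"
    using M N by (simp add: vprod_def product_small)
  ultimately show ?thesis by simp
qed

end

context level
begin

abbreviation "\<I> \<equiv> IC elts \<alpha> C"

lemma
  assumes X: "X \<in> Ob \<I>" and Y: "Y \<in> Ob \<I>" and f: "f \<in> Hom \<I> X Y"
  shows hom_lin: "s \<in> SC C \<Longrightarrow> lin (fst X s) (fst Y s) (f s)"
    and hom_act: "\<lbrakk>b \<in> BH; s \<in> SC C; v \<in> carrier (fst X (sh b s))\<rbrakk> \<Longrightarrow>
      f s (act elts X b s v) = act elts Y b s (f (sh b s) v)"
  using f unfolding IC_hom_iff[OF X Y] by (auto simp: PiE_iff lin_maps_iff)

lemma hom_ext:
  assumes X: "X \<in> Ob \<I>" and Y: "Y \<in> Ob \<I>" and fg: "f \<in> Hom \<I> X Y" "g \<in> Hom \<I> X Y"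
    and e: "\<And>s x. \<lbrakk>s \<in> SC C; x \<in> carrier (fst X s)\<rbrakk> \<Longrightarrow> f s x = g s x"
  shows "f = g"
proof (rule PiE_ext)
  show "f \<in> (\<Pi>\<^sub>E s\<in>SC C. lin_maps (fst X s) (fst Y s))" "g \<in> (\<Pi>\<^sub>E s\<in>SC C. lin_maps (fst X s) (fst Y s))"
    using fg unfolding IC_hom_iff[OF X Y] by blast+
  then show "f s = g s" if "s \<in> SC C" for s
    using e[OF that] that by (intro lin_maps_eqI[of "f s" "fst X s" "fst Y s" "g s"]) auto
qed

lemma homI:
  assumes X: "X \<in> Ob \<I>" and Y: "Y \<in> Ob \<I>"
    and l: "\<And>s. s \<in> SC C \<Longrightarrow> lin (fst X s) (fst Y s) (f s)"
    and e: "\<And>b s v. \<lbrakk>b \<in> BH; s \<in> SC C; v \<in> carrier (fst X (sh b s))\<rbrakk> \<Longrightarrow>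
      f s (act elts X b s v) = act elts Y b s (f (sh b s) v)"
  shows "(\<lambda>s\<in>SC C. \<lambda>x\<in>carrier (fst X s). f s x) \<in> Hom \<I> X Y"
  unfolding IC_hom_iff[OF X Y]
proof (intro conjI ballI)
  show "(\<lambda>s\<in>SC C. \<lambda>x\<in>carrier (fst X s). f s x) \<in> (\<Pi>\<^sub>E s\<in>SC C. lin_maps (fst X s) (fst Y s))"
    by (intro restrict_PiE[THEN iffD2] Pi_I restrict_lin_maps IC_mod[OF X] l)
  fix b :: "('k, 'n) dbl" and s v
  assume b: "b \<in> BH" "s \<in> SC C" and v: "v \<in> carrier (fst X (sh b s))"
  have "act elts X b s v \<in> carrier (fst X s)" by (rule lin_in[OF act_lin[OF X b] v])
  then show "(\<lambda>s\<in>SC C. \<lambda>x\<in>carrier (fst X s). f s x) s (act elts X b s v) =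
      act elts Y b s ((\<lambda>s\<in>SC C. \<lambda>x\<in>carrier (fst X s). f s x) (sh b s) v)"
    using b v e sh_in[OF b] by simp
qed

lemma IC_ops:
  "Idm \<I> X = (\<lambda>s\<in>SC C. \<lambda>x\<in>carrier (fst X s). x)"
  "Cmp \<I> X Y Z g f = (\<lambda>s\<in>SC C. \<lambda>x\<in>carrier (fst X s). g s (f s x))"
  "Zero \<I> X Y = (\<lambda>s\<in>SC C. \<lambda>x\<in>carrier (fst X s). \<zero>\<^bsub>fst Y s\<^esub>)"
  "Add \<I> X Y f f' = (\<lambda>s\<in>SC C. \<lambda>x\<in>carrier (fst X s). f s x \<oplus>\<^bsub>fst Y s\<^esub> f' s x)"
  "Scale \<I> X Y c f = (\<lambda>s\<in>SC C. \<lambda>x\<in>carrier (fst X s). c \<odot>\<^bsub>fst Y s\<^esub> f s x)"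
  by (simp_all add: IC_simps compose_def)

lemma IC_id_in: "X \<in> Ob \<I> \<Longrightarrow> Idm \<I> X \<in> Hom \<I> X X"
  unfolding IC_ops by (rule homI) (simp_all add: lin_def)

lemma
  assumes X: "X \<in> Ob \<I>" and Y: "Y \<in> Ob \<I>"
  shows IC_cmp_in: "\<lbrakk>Z \<in> Ob \<I>; f \<in> Hom \<I> X Y; g \<in> Hom \<I> Y Z\<rbrakk> \<Longrightarrow> Cmp \<I> X Y Z g f \<in> Hom \<I> X Z"
    and IC_zero_in: "Zero \<I> X Y \<in> Hom \<I> X Y"
    and IC_add_in: "\<lbrakk>f \<in> Hom \<I> X Y; f' \<in> Hom \<I> X Y\<rbrakk> \<Longrightarrow> Add \<I> X Y f f' \<in> Hom \<I> X Y"
    and IC_scale_in: "f \<in> Hom \<I> X Y \<Longrightarrow> Scale \<I> X Y c f \<in> Hom \<I> X Y"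
proof -
  note mX = IC_mod[OF X] and mY = IC_mod[OF Y]
  show "Cmp \<I> X Y Z g f \<in> Hom \<I> X Z" if Z: "Z \<in> Ob \<I>" and f: "f \<in> Hom \<I> X Y" and g: "g \<in> Hom \<I> Y Z"
    unfolding IC_ops
    by (rule homI[OF X Z])
      (simp_all add: lin_comp[OF hom_lin[OF X Y f] hom_lin[OF Y Z g]] hom_act[OF X Y f] hom_act[OF Y Z g]
        lin_in[OF hom_lin[OF X Y f]] sh_in)
  show "Zero \<I> X Y \<in> Hom \<I> X Y" unfolding IC_ops
  proof (rule homI[OF X Y])
    show "lin (fst X s) (fst Y s) (\<lambda>x. \<zero>\<^bsub>fst Y s\<^esub>)" if "s \<in> SC C" for s
      using mY[OF that] by (simp add: lin_def zero_in vadd_zero vsmult_zero)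
    show "\<zero>\<^bsub>fst Y s\<^esub> = act elts Y b s \<zero>\<^bsub>fst Y (sh b s)\<^esub>" if "b \<in> BH" "s \<in> SC C" for b s
      using lin_zero[OF mY[OF sh_in[OF that]] mY[OF that(2)] act_lin[OF Y that]] by simp
  qed
  show "Add \<I> X Y f f' \<in> Hom \<I> X Y" if f: "f \<in> Hom \<I> X Y" and f': "f' \<in> Hom \<I> X Y" unfolding IC_ops
  proof (rule homI[OF X Y])
    show "lin (fst X s) (fst Y s) (\<lambda>x. f s x \<oplus>\<^bsub>fst Y s\<^esub> f' s x)" if s: "s \<in> SC C" for s
      using mY[OF s] lin_in[OF hom_lin[OF X Y f s]] lin_in[OF hom_lin[OF X Y f' s]]
      by (simp add: lin_def lin_add[OF hom_lin[OF X Y f s]] lin_add[OF hom_lin[OF X Y f' s]]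
          lin_smult[OF hom_lin[OF X Y f s]] lin_smult[OF hom_lin[OF X Y f' s]] add_in smult_add_right
          vadd_assoc vadd_lcomm)
    show "f s (act elts X b s v) \<oplus>\<^bsub>fst Y s\<^esub> f' s (act elts X b s v) =
        act elts Y b s (f (sh b s) v \<oplus>\<^bsub>fst Y (sh b s)\<^esub> f' (sh b s) v)"
      if b: "b \<in> BH" "s \<in> SC C" and v: "v \<in> carrier (fst X (sh b s))" for b s v
      using lin_add[OF act_lin[OF Y b] lin_in[OF hom_lin[OF X Y f sh_in[OF b]] v] lin_in[OF hom_lin[OF X Y f' sh_in[OF b]] v]]
      by (simp add: hom_act[OF X Y f b v] hom_act[OF X Y f' b v])
  qed
  show "Scale \<I> X Y c f \<in> Hom \<I> X Y" if f: "f \<in> Hom \<I> X Y" unfolding IC_ops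
  proof (rule homI[OF X Y])
    show "lin (fst X s) (fst Y s) (\<lambda>x. c \<odot>\<^bsub>fst Y s\<^esub> f s x)" if s: "s \<in> SC C" for s
      using mY[OF s] lin_in[OF hom_lin[OF X Y f s]]
      by (simp add: lin_def lin_add[OF hom_lin[OF X Y f s]] lin_smult[OF hom_lin[OF X Y f s]]
          smult_in smult_add_right smult_smult mult.commute)
    show "c \<odot>\<^bsub>fst Y s\<^esub> f s (act elts X b s v) = act elts Y b s (c \<odot>\<^bsub>fst Y (sh b s)\<^esub> f (sh b s) v)"
      if b: "b \<in> BH" "s \<in> SC C" and v: "v \<in> carrier (fst X (sh b s))" for b s v
      using lin_smult[OF act_lin[OF Y b] lin_in[OF hom_lin[OF X Y f sh_in[OF b]] v]]
      by (simp add: hom_act[OF X Y f b v])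
  qed
qed

lemma IC_linear: "linear_category Lam \<I>"
proof -
  have ext: "f = g" if "X \<in> Ob \<I>" "Y \<in> Ob \<I>" "f \<in> Hom \<I> X Y" "g \<in> Hom \<I> X Y"
    "\<And>s x. \<lbrakk>s \<in> SC C; x \<in> carrier (fst X s)\<rbrakk> \<Longrightarrow> f s x = g s x" for X Y f g
    using that by (rule hom_ext)
  have m: "module Lam (hom_module \<I> X Y)" if XY: "X \<in> Ob \<I>" "Y \<in> Ob \<I>" for X Y
  proof -
    note cl = IC_zero_in[OF XY] IC_add_in[OF XY] IC_scale_in[OF XY]
    note li = lin_in[OF hom_lin[OF XY]]
    note mY = IC_mod[OF XY(2)]
    show ?thesis
    proof (rule hom_moduleI)
      show "Add \<I> X Y f g = Add \<I> X Y g f" if "f \<in> Hom \<I> X Y" "g \<in> Hom \<I> X Y" for f g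
        by (rule ext[OF XY]) (use that in \<open>simp_all add: cl, simp add: IC_ops li vadd_comm[OF mY]\<close>)
      show "Add \<I> X Y (Add \<I> X Y f g) h = Add \<I> X Y f (Add \<I> X Y g h)"
        if "f \<in> Hom \<I> X Y" "g \<in> Hom \<I> X Y" "h \<in> Hom \<I> X Y" for f g h
        by (rule ext[OF XY]) (use that in \<open>simp_all add: cl, simp add: IC_ops li vadd_assoc[OF mY]\<close>)
      show "Add \<I> X Y (Zero \<I> X Y) f = f" if "f \<in> Hom \<I> X Y" for f
        by (rule ext[OF XY]) (use that in \<open>simp_all add: cl, simp add: IC_ops li vadd_zero[OF mY]\<close>)
      show "Add \<I> X Y (Scale \<I> X Y (\<ominus>\<^bsub>Lam\<^esub> \<one>\<^bsub>Lam\<^esub>) f) f = Zero \<I> X Y" if "f \<in> Hom \<I> X Y" for f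
        by (rule ext[OF XY]) (use that in \<open>simp_all add: cl, simp add: IC_ops li neg_add[OF mY]\<close>)
      show "Scale \<I> X Y (a \<oplus>\<^bsub>Lam\<^esub> b) f = Add \<I> X Y (Scale \<I> X Y a f) (Scale \<I> X Y b f)"
        if "f \<in> Hom \<I> X Y" for a b f
        by (rule ext[OF XY]) (use that in \<open>simp_all add: cl, simp add: IC_ops li smult_add_left[OF mY]\<close>)
      show "Scale \<I> X Y a (Add \<I> X Y f g) = Add \<I> X Y (Scale \<I> X Y a f) (Scale \<I> X Y a g)"
        if "f \<in> Hom \<I> X Y" "g \<in> Hom \<I> X Y" for a f g
        by (rule ext[OF XY]) (use that in \<open>simp_all add: cl, simp add: IC_ops li smult_add_right[OF mY]\<close>)
      show "Scale \<I> X Y (a \<otimes>\<^bsub>Lam\<^esub> b) f = Scale \<I> X Y a (Scale \<I> X Y b f)"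
        if "f \<in> Hom \<I> X Y" for a b f
        by (rule ext[OF XY]) (use that in \<open>simp_all add: cl, simp add: IC_ops li smult_smult[OF mY]\<close>)
      show "Scale \<I> X Y \<one>\<^bsub>Lam\<^esub> f = f" if "f \<in> Hom \<I> X Y" for f
        by (rule ext[OF XY]) (use that in \<open>simp_all add: cl, simp add: IC_ops li smult_one[OF mY]\<close>)
    qed (simp_all add: Lam_cring cl)
  qed
  show ?thesis
    unfolding linear_category_def is_category_def
  proof (intro conjI ballI)
    show "Idm \<I> X \<in> Hom \<I> X X" if "X \<in> Ob \<I>" for X using that by (rule IC_id_in)
    show "Cmp \<I> X Y Z g f \<in> Hom \<I> X Z"
      if "X \<in> Ob \<I>" "Y \<in> Ob \<I>" "Z \<in> Ob \<I>" "f \<in> Hom \<I> X Y" "g \<in> Hom \<I> Y Z" for X Y Z f g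
      using that by (rule IC_cmp_in)
    show "Cmp \<I> X X Y f (Idm \<I> X) = f" "Cmp \<I> X Y Y (Idm \<I> Y) f = f"
      if o: "X \<in> Ob \<I>" "Y \<in> Ob \<I>" and f: "f \<in> Hom \<I> X Y" for X Y f
      by (rule ext[OF o]; (intro IC_cmp_in IC_id_in o f | simp add: IC_ops lin_in[OF hom_lin[OF o f]]))+
    show "Cmp \<I> W Y Z h (Cmp \<I> W X Y g f) = Cmp \<I> W X Z (Cmp \<I> X Y Z h g) f"
      if o: "W \<in> Ob \<I>" "X \<in> Ob \<I>" "Y \<in> Ob \<I>" "Z \<in> Ob \<I>"
        and f: "f \<in> Hom \<I> W X" "g \<in> Hom \<I> X Y" "h \<in> Hom \<I> Y Z" for W X Y Z f g h
      by (rule ext[OF o(1,4)]; (intro IC_cmp_in o f | simp add: IC_ops lin_in[OF hom_lin[OF o(1,2) f(1)]]))+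
    show "module Lam (hom_module \<I> X Y)" if "X \<in> Ob \<I>" "Y \<in> Ob \<I>" for X Y using that by (rule m)
    fix X Y Z f g assume o: "X \<in> Ob \<I>" "Y \<in> Ob \<I>" "Z \<in> Ob \<I>" and f: "f \<in> Hom \<I> X Y" and g: "g \<in> Hom \<I> Y Z"
    note lf = lin_in[OF hom_lin[OF o(1,2) f]] and lg = lin_in[OF hom_lin[OF o(2,3) g]]
    show "Cmp \<I> X Y Z g (Add \<I> X Y f f') = Add \<I> X Z (Cmp \<I> X Y Z g f) (Cmp \<I> X Y Z g f')"
      if f': "f' \<in> Hom \<I> X Y" for f'
      by (rule ext[OF o(1,3)]; (intro IC_cmp_in IC_add_in o f f' g |
            simp add: IC_ops lf lin_in[OF hom_lin[OF o(1,2) f']] lin_add[OF hom_lin[OF o(2,3) g]]))+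
    show "Cmp \<I> X Y Z (Add \<I> Y Z g g') f = Add \<I> X Z (Cmp \<I> X Y Z g f) (Cmp \<I> X Y Z g' f)"
      if g': "g' \<in> Hom \<I> Y Z" for g'
      by (rule ext[OF o(1,3)]; (intro IC_cmp_in IC_add_in o f g g' | simp add: IC_ops lf))+
    fix c
    show "Cmp \<I> X Y Z g (Scale \<I> X Y c f) = Scale \<I> X Z c (Cmp \<I> X Y Z g f)"
      by (rule ext[OF o(1,3)]; (intro IC_cmp_in IC_scale_in o f g |
            simp add: IC_ops lf lin_smult[OF hom_lin[OF o(2,3) g]]))+
    show "Cmp \<I> X Y Z (Scale \<I> Y Z c g) f = Scale \<I> X Z c (Cmp \<I> X Y Z g f)"
      by (rule ext[OF o(1,3)]; (intro IC_cmp_in IC_scale_in o f g | simp add: IC_ops lf))+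
  qed
qed

end

context level
begin

definition ptw_kernel where
  "ptw_kernel X Y f K i \<longleftrightarrow> K \<in> Ob \<I> \<and> i \<in> Hom \<I> K X \<and>
    (\<forall>s\<in>SC C. inj_on (i s) (carrier (fst K s)) \<and>
       i s ` carrier (fst K s) = {x \<in> carrier (fst X s). f s x = \<zero>\<^bsub>fst Y s\<^esub>})"

definition ptw_cokernel where
  "ptw_cokernel X Y f Q p \<longleftrightarrow> Q \<in> Ob \<I> \<and> p \<in> Hom \<I> Y Q \<and>
    (\<forall>s\<in>SC C. p s ` carrier (fst Y s) = carrier (fst Q s) \<and>
       {y \<in> carrier (fst Y s). p s y = \<zero>\<^bsub>fst Q s\<^esub>} = f s ` carrier (fst X s))"

interpretation I: lin_cat Lam \<I> by unfold_locales (rule IC_linear)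

lemma cmp_at: "\<lbrakk>s \<in> SC C; x \<in> carrier (fst X s)\<rbrakk> \<Longrightarrow> Cmp \<I> X Y Z g f s x = g s (f s x)"
  and zero_at: "\<lbrakk>s \<in> SC C; x \<in> carrier (fst X s)\<rbrakk> \<Longrightarrow> Zero \<I> X Y s x = \<zero>\<^bsub>fst Y s\<^esub>"
  and id_at: "\<lbrakk>s \<in> SC C; x \<in> carrier (fst X s)\<rbrakk> \<Longrightarrow> Idm \<I> X s x = x"
  by (simp_all add: IC_ops)

text \<open>The factorization through \<open>i\<close> is forced at each coset because \<open>i\<close> is injective there, and for the same
  reason it commutes with the action.\<close>

lemma ptw_kernel_is_kernel:
  assumes X: "X \<in> Ob \<I>" and Y: "Y \<in> Ob \<I>" and f: "f \<in> Hom \<I> X Y" and k: "ptw_kernel X Y f K i"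
  shows "is_kernel \<I> X Y f K i"
proof -
  have K: "K \<in> Ob \<I>" and i: "i \<in> Hom \<I> K X"
    and inj: "\<And>s. s \<in> SC C \<Longrightarrow> inj_on (i s) (carrier (fst K s))"
    and im: "\<And>s. s \<in> SC C \<Longrightarrow> i s ` carrier (fst K s) = {x \<in> carrier (fst X s). f s x = \<zero>\<^bsub>fst Y s\<^esub>}"
    using k by (auto simp: ptw_kernel_def)
  have "Cmp \<I> K X Y f i = Zero \<I> K Y"
  proof (rule hom_ext[OF K Y])
    show "Cmp \<I> K X Y f i s x = Zero \<I> K Y s x" if "s \<in> SC C" "x \<in> carrier (fst K s)" for s x
      using im[OF that(1)] that by (auto simp: cmp_at zero_at)
  qed (use K X Y f i in \<open>auto intro: I.cmp_in I.zero_in\<close>)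
  moreover have "\<exists>!l. l \<in> Hom \<I> W K \<and> Cmp \<I> W K X i l = g"
    if W: "W \<in> Ob \<I>" and g: "g \<in> Hom \<I> W X" and z: "Cmp \<I> W X Y f g = Zero \<I> W Y" for W g
  proof -
    have gim: "g s w \<in> i s ` carrier (fst K s)" if s: "s \<in> SC C" and w: "w \<in> carrier (fst W s)" for s w
      using fun_cong[OF fun_cong[OF z, of s], of w] lin_in[OF hom_lin[OF W X g s] w] s w
      by (simp add: cmp_at zero_at im)
    have "\<exists>h. lin (fst W s) (fst K s) h \<and> (\<forall>w\<in>carrier (fst W s). i s (h w) = g s w)" if s: "s \<in> SC C" for s
      by (rule lin_lift[OF IC_mod[OF W s] IC_mod[OF K s] hom_lin[OF K X i s] inj[OF s] hom_lin[OF W X g s] gim[OF s]])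
        auto
    then obtain h where h: "\<And>s. s \<in> SC C \<Longrightarrow> lin (fst W s) (fst K s) (h s)"
      and ih: "\<And>s w. \<lbrakk>s \<in> SC C; w \<in> carrier (fst W s)\<rbrakk> \<Longrightarrow> i s (h s w) = g s w" by metis
    let ?l = "\<lambda>s\<in>SC C. \<lambda>w\<in>carrier (fst W s). h s w"
    have l: "?l \<in> Hom \<I> W K"
    proof (rule homI[OF W K h])
      fix b :: "('k, 'n) dbl" and s v assume b: "b \<in> BH" "s \<in> SC C" and v: "v \<in> carrier (fst W (sh b s))"
      note s' = sh_in[OF b] and a = lin_in[OF act_lin[OF W b] v]
      have "i s (h s (act elts W b s v)) = i s (act elts K b s (h (sh b s) v))"
        using ih[OF b(2) a] hom_act[OF W X g b v] hom_act[OF K X i b lin_in[OF h[OF s'] v]] ih[OF s' v] by simp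
      then show "h s (act elts W b s v) = act elts K b s (h (sh b s) v)"
        by (rule inj_onD[OF inj[OF b(2)]])
          (rule lin_in[OF h[OF b(2)] a], rule lin_in[OF act_lin[OF K b] lin_in[OF h[OF s'] v]])
    qed
    show ?thesis
    proof (rule ex1I[of _ ?l], intro conjI l)
      show "Cmp \<I> W K X i ?l = g"
        by (rule hom_ext[OF W X I.cmp_in[OF W K X l i] g]) (simp add: cmp_at ih)
      fix l' assume l': "l' \<in> Hom \<I> W K \<and> Cmp \<I> W K X i l' = g"
      show "l' = ?l"
      proof (rule hom_ext[OF W K _ l])
        fix s w assume s: "s \<in> SC C" and w: "w \<in> carrier (fst W s)"
        have "i s (l' s w) = i s (?l s w)" using l' s w ih cmp_at[OF s w, of K X i l'] by simp
        moreover have "l' s w \<in> carrier (fst K s)"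
          using l' by (intro lin_in[OF hom_lin[OF W K _ s] w]) blast
        moreover have "?l s w \<in> carrier (fst K s)" using lin_in[OF h[OF s] w] s w by simp
        ultimately show "l' s w = ?l s w" by (rule inj_onD[OF inj[OF s]])
      qed (use l' in blast)
    qed
  qed
  ultimately show ?thesis unfolding is_kernel_def using K i by blast
qed

text \<open>The factorization through \<open>p\<close> is checked to commute with the action on lifts of elements along the
  surjection \<open>p\<close>.\<close>

lemma ptw_cokernel_is_cokernel:
  assumes X: "X \<in> Ob \<I>" and Y: "Y \<in> Ob \<I>" and f: "f \<in> Hom \<I> X Y" and c: "ptw_cokernel X Y f Q p"
  shows "is_cokernel \<I> X Y f Q p"
proof -
  have Q: "Q \<in> Ob \<I>" and p: "p \<in> Hom \<I> Y Q"
    and surj: "\<And>s. s \<in> SC C \<Longrightarrow> p s ` carrier (fst Y s) = carrier (fst Q s)"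
    and ker: "\<And>s. s \<in> SC C \<Longrightarrow> {y \<in> carrier (fst Y s). p s y = \<zero>\<^bsub>fst Q s\<^esub>} = f s ` carrier (fst X s)"
    using c by (auto simp: ptw_cokernel_def)
  have "Cmp \<I> X Y Q p f = Zero \<I> X Q"
  proof (rule hom_ext[OF X Q])
    show "Cmp \<I> X Y Q p f s x = Zero \<I> X Q s x" if "s \<in> SC C" "x \<in> carrier (fst X s)" for s x
      using ker[OF that(1)] that by (auto simp: cmp_at zero_at)
  qed (use Q X Y f p in \<open>auto intro: I.cmp_in I.zero_in\<close>)
  moreover have "\<exists>!l. l \<in> Hom \<I> Q W \<and> Cmp \<I> Y Q W l p = g"
    if W: "W \<in> Ob \<I>" and g: "g \<in> Hom \<I> Y W" and z: "Cmp \<I> X Y W g f = Zero \<I> X W" for W g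
  proof -
    have gk: "g s y = \<zero>\<^bsub>fst W s\<^esub>" if s: "s \<in> SC C" and y: "y \<in> carrier (fst Y s)" "p s y = \<zero>\<^bsub>fst Q s\<^esub>" for s y
    proof -
      obtain x where x: "x \<in> carrier (fst X s)" "y = f s x" using ker[OF s] y by blast
      then show ?thesis
        using fun_cong[OF fun_cong[OF z, of s], of x] s by (simp add: cmp_at zero_at)
    qed
    have "\<exists>h. lin (fst Q s) (fst W s) h \<and> (\<forall>y\<in>carrier (fst Y s). h (p s y) = g s y)" if s: "s \<in> SC C" for s
      by (rule lin_factor[OF IC_mod[OF Y s] IC_mod[OF Q s] IC_mod[OF W s] hom_lin[OF Y Q p s] surj[OF s]
            hom_lin[OF Y W g s] gk[OF s]]) auto
    then obtain h where h: "\<And>s. s \<in> SC C \<Longrightarrow> lin (fst Q s) (fst W s) (h s)"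
      and hp: "\<And>s y. \<lbrakk>s \<in> SC C; y \<in> carrier (fst Y s)\<rbrakk> \<Longrightarrow> h s (p s y) = g s y" by metis
    let ?l = "\<lambda>s\<in>SC C. \<lambda>q\<in>carrier (fst Q s). h s q"
    have pre: "\<exists>y\<in>carrier (fst Y s). q = p s y" if "s \<in> SC C" "q \<in> carrier (fst Q s)" for s q
      using surj[OF that(1)] that(2) by auto
    have l: "?l \<in> Hom \<I> Q W"
    proof (rule homI[OF Q W h])
      fix b :: "('k, 'n) dbl" and s v assume b: "b \<in> BH" "s \<in> SC C" and v: "v \<in> carrier (fst Q (sh b s))"
      obtain y where y: "y \<in> carrier (fst Y (sh b s))" "v = p (sh b s) y" using pre[OF sh_in[OF b] v] by blast
      have "h s (act elts Q b s v) = g s (act elts Y b s y)"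
        using hom_act[OF Y Q p b y(1)] hp[OF b(2) lin_in[OF act_lin[OF Y b] y(1)]] y(2) by simp
      also have "\<dots> = act elts W b s (h (sh b s) v)"
        using hom_act[OF Y W g b y(1)] hp[OF sh_in[OF b] y(1)] y(2) by simp
      finally show "h s (act elts Q b s v) = act elts W b s (h (sh b s) v)" .
    qed
    show ?thesis
    proof (rule ex1I[of _ ?l], intro conjI l)
      show "Cmp \<I> Y Q W ?l p = g"
        by (rule hom_ext[OF Y W I.cmp_in[OF Y Q W p l] g]) (simp add: cmp_at hp lin_in[OF hom_lin[OF Y Q p]])
      fix l' assume l': "l' \<in> Hom \<I> Q W \<and> Cmp \<I> Y Q W l' p = g"
      show "l' = ?l"
      proof (rule hom_ext[OF Q W _ l])
        fix s q assume s: "s \<in> SC C" and q: "q \<in> carrier (fst Q s)"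
        obtain y where y: "y \<in> carrier (fst Y s)" "q = p s y" using pre[OF s q] by blast
        then show "l' s q = ?l s q" using l' s q hp[OF s y(1)] cmp_at[OF s y(1), of Q W l' p] by simp
      qed (use l' in blast)
    qed
  qed
  ultimately show ?thesis unfolding is_cokernel_def using Q p by blast
qed

end

locale univ_level = level elts \<alpha> C + grothendieck_universe elts
  for elts :: "'v \<Rightarrow> 'v set" and \<alpha> :: "'n::{finite, linorder} \<Rightarrow> lam"
    and C :: "('k::field, 'n) dbl set"
begin

interpretation I: lin_cat Lam \<I> by unfold_locales (rule IC_linear)

text \<open>The action maps of \<open>Y\<close> are injective, so those of \<open>X\<close> restrict to bijections between the kernels of \<open>f\<close>
  at different cosets.\<close>

lemma ptw_kernel_exists:
  assumes X: "X \<in> Ob \<I>" and Y: "Y \<in> Ob \<I>" and f: "f \<in> Hom \<I> X Y"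
  obtains K i where "ptw_kernel X Y f K i"
proof -
  define V where "V = (\<lambda>s\<in>SC C. (fst X s)\<lparr>carrier := {x \<in> carrier (fst X s). f s x = \<zero>\<^bsub>fst Y s\<^esub>}\<rparr>)"
  have Vs: "V s = (fst X s)\<lparr>carrier := {x \<in> carrier (fst X s). f s x = \<zero>\<^bsub>fst Y s\<^esub>}\<rparr>" if "s \<in> SC C" for s
    using that by (simp add: V_def)
  have V: "V \<in> Ob (VC elts C)"
    unfolding VC_simps V_def
    by (intro restrict_PiE[THEN iffD2] Pi_I Vect_kernel IC_space[OF X] IC_mod[OF Y] hom_lin[OF X Y f])
  have f_act: "f s (act elts X b s v) = \<zero>\<^bsub>fst Y s\<^esub> \<longleftrightarrow> f (sh b s) v = \<zero>\<^bsub>fst Y (sh b s)\<^esub>"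
    if b: "b \<in> BH" "s \<in> SC C" and v: "v \<in> carrier (fst X (sh b s))" for b s v
  proof -
    have "inj_on (act elts Y b s) (carrier (fst Y (sh b s)))" using act_bij[OF Y b] by (simp add: bij_betw_def)
    then show ?thesis
      using hom_act[OF X Y f b v] lin_zero[OF IC_mod[OF Y sh_in[OF b]] IC_mod[OF Y b(2)] act_lin[OF Y b]]
        lin_in[OF hom_lin[OF X Y f sh_in[OF b]] v] zero_in[OF IC_mod[OF Y sh_in[OF b]]]
      by (metis inj_onD)
  qed
  have "is_action \<alpha> C V (act elts X)"
    unfolding is_action_def
  proof (intro conjI ballI)
    fix b :: "('k, 'n) dbl" and s assume b: "b \<in> BH" "s \<in> SC C"
    note s' = sh_in[OF b]
    show "lin (V (sh b s)) (V s) (act elts X b s)"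
      using act_lin[OF X b] f_act[OF b] by (simp add: Vs b s' lin_def)
    show "bij_betw (act elts X b s) (carrier (V (sh b s))) (carrier (V s))"
    proof -
      have "act elts X b s ` {v \<in> carrier (fst X (sh b s)). f (sh b s) v = \<zero>\<^bsub>fst Y (sh b s)\<^esub>} =
          {w \<in> carrier (fst X s). f s w = \<zero>\<^bsub>fst Y s\<^esub>}"
      proof (intro equalityI subsetI)
        fix w assume w: "w \<in> {w \<in> carrier (fst X s). f s w = \<zero>\<^bsub>fst Y s\<^esub>}"
        then obtain v where "v \<in> carrier (fst X (sh b s))" "w = act elts X b s v"
          using act_bij[OF X b] by (auto simp: bij_betw_def)
        then show "w \<in> act elts X b s ` {v \<in> carrier (fst X (sh b s)). f (sh b s) v = \<zero>\<^bsub>fst Y (sh b s)\<^esub>}"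
          using w f_act[OF b] by simp
      qed (use f_act[OF b] lin_in[OF act_lin[OF X b]] in auto)
      moreover have "inj_on (act elts X b s) {v \<in> carrier (fst X (sh b s)). f (sh b s) v = \<zero>\<^bsub>fst Y (sh b s)\<^esub>}"
        using act_bij[OF X b] by (auto simp: bij_betw_def intro: inj_on_subset)
      ultimately show ?thesis by (simp add: bij_betw_def Vs b s')
    qed
  next
    fix b b' s v assume b: "b \<in> BH" "b' \<in> BH" "s \<in> SC C" and v: "v \<in> carrier (V (sh b' (sh b s)))"
    show "act elts X b s (act elts X b' (sh b s) v) = sigma \<alpha> b b' \<odot>\<^bsub>V s\<^esub> act elts X (b \<otimes>\<^bsub>GH\<^esub> b') s v"
      using act_mult[OF X b] v b by (simp add: Vs sh_in)
  next
    show "act elts X \<one>\<^bsub>GH\<^esub> s v = v" if "s \<in> SC C" "v \<in> carrier (V s)" for s v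
      using act_one[OF X] that by (simp add: Vs)
  qed
  from IC_of_action[OF V this] obtain K where K: "K \<in> Ob \<I>" "fst K = V"
    and a: "\<And>b s v. \<lbrakk>b \<in> BH; s \<in> SC C; v \<in> carrier (V (sh b s))\<rbrakk> \<Longrightarrow> act elts K b s v = act elts X b s v"
    by blast
  have "(\<lambda>s\<in>SC C. \<lambda>x\<in>carrier (fst K s). x) \<in> Hom \<I> K X"
    by (rule homI[OF K(1) X]) (simp_all add: K(2) Vs lin_def a)
  then have "ptw_kernel X Y f K (\<lambda>s\<in>SC C. \<lambda>x\<in>carrier (fst K s). x)"
    unfolding ptw_kernel_def using K by (auto simp: Vs inj_on_def)
  then show thesis by (rule that)
qed

lemma ptw_cokernel_exists:
  assumes X: "X \<in> Ob \<I>" and Y: "Y \<in> Ob \<I>" and f: "f \<in> Hom \<I> X Y"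
  obtains Q p where "ptw_cokernel X Y f Q p"
proof -
  define quot where "quot s Q p \<longleftrightarrow> Q \<in> Ob (Vect elts) \<and> lin (fst Y s) Q p \<and>
      p ` carrier (fst Y s) = carrier Q \<and>
      {y \<in> carrier (fst Y s). p y = \<zero>\<^bsub>Q\<^esub>} = f s ` carrier (fst X s)" for s Q p
  have "\<exists>Q p. quot s Q p" if s: "s \<in> SC C" for s
    unfolding quot_def
    by (rule Vect_quotient[OF IC_mod[OF X s] IC_space[OF Y s] hom_lin[OF X Y f s]]) blast
  then obtain Q0 p where "\<And>s. s \<in> SC C \<Longrightarrow> quot s (Q0 s) (p s)" by metis
  note q0 = this[unfolded quot_def]
  define V where "V = restrict Q0 (SC C)"
  have Vs: "V s = Q0 s" if "s \<in> SC C" for s using that by (simp add: V_def)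
  have V: "V \<in> Ob (VC elts C)" using q0 by (simp add: V_def)
  have mV: "module Lam (V s)" if "s \<in> SC C" for s using q0[OF that] by (simp add: Vs that)
  have p: "lin (fst Y s) (V s) (p s)" and surj: "p s ` carrier (fst Y s) = carrier (V s)"
    and ker: "{y \<in> carrier (fst Y s). p s y = \<zero>\<^bsub>V s\<^esub>} = f s ` carrier (fst X s)" if "s \<in> SC C" for s
    using q0[OF that] by (simp_all add: Vs that)
  have pre: "\<exists>y\<in>carrier (fst Y s). q = p s y" if "s \<in> SC C" "q \<in> carrier (V s)" for s q
    using surj[OF that(1)] that(2) by auto
  \<comment> \<open>The action on \<open>Y\<close> preserves the image of \<open>f\<close> in both directions, so it descends to the quotient.\<close>
  have f_act: "p s (act elts Y b s y) = \<zero>\<^bsub>V s\<^esub> \<longleftrightarrow> p (sh b s) y = \<zero>\<^bsub>V (sh b s)\<^esub>"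
    if b: "b \<in> BH" "s \<in> SC C" and y: "y \<in> carrier (fst Y (sh b s))" for b s y
  proof
    assume "p s (act elts Y b s y) = \<zero>\<^bsub>V s\<^esub>"
    then obtain x where x: "x \<in> carrier (fst X s)" "act elts Y b s y = f s x"
      using ker[OF b(2)] lin_in[OF act_lin[OF Y b] y] by blast
    obtain x' where x': "x' \<in> carrier (fst X (sh b s))" "x = act elts X b s x'"
      using act_bij[OF X b] x(1) by (auto simp: bij_betw_def)
    have "act elts Y b s y = act elts Y b s (f (sh b s) x')"
      using hom_act[OF X Y f b x'(1)] x x' by simp
    then have "y = f (sh b s) x'"
      using act_bij[OF Y b] y lin_in[OF hom_lin[OF X Y f sh_in[OF b]] x'(1)] by (metis bij_betw_def inj_onD)
    then show "p (sh b s) y = \<zero>\<^bsub>V (sh b s)\<^esub>" using ker[OF sh_in[OF b]] x'(1) by blast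
  next
    assume "p (sh b s) y = \<zero>\<^bsub>V (sh b s)\<^esub>"
    then obtain x where x: "x \<in> carrier (fst X (sh b s))" "y = f (sh b s) x" using ker[OF sh_in[OF b]] y by blast
    have "act elts Y b s y = f s (act elts X b s x)" using hom_act[OF X Y f b x(1)] x(2) by simp
    then show "p s (act elts Y b s y) = \<zero>\<^bsub>V s\<^esub>"
      using ker[OF b(2)] lin_in[OF act_lin[OF X b] x(1)] by blast
  qed
  have "\<exists>h. lin (V (sh b s)) (V s) h \<and> (\<forall>y\<in>carrier (fst Y (sh b s)). h (p (sh b s) y) = p s (act elts Y b s y))"
    if b: "b \<in> BH" "s \<in> SC C" for b s
  proof -
    note s' = sh_in[OF b]
    have k: "p s (act elts Y b s y) = \<zero>\<^bsub>V s\<^esub>"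
      if "y \<in> carrier (fst Y (sh b s))" "p (sh b s) y = \<zero>\<^bsub>V (sh b s)\<^esub>" for y
      using f_act[OF b that(1)] that(2) by blast
    show ?thesis
      by (rule lin_factor[OF IC_mod[OF Y s'] mV[OF s'] mV[OF b(2)] p[OF s'] surj[OF s']
            lin_comp[OF act_lin[OF Y b] p[OF b(2)]] k]) auto
  qed
  then obtain \<theta> where \<theta>: "\<And>b s. \<lbrakk>b \<in> BH; s \<in> SC C\<rbrakk> \<Longrightarrow> lin (V (sh b s)) (V s) (\<theta> b s)"
    and \<theta>p: "\<And>b s y. \<lbrakk>b \<in> BH; s \<in> SC C; y \<in> carrier (fst Y (sh b s))\<rbrakk> \<Longrightarrow>
      \<theta> b s (p (sh b s) y) = p s (act elts Y b s y)" by metis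
  have "is_action \<alpha> C V \<theta>"
    unfolding is_action_def
  proof (intro conjI ballI)
    fix b :: "('k, 'n) dbl" and s assume b: "b \<in> BH" "s \<in> SC C"
    note s' = sh_in[OF b]
    show "lin (V (sh b s)) (V s) (\<theta> b s)" by (rule \<theta>[OF b])
    have "inj_on (\<theta> b s) (carrier (V (sh b s)))"
      unfolding lin_inj_iff[OF mV[OF s'] mV[OF b(2)] \<theta>[OF b]]
    proof (intro ballI impI)
      fix q assume q: "q \<in> carrier (V (sh b s))" "\<theta> b s q = \<zero>\<^bsub>V s\<^esub>"
      obtain y where y: "y \<in> carrier (fst Y (sh b s))" "q = p (sh b s) y" using pre[OF s' q(1)] by blast
      then show "q = \<zero>\<^bsub>V (sh b s)\<^esub>" using q(2) \<theta>p[OF b y(1)] f_act[OF b y(1)] by simp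
    qed
    moreover have "carrier (V s) \<subseteq> \<theta> b s ` carrier (V (sh b s))"
    proof
      fix q assume "q \<in> carrier (V s)"
      then obtain y where y: "y \<in> carrier (fst Y s)" "q = p s y" using pre[OF b(2)] by blast
      obtain y' where y': "y' \<in> carrier (fst Y (sh b s))" "y = act elts Y b s y'"
        using act_bij[OF Y b] y(1) by (auto simp: bij_betw_def)
      then have "q = \<theta> b s (p (sh b s) y')" using \<theta>p[OF b y'(1)] y(2) by simp
      then show "q \<in> \<theta> b s ` carrier (V (sh b s))" using lin_in[OF p[OF s'] y'(1)] by blast
    qed
    ultimately show "bij_betw (\<theta> b s) (carrier (V (sh b s))) (carrier (V s))"
      using lin_in[OF \<theta>[OF b]] by (auto simp: bij_betw_def)
  next
    fix b b' :: "('k, 'n) dbl" and s v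
    assume b: "b \<in> BH" "b' \<in> BH" "s \<in> SC C" and v: "v \<in> carrier (V (sh b' (sh b s)))"
    note s' = sh_in[OF b(1,3)]
    note s'' = sh_in[OF b(2) s']
    obtain y where y: "y \<in> carrier (fst Y (sh b' (sh b s)))" "v = p (sh b' (sh b s)) y" using pre[OF s'' v] by blast
    have y': "act elts Y b' (sh b s) y \<in> carrier (fst Y (sh b s))" by (rule lin_in[OF act_lin[OF Y b(2) s'] y(1)])
    have y2: "y \<in> carrier (fst Y (sh (b \<otimes>\<^bsub>GH\<^esub> b') s))" using y(1) by (simp add: sh_mult[OF b])
    note bb = BH_mult[OF b(1,2)]
    have "\<theta> b s (\<theta> b' (sh b s) v) = p s (sigma \<alpha> b b' \<odot>\<^bsub>fst Y s\<^esub> act elts Y (b \<otimes>\<^bsub>GH\<^esub> b') s y)"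
      using \<theta>p[OF b(2) s' y(1)] \<theta>p[OF b(1,3) y'] act_mult[OF Y b y(1)] y(2) by simp
    also have "\<dots> = sigma \<alpha> b b' \<odot>\<^bsub>V s\<^esub> p s (act elts Y (b \<otimes>\<^bsub>GH\<^esub> b') s y)"
      by (rule lin_smult[OF p[OF b(3)] lin_in[OF act_lin[OF Y bb b(3)] y2]])
    also have "p s (act elts Y (b \<otimes>\<^bsub>GH\<^esub> b') s y) = \<theta> (b \<otimes>\<^bsub>GH\<^esub> b') s v"
      using \<theta>p[OF bb b(3) y2] y(2) by (simp add: sh_mult[OF b])
    finally show "\<theta> b s (\<theta> b' (sh b s) v) = sigma \<alpha> b b' \<odot>\<^bsub>V s\<^esub> \<theta> (b \<otimes>\<^bsub>GH\<^esub> b') s v" .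
  next
    fix s v assume s: "s \<in> SC C" and v: "v \<in> carrier (V s)"
    obtain y where y: "y \<in> carrier (fst Y s)" "v = p s y" using pre[OF s v] by blast
    have "y \<in> carrier (fst Y (sh \<one>\<^bsub>GH\<^esub> s))" unfolding sh_one(1)[OF s] by (rule y(1))
    from \<theta>p[OF BH_one s this] show "\<theta> \<one>\<^bsub>GH\<^esub> s v = v"
      unfolding sh_one(1)[OF s] using act_one[OF Y s y(1)] y(2) by simp
  qed
  from IC_of_action[OF V this] obtain Q where Q: "Q \<in> Ob \<I>" "fst Q = V"
    and a: "\<And>b s v. \<lbrakk>b \<in> BH; s \<in> SC C; v \<in> carrier (V (sh b s))\<rbrakk> \<Longrightarrow> act elts Q b s v = \<theta> b s v"
    by blast
  have "(\<lambda>s\<in>SC C. \<lambda>x\<in>carrier (fst Y s). p s x) \<in> Hom \<I> Y Q"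
    by (rule homI[OF Y Q(1)]) (simp_all add: Q(2) p a \<theta>p lin_in[OF p] sh_in)
  then have "ptw_cokernel X Y f Q (\<lambda>s\<in>SC C. \<lambda>x\<in>carrier (fst Y s). p s x)"
    unfolding ptw_cokernel_def using Q surj ker by (auto cong: conj_cong)
  then show thesis by (rule that)
qed

text \<open>Kernels are unique up to isomorphism, and an isomorphism is bijective at each coset. Pointwise
  kernels are evidently preserved by reindexing, and through this lemma so are kernels.\<close>

lemma is_kernel_ptw:
  assumes X: "X \<in> Ob \<I>" and Y: "Y \<in> Ob \<I>" and f: "f \<in> Hom \<I> X Y" and k: "is_kernel \<I> X Y f K i"
  shows "ptw_kernel X Y f K i"
proof -
  obtain K0 i0 where p0: "ptw_kernel X Y f K0 i0" by (rule ptw_kernel_exists[OF X Y f])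
  have k0: "is_kernel \<I> X Y f K0 i0" by (rule ptw_kernel_is_kernel[OF X Y f p0])
  have K: "K \<in> Ob \<I>" "i \<in> Hom \<I> K X" "Cmp \<I> K X Y f i = Zero \<I> K Y"
    and K0: "K0 \<in> Ob \<I>" "i0 \<in> Hom \<I> K0 X" "Cmp \<I> K0 X Y f i0 = Zero \<I> K0 Y"
    using k k0 by (auto simp: is_kernel_def)
  obtain l where l: "l \<in> Hom \<I> K0 K" "Cmp \<I> K0 K X i l = i0" using k K0 unfolding is_kernel_def by blast
  obtain m where m: "m \<in> Hom \<I> K K0" "Cmp \<I> K K0 X i0 m = i" using k0 K unfolding is_kernel_def by blast
  have "Cmp \<I> K K0 K l m = Idm \<I> K"
  proof -
    have "is_mono \<I> K X i" by (rule kernel_is_mono[OF k I.lin_cat_axioms X Y f])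
    moreover have "Cmp \<I> K K X i (Cmp \<I> K K0 K l m) = Cmp \<I> K K X i (Idm \<I> K)"
      using I.assoc[OF K(1) K0(1) K(1) X m(1) l(1) K(2)] l(2) m(2) I.id_right[OF K(1) X K(2)] by simp
    ultimately show ?thesis
      unfolding is_mono_def using K(1) I.cmp_in[OF K(1) K0(1) K(1) m(1) l(1)] I.id_in[OF K(1)] by blast
  qed
  then have inv: "l s (m s x) = x" if "s \<in> SC C" "x \<in> carrier (fst K s)" for s x
    using that cmp_at[of s x K K0 K l m] id_at[of s x K] by simp
  have "inj_on (i s) (carrier (fst K s)) \<and> i s ` carrier (fst K s) = i0 s ` carrier (fst K0 s)" if s: "s \<in> SC C" for s
  proof -
    have im: "i s x = i0 s (m s x)" if "x \<in> carrier (fst K s)" for x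
      using cmp_at[OF s that, of K0 X i0 m] m(2) by simp
    have il: "i0 s y = i s (l s y)" if "y \<in> carrier (fst K0 s)" for y
      using cmp_at[OF s that, of K X i l] l(2) by simp
    have mi: "m s x \<in> carrier (fst K0 s)" if "x \<in> carrier (fst K s)" for x
      by (rule lin_in[OF hom_lin[OF K(1) K0(1) m(1) s] that])
    have li: "l s y \<in> carrier (fst K s)" if "y \<in> carrier (fst K0 s)" for y
      by (rule lin_in[OF hom_lin[OF K0(1) K(1) l(1) s] that])
    have "inj_on (i0 s) (carrier (fst K0 s))" using p0 s by (simp add: ptw_kernel_def)
    then have "inj_on (i s) (carrier (fst K s))"
      by (intro inj_on_inverseI[of _ "\<lambda>z. l s (inv_into (carrier (fst K0 s)) (i0 s) z)"])
        (simp add: im mi inv_into_f_f inv(1)[OF s])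
    moreover have "i s ` carrier (fst K s) = i0 s ` carrier (fst K0 s)"
    proof (intro equalityI image_subsetI)
      show "i s x \<in> i0 s ` carrier (fst K0 s)" if "x \<in> carrier (fst K s)" for x
        using im[OF that] mi[OF that] by simp
      show "i0 s y \<in> i s ` carrier (fst K s)" if "y \<in> carrier (fst K0 s)" for y
        using il[OF that] li[OF that] by simp
    qed
    ultimately show ?thesis by blast
  qed
  then show ?thesis using p0 K by (simp add: ptw_kernel_def)
qed

lemma is_cokernel_ptw:
  assumes X: "X \<in> Ob \<I>" and Y: "Y \<in> Ob \<I>" and f: "f \<in> Hom \<I> X Y" and c: "is_cokernel \<I> X Y f Q p"
  shows "ptw_cokernel X Y f Q p"
proof -
  obtain Q0 p0 where w0: "ptw_cokernel X Y f Q0 p0" by (rule ptw_cokernel_exists[OF X Y f])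
  have c0: "is_cokernel \<I> X Y f Q0 p0" by (rule ptw_cokernel_is_cokernel[OF X Y f w0])
  have Q: "Q \<in> Ob \<I>" "p \<in> Hom \<I> Y Q" "Cmp \<I> X Y Q p f = Zero \<I> X Q"
    and Q0: "Q0 \<in> Ob \<I>" "p0 \<in> Hom \<I> Y Q0" "Cmp \<I> X Y Q0 p0 f = Zero \<I> X Q0"
    using c c0 by (auto simp: is_cokernel_def)
  obtain l where l: "l \<in> Hom \<I> Q Q0" "Cmp \<I> Y Q Q0 l p = p0" using c Q0 unfolding is_cokernel_def by blast
  obtain m where m: "m \<in> Hom \<I> Q0 Q" "Cmp \<I> Y Q0 Q m p0 = p" using c0 Q unfolding is_cokernel_def by blast
  have epi: "u = v" if "u \<in> Hom \<I> Q Q" "v \<in> Hom \<I> Q Q" "Cmp \<I> Y Q Q u p = p" "Cmp \<I> Y Q Q v p = p" for u v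
    using c Q that unfolding is_cokernel_def by blast
  have "Cmp \<I> Q Q0 Q m l = Idm \<I> Q"
  proof (rule epi)
    show "Cmp \<I> Y Q Q (Cmp \<I> Q Q0 Q m l) p = p"
      using I.assoc[OF Y Q(1) Q0(1) Q(1) Q(2) l(1) m(1)] l(2) m(2) by simp
  qed (use Q Q0 l m Y in \<open>auto intro: I.cmp_in I.id_in I.id_left\<close>)
  then have inv: "m s (l s x) = x" if "s \<in> SC C" "x \<in> carrier (fst Q s)" for s x
    using that cmp_at[of s x Q Q0 Q m l] id_at[of s x Q] by simp
  have "p s ` carrier (fst Y s) = carrier (fst Q s) \<and>
      {y \<in> carrier (fst Y s). p s y = \<zero>\<^bsub>fst Q s\<^esub>} = f s ` carrier (fst X s)" if s: "s \<in> SC C" for s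
  proof -
    have pm: "p s y = m s (p0 s y)" if "y \<in> carrier (fst Y s)" for y
      using cmp_at[OF s that, of Q0 Q m p0] m(2) by simp
    have pl: "p0 s y = l s (p s y)" if "y \<in> carrier (fst Y s)" for y
      using cmp_at[OF s that, of Q Q0 l p] l(2) by simp
    note lQ = hom_lin[OF Q(1) Q0(1) l(1) s] and mQ = hom_lin[OF Q0(1) Q(1) m(1) s] and pY = hom_lin[OF Y Q(1,2) s]
    have s0: "p0 s ` carrier (fst Y s) = carrier (fst Q0 s)"
      and k0: "{y \<in> carrier (fst Y s). p0 s y = \<zero>\<^bsub>fst Q0 s\<^esub>} = f s ` carrier (fst X s)"
      using w0 s by (auto simp: ptw_cokernel_def)
    have "q \<in> p s ` carrier (fst Y s)" if q: "q \<in> carrier (fst Q s)" for q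
    proof -
      have "l s q \<in> p0 s ` carrier (fst Y s)" using lin_in[OF lQ q] s0 by simp
      then obtain y where "y \<in> carrier (fst Y s)" "l s q = p0 s y" by blast
      then show ?thesis using inv[OF s q] pm by (intro image_eqI[of _ _ y]) simp_all
    qed
    then have "p s ` carrier (fst Y s) = carrier (fst Q s)" using lin_in[OF pY] by blast
    moreover have "p s y = \<zero>\<^bsub>fst Q s\<^esub> \<longleftrightarrow> p0 s y = \<zero>\<^bsub>fst Q0 s\<^esub>" if y: "y \<in> carrier (fst Y s)" for y
      using pm[OF y] pl[OF y] lin_zero[OF IC_mod[OF Q(1) s] IC_mod[OF Q0(1) s] lQ]
        lin_zero[OF IC_mod[OF Q0(1) s] IC_mod[OF Q(1) s] mQ] by metis
    ultimately show ?thesis using k0 by (simp cong: conj_cong)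
  qed
  then show ?thesis using Q by (simp add: ptw_cokernel_def)
qed

lemma IC_zero_object: "\<exists>Z. is_zero_object \<I> Z"
proof -
  obtain M where M: "M \<in> Ob (Vect elts)" "carrier M = {\<zero>\<^bsub>M\<^esub>}" by (rule Vect_zero)
  define V where "V = (\<lambda>s\<in>SC C. M)"
  have V: "V \<in> Ob (VC elts C)" using M by (simp add: V_def)
  have z: "\<zero>\<^bsub>M\<^esub> \<oplus>\<^bsub>M\<^esub> \<zero>\<^bsub>M\<^esub> = \<zero>\<^bsub>M\<^esub>" "c \<odot>\<^bsub>M\<^esub> \<zero>\<^bsub>M\<^esub> = \<zero>\<^bsub>M\<^esub>" for c
    using M by (auto simp: vadd_zero zero_in vsmult_zero)
  have action: "is_action \<alpha> C V (\<lambda>b s v. \<zero>\<^bsub>M\<^esub>)"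
    by (auto simp: is_action_def V_def sh_in lin_def M(2) z bij_betw_def)
  obtain Z where Z: "Z \<in> Ob \<I>" "fst Z = V" by (rule IC_of_action[OF V action]) (rule that)
  have "Idm \<I> Z = Zero \<I> Z Z"
    by (rule hom_ext[OF Z(1) Z(1) I.id_in[OF Z(1)] I.zero_in[OF Z(1) Z(1)]])
      (simp add: id_at zero_at Z(2) V_def M(2))
  then have "is_zero_object \<I> Z" using I.zero_object_iff[OF Z(1)] by blast
  then show ?thesis by blast
qed

lemma IC_biproduct:
  assumes X: "X \<in> Ob \<I>" and Y: "Y \<in> Ob \<I>"
  shows "\<exists>B i j p q. is_biproduct \<I> X Y B i j p q"
proof -
  define V where "V = (\<lambda>s\<in>SC C. vprod (fst X s) (fst Y s))"
  have Vs: "V s = vprod (fst X s) (fst Y s)" if "s \<in> SC C" for s using that by (simp add: V_def)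
  have V: "V \<in> Ob (VC elts C)"
    unfolding VC_simps V_def
    by (intro restrict_PiE[THEN iffD2] Pi_I vprod_ob IC_space[OF X] IC_space[OF Y])
  note mX = IC_mod[OF X] and mY = IC_mod[OF Y]
  define \<theta> where "\<theta> b s u = opair (act elts X b s (fst (unpair u))) (act elts Y b s (snd (unpair u)))" for b s u
  have action: "is_action \<alpha> C V \<theta>"
    unfolding is_action_def
  proof (intro conjI ballI)
    fix b :: "('k, 'n) dbl" and s assume b: "b \<in> BH" "s \<in> SC C"
    note s' = sh_in[OF b]
    note aX = act_lin[OF X b] and aY = act_lin[OF Y b]
    note bX = act_bij[OF X b, unfolded bij_betw_def] and bY = act_bij[OF Y b, unfolded bij_betw_def]
    show "lin (V (sh b s)) (V s) (\<theta> b s)"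
      by (auto simp: lin_def Vs b s' vprod_simps \<theta>_def opair_eq_iff lin_in[OF aX] lin_in[OF aY]
          lin_add[OF aX] lin_add[OF aY] lin_smult[OF aX] lin_smult[OF aY])
    have "inj_on (\<theta> b s) (carrier (V (sh b s)))"
      by (auto simp: inj_on_def Vs s' vprod_simps \<theta>_def opair_eq_iff inj_on_eq_iff[OF conjunct1[OF bX]]
          inj_on_eq_iff[OF conjunct1[OF bY]])
    moreover have "w \<in> \<theta> b s ` carrier (V (sh b s))" if w: "w \<in> carrier (V s)" for w
    proof -
      obtain x y where xy: "x \<in> carrier (fst X s)" "y \<in> carrier (fst Y s)" "w = opair x y"
        using w by (auto simp: Vs b vprod_simps)
      have "x \<in> act elts X b s ` carrier (fst X (sh b s))" "y \<in> act elts Y b s ` carrier (fst Y (sh b s))"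
        unfolding conjunct2[OF bX] conjunct2[OF bY] by (fact xy)+
      then obtain x' y' where "x' \<in> carrier (fst X (sh b s))" "y' \<in> carrier (fst Y (sh b s))"
        "w = opair (act elts X b s x') (act elts Y b s y')"
        unfolding xy(3) by blast
      then show ?thesis
        by (intro image_eqI[of _ _ "opair x' y'"]) (auto simp: \<theta>_def Vs s' vprod_simps opair_eq_iff)
    qed
    moreover have "\<theta> b s u \<in> carrier (V s)" if "u \<in> carrier (V (sh b s))" for u
      using that by (auto simp: \<theta>_def Vs b s' vprod_simps opair_eq_iff lin_in[OF aX] lin_in[OF aY])
    ultimately show "bij_betw (\<theta> b s) (carrier (V (sh b s))) (carrier (V s))"
      unfolding bij_betw_def by (intro conjI equalityI subsetI image_subsetI)
  next
    fix b b' :: "('k, 'n) dbl" and s v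
    assume b: "b \<in> BH" "b' \<in> BH" "s \<in> SC C" and v: "v \<in> carrier (V (sh b' (sh b s)))"
    obtain x y where "x \<in> carrier (fst X (sh b' (sh b s)))" "y \<in> carrier (fst Y (sh b' (sh b s)))" "v = opair x y"
      using v by (auto simp: Vs b sh_in vprod_simps)
    then show "\<theta> b s (\<theta> b' (sh b s) v) = sigma \<alpha> b b' \<odot>\<^bsub>V s\<^esub> \<theta> (b \<otimes>\<^bsub>GH\<^esub> b') s v"
      by (simp add: \<theta>_def Vs b vprod_simps act_mult[OF X b] act_mult[OF Y b])
  next
    fix s v assume s: "s \<in> SC C" and v: "v \<in> carrier (V s)"
    then show "\<theta> \<one>\<^bsub>GH\<^esub> s v = v"
      by (auto simp: \<theta>_def Vs vprod_simps act_one[OF X s] act_one[OF Y s])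
  qed
  obtain B where B: "B \<in> Ob \<I>" "fst B = V"
    and a: "\<And>b s v. \<lbrakk>b \<in> BH; s \<in> SC C; v \<in> carrier (V (sh b s))\<rbrakk> \<Longrightarrow> act elts B b s v = \<theta> b s v"
    using IC_of_action[OF V action] by blast
  define i where "i = (\<lambda>s\<in>SC C. \<lambda>x\<in>carrier (fst X s). opair x \<zero>\<^bsub>fst Y s\<^esub>)"
  define j where "j = (\<lambda>s\<in>SC C. \<lambda>y\<in>carrier (fst Y s). opair \<zero>\<^bsub>fst X s\<^esub> y)"
  define p where "p = (\<lambda>s\<in>SC C. \<lambda>u\<in>carrier (fst B s). fst (unpair u))"
  define q where "q = (\<lambda>s\<in>SC C. \<lambda>u\<in>carrier (fst B s). snd (unpair u))"
  have z: "act elts Z b s \<zero>\<^bsub>fst Z (sh b s)\<^esub> = \<zero>\<^bsub>fst Z s\<^esub>" if "Z \<in> Ob \<I>" "b \<in> BH" "s \<in> SC C" for Z b s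
    using that sh_in by (intro lin_zero IC_mod act_lin) auto
  have i: "i \<in> Hom \<I> X B" unfolding i_def
    by (rule homI[OF X B(1)])
      (simp_all add: B(2) Vs a sh_in vprod_simps \<theta>_def z X Y lin_def opair_eq_iff
        zero_in[OF mY] vadd_zero[OF mY] vsmult_zero[OF mY])
  have j: "j \<in> Hom \<I> Y B" unfolding j_def
    by (rule homI[OF Y B(1)])
      (simp_all add: B(2) Vs a sh_in vprod_simps \<theta>_def z X Y lin_def opair_eq_iff
        zero_in[OF mX] vadd_zero[OF mX] vsmult_zero[OF mX])
  have p: "p \<in> Hom \<I> B X" and q: "q \<in> Hom \<I> B Y" unfolding p_def q_def
    by (rule homI[OF B(1)]; use X Y in \<open>auto simp: B(2) Vs a sh_in vprod_simps \<theta>_def lin_def\<close>)+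
  have at: "x \<in> carrier (fst X s) \<Longrightarrow> i s x = opair x \<zero>\<^bsub>fst Y s\<^esub>"
    "y \<in> carrier (fst Y s) \<Longrightarrow> j s y = opair \<zero>\<^bsub>fst X s\<^esub> y"
    "\<lbrakk>x \<in> carrier (fst X s); y \<in> carrier (fst Y s)\<rbrakk> \<Longrightarrow> p s (opair x y) = x"
    "\<lbrakk>x \<in> carrier (fst X s); y \<in> carrier (fst Y s)\<rbrakk> \<Longrightarrow> q s (opair x y) = y"
    if "s \<in> SC C" for s x y
    using that by (auto simp: i_def j_def p_def q_def B(2) Vs vprod_simps opair_eq_iff)
  have zX: "\<zero>\<^bsub>fst X s\<^esub> \<in> carrier (fst X s)" and zY: "\<zero>\<^bsub>fst Y s\<^esub> \<in> carrier (fst Y s)" if "s \<in> SC C" for s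
    using that by (auto intro: zero_in mX mY)
  have "is_biproduct \<I> X Y B i j p q"
    unfolding is_biproduct_def
  proof (intro conjI B(1) i j p q)
    show "Cmp \<I> X B X p i = Idm \<I> X"
      by (rule hom_ext[OF X X I.cmp_in[OF X B(1) X i p] I.id_in[OF X]]) (simp add: cmp_at id_at at zY)
    show "Cmp \<I> Y B Y q j = Idm \<I> Y"
      by (rule hom_ext[OF Y Y I.cmp_in[OF Y B(1) Y j q] I.id_in[OF Y]]) (simp add: cmp_at id_at at zX)
    show "Cmp \<I> X B Y q i = Zero \<I> X Y"
      by (rule hom_ext[OF X Y I.cmp_in[OF X B(1) Y i q] I.zero_in[OF X Y]]) (simp add: cmp_at zero_at at zY)
    show "Cmp \<I> Y B X p j = Zero \<I> Y X"
      by (rule hom_ext[OF Y X I.cmp_in[OF Y B(1) X j p] I.zero_in[OF Y X]]) (simp add: cmp_at zero_at at zX)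
    note c = I.cmp_in[OF B(1) X B(1) p i] I.cmp_in[OF B(1) Y B(1) q j]
    show "Add \<I> B B (Cmp \<I> B X B i p) (Cmp \<I> B Y B j q) = Idm \<I> B"
    proof (rule hom_ext[OF B(1) B(1) I.add_in[OF B(1) B(1) c] I.id_in[OF B(1)]])
      fix s u assume s: "s \<in> SC C" and u: "u \<in> carrier (fst B s)"
      obtain x y where xy: "x \<in> carrier (fst X s)" "y \<in> carrier (fst Y s)" "u = opair x y"
        using u by (auto simp: B(2) Vs s vprod_simps)
      have "Add \<I> B B (Cmp \<I> B X B i p) (Cmp \<I> B Y B j q) s u = i s (p s u) \<oplus>\<^bsub>fst B s\<^esub> j s (q s u)"
        using s u by (simp add: IC_ops)
      also have "\<dots> = u"
        using s xy by (simp add: at B(2) Vs vprod_simps vadd_zero[OF mY[OF s]] vadd_zero_right[OF mX[OF s]])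
      finally show "Add \<I> B B (Cmp \<I> B X B i p) (Cmp \<I> B Y B j q) s u = Idm \<I> B s u"
        using s u by (simp add: id_at)
    qed
  qed
  then show ?thesis by blast
qed

text \<open>The kernel of a monomorphism vanishes, so the monomorphism is injective at each coset and is then
  the pointwise kernel of its cokernel; dually for epimorphisms.\<close>

lemma IC_abelian: "abelian_linear_category Lam \<I>"
  unfolding abelian_linear_category_def
proof (intro conjI ballI impI)
  show "linear_category Lam \<I>" by (rule IC_linear)
  show "\<exists>Z. is_zero_object \<I> Z" by (rule IC_zero_object)
  fix X Y assume o: "X \<in> Ob \<I>" "Y \<in> Ob \<I>"
  show "\<exists>P i j p q. is_biproduct \<I> X Y P i j p q" by (rule IC_biproduct[OF o])
  fix f assume f: "f \<in> Hom \<I> X Y"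
  obtain K i where k: "ptw_kernel X Y f K i" by (rule ptw_kernel_exists[OF o f])
  obtain Q p where c: "ptw_cokernel X Y f Q p" by (rule ptw_cokernel_exists[OF o f])
  have K: "K \<in> Ob \<I>" "i \<in> Hom \<I> K X" and Q: "Q \<in> Ob \<I>" "p \<in> Hom \<I> Y Q"
    using k c by (auto simp: ptw_kernel_def ptw_cokernel_def)
  note k' = ptw_kernel_is_kernel[OF o f k] and c' = ptw_cokernel_is_cokernel[OF o f c]
  show "\<exists>K i. is_kernel \<I> X Y f K i" using k' by blast
  show "\<exists>Q p. is_cokernel \<I> X Y f Q p" using c' by blast
  show "\<exists>Z\<in>Ob \<I>. \<exists>g\<in>Hom \<I> Y Z. is_kernel \<I> Y Z g X f" if m: "is_mono \<I> X Y f"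
  proof -
    have i0: "i = Zero \<I> K X"
      using m K k' unfolding I.mono_iff[OF o f] is_kernel_def by blast
    have "inj_on (f s) (carrier (fst X s))" if s: "s \<in> SC C" for s
      unfolding lin_inj_iff[OF IC_mod[OF o(1) s] IC_mod[OF o(2) s] hom_lin[OF o f s]]
    proof (intro ballI impI)
      fix x assume "x \<in> carrier (fst X s)" "f s x = \<zero>\<^bsub>fst Y s\<^esub>"
      then have "x \<in> i s ` carrier (fst K s)" using k s by (simp add: ptw_kernel_def)
      then show "x = \<zero>\<^bsub>fst X s\<^esub>" using zero_at[OF s, of _ K X] i0 by auto
    qed
    then have "ptw_kernel Y Q p X f" using c f o by (simp add: ptw_kernel_def ptw_cokernel_def)
    then show ?thesis using ptw_kernel_is_kernel[OF o(2) Q(1,2)] Q by blast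
  qed
  show "\<exists>Z\<in>Ob \<I>. \<exists>g\<in>Hom \<I> Z X. is_cokernel \<I> Z X g Y f" if e: "is_epi \<I> X Y f"
  proof -
    have "Cmp \<I> X Y Q p f = Cmp \<I> X Y Q (Zero \<I> Y Q) f"
      using c' o Q f by (simp add: is_cokernel_def I.cmp_zero_left)
    then have p0: "p = Zero \<I> Y Q"
      using e Q I.zero_in[OF o(2) Q(1)] unfolding is_epi_def by blast
    have "f s ` carrier (fst X s) = carrier (fst Y s)" if s: "s \<in> SC C" for s
    proof -
      have "f s ` carrier (fst X s) = {y \<in> carrier (fst Y s). p s y = \<zero>\<^bsub>fst Q s\<^esub>}"
        using c s by (simp add: ptw_cokernel_def)
      then show ?thesis using zero_at[OF s, of _ Y Q] p0 by auto
    qed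
    then have "ptw_cokernel K X i Y f" using k f o by (simp add: ptw_kernel_def ptw_cokernel_def)
    then show ?thesis using ptw_cokernel_is_cokernel[OF K(1) o(1) K(2)] K by blast
  qed
qed

end

section \<open>Reindexing along equivariant maps of coset spaces\<close>

text \<open>Pullback to a smaller level and right translation are both given by precomposition with a map of
  coset spaces that commutes with left multiplication. Such a map intertwines the actions of \<open>B\<^sub>H\<close>, and
  precomposition with it acts on spaces and action maps without changing them.\<close>

locale reindexing = src: univ_level elts \<alpha> C + tgt: univ_level elts \<alpha> D
  for elts :: "'v \<Rightarrow> 'v set" and \<alpha> :: "'n::{finite, linorder} \<Rightarrow> lam"
    and C D :: "('k::field, 'n) dbl set" +
  fixes \<phi> :: "('k, 'n) dbl set \<Rightarrow> ('k, 'n) dbl set"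
  assumes \<phi>_in: "s \<in> SC D \<Longrightarrow> \<phi> s \<in> SC C"
    and \<phi>_left: "\<lbrakk>b \<in> carrier GH; s \<in> SC D\<rbrakk> \<Longrightarrow> \<phi> (b <#\<^bsub>GH\<^esub> s) = b <#\<^bsub>GH\<^esub> \<phi> s"
begin

abbreviation "L \<equiv> lift_ftor elts \<alpha> C (reindex (SC C) (SC D) \<phi> (Vect elts))"

lemma \<phi>_sh: "\<lbrakk>b \<in> BH; s \<in> SC D\<rbrakk> \<Longrightarrow> \<phi> (sh b s) = sh b (\<phi> s)"
  using BH_sub by (intro \<phi>_left) auto

lemma L_ob:
  assumes X: "X \<in> Ob (IC elts \<alpha> C)"
  shows "FOb L X = (\<lambda>s\<in>SC D. fst X (\<phi> s), \<lambda>b\<in>BH. \<lambda>s\<in>SC D. snd X b (\<phi> s))"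
proof -
  obtain V \<epsilon> where e: "X = (V, \<epsilon>)" by (cases X)
  have V: "V \<in> Ob (VC elts C)" using src.IC_fam[OF X] by (simp add: e)
  have "\<epsilon> b \<in> Hom (VC elts C) (FOb (T_ftor elts C b) V) V" if "b \<in> BH" for b
    using X that unfolding src.IC_ob_iff by (auto simp: e src.T_ob[OF V] PiE_iff)
  then have "FMor (reindex (SC C) (SC D) \<phi> (Vect elts)) (FOb (T_ftor elts C b) V) V (\<epsilon> b) =
      (\<lambda>s\<in>SC D. \<epsilon> b (\<phi> s))" if "b \<in> BH" for b
    using V src.T_ob_in[OF V that] that unfolding reindex_def VC_def by (intro FMor_mk_ftor)
  moreover have "FOb (reindex (SC C) (SC D) \<phi> (Vect elts)) V = (\<lambda>s\<in>SC D. V (\<phi> s))"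
    using V unfolding reindex_def VC_def by (rule FOb_mk_ftor)
  ultimately show ?thesis
    using X by (simp add: e lift_ftor_def FOb_mk_ftor cong: restrict_cong)
qed

lemma L_space: "\<lbrakk>X \<in> Ob (IC elts \<alpha> C); s \<in> SC D\<rbrakk> \<Longrightarrow> fst (FOb L X) s = fst X (\<phi> s)"
  by (simp add: L_ob)

lemma L_act:
  assumes X: "X \<in> Ob (IC elts \<alpha> C)" and b: "b \<in> BH" "s \<in> SC D"
  shows "act elts (FOb L X) b s v = act elts X b (\<phi> s) v"
  using b tgt.sh_in[OF b] by (simp add: act_def L_ob[OF X] \<phi>_sh)

lemma L_ob_in:
  assumes X: "X \<in> Ob (IC elts \<alpha> C)" shows "FOb L X \<in> Ob (IC elts \<alpha> D)"
  unfolding tgt.IC_ob_iff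
proof (intro conjI)
  have V: "fst (FOb L X) s \<in> Ob (Vect elts)" if "s \<in> SC D" for s
    using src.IC_space[OF X \<phi>_in[OF that]] L_space[OF X that] by simp
  then show "fst (FOb L X) \<in> Ob (VC elts D)"
    unfolding VC_simps L_ob[OF X] fst_conv by (intro restrict_PiE[THEN iffD2] Pi_I) simp
  have "snd X b (\<phi> s) \<in> lin_maps (LT elts b (fst (FOb L X) (sh b s))) (fst (FOb L X) s)"
    if b: "b \<in> BH" "s \<in> SC D" for b :: "('k, 'n) dbl" and s
    using X b \<phi>_in[OF b(2)] unfolding src.IC_ob_iff
    by (auto simp: L_space[OF X] tgt.sh_in \<phi>_sh)
  then show "snd (FOb L X) \<in> (\<Pi>\<^sub>E b\<in>BH. \<Pi>\<^sub>E s\<in>SC D. lin_maps (LT elts b (fst (FOb L X) (sh b s))) (fst (FOb L X) s))"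
    unfolding L_ob[OF X, THEN arg_cong[of _ _ snd], unfolded snd_conv] by (intro restrict_PiE[THEN iffD2] Pi_I)
  show "is_action \<alpha> D (fst (FOb L X)) (act elts (FOb L X))"
    unfolding is_action_def
  proof (intro conjI ballI)
    fix b :: "('k, 'n) dbl" and s assume b: "b \<in> BH" "s \<in> SC D"
    have e: "act elts (FOb L X) b s = act elts X b (\<phi> s)" using L_act[OF X b] by blast
    show "lin (fst (FOb L X) (sh b s)) (fst (FOb L X) s) (act elts (FOb L X) b s)"
      "bij_betw (act elts (FOb L X) b s) (carrier (fst (FOb L X) (sh b s))) (carrier (fst (FOb L X) s))"
      unfolding e L_space[OF X b(2)] L_space[OF X tgt.sh_in[OF b]] \<phi>_sh[OF b]
      by (rule src.act_lin[OF X b(1) \<phi>_in[OF b(2)]], rule src.act_bij[OF X b(1) \<phi>_in[OF b(2)]])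
  next
    fix b b' :: "('k, 'n) dbl" and s v assume b: "b \<in> BH" "b' \<in> BH" "s \<in> SC D"
      and v: "v \<in> carrier (fst (FOb L X) (sh b' (sh b s)))"
    note s' = tgt.sh_in[OF b(1,3)]
    note s'' = tgt.sh_in[OF b(2) s']
    show "act elts (FOb L X) b s (act elts (FOb L X) b' (sh b s) v) =
        sigma \<alpha> b b' \<odot>\<^bsub>fst (FOb L X) s\<^esub> act elts (FOb L X) (b \<otimes>\<^bsub>GH\<^esub> b') s v"
      using src.act_mult[OF X b(1,2) \<phi>_in[OF b(3)]] v
      unfolding L_act[OF X b(1,3)] L_act[OF X b(2) s'] L_act[OF X BH_mult[OF b(1,2)] b(3)]
        L_space[OF X b(3)] L_space[OF X s''] \<phi>_sh[OF b(2) s'] \<phi>_sh[OF b(1,3)] by blast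
  next
    fix s v assume s: "s \<in> SC D" and v: "v \<in> carrier (fst (FOb L X) s)"
    show "act elts (FOb L X) \<one>\<^bsub>GH\<^esub> s v = v"
      using src.act_one[OF X \<phi>_in[OF s]] v unfolding L_act[OF X BH_one s] L_space[OF X s] by blast
  qed
qed

lemma L_mor:
  assumes X: "X \<in> Ob (IC elts \<alpha> C)" and Y: "Y \<in> Ob (IC elts \<alpha> C)" and f: "f \<in> Hom (IC elts \<alpha> C) X Y"
  shows "FMor L X Y f = (\<lambda>s\<in>SC D. f (\<phi> s))"
proof -
  have "f \<in> Hom (VC elts C) (fst X) (fst Y)" using f by (simp add: src.IC_simps)
  then have "FMor (reindex (SC C) (SC D) \<phi> (Vect elts)) (fst X) (fst Y) f = (\<lambda>s\<in>SC D. f (\<phi> s))"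
    using src.IC_fam[OF X] src.IC_fam[OF Y] unfolding reindex_def VC_def by (intro FMor_mk_ftor)
  then show ?thesis using X Y f by (simp add: lift_ftor_def FMor_mk_ftor)
qed

lemma L_mor_in:
  assumes X: "X \<in> Ob (IC elts \<alpha> C)" and Y: "Y \<in> Ob (IC elts \<alpha> C)" and f: "f \<in> Hom (IC elts \<alpha> C) X Y"
  shows "FMor L X Y f \<in> Hom (IC elts \<alpha> D) (FOb L X) (FOb L Y)"
  unfolding tgt.IC_hom_iff[OF L_ob_in[OF X] L_ob_in[OF Y]] L_mor[OF X Y f]
proof (intro conjI ballI)
  have "f (\<phi> s) \<in> lin_maps (fst X (\<phi> s)) (fst Y (\<phi> s))" if "s \<in> SC D" for s
    using f \<phi>_in[OF that] unfolding src.IC_hom_iff[OF X Y] by auto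
  then show "(\<lambda>s\<in>SC D. f (\<phi> s)) \<in> (\<Pi>\<^sub>E s\<in>SC D. lin_maps (fst (FOb L X) s) (fst (FOb L Y) s))"
    by (intro restrict_PiE[THEN iffD2] Pi_I) (simp add: L_space X Y)
  fix b :: "('k, 'n) dbl" and s v
  assume b: "b \<in> BH" "s \<in> SC D" and v: "v \<in> carrier (fst (FOb L X) (sh b s))"
  have "v \<in> carrier (fst X (sh b (\<phi> s)))" using v by (simp add: L_space[OF X tgt.sh_in[OF b]] \<phi>_sh[OF b])
  then show "(\<lambda>s\<in>SC D. f (\<phi> s)) s (act elts (FOb L X) b s v) =
      act elts (FOb L Y) b s ((\<lambda>s\<in>SC D. f (\<phi> s)) (sh b s) v)"
    using b tgt.sh_in[OF b] src.hom_act[OF X Y f b(1) \<phi>_in[OF b(2)]] by (simp add: L_act X Y \<phi>_sh)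
qed

lemma L_at: "\<lbrakk>X \<in> Ob (IC elts \<alpha> C); Y \<in> Ob (IC elts \<alpha> C); f \<in> Hom (IC elts \<alpha> C) X Y; s \<in> SC D\<rbrakk> \<Longrightarrow>
    FMor L X Y f s = f (\<phi> s)"
  by (simp add: L_mor)

lemma L_linear: "linear_ftor Lam (IC elts \<alpha> C) (IC elts \<alpha> D) L"
proof -
  interpret S: lin_cat Lam "IC elts \<alpha> C" by unfold_locales (rule src.IC_linear)
  have ftor: "is_ftor (IC elts \<alpha> C) (IC elts \<alpha> D) L"
    unfolding is_ftor_def
  proof (intro conjI ballI allI impI)
    show "FOb L \<in> Ob (IC elts \<alpha> C) \<rightarrow>\<^sub>E Ob (IC elts \<alpha> D)"
      by (intro PiE_I L_ob_in) (simp_all add: lift_ftor_def mk_ftor_def)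
    show "FMor L X Y \<in> Hom (IC elts \<alpha> C) X Y \<rightarrow>\<^sub>E Hom (IC elts \<alpha> D) (FOb L X) (FOb L Y)"
      if "X \<in> Ob (IC elts \<alpha> C)" "Y \<in> Ob (IC elts \<alpha> C)" for X Y
      by (intro PiE_I L_mor_in that) (simp_all add: lift_ftor_def mk_ftor_def)
    show "FMor L X Y f = undefined" if "X \<notin> Ob (IC elts \<alpha> C) \<or> Y \<notin> Ob (IC elts \<alpha> C)" for X Y f
      using that by (auto simp: lift_ftor_def mk_ftor_def)
    show "FMor L X X (Idm (IC elts \<alpha> C) X) = Idm (IC elts \<alpha> D) (FOb L X)" if X: "X \<in> Ob (IC elts \<alpha> C)" for X
      unfolding L_mor[OF X X S.id_in[OF X]] unfolding src.IC_ops tgt.IC_ops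
      using \<phi>_in by (intro restrict_ext) (simp add: L_space[OF X])
    show "FMor L X Z (Cmp (IC elts \<alpha> C) X Y Z g f) =
        Cmp (IC elts \<alpha> D) (FOb L X) (FOb L Y) (FOb L Z) (FMor L Y Z g) (FMor L X Y f)"
      if o: "X \<in> Ob (IC elts \<alpha> C)" "Y \<in> Ob (IC elts \<alpha> C)" "Z \<in> Ob (IC elts \<alpha> C)"
        and f: "f \<in> Hom (IC elts \<alpha> C) X Y" and g: "g \<in> Hom (IC elts \<alpha> C) Y Z" for X Y Z f g
      unfolding L_mor[OF o(1,3) S.cmp_in[OF o f g]] L_mor[OF o(1,2) f] L_mor[OF o(2,3) g] unfolding src.IC_ops tgt.IC_ops
      using \<phi>_in by (intro restrict_ext) (simp add: L_space[OF o(1)])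
  qed
  have add: "FMor L X Y (Add (IC elts \<alpha> C) X Y f g) = Add (IC elts \<alpha> D) (FOb L X) (FOb L Y) (FMor L X Y f) (FMor L X Y g)"
    if o: "X \<in> Ob (IC elts \<alpha> C)" "Y \<in> Ob (IC elts \<alpha> C)"
      and f: "f \<in> Hom (IC elts \<alpha> C) X Y" and g: "g \<in> Hom (IC elts \<alpha> C) X Y" for X Y f g
    unfolding L_mor[OF o S.add_in[OF o f g]] L_mor[OF o f] L_mor[OF o g] unfolding src.IC_ops tgt.IC_ops
    using \<phi>_in by (intro restrict_ext) (simp add: L_space o)
  have "FMor L X Y (Scale (IC elts \<alpha> C) X Y c f) = Scale (IC elts \<alpha> D) (FOb L X) (FOb L Y) c (FMor L X Y f)"
    if o: "X \<in> Ob (IC elts \<alpha> C)" "Y \<in> Ob (IC elts \<alpha> C)" and f: "f \<in> Hom (IC elts \<alpha> C) X Y" for X Y f c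
  proof -
    have c: "Scale (IC elts \<alpha> C) X Y c f \<in> Hom (IC elts \<alpha> C) X Y" by (rule S.scale_in[OF o f]) simp
    show ?thesis
      unfolding L_mor[OF o c] L_mor[OF o f] unfolding src.IC_ops tgt.IC_ops
      using \<phi>_in by (intro restrict_ext) (simp add: L_space o)
  qed
  with ftor add show ?thesis unfolding linear_ftor_def by blast
qed

lemma L_kernel:
  assumes X: "X \<in> Ob (IC elts \<alpha> C)" and Y: "Y \<in> Ob (IC elts \<alpha> C)" and f: "f \<in> Hom (IC elts \<alpha> C) X Y"
    and k: "is_kernel (IC elts \<alpha> C) X Y f K i"
  shows "is_kernel (IC elts \<alpha> D) (FOb L X) (FOb L Y) (FMor L X Y f) (FOb L K) (FMor L K X i)"
proof -
  have p: "src.ptw_kernel X Y f K i" by (rule src.is_kernel_ptw[OF X Y f k])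
  then have K: "K \<in> Ob (IC elts \<alpha> C)" "i \<in> Hom (IC elts \<alpha> C) K X" by (auto simp: src.ptw_kernel_def)
  have "tgt.ptw_kernel (FOb L X) (FOb L Y) (FMor L X Y f) (FOb L K) (FMor L K X i)"
    using p L_ob_in[OF K(1)] L_mor_in[OF K(1) X K(2)] \<phi>_in
    by (simp add: src.ptw_kernel_def tgt.ptw_kernel_def L_space X Y K(1) L_at[OF X Y f] L_at[OF K(1) X K(2)])
  then show ?thesis by (rule tgt.ptw_kernel_is_kernel[OF L_ob_in[OF X] L_ob_in[OF Y] L_mor_in[OF X Y f]])
qed

lemma L_cokernel:
  assumes X: "X \<in> Ob (IC elts \<alpha> C)" and Y: "Y \<in> Ob (IC elts \<alpha> C)" and f: "f \<in> Hom (IC elts \<alpha> C) X Y"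
    and c: "is_cokernel (IC elts \<alpha> C) X Y f Q p"
  shows "is_cokernel (IC elts \<alpha> D) (FOb L X) (FOb L Y) (FMor L X Y f) (FOb L Q) (FMor L Y Q p)"
proof -
  have w: "src.ptw_cokernel X Y f Q p" by (rule src.is_cokernel_ptw[OF X Y f c])
  then have Q: "Q \<in> Ob (IC elts \<alpha> C)" "p \<in> Hom (IC elts \<alpha> C) Y Q" by (auto simp: src.ptw_cokernel_def)
  have "tgt.ptw_cokernel (FOb L X) (FOb L Y) (FMor L X Y f) (FOb L Q) (FMor L Y Q p)"
    using w L_ob_in[OF Q(1)] L_mor_in[OF Y Q] \<phi>_in
    by (simp add: src.ptw_cokernel_def tgt.ptw_cokernel_def L_space X Y Q(1) L_at[OF X Y f] L_at[OF Y Q])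
  then show ?thesis by (rule tgt.ptw_cokernel_is_cokernel[OF L_ob_in[OF X] L_ob_in[OF Y] L_mor_in[OF X Y f]])
qed

lemma L_id:
  assumes CD: "C = D" and id: "\<And>s. s \<in> SC C \<Longrightarrow> \<phi> s = s"
  shows "X \<in> Ob (IC elts \<alpha> C) \<Longrightarrow> FOb L X = X"
    and "\<lbrakk>X \<in> Ob (IC elts \<alpha> C); Y \<in> Ob (IC elts \<alpha> C); f \<in> Hom (IC elts \<alpha> C) X Y\<rbrakk> \<Longrightarrow> FMor L X Y f = f"
proof -
  have id': "\<phi> s = s" if "s \<in> SC D" for s using id that CD by simp
  show "FOb L X = X" if X: "X \<in> Ob (IC elts \<alpha> C)"
  proof -
    have "fst X \<in> extensional (SC D)" "snd X \<in> extensional BH" "\<And>b. b \<in> BH \<Longrightarrow> snd X b \<in> extensional (SC D)"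
      using X unfolding src.IC_ob_iff CD[symmetric] by (auto simp: PiE_iff)
    then have "(\<lambda>s\<in>SC D. fst X s) = fst X" "(\<lambda>b\<in>BH. \<lambda>s\<in>SC D. snd X b s) = snd X"
      by (simp_all add: extensional_restrict cong: restrict_cong)
    then show ?thesis
      unfolding L_ob[OF X] by (simp add: id' prod_eq_iff cong: restrict_cong)
  qed
  show "FMor L X Y f = f"
    if o: "X \<in> Ob (IC elts \<alpha> C)" "Y \<in> Ob (IC elts \<alpha> C)" and f: "f \<in> Hom (IC elts \<alpha> C) X Y"
  proof -
    have "f \<in> extensional (SC D)" using f unfolding src.IC_hom_iff[OF o] CD[symmetric] by (auto simp: PiE_iff)
    then show ?thesis
      unfolding L_mor[OF o f] by (simp add: id' extensional_restrict cong: restrict_cong)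
  qed
qed

end

abbreviation "reindex_IC elts \<alpha> C D \<phi> \<equiv> lift_ftor elts \<alpha> C (reindex (SC C) (SC D) \<phi> (Vect elts))"

text \<open>Pullbacks of functions along maps compose strictly, so every strict identity required of
  refinements and right translations reduces to one between maps of coset spaces.\<close>

lemma reindexing_comp:
  assumes 1: "reindexing elts C D \<phi>" and 2: "reindexing elts D E \<psi>"
    and \<xi>: "\<And>s. s \<in> SC E \<Longrightarrow> \<xi> s = \<phi> (\<psi> s)"
  shows "X \<in> Ob (IC elts \<alpha> C) \<Longrightarrow>
      FOb (reindex_IC elts \<alpha> D E \<psi>) (FOb (reindex_IC elts \<alpha> C D \<phi>) X) = FOb (reindex_IC elts \<alpha> C E \<xi>) X"
    and "\<lbrakk>X \<in> Ob (IC elts \<alpha> C); Y \<in> Ob (IC elts \<alpha> C); f \<in> Hom (IC elts \<alpha> C) X Y\<rbrakk> \<Longrightarrow>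
      FMor (reindex_IC elts \<alpha> D E \<psi>) (FOb (reindex_IC elts \<alpha> C D \<phi>) X) (FOb (reindex_IC elts \<alpha> C D \<phi>) Y)
        (FMor (reindex_IC elts \<alpha> C D \<phi>) X Y f) = FMor (reindex_IC elts \<alpha> C E \<xi>) X Y f"
proof -
  interpret f: reindexing elts \<alpha> C D \<phi> by fact
  interpret g: reindexing elts \<alpha> D E \<psi> by fact
  interpret h: reindexing elts \<alpha> C E \<xi>
  proof unfold_locales
    show "\<xi> s \<in> SC C" if "s \<in> SC E" for s using that by (simp add: \<xi> f.\<phi>_in g.\<phi>_in)
    show "\<xi> (b <#\<^bsub>GH\<^esub> s) = b <#\<^bsub>GH\<^esub> \<xi> s" if b: "b \<in> carrier GH" "s \<in> SC E" for b s
      using b SC_left[OF subgroup.subset[OF g.tgt.C] b(2,1)] by (simp add: \<xi> f.\<phi>_left g.\<phi>_left g.\<phi>_in)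
  qed
  show "FOb g.L (FOb f.L X) = FOb h.L X" if X: "X \<in> Ob (IC elts \<alpha> C)"
    unfolding g.L_ob[OF f.L_ob_in[OF X]] h.L_ob[OF X] unfolding f.L_ob[OF X]
    by (simp add: g.\<phi>_in \<xi> cong: restrict_cong)
  show "FMor g.L (FOb f.L X) (FOb f.L Y) (FMor f.L X Y f) = FMor h.L X Y f"
    if o: "X \<in> Ob (IC elts \<alpha> C)" "Y \<in> Ob (IC elts \<alpha> C)" and f: "f \<in> Hom (IC elts \<alpha> C) X Y"
    unfolding g.L_mor[OF f.L_ob_in[OF o(1)] f.L_ob_in[OF o(2)] f.L_mor_in[OF o f]] h.L_mor[OF o f]
    unfolding f.L_mor[OF o f] by (simp add: g.\<phi>_in \<xi> cong: restrict_cong)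
qed


section \<open>The uniformly smooth principal series\<close>

lemma pull_eq: "pull elts \<alpha> D C = reindex_IC elts \<alpha> C D (\<lambda>s. s <#>\<^bsub>GH\<^esub> C)"
  by (simp add: pull_def pull_V_def)

lemma right_tr_eq: "right_tr elts \<alpha> h C = reindex_IC elts \<alpha> C (conj_set h C) (\<lambda>s. s #>\<^bsub>GH\<^esub> h)"
  by (simp add: right_tr_def right_V_def)

lemma hom_class_colim: "hom_class elts \<alpha> = colim_class CH (IC elts \<alpha>) (pull elts \<alpha>)"
  and hom_reps_colim: "hom_reps elts \<alpha> = colim_reps CH (IC elts \<alpha>) (pull elts \<alpha>)"
  and hom_eq_colim: "hom_eq elts \<alpha> = colim_eq CH (IC elts \<alpha>) (pull elts \<alpha>)"
  by (simp_all add: fun_eq_iff hom_class_def colim_class_def hom_eq_def colim_eq_def hom_reps_def colim_reps_def)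

lemma I_usm_colim: "I_usm elts \<alpha> = colim_cat CH (IC elts \<alpha>) (pull elts \<alpha>)"
  by (simp add: I_usm_def colim_cat_def Let_def hom_reps_colim hom_eq_colim hom_class_colim)

lemma R_ftor_colim_act:
  "R_ftor elts \<alpha> h = colim_act CH (IC elts \<alpha>) (pull elts \<alpha>) conj_set (right_tr elts \<alpha>) h"
proof -
  have o: "R_ob elts \<alpha> = colim_act_ob conj_set (right_tr elts \<alpha>)"
    by (intro ext) (simp add: R_ob_def colim_act_ob_def)
  show ?thesis by (simp add: R_ftor_def colim_act_def I_usm_colim hom_class_colim o)
qed

context grothendieck_universe
begin

lemma univ_levelI: "subgroup C GH \<Longrightarrow> univ_level elts C"
  by (intro univ_level.intro level.intro grothendieck_universe_axioms)

lemma reindexing_pull: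
  assumes "subgroup C GH" "subgroup D GH" "D \<subseteq> C" shows "reindexing elts C D (\<lambda>s. s <#>\<^bsub>GH\<^esub> C)"
  by (intro reindexing.intro reindexing_axioms.intro univ_levelI assms proj_SC[OF assms] proj_left[OF assms, symmetric])

lemma reindexing_right:
  assumes h: "h \<in> carrier GH" and C: "subgroup C GH"
  shows "reindexing elts C (conj_set h C) (\<lambda>s. s #>\<^bsub>GH\<^esub> h)"
proof (intro reindexing.intro reindexing_axioms.intro univ_levelI C)
  show C': "subgroup (conj_set h C) GH" by (rule conj_set_subgroup[OF h C])
  show "s #>\<^bsub>GH\<^esub> h \<in> SC C" if "s \<in> SC (conj_set h C)" for s
    by (rule right_SC[OF h subgroup.subset[OF C] that])
  show "(b <#\<^bsub>GH\<^esub> s) #>\<^bsub>GH\<^esub> h = b <#\<^bsub>GH\<^esub> (s #>\<^bsub>GH\<^esub> h)"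
    if "b \<in> carrier GH" "s \<in> SC (conj_set h C)" for b s
    by (rule right_left[OF h that(1) SC_sub[OF that(2) subgroup.subset[OF C']], symmetric])
qed

text \<open>The identities of coset maps used here are \<open>(s C') C = s C\<close> for \<open>C' \<subseteq> C\<close>, \<open>(s g) h = s (g h)\<close>,
  \<open>(s hCh\<inverse>) h = (s h) C\<close>, and \<open>s h = s\<close> for \<open>s \<in> H/C\<close> and \<open>h \<in> C\<close>.\<close>

lemma principal_series_system:
  "system_action Lam (CH :: ('k::field, 'n::{finite, linorder}) dbl set set) (IC elts \<alpha>) (pull elts \<alpha>)
     GH conj_set (right_tr elts \<alpha>)"
proof -
  have lev: "univ_level elts C" if "C \<in> CH" for C :: "('k, 'n) dbl set"
    by (rule univ_levelI[OF CH_subgroup[OF that]])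
  have pl: "reindexing elts C D (\<lambda>s. s <#>\<^bsub>GH\<^esub> C)" if "C \<in> CH" "D \<in> CH" "D \<subseteq> C"
    for C D :: "('k, 'n) dbl set"
    using that by (intro reindexing_pull CH_subgroup)
  have rt: "reindexing elts C (conj_set h C) (\<lambda>s. s #>\<^bsub>GH\<^esub> h)" if "h \<in> carrier GH" "C \<in> CH"
    for C :: "('k, 'n) dbl set" and h
    using that by (intro reindexing_right CH_subgroup)
  have mono: "conj_set h D \<subseteq> conj_set h C" if "D \<subseteq> C" for h and C D :: "('k, 'n) dbl set"
    using that by (auto simp: conj_set_eq)
  have mult: "conj_set (g \<otimes>\<^bsub>GH\<^esub> h) C = conj_set g (conj_set h C)"
    if "g \<in> carrier GH" "h \<in> carrier GH" "C \<in> CH" for g h and C :: "('k, 'n) dbl set"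
    by (rule conj_set_mult[OF that(1,2) subgroup.subset[OF CH_subgroup[OF that(3)]]])
  have SC_carrier: "s \<subseteq> carrier GH" if "s \<in> SC C" "C \<in> CH" for s and C :: "('k, 'n) dbl set"
    by (rule SC_sub[OF that(1) subgroup.subset[OF CH_subgroup[OF that(2)]]])
  show ?thesis
  proof (intro system_action.intro direct_system.intro system_action_axioms.intro GH_group, goal_cases)
    case 1 show ?case by (rule CH_nonempty)
  next
    case 2 then show ?case by (rule CH_inter)
  next
    case 3 then show ?case by (intro univ_level.IC_abelian lev)
  next
    case 4 then show ?case unfolding pull_eq by (intro reindexing.L_linear pl)
  next
    case 5 then show ?case unfolding pull_eq by (intro reindexing.L_kernel pl)
  next
    case 6 then show ?case unfolding pull_eq by (intro reindexing.L_cokernel pl)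
  next
    case 7 then show ?case unfolding pull_eq
      by (intro reindexing.L_id(1)[OF pl] proj_self CH_subgroup) auto
  next
    case 8 then show ?case unfolding pull_eq
      by (intro reindexing.L_id(2)[OF pl] proj_self CH_subgroup) auto
  next
    case (9 C D E X) then show ?case unfolding pull_eq
      by (intro reindexing_comp(1)[OF pl pl] proj_proj[symmetric, where E = E] CH_subgroup) auto
  next
    case (10 C D E X Y f) then show ?case unfolding pull_eq
      by (intro reindexing_comp(2)[OF pl pl] proj_proj[symmetric, where E = E] CH_subgroup) auto
  next
    case 11 then show ?case by (rule CH_subgroup)
  next
    case 12 then show ?case by (rule CH_conj)
  next
    case 13 then show ?case by (intro mono)
  next
    case 14 then show ?case by (rule mult)
  next
    case 15 then show ?case unfolding right_tr_eq by (intro reindexing.L_linear rt)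
  next
    case (16 g h C X)
    have "FOb (reindex_IC elts \<alpha> (conj_set h C) (conj_set g (conj_set h C)) (\<lambda>s. s #>\<^bsub>GH\<^esub> g))
        (FOb (reindex_IC elts \<alpha> C (conj_set h C) (\<lambda>s. s #>\<^bsub>GH\<^esub> h)) X) =
      FOb (reindex_IC elts \<alpha> C (conj_set g (conj_set h C)) (\<lambda>s. s #>\<^bsub>GH\<^esub> (g \<otimes>\<^bsub>GH\<^esub> h))) X"
      by (rule reindexing_comp(1)[OF rt rt])
        (use 16 in \<open>simp_all add: CH_conj right_right SC_carrier\<close>)
    then show ?case using 16 unfolding right_tr_eq by (simp add: mult)
  next
    case (17 g h C X Y f)
    have "FMor (reindex_IC elts \<alpha> (conj_set h C) (conj_set g (conj_set h C)) (\<lambda>s. s #>\<^bsub>GH\<^esub> g))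
        (FOb (reindex_IC elts \<alpha> C (conj_set h C) (\<lambda>s. s #>\<^bsub>GH\<^esub> h)) X)
        (FOb (reindex_IC elts \<alpha> C (conj_set h C) (\<lambda>s. s #>\<^bsub>GH\<^esub> h)) Y)
        (FMor (reindex_IC elts \<alpha> C (conj_set h C) (\<lambda>s. s #>\<^bsub>GH\<^esub> h)) X Y f) =
      FMor (reindex_IC elts \<alpha> C (conj_set g (conj_set h C)) (\<lambda>s. s #>\<^bsub>GH\<^esub> (g \<otimes>\<^bsub>GH\<^esub> h))) X Y f"
      by (rule reindexing_comp(2)[OF rt rt])
        (use 17 in \<open>simp_all add: CH_conj right_right SC_carrier\<close>)
    then show ?case using 17 unfolding right_tr_eq by (simp add: mult)
  next
    case (18 h C D X)
    let ?\<xi> = "\<lambda>s. (s #>\<^bsub>GH\<^esub> h) <#>\<^bsub>GH\<^esub> C"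
    have "FOb (reindex_IC elts \<alpha> (conj_set h C) (conj_set h D) (\<lambda>s. s <#>\<^bsub>GH\<^esub> conj_set h C))
        (FOb (reindex_IC elts \<alpha> C (conj_set h C) (\<lambda>s. s #>\<^bsub>GH\<^esub> h)) X) =
      FOb (reindex_IC elts \<alpha> C (conj_set h D) ?\<xi>) X"
      by (rule reindexing_comp(1)[OF rt pl])
        (use 18 in \<open>simp_all add: CH_conj mono right_proj[where D = D] CH_subgroup\<close>)
    moreover have "FOb (reindex_IC elts \<alpha> D (conj_set h D) (\<lambda>s. s #>\<^bsub>GH\<^esub> h))
        (FOb (reindex_IC elts \<alpha> C D (\<lambda>s. s <#>\<^bsub>GH\<^esub> C)) X) = FOb (reindex_IC elts \<alpha> C (conj_set h D) ?\<xi>) X"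
      by (rule reindexing_comp(1)[OF pl rt]) (use 18 in simp_all)
    ultimately show ?case unfolding pull_eq right_tr_eq by simp
  next
    case (19 h C D X Y f)
    let ?\<xi> = "\<lambda>s. (s #>\<^bsub>GH\<^esub> h) <#>\<^bsub>GH\<^esub> C"
    have "FMor (reindex_IC elts \<alpha> (conj_set h C) (conj_set h D) (\<lambda>s. s <#>\<^bsub>GH\<^esub> conj_set h C))
        (FOb (reindex_IC elts \<alpha> C (conj_set h C) (\<lambda>s. s #>\<^bsub>GH\<^esub> h)) X)
        (FOb (reindex_IC elts \<alpha> C (conj_set h C) (\<lambda>s. s #>\<^bsub>GH\<^esub> h)) Y)
        (FMor (reindex_IC elts \<alpha> C (conj_set h C) (\<lambda>s. s #>\<^bsub>GH\<^esub> h)) X Y f) =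
      FMor (reindex_IC elts \<alpha> C (conj_set h D) ?\<xi>) X Y f"
      by (rule reindexing_comp(2)[OF rt pl])
        (use 19 in \<open>simp_all add: CH_conj mono right_proj[where D = D] CH_subgroup\<close>)
    moreover have "FMor (reindex_IC elts \<alpha> D (conj_set h D) (\<lambda>s. s #>\<^bsub>GH\<^esub> h))
        (FOb (reindex_IC elts \<alpha> C D (\<lambda>s. s <#>\<^bsub>GH\<^esub> C)) X) (FOb (reindex_IC elts \<alpha> C D (\<lambda>s. s <#>\<^bsub>GH\<^esub> C)) Y)
        (FMor (reindex_IC elts \<alpha> C D (\<lambda>s. s <#>\<^bsub>GH\<^esub> C)) X Y f) =
      FMor (reindex_IC elts \<alpha> C (conj_set h D) ?\<xi>) X Y f"
      by (rule reindexing_comp(2)[OF pl rt]) (use 19 in simp_all)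
    ultimately show ?case unfolding pull_eq right_tr_eq by simp
  next
    case 20 then show ?case by (intro conj_set_fix CH_subgroup)
  next
    case (21 C h X)
    have h: "h \<in> carrier GH" using 21 subgroup.subset[OF CH_subgroup] by blast
    show ?case unfolding right_tr_eq
      by (rule reindexing.L_id(1)[OF rt[OF h]])
        (use 21 in \<open>simp_all add: conj_set_fix right_fix[where C = C] CH_subgroup\<close>)
  next
    case (22 C h X Y f)
    have h: "h \<in> carrier GH" using 22 subgroup.subset[OF CH_subgroup] by blast
    show ?case unfolding right_tr_eq
      by (rule reindexing.L_id(2)[OF rt[OF h]])
        (use 22 in \<open>simp_all add: conj_set_fix right_fix[where C = C] CH_subgroup\<close>)
  qed
qed

end

theorem theorem5p4:
  fixes elts :: "'v \<Rightarrow> 'v set"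
    and \<alpha> :: "'n::{finite, linorder} \<Rightarrow> complex fls"
    and \<I> :: "(complex fls, ('k::{finite, field}, 'n, 'v) ps_ob, ('k, 'n, 'v) ps_mor) lincat"
    and \<rho> :: "(('k, 'n) dbl, ('k, 'n, 'v) ps_ob, ('k, 'n, 'v) ps_mor) two_rep"
  assumes "grothendieck_universe elts"
    and "\<And>r. \<alpha> r \<noteq> 0"
    and "\<I> = I_usm elts \<alpha>"
    and "\<rho> = rho elts \<alpha>"
  shows "abelian_linear_category Lam \<I>
    \<and> exact_two_representation GH Lam \<I> \<rho>
    \<and> strict_two_representation GH Lam \<I> \<rho>
    \<and> uniformly_smooth GH CH \<I> \<rho>
    \<and> (\<forall>Y\<in>Ob \<I>. open_subgroup GH CH (stabilizer_ob GH \<rho> Y))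
    \<and> (\<forall>Y\<in>Ob \<I>. \<forall>Y'\<in>Ob \<I>. \<forall>w\<in>Hom \<I> Y Y'.
          open_subgroup GH CH (stabilizer_mor GH \<rho> Y Y' w))"
proof -
  interpret U: grothendieck_universe elts by fact
  interpret S: system_action Lam "CH :: ('k, 'n) dbl set set" "IC elts \<alpha>" "pull elts \<alpha>" GH conj_set
    "right_tr elts \<alpha>" by (rule U.principal_series_system)
  have \<I>: "\<I> = S.\<C>" by (simp add: assms(3) I_usm_colim)
  have \<rho>: "\<rho> = (let N = Aut_ex Lam S.\<C> in \<lparr>FOb = (\<lambda>h\<in>carrier GH. S.act h),
      FMor = (\<lambda>h h' x. if h \<in> carrier GH \<and> h = h' then Idm N (S.act h) else undefined),
      MMu = (\<lambda>h h'. Idm N (S.act (h \<otimes>\<^bsub>GH\<^esub> h'))), MEps = Idm N (S.act \<one>\<^bsub>GH\<^esub>)\<rparr>)"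
    unfolding assms(4) rho_def I_usm_colim R_ftor_colim_act ..
  show ?thesis
    unfolding \<I> uniformly_smooth_def open_subgroup_def
    by (intro conjI ballI S.abelian_colim S.act_exact_rep[OF \<rho>] S.act_strict_rep[OF \<rho>]
      S.stabilizer_ob_open[OF \<rho>] S.stabilizer_mor_open[OF \<rho>])
qed

end
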